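(* Let $\mathbb T$ be a geometric theory. Then for any $\mathbb T$-models $M$ and $N$ in a Grothendieck topos $\mathcal E$ there exists an object $Hom^{\mathcal E}_{\mathbb T}(M,N)$ of $\mathcal E$ (the "object of $\mathbb T$-model homomorphisms from $M$ to $N$") satisfying the universal property that for any object $E$ of $\mathcal E$ the generalized elements $E\to Hom^{\mathcal E}_{\mathbb T}(M,N)$ are in bijective correspondence, naturally in $E\in\mathcal E$, with the $\mathbb T$-model homomorphisms $!_E^{\ast}(M)\to{!}_E^{\ast}(N)$ in $\mathbb T\textrm{-mod}(\mathcal E/E)$.
   Context: For an object $E$ of $\mathcal E$, $!_E:E\to1$ is the unique arrow and $!_E^{\ast}:\mathcal E\to\mathcal E/E$ is the pullback functor along it, which (being the inverse image of a geometric morphism) sends $\mathbb T$-models in $\mathcal E$ to $\mathbb T$-models in $\mathcal E/E$. $\mathbb T\textrm{-mod}(\mathcal F)$ denotes the category of $\mathbb T$-models and $\mathbb T$-model homomorphisms in a topos $\mathcal F$. A generalized element of an object $X$ is an arrow $E\to X$. *)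

theory Defs
  imports "HOL-Library.FuncSet" "HOL-Library.Equipollence"
begin

section \<open>Smallness\<close>

text \<open>
  A Grothendieck topos is a large category built from \<^emph>\<open>small\<close> sets.  Smallness is taken relative to
  a universe: a type whose cardinality is an infinite regular strong limit cardinal.  The small
  subsets of such a type are, up to bijection, all small sets.  The uncountable instances are the
  usual Grothendieck universes.  Uncountability is not imposed, so that the type of natural
  numbers is an instance too (small = finite).
\<close>

class universe =
  assumes infinite_universe: "infinite (UNIV :: 'a set)"
    and small_Pow: "(X :: 'a set) \<prec> (UNIV :: 'a set) \<Longrightarrow> Pow X \<prec> (UNIV :: 'a set)"
    and small_UN: "(I :: 'a set) \<prec> (UNIV :: 'a set) \<Longrightarrow>
      (\<And>i. i \<in> I \<Longrightarrow> (Y :: 'a \<Rightarrow> 'a set) i \<prec> (UNIV :: 'a set)) \<Longrightarrow> (\<Union>i\<in>I. Y i) \<prec> (UNIV :: 'a set)"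

lemma lesspoll_UNIV_nat_iff: "(X :: 'b set) \<prec> (UNIV :: nat set) \<longleftrightarrow> finite X"
proof
  assume "X \<prec> (UNIV :: nat set)"
  then show "finite X"
    using infinite_le_lepoll lepoll_antisym lesspoll_def by blast
next
  assume "finite X"
  then show "X \<prec> (UNIV :: nat set)"
    by (simp add: finite_lesspoll_infinite)
qed

instance nat :: universe
  by standard (auto simp: lesspoll_UNIV_nat_iff)

definition small :: "'u::universe itself \<Rightarrow> 'a set \<Rightarrow> bool"
  where "small _ X \<longleftrightarrow> X \<prec> (UNIV :: 'u set)"

section \<open>Categories\<close>

record ('o, 'a) cat =
  Ob :: "'o set"
  Ar :: "'a set"
  Dom :: "'a \<Rightarrow> 'o"
  Cod :: "'a \<Rightarrow> 'o"
  Id :: "'o \<Rightarrow> 'a"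
  Cmp :: "'a \<Rightarrow> 'a \<Rightarrow> 'a" (infixr "\<cdot>\<index>" 70)

definition hom :: "('o, 'a) cat \<Rightarrow> 'o \<Rightarrow> 'o \<Rightarrow> 'a set"
  where "hom C X Y = {f \<in> Ar C. Dom C f = X \<and> Cod C f = Y}"

locale category =
  fixes C :: "('o, 'a) cat" (structure)
  assumes Dom_Ob: "f \<in> Ar C \<Longrightarrow> Dom C f \<in> Ob C"
    and Cod_Ob: "f \<in> Ar C \<Longrightarrow> Cod C f \<in> Ob C"
    and Id_hom: "X \<in> Ob C \<Longrightarrow> Id C X \<in> hom C X X"
    and Cmp_hom: "f \<in> hom C X Y \<Longrightarrow> g \<in> hom C Y Z \<Longrightarrow> g \<cdot> f \<in> hom C X Z"
    and Cmp_assoc: "f \<in> hom C W X \<Longrightarrow> g \<in> hom C X Y \<Longrightarrow> h \<in> hom C Y Z \<Longrightarrow> (h \<cdot> g) \<cdot> f = h \<cdot> (g \<cdot> f)"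
    and Cmp_Id_right: "f \<in> hom C X Y \<Longrightarrow> f \<cdot> Id C X = f"
    and Cmp_Id_left: "f \<in> hom C X Y \<Longrightarrow> Id C Y \<cdot> f = f"

record ('o, 'a, 'p, 'b) fnctr =
  FOb :: "'o \<Rightarrow> 'p"
  FAr :: "'a \<Rightarrow> 'b"

locale cat_functor =
  C: category C + D: category D
  for C :: "('o, 'a) cat" and D :: "('p, 'b) cat" and F :: "('o, 'a, 'p, 'b) fnctr" +
  assumes FOb_Ob: "X \<in> Ob C \<Longrightarrow> FOb F X \<in> Ob D"
    and FAr_hom: "f \<in> hom C X Y \<Longrightarrow> FAr F f \<in> hom D (FOb F X) (FOb F Y)"
    and FAr_Id: "X \<in> Ob C \<Longrightarrow> FAr F (Id C X) = Id D (FOb F X)"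
    and FAr_Cmp: "f \<in> hom C X Y \<Longrightarrow> g \<in> hom C Y Z \<Longrightarrow>
      FAr F (g \<cdot>\<^bsub>C\<^esub> f) = FAr F g \<cdot>\<^bsub>D\<^esub> FAr F f"

definition id_functor :: "('o, 'a, 'o, 'a) fnctr"
  where "id_functor = \<lparr>FOb = id, FAr = id\<rparr>"

definition comp_functor ::
    "('p, 'b, 'q, 'c) fnctr \<Rightarrow> ('o, 'a, 'p, 'b) fnctr \<Rightarrow> ('o, 'a, 'q, 'c) fnctr"
  where "comp_functor G F = \<lparr>FOb = FOb G \<circ> FOb F, FAr = FAr G \<circ> FAr F\<rparr>"

definition is_inverse :: "('o, 'a) cat \<Rightarrow> 'a \<Rightarrow> 'a \<Rightarrow> bool"
  where "is_inverse C f g \<longleftrightarrow> f \<in> Ar C \<and> g \<in> hom C (Cod C f) (Dom C f) \<and>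
    g \<cdot>\<^bsub>C\<^esub> f = Id C (Dom C f) \<and> f \<cdot>\<^bsub>C\<^esub> g = Id C (Cod C f)"

definition iso :: "('o, 'a) cat \<Rightarrow> 'a \<Rightarrow> bool"
  where "iso C f \<longleftrightarrow> (\<exists>g. is_inverse C f g)"

definition inv_ar :: "('o, 'a) cat \<Rightarrow> 'a \<Rightarrow> 'a"
  where "inv_ar C f = (THE g. is_inverse C f g)"

definition natural_iso :: "('o, 'a) cat \<Rightarrow> ('p, 'b) cat \<Rightarrow>
    ('o, 'a, 'p, 'b) fnctr \<Rightarrow> ('o, 'a, 'p, 'b) fnctr \<Rightarrow> ('o \<Rightarrow> 'b) \<Rightarrow> bool"
  where "natural_iso C D F G \<eta> \<longleftrightarrow>
    (\<forall>X \<in> Ob C. \<eta> X \<in> hom D (FOb F X) (FOb G X) \<and> iso D (\<eta> X)) \<and>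
    (\<forall>f \<in> Ar C. \<eta> (Cod C f) \<cdot>\<^bsub>D\<^esub> FAr F f = FAr G f \<cdot>\<^bsub>D\<^esub> \<eta> (Dom C f))"

definition equivalent_cats :: "('o, 'a) cat \<Rightarrow> ('p, 'b) cat \<Rightarrow> bool"
  where "equivalent_cats C D \<longleftrightarrow> (\<exists>F G \<eta> \<epsilon>. cat_functor C D F \<and> cat_functor D C G \<and>
    natural_iso C C id_functor (comp_functor G F) \<eta> \<and>
    natural_iso D D (comp_functor F G) id_functor \<epsilon>)"

section \<open>Sites, sheaves and Grothendieck toposes\<close>

definition sieve :: "('o, 'a) cat \<Rightarrow> 'o \<Rightarrow> 'a set \<Rightarrow> bool"
  where "sieve C c S \<longleftrightarrow> S \<subseteq> {f \<in> Ar C. Cod C f = c} \<and>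
    (\<forall>f \<in> S. \<forall>g \<in> Ar C. Cod C g = Dom C f \<longrightarrow> f \<cdot>\<^bsub>C\<^esub> g \<in> S)"

definition pull_sieve :: "('o, 'a) cat \<Rightarrow> 'a \<Rightarrow> 'a set \<Rightarrow> 'a set"
  where "pull_sieve C f S = {g \<in> Ar C. Cod C g = Dom C f \<and> f \<cdot>\<^bsub>C\<^esub> g \<in> S}"

locale site = category C for C :: "('o, 'a) cat" (structure) +
  fixes J :: "'o \<Rightarrow> 'a set set"
  assumes J_sieve: "c \<in> Ob C \<Longrightarrow> S \<in> J c \<Longrightarrow> sieve C c S"
    and J_max: "c \<in> Ob C \<Longrightarrow> {f \<in> Ar C. Cod C f = c} \<in> J c"
    and J_stable: "f \<in> hom C d c \<Longrightarrow> S \<in> J c \<Longrightarrow> pull_sieve C f S \<in> J d"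
    and J_trans: "c \<in> Ob C \<Longrightarrow> S \<in> J c \<Longrightarrow> sieve C c R \<Longrightarrow>
      (\<And>f. f \<in> S \<Longrightarrow> pull_sieve C f R \<in> J (Dom C f)) \<Longrightarrow> R \<in> J c"

text \<open>
  Presheaves of small sets, a small set being represented by a small subset of the universe.
  Values outside the base category are fixed, so that equal presheaves are equal records.
\<close>

record ('o, 'a, 'u) psh =
  Sec :: "'o \<Rightarrow> 'u set"
  Res :: "'a \<Rightarrow> 'u \<Rightarrow> 'u"

locale presheaf = category C for C :: "('o, 'a) cat" (structure) +
  fixes P :: "('o, 'a, 'u::universe) psh"
  assumes Sec_small: "c \<in> Ob C \<Longrightarrow> small TYPE('u) (Sec P c)"
    and Sec_off: "c \<notin> Ob C \<Longrightarrow> Sec P c = {}"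
    and Res_fun: "f \<in> hom C d c \<Longrightarrow> Res P f \<in> Sec P c \<rightarrow>\<^sub>E Sec P d"
    and Res_off: "f \<notin> Ar C \<Longrightarrow> Res P f = (\<lambda>x. undefined)"
    and Res_Id: "c \<in> Ob C \<Longrightarrow> x \<in> Sec P c \<Longrightarrow> Res P (Id C c) x = x"
    and Res_Cmp: "g \<in> hom C e d \<Longrightarrow> f \<in> hom C d c \<Longrightarrow> x \<in> Sec P c \<Longrightarrow>
      Res P (f \<cdot> g) x = Res P g (Res P f x)"

definition matching_family ::
    "('o, 'a) cat \<Rightarrow> ('o, 'a, 'u) psh \<Rightarrow> 'a set \<Rightarrow> ('a \<Rightarrow> 'u) \<Rightarrow> bool"
  where "matching_family C P S x \<longleftrightarrow> (\<forall>f \<in> S. x f \<in> Sec P (Dom C f) \<and>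
    (\<forall>g \<in> Ar C. Cod C g = Dom C f \<longrightarrow> Res P g (x f) = x (f \<cdot>\<^bsub>C\<^esub> g)))"

definition is_sheaf ::
    "('o, 'a) cat \<Rightarrow> ('o \<Rightarrow> 'a set set) \<Rightarrow> ('o, 'a, 'u::universe) psh \<Rightarrow> bool"
  where "is_sheaf C J P \<longleftrightarrow> presheaf C P \<and>
    (\<forall>c \<in> Ob C. \<forall>S \<in> J c. \<forall>x. matching_family C P S x \<longrightarrow>
      (\<exists>!a. a \<in> Sec P c \<and> (\<forall>f \<in> S. Res P f a = x f)))"

definition nat_trans ::
    "('o, 'a) cat \<Rightarrow> ('o, 'a, 'u) psh \<Rightarrow> ('o, 'a, 'u) psh \<Rightarrow> ('o \<Rightarrow> 'u \<Rightarrow> 'u) set"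
  where "nat_trans C P Q = {\<eta> \<in> (\<Pi>\<^sub>E c \<in> Ob C. Sec P c \<rightarrow>\<^sub>E Sec Q c).
    \<forall>f \<in> Ar C. \<forall>x \<in> Sec P (Cod C f). \<eta> (Dom C f) (Res P f x) = Res Q f (\<eta> (Cod C f) x)}"

definition Sh :: "('o, 'a) cat \<Rightarrow> ('o \<Rightarrow> 'a set set) \<Rightarrow>
    (('o, 'a, 'u::universe) psh,
     ('o, 'a, 'u) psh \<times> ('o \<Rightarrow> 'u \<Rightarrow> 'u) \<times> ('o, 'a, 'u) psh) cat"
  where "Sh C J = \<lparr>
    Ob = {P. is_sheaf C J P},
    Ar = {(P, \<eta>, Q). is_sheaf C J P \<and> is_sheaf C J Q \<and> \<eta> \<in> nat_trans C P Q},
    Dom = (\<lambda>(P, \<eta>, Q). P),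
    Cod = (\<lambda>(P, \<eta>, Q). Q),
    Id = (\<lambda>P. (P, \<lambda>c\<in>Ob C. \<lambda>x\<in>Sec P c. x, P)),
    Cmp = (\<lambda>(Q', \<theta>, R) (P, \<eta>, Q). (P, \<lambda>c\<in>Ob C. compose (Sec P c) (\<theta> c) (\<eta> c), R))\<rparr>"

text \<open>
  There is no loss of generality in drawing the objects and arrows of the small site from the
  universe itself, since every small set is in bijection with a small subset of the universe.
\<close>

definition grothendieck_topos :: "'u::universe itself \<Rightarrow> ('o, 'a) cat \<Rightarrow> bool"
  where "grothendieck_topos u \<E> \<longleftrightarrow> category \<E> \<and>
    (\<exists>(C :: ('u, 'u) cat) J. site C J \<and> small u (Ob C) \<and> small u (Ar C) \<and>
      equivalent_cats \<E> (Sh C J :: (('u, 'u, 'u) psh, _) cat))"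

section \<open>Finite limits and subobjects\<close>

text \<open>Limits, images and unions are chosen representatives of the respective universal property.\<close>

definition is_terminal :: "('o, 'a) cat \<Rightarrow> 'o \<Rightarrow> bool"
  where "is_terminal C T \<longleftrightarrow> T \<in> Ob C \<and> (\<forall>X \<in> Ob C. \<exists>!f. f \<in> hom C X T)"

definition one :: "('o, 'a) cat \<Rightarrow> 'o"
  where "one C = (SOME T. is_terminal C T)"

definition bang :: "('o, 'a) cat \<Rightarrow> 'o \<Rightarrow> 'a"
  where "bang C X = (THE f. f \<in> hom C X (one C))"

definition is_product :: "('o, 'a) cat \<Rightarrow> 'o list \<Rightarrow> 'o \<Rightarrow> 'a list \<Rightarrow> bool"
  where "is_product C As P ps \<longleftrightarrow> P \<in> Ob C \<and>
    list_all2 (\<lambda>p A. p \<in> hom C P A) ps As \<and>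
    (\<forall>X \<in> Ob C. \<forall>fs. list_all2 (\<lambda>f A. f \<in> hom C X A) fs As \<longrightarrow>
      (\<exists>!u. u \<in> hom C X P \<and> map (\<lambda>p. p \<cdot>\<^bsub>C\<^esub> u) ps = fs))"

definition product :: "('o, 'a) cat \<Rightarrow> 'o list \<Rightarrow> 'o \<times> 'a list"
  where "product C As = (SOME (P, ps). is_product C As P ps)"

definition prod_ob :: "('o, 'a) cat \<Rightarrow> 'o list \<Rightarrow> 'o"
  where "prod_ob C As = fst (product C As)"

definition prjs :: "('o, 'a) cat \<Rightarrow> 'o list \<Rightarrow> 'a list"
  where "prjs C As = snd (product C As)"

definition tuple :: "('o, 'a) cat \<Rightarrow> 'o \<Rightarrow> 'o list \<Rightarrow> 'a list \<Rightarrow> 'a"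
  where "tuple C X As fs =
    (THE u. u \<in> hom C X (prod_ob C As) \<and> map (\<lambda>p. p \<cdot>\<^bsub>C\<^esub> u) (prjs C As) = fs)"

definition prod_map :: "('o, 'a) cat \<Rightarrow> 'o list \<Rightarrow> 'o list \<Rightarrow> 'a list \<Rightarrow> 'a"
  where "prod_map C As Bs gs =
    tuple C (prod_ob C As) Bs (map2 (\<lambda>g p. g \<cdot>\<^bsub>C\<^esub> p) gs (prjs C As))"

definition is_pullback :: "('o, 'a) cat \<Rightarrow> 'a \<Rightarrow> 'a \<Rightarrow> 'a \<Rightarrow> 'a \<Rightarrow> bool"
  where "is_pullback C f g p q \<longleftrightarrow>
    p \<in> hom C (Dom C p) (Dom C f) \<and> q \<in> hom C (Dom C p) (Dom C g) \<and>
    f \<cdot>\<^bsub>C\<^esub> p = g \<cdot>\<^bsub>C\<^esub> q \<and>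
    (\<forall>X \<in> Ob C. \<forall>h \<in> hom C X (Dom C f). \<forall>k \<in> hom C X (Dom C g).
      f \<cdot>\<^bsub>C\<^esub> h = g \<cdot>\<^bsub>C\<^esub> k \<longrightarrow>
      (\<exists>!u. u \<in> hom C X (Dom C p) \<and> p \<cdot>\<^bsub>C\<^esub> u = h \<and> q \<cdot>\<^bsub>C\<^esub> u = k))"

definition pb :: "('o, 'a) cat \<Rightarrow> 'a \<Rightarrow> 'a \<Rightarrow> 'a \<times> 'a"
  where "pb C f g = (SOME (p, q). is_pullback C f g p q)"

definition is_equalizer :: "('o, 'a) cat \<Rightarrow> 'a \<Rightarrow> 'a \<Rightarrow> 'a \<Rightarrow> bool"
  where "is_equalizer C f g m \<longleftrightarrow> m \<in> hom C (Dom C m) (Dom C f) \<and>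
    f \<cdot>\<^bsub>C\<^esub> m = g \<cdot>\<^bsub>C\<^esub> m \<and>
    (\<forall>X \<in> Ob C. \<forall>h \<in> hom C X (Dom C f). f \<cdot>\<^bsub>C\<^esub> h = g \<cdot>\<^bsub>C\<^esub> h \<longrightarrow>
      (\<exists>!u. u \<in> hom C X (Dom C m) \<and> m \<cdot>\<^bsub>C\<^esub> u = h))"

text \<open>Subobjects of X are represented by monomorphisms into X.\<close>

definition subs :: "('o, 'a) cat \<Rightarrow> 'o \<Rightarrow> 'a set"
  where "subs C X = {m \<in> Ar C. Cod C m = X \<and>
    (\<forall>Y \<in> Ob C. \<forall>f \<in> hom C Y (Dom C m). \<forall>g \<in> hom C Y (Dom C m).
      m \<cdot>\<^bsub>C\<^esub> f = m \<cdot>\<^bsub>C\<^esub> g \<longrightarrow> f = g)}"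

definition factors :: "('o, 'a) cat \<Rightarrow> 'a \<Rightarrow> 'a \<Rightarrow> bool"
  where "factors C f m \<longleftrightarrow> (\<exists>k \<in> hom C (Dom C f) (Dom C m). m \<cdot>\<^bsub>C\<^esub> k = f)"

definition image_ar :: "('o, 'a) cat \<Rightarrow> 'a \<Rightarrow> 'a"
  where "image_ar C f = (SOME m. m \<in> subs C (Cod C f) \<and> factors C f m \<and>
    (\<forall>n \<in> subs C (Cod C f). factors C f n \<longrightarrow> factors C m n))"

definition meet_sub :: "('o, 'a) cat \<Rightarrow> 'o \<Rightarrow> 'a \<Rightarrow> 'a \<Rightarrow> 'a"
  where "meet_sub C X m m' = (SOME k. k \<in> subs C X \<and> factors C k m \<and> factors C k m' \<and>
    (\<forall>n \<in> subs C X. factors C n m \<and> factors C n m' \<longrightarrow> factors C n k))"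

definition union_sub :: "('o, 'a) cat \<Rightarrow> 'o \<Rightarrow> 'a set \<Rightarrow> 'a"
  where "union_sub C X U = (SOME k. k \<in> subs C X \<and> (\<forall>m \<in> U. factors C m k) \<and>
    (\<forall>n \<in> subs C X. (\<forall>m \<in> U. factors C m n) \<longrightarrow> factors C k n))"

section \<open>Slices and pullback functors\<close>

definition slice :: "('o, 'a) cat \<Rightarrow> 'o \<Rightarrow> ('a, 'a \<times> 'a \<times> 'a) cat"
  where "slice C B = \<lparr>
    Ob = {x \<in> Ar C. Cod C x = B},
    Ar = {(x, g, y). x \<in> Ar C \<and> Cod C x = B \<and> y \<in> Ar C \<and> Cod C y = B \<and>
           g \<in> hom C (Dom C x) (Dom C y) \<and> y \<cdot>\<^bsub>C\<^esub> g = x},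
    Dom = (\<lambda>(x, g, y). x),
    Cod = (\<lambda>(x, g, y). y),
    Id = (\<lambda>x. (x, Id C (Dom C x), x)),
    Cmp = (\<lambda>(y', k, z) (x, g, y). (x, k \<cdot>\<^bsub>C\<^esub> g, z))\<rparr>"

definition slice_ar :: "'a \<times> 'a \<times> 'a \<Rightarrow> 'a"
  where "slice_ar = (\<lambda>(x, g, y). g)"

text \<open>For an arrow f from A to B, the functor from the slice over B to the slice over A.\<close>

definition pb_functor :: "('o, 'a) cat \<Rightarrow> 'a \<Rightarrow> ('a, 'a \<times> 'a \<times> 'a, 'a, 'a \<times> 'a \<times> 'a) fnctr"
  where "pb_functor C f = \<lparr>
    FOb = (\<lambda>x. fst (pb C f x)),
    FAr = (\<lambda>(x, g, y). (fst (pb C f x),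
      THE u. u \<in> hom C (Dom C (fst (pb C f x))) (Dom C (fst (pb C f y))) \<and>
        fst (pb C f y) \<cdot>\<^bsub>C\<^esub> u = fst (pb C f x) \<and>
        snd (pb C f y) \<cdot>\<^bsub>C\<^esub> u = g \<cdot>\<^bsub>C\<^esub> snd (pb C f x),
      fst (pb C f y)))\<rparr>"

text \<open>
  The functor \<open>!\<^sub>E\<^sup>*\<close>: pullback along the arrow from E to the terminal object, after identifying C
  with its slice over the terminal object.
\<close>

definition bang_pb :: "('o, 'a) cat \<Rightarrow> 'o \<Rightarrow> ('o, 'a, 'a, 'a \<times> 'a \<times> 'a) fnctr"
  where "bang_pb C E = \<lparr>
    FOb = (\<lambda>X. FOb (pb_functor C (bang C E)) (bang C X)),
    FAr = (\<lambda>g. FAr (pb_functor C (bang C E)) (bang C (Dom C g), g, bang C (Cod C g)))\<rparr>"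

text \<open>
  For f from E' to E, the canonical isomorphism in the slice over E', at X, from \<open>f\<^sup>*(!\<^sub>E\<^sup>* X)\<close> to
  \<open>!\<^sub>E\<^sub>'\<^sup>* X\<close> coming from \<open>!\<^sub>E \<cdot> f = !\<^sub>E\<^sub>'\<close>: the arrow over E' that commutes with the projections to X.
\<close>

definition bang_pb_comp :: "('o, 'a) cat \<Rightarrow> 'a \<Rightarrow> 'o \<Rightarrow> 'a \<times> 'a \<times> 'a"
  where "bang_pb_comp C f X =
    (let x = FOb (bang_pb C (Cod C f)) X in
     THE t. t \<in> hom (slice C (Dom C f)) (FOb (pb_functor C f) x) (FOb (bang_pb C (Dom C f)) X) \<and>
       snd (pb C (bang C (Dom C f)) (bang C X)) \<cdot>\<^bsub>C\<^esub> slice_ar t =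
       snd (pb C (bang C (Cod C f)) (bang C X)) \<cdot>\<^bsub>C\<^esub> snd (pb C f x))"

section \<open>Geometric theories\<close>

record ('s, 'f, 'r) signature =
  Sorts :: "'s set"
  Funs :: "'f set"
  Rels :: "'r set"
  FDom :: "'f \<Rightarrow> 's list"
  FCod :: "'f \<Rightarrow> 's"
  RAr :: "'r \<Rightarrow> 's list"

definition is_signature :: "('s, 'f, 'r) signature \<Rightarrow> bool"
  where "is_signature \<Sigma> \<longleftrightarrow>
    (\<forall>f \<in> Funs \<Sigma>. FDom \<Sigma> f \<in> lists (Sorts \<Sigma>) \<and> FCod \<Sigma> f \<in> Sorts \<Sigma>) \<and>
    (\<forall>R \<in> Rels \<Sigma>. RAr \<Sigma> R \<in> lists (Sorts \<Sigma>))"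

text \<open>
  Variables are de Bruijn indices into a context, which is a list of sorts.  Disjunctions are indexed by
  small subsets of the universe.  Falsity and finite disjunctions are special cases.
\<close>

datatype 'f tm = Var nat | Fun 'f "'f tm list"

datatype ('s, 'f, 'r, 'u) fm =
    Rel 'r "'f tm list"
  | Eq "'f tm" "'f tm"
  | Top
  | And "('s, 'f, 'r, 'u) fm" "('s, 'f, 'r, 'u) fm"
  | Disj "'u set" "'u \<Rightarrow> ('s, 'f, 'r, 'u) fm"
  | Ex 's "('s, 'f, 'r, 'u) fm"

inductive has_sort :: "('s, 'f, 'r) signature \<Rightarrow> 's list \<Rightarrow> 'f tm \<Rightarrow> 's \<Rightarrow> bool"
  for \<Sigma> \<Gamma> where
    "i < length \<Gamma> \<Longrightarrow> has_sort \<Sigma> \<Gamma> (Var i) (\<Gamma> ! i)"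
  | "f \<in> Funs \<Sigma> \<Longrightarrow> list_all2 (has_sort \<Sigma> \<Gamma>) ts (FDom \<Sigma> f) \<Longrightarrow> has_sort \<Sigma> \<Gamma> (Fun f ts) (FCod \<Sigma> f)"

primrec geometric_fm ::
    "('s, 'f, 'r) signature \<Rightarrow> ('s, 'f, 'r, 'u::universe) fm \<Rightarrow> 's list \<Rightarrow> bool" where
    "geometric_fm \<Sigma> (Rel R ts) \<Gamma> \<longleftrightarrow> R \<in> Rels \<Sigma> \<and> list_all2 (has_sort \<Sigma> \<Gamma>) ts (RAr \<Sigma> R)"
  | "geometric_fm \<Sigma> (Eq s t) \<Gamma> \<longleftrightarrow> (\<exists>A. has_sort \<Sigma> \<Gamma> s A \<and> has_sort \<Sigma> \<Gamma> t A)"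
  | "geometric_fm \<Sigma> Top \<Gamma> \<longleftrightarrow> True"
  | "geometric_fm \<Sigma> (And \<phi> \<psi>) \<Gamma> \<longleftrightarrow> geometric_fm \<Sigma> \<phi> \<Gamma> \<and> geometric_fm \<Sigma> \<psi> \<Gamma>"
  | "geometric_fm \<Sigma> (Disj I \<phi>s) \<Gamma> \<longleftrightarrow> small TYPE('u) I \<and> (\<forall>i \<in> I. geometric_fm \<Sigma> (\<phi>s i) \<Gamma>)"
  | "geometric_fm \<Sigma> (Ex A \<phi>) \<Gamma> \<longleftrightarrow> A \<in> Sorts \<Sigma> \<and> geometric_fm \<Sigma> \<phi> (A # \<Gamma>)"

text \<open>An axiom is a sequent: a context, an antecedent and a succedent.\<close>

record ('s, 'f, 'r, 'u) thy =
  Sg :: "('s, 'f, 'r) signature"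
  Axs :: "('s list \<times> ('s, 'f, 'r, 'u) fm \<times> ('s, 'f, 'r, 'u) fm) set"

definition geometric_theory :: "('s, 'f, 'r, 'u::universe) thy \<Rightarrow> bool"
  where "geometric_theory \<T> \<longleftrightarrow> is_signature (Sg \<T>) \<and>
    small TYPE('u) (Sorts (Sg \<T>)) \<and> small TYPE('u) (Funs (Sg \<T>)) \<and> small TYPE('u) (Rels (Sg \<T>)) \<and>
    small TYPE('u) (Axs \<T>) \<and>
    (\<forall>(\<Gamma>, \<phi>, \<psi>) \<in> Axs \<T>. \<Gamma> \<in> lists (Sorts (Sg \<T>)) \<and>
      geometric_fm (Sg \<T>) \<phi> \<Gamma> \<and> geometric_fm (Sg \<T>) \<psi> \<Gamma>)"

section \<open>Structures and models in a category\<close>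

record ('s, 'f, 'r, 'o, 'a) struct =
  SortI :: "'s \<Rightarrow> 'o"
  FunI :: "'f \<Rightarrow> 'a"
  RelI :: "'r \<Rightarrow> 'a"

definition is_struct ::
    "('s, 'f, 'r) signature \<Rightarrow> ('o, 'a) cat \<Rightarrow> ('s, 'f, 'r, 'o, 'a) struct \<Rightarrow> bool"
  where "is_struct \<Sigma> C M \<longleftrightarrow>
    (\<forall>A \<in> Sorts \<Sigma>. SortI M A \<in> Ob C) \<and>
    (\<forall>f \<in> Funs \<Sigma>. FunI M f \<in> hom C (prod_ob C (map (SortI M) (FDom \<Sigma> f))) (SortI M (FCod \<Sigma> f))) \<and>
    (\<forall>R \<in> Rels \<Sigma>. RelI M R \<in> subs C (prod_ob C (map (SortI M) (RAr \<Sigma> R))))"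

primrec sem_tm :: "('s, 'f, 'r) signature \<Rightarrow> ('o, 'a) cat \<Rightarrow> ('s, 'f, 'r, 'o, 'a) struct \<Rightarrow>
    's list \<Rightarrow> 'f tm \<Rightarrow> 'a" where
    "sem_tm \<Sigma> C M \<Gamma> (Var i) = prjs C (map (SortI M) \<Gamma>) ! i"
  | "sem_tm \<Sigma> C M \<Gamma> (Fun f ts) = FunI M f \<cdot>\<^bsub>C\<^esub>
      tuple C (prod_ob C (map (SortI M) \<Gamma>)) (map (SortI M) (FDom \<Sigma> f)) (map (sem_tm \<Sigma> C M \<Gamma>) ts)"

primrec sem_fm :: "('s, 'f, 'r) signature \<Rightarrow> ('o, 'a) cat \<Rightarrow> ('s, 'f, 'r, 'o, 'a) struct \<Rightarrow>
    ('s, 'f, 'r, 'u) fm \<Rightarrow> 's list \<Rightarrow> 'a" where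
    "sem_fm \<Sigma> C M (Rel R ts) \<Gamma> = fst (pb C
      (tuple C (prod_ob C (map (SortI M) \<Gamma>)) (map (SortI M) (RAr \<Sigma> R)) (map (sem_tm \<Sigma> C M \<Gamma>) ts))
      (RelI M R))"
  | "sem_fm \<Sigma> C M (Eq s t) \<Gamma> = (SOME m. is_equalizer C (sem_tm \<Sigma> C M \<Gamma> s) (sem_tm \<Sigma> C M \<Gamma> t) m)"
  | "sem_fm \<Sigma> C M Top \<Gamma> = Id C (prod_ob C (map (SortI M) \<Gamma>))"
  | "sem_fm \<Sigma> C M (And \<phi> \<psi>) \<Gamma> =
      meet_sub C (prod_ob C (map (SortI M) \<Gamma>)) (sem_fm \<Sigma> C M \<phi> \<Gamma>) (sem_fm \<Sigma> C M \<psi> \<Gamma>)"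
  | "sem_fm \<Sigma> C M (Disj I \<phi>s) \<Gamma> =
      union_sub C (prod_ob C (map (SortI M) \<Gamma>)) ((\<lambda>i. sem_fm \<Sigma> C M (\<phi>s i) \<Gamma>) ` I)"
  | "sem_fm \<Sigma> C M (Ex A \<phi>) \<Gamma> = image_ar C
      (tuple C (prod_ob C (map (SortI M) (A # \<Gamma>))) (map (SortI M) \<Gamma>) (tl (prjs C (map (SortI M) (A # \<Gamma>))))
        \<cdot>\<^bsub>C\<^esub> sem_fm \<Sigma> C M \<phi> (A # \<Gamma>))"

definition is_model ::
    "('s, 'f, 'r, 'u) thy \<Rightarrow> ('o, 'a) cat \<Rightarrow> ('s, 'f, 'r, 'o, 'a) struct \<Rightarrow> bool"
  where "is_model \<T> C M \<longleftrightarrow> is_struct (Sg \<T>) C M \<and>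
    (\<forall>(\<Gamma>, \<phi>, \<psi>) \<in> Axs \<T>. factors C (sem_fm (Sg \<T>) C M \<phi> \<Gamma>) (sem_fm (Sg \<T>) C M \<psi> \<Gamma>))"

definition struct_homs :: "('s, 'f, 'r) signature \<Rightarrow> ('o, 'a) cat \<Rightarrow>
    ('s, 'f, 'r, 'o, 'a) struct \<Rightarrow> ('s, 'f, 'r, 'o, 'a) struct \<Rightarrow> ('s \<Rightarrow> 'a) set"
  where "struct_homs \<Sigma> C M N = {h \<in> (\<Pi>\<^sub>E A \<in> Sorts \<Sigma>. hom C (SortI M A) (SortI N A)).
    (\<forall>f \<in> Funs \<Sigma>. h (FCod \<Sigma> f) \<cdot>\<^bsub>C\<^esub> FunI M f = FunI N f \<cdot>\<^bsub>C\<^esub>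
      prod_map C (map (SortI M) (FDom \<Sigma> f)) (map (SortI N) (FDom \<Sigma> f)) (map h (FDom \<Sigma> f))) \<and>
    (\<forall>R \<in> Rels \<Sigma>. factors C
      (prod_map C (map (SortI M) (RAr \<Sigma> R)) (map (SortI N) (RAr \<Sigma> R)) (map h (RAr \<Sigma> R))
        \<cdot>\<^bsub>C\<^esub> RelI M R)
      (RelI N R))}"

definition T_mod :: "('s, 'f, 'r, 'u) thy \<Rightarrow> ('o, 'a) cat \<Rightarrow>
    (('s, 'f, 'r, 'o, 'a) struct,
     ('s, 'f, 'r, 'o, 'a) struct \<times> ('s \<Rightarrow> 'a) \<times> ('s, 'f, 'r, 'o, 'a) struct) cat"
  where "T_mod \<T> C = \<lparr>
    Ob = {M. is_model \<T> C M},
    Ar = {(M, h, N). is_model \<T> C M \<and> is_model \<T> C N \<and> h \<in> struct_homs (Sg \<T>) C M N},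
    Dom = (\<lambda>(M, h, N). M),
    Cod = (\<lambda>(M, h, N). N),
    Id = (\<lambda>M. (M, \<lambda>A\<in>Sorts (Sg \<T>). Id C (SortI M A), M)),
    Cmp = (\<lambda>(N', k, L) (M, h, N). (M, \<lambda>A\<in>Sorts (Sg \<T>). k A \<cdot>\<^bsub>C\<^esub> h A, L))\<rparr>"

text \<open>
  The image of a structure under a functor F from C to D that preserves finite limits.
  The comparison arrow from \<open>F (A\<^sub>1 \<times> \<dots> \<times> A\<^sub>n)\<close> to \<open>F A\<^sub>1 \<times> \<dots> \<times> F A\<^sub>n\<close> is then an isomorphism.
\<close>

definition prod_comparison ::
    "('o, 'a) cat \<Rightarrow> ('p, 'b) cat \<Rightarrow> ('o, 'a, 'p, 'b) fnctr \<Rightarrow> 'o list \<Rightarrow> 'b"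
  where "prod_comparison C D F As =
    tuple D (FOb F (prod_ob C As)) (map (FOb F) As) (map (FAr F) (prjs C As))"

definition map_struct :: "('s, 'f, 'r) signature \<Rightarrow> ('o, 'a) cat \<Rightarrow> ('p, 'b) cat \<Rightarrow>
    ('o, 'a, 'p, 'b) fnctr \<Rightarrow> ('s, 'f, 'r, 'o, 'a) struct \<Rightarrow> ('s, 'f, 'r, 'p, 'b) struct"
  where "map_struct \<Sigma> C D F M = \<lparr>
    SortI = (\<lambda>A. FOb F (SortI M A)),
    FunI = (\<lambda>f. FAr F (FunI M f) \<cdot>\<^bsub>D\<^esub>
      inv_ar D (prod_comparison C D F (map (SortI M) (FDom \<Sigma> f)))),
    RelI = (\<lambda>R. prod_comparison C D F (map (SortI M) (RAr \<Sigma> R)) \<cdot>\<^bsub>D\<^esub> FAr F (RelI M R))\<rparr>"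

text \<open>The structure \<open>!\<^sub>E\<^sup>*(M)\<close> in the slice over E.\<close>

definition bang_struct :: "('s, 'f, 'r) signature \<Rightarrow> ('o, 'a) cat \<Rightarrow> 'o \<Rightarrow>
    ('s, 'f, 'r, 'o, 'a) struct \<Rightarrow> ('s, 'f, 'r, 'a, 'a \<times> 'a \<times> 'a) struct"
  where "bang_struct \<Sigma> C E M = map_struct \<Sigma> C (slice C E) (bang_pb C E) M"

text \<open>
  The action of f from E' to E on homomorphisms h from \<open>!\<^sub>E\<^sup>*(M)\<close> to \<open>!\<^sub>E\<^sup>*(N)\<close>: apply the functor \<open>f\<^sup>*\<close> and
  transport along the canonical isomorphisms from \<open>f\<^sup>*(!\<^sub>E\<^sup>* X)\<close> to \<open>!\<^sub>E\<^sub>'\<^sup>* X\<close>.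
\<close>

definition reindex_hom :: "('s, 'f, 'r) signature \<Rightarrow> ('o, 'a) cat \<Rightarrow> ('s, 'f, 'r, 'o, 'a) struct \<Rightarrow>
    ('s, 'f, 'r, 'o, 'a) struct \<Rightarrow> 'a \<Rightarrow> ('s \<Rightarrow> 'a \<times> 'a \<times> 'a) \<Rightarrow> ('s \<Rightarrow> 'a \<times> 'a \<times> 'a)"
  where "reindex_hom \<Sigma> C M N f h = (\<lambda>A\<in>Sorts \<Sigma>.
    bang_pb_comp C f (SortI N A) \<cdot>\<^bsub>slice C (Dom C f)\<^esub>
    (FAr (pb_functor C f) (h A) \<cdot>\<^bsub>slice C (Dom C f)\<^esub>
     inv_ar (slice C (Dom C f)) (bang_pb_comp C f (SortI M A))))"

definition reindex :: "('s, 'f, 'r) signature \<Rightarrow> ('o, 'a) cat \<Rightarrow> ('s, 'f, 'r, 'o, 'a) struct \<Rightarrow>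
    ('s, 'f, 'r, 'o, 'a) struct \<Rightarrow> 'a \<Rightarrow>
    ('s, 'f, 'r, 'a, 'a \<times> 'a \<times> 'a) struct \<times> ('s \<Rightarrow> 'a \<times> 'a \<times> 'a) \<times>
      ('s, 'f, 'r, 'a, 'a \<times> 'a \<times> 'a) struct \<Rightarrow>
    ('s, 'f, 'r, 'a, 'a \<times> 'a \<times> 'a) struct \<times> ('s \<Rightarrow> 'a \<times> 'a \<times> 'a) \<times>
      ('s, 'f, 'r, 'a, 'a \<times> 'a \<times> 'a) struct"
  where "reindex \<Sigma> C M N f = (\<lambda>(M', h, N').
    (bang_struct \<Sigma> C (Dom C f) M, reindex_hom \<Sigma> C M N f h, bang_struct \<Sigma> C (Dom C f) N))"

end

theory Submission
  imports Defs
begin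

text \<open>
  A homomorphism from \<open>!\<^sub>E\<^sup>*(M)\<close> to \<open>!\<^sub>E\<^sup>*(N)\<close> is a family of arrows over E, one for each sort A.  By the
  adjunction between the domain functor of the slice and \<open>!\<^sub>E\<^sup>*\<close> such a family amounts to arrows
  \<open>E \<times> MA \<rightarrow> NA\<close>, and these are represented by \<open>B = \<Prod>\<^sub>A NA\<^bsup>MA\<^esup>\<close> (lemma \<open>object_of_families\<close>).  Whether
  a family commutes with the function symbols and preserves the relation symbols can be read off
  from its action on generalized elements.  Call \<open>b : T \<rightarrow> B\<close> respectful if, at every stage
  \<open>s : S \<rightarrow> T\<close>, the operations on generalized elements given by \<open>b \<cdot> s\<close> preserve the structure.  This
  property passes to later stages and is local, that is, it can be tested on a cover of T.  Such a
  property is the property of factoring through a subobject of B, namely through the union of the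
  images of all respectful arrows (lemma \<open>respectful_subobject\<close>).  That subobject is the object of
  homomorphisms: its generalized elements at E are the respectful arrows \<open>E \<rightarrow> B\<close>, which correspond
  to the homomorphisms over E (lemmas \<open>components_struct_hom\<close> and \<open>bij_betw_slice_homs\<close>).

  Homomorphisms are arrows of the category of models over E, so it also matters that \<open>!\<^sub>E\<^sup>*(M)\<close> is a
  model.  This is shown by Kripke-Joyal semantics.  The relation \<open>forces\<close> says that a tuple of
  generalized elements factors through the interpretation of a formula, and it has the usual
  recursive clauses, in which disjunction and existence hold locally.  A generalized element of
  \<open>!\<^sub>E\<^sup>* X\<close> at a stage \<open>t : T \<rightarrow> E\<close> is the same thing as one of X at T, and t and T have the same
  covers.  Hence forcing over E and forcing in the topos agree (lemma \<open>forces_BM\<close>), and with them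
  the validity of sequents.

  The topos itself enters in two ways only: through the object B, and through finite limits
  together with unions of arbitrary families of images, stable under pullback (locale
  \<open>geometric_category\<close>, which contains the slices as well).  Both are obtained by describing the
  topos through sections, in the locale \<open>sheaf_model\<close>: along an equivalence with a category of
  sheaves every object acquires sets of sections over the objects of the site, arrows become
  natural families of functions, and every sheaf of small sets is represented by an object.  Since
  pullbacks, subsheaves given by a local condition and sheaves of families of maps are all defined
  section by section, the constructions can be carried out pointwise.
\<close>

section \<open>Small sets\<close>

lemma small_lepoll:
  assumes "small TYPE('u::universe) X" "Y \<lesssim> X"
  shows "small TYPE('u) Y"
  using assms lesspoll_trans1 unfolding small_def by blast

lemma small_subset:
  assumes "small TYPE('u::universe) X" "Y \<subseteq> X"
  shows "small TYPE('u) Y"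
  using assms small_lepoll subset_imp_lepoll by blast

text \<open>
  Values in an arbitrary type can be replaced by elements of the universe; this is how sheaves of
  pairs or of functions become sheaves in the sense of \<open>is_sheaf\<close>.
\<close>

lemma small_code:
  assumes "small TYPE('u::universe) X"
  obtains e :: "'x \<Rightarrow> 'u::universe" where "inj_on e X" "small TYPE('u) (e ` X)"
proof -
  have "X \<lesssim> (UNIV :: 'u set)"
    using assms lesspoll_def small_def by blast
  then obtain e :: "'x \<Rightarrow> 'u" where e: "inj_on e X"
    unfolding lepoll_def by blast
  moreover have "small TYPE('u) (e ` X)"
    using assms image_lepoll small_lepoll by blast
  ultimately show thesis
    using that by blast
qed

lemma small_unit: "small TYPE('u::universe) {x}"
  unfolding small_def using infinite_universe finite_lesspoll_infinite by blast

lemma small_Powset: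
  assumes "small TYPE('u::universe) X"
  shows "small TYPE('u) (Pow X)"
proof -
  obtain e :: "'a \<Rightarrow> 'u" where e: "inj_on e X" "small TYPE('u) (e ` X)"
    using small_code[OF assms] .
  have "small TYPE('u) (Pow (e ` X))"
    using e(2) small_Pow unfolding small_def by blast
  moreover have "Pow X \<lesssim> Pow (e ` X)"
    unfolding lepoll_def
    by (intro exI[of _ "\<lambda>Y. e ` Y"]) (use inj_on_image_Pow[OF e(1)] in auto)
  ultimately show ?thesis
    using small_lepoll by blast
qed

text \<open>
  An infinite universe contains a copy of its own square.  Inside that copy the disjoint union is
  the union, over a small index set, of small subsets of the universe.
\<close>

lemma small_Sigma:
  assumes I: "small TYPE('u::universe) I" and Y: "\<And>i. i \<in> I \<Longrightarrow> small TYPE('u) (Y i)"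
  shows "small TYPE('u) (Sigma I Y)"
proof -
  have "\<exists>p :: 'u \<times> 'u \<Rightarrow> 'u. inj p"
    using card_of_Times_same_infinite[OF infinite_universe[where 'a='u]]
    by (metis card_of_ordIso bij_betw_def UNIV_Times_UNIV)
  then obtain p :: "'u \<times> 'u \<Rightarrow> 'u" where p: "inj p" ..
  obtain e :: "_ \<Rightarrow> 'u" where e: "inj_on e I" "small TYPE('u) (e ` I)"
    using small_code[OF I] .
  have "\<forall>i. \<exists>d :: _ \<Rightarrow> 'u. i \<in> I \<longrightarrow> inj_on d (Y i) \<and> small TYPE('u) (d ` Y i)"
    using small_code Y by metis
  then obtain d :: "_ \<Rightarrow> _ \<Rightarrow> 'u" where d: "\<And>i. i \<in> I \<Longrightarrow> inj_on (d i) (Y i) \<and> small TYPE('u) (d i ` Y i)"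
    by metis
  define Z where "Z j = (\<lambda>y. p (j, d (inv_into I e j) y)) ` Y (inv_into I e j)" for j
  have "small TYPE('u) (Z j)" if "j \<in> e ` I" for j
    unfolding Z_def by (rule small_lepoll[OF Y image_lepoll]) (use that in \<open>simp add: inv_into_into\<close>)
  then have "small TYPE('u) (\<Union>j\<in>e ` I. Z j)"
    using small_UN e(2) unfolding small_def by blast
  moreover have "Sigma I Y \<lesssim> (\<Union>j\<in>e ` I. Z j)"
    unfolding lepoll_def
  proof (intro exI[of _ "\<lambda>(i, y). p (e i, d i y)"] conjI)
    show "inj_on (\<lambda>(i, y). p (e i, d i y)) (Sigma I Y)"
    proof (rule inj_onI, clarsimp)
      fix i y i' y'
      assume *: "i \<in> I" "y \<in> Y i" "i' \<in> I" "y' \<in> Y i'" "p (e i, d i y) = p (e i', d i' y')"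
      then have "e i = e i'" "d i y = d i' y'"
        using p by (auto dest: injD)
      then show "i = i' \<and> y = y'"
        using * e(1) d by (metis inj_onD)
    qed
    show "(\<lambda>(i, y). p (e i, d i y)) ` Sigma I Y \<subseteq> (\<Union>j\<in>e ` I. Z j)"
      unfolding Z_def using e(1) by auto
  qed
  ultimately show ?thesis
    using small_lepoll by blast
qed

text \<open>
  A function on I is determined by its graph, which is a subset of the disjoint union.
\<close>

lemma small_PiE:
  assumes I: "small TYPE('u::universe) I" and Y: "\<And>i. i \<in> I \<Longrightarrow> small TYPE('u) (Y i)"
  shows "small TYPE('u) (Pi\<^sub>E I Y)"
proof -
  have "Pi\<^sub>E I Y \<lesssim> Pow (Sigma I Y)"
    unfolding lepoll_def
  proof (intro exI[of _ "\<lambda>h. (\<lambda>i. (i, h i)) ` I"] conjI)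
    show "inj_on (\<lambda>h. (\<lambda>i. (i, h i)) ` I) (Pi\<^sub>E I Y)"
    proof (rule inj_onI)
      fix h h' assume *: "h \<in> Pi\<^sub>E I Y" "h' \<in> Pi\<^sub>E I Y" "(\<lambda>i. (i, h i)) ` I = (\<lambda>i. (i, h' i)) ` I"
      have "h i = h' i" if "i \<in> I" for i
        using *(3) that by auto
      then show "h = h'"
        using *(1,2) by (blast intro: PiE_ext)
    qed
  qed (auto simp: PiE_iff)
  then show ?thesis
    using small_lepoll small_Powset small_Sigma assms by blast
qed

section \<open>Composition of arrows\<close>

lemma hom_iff: "f \<in> hom C X Y \<longleftrightarrow> f \<in> Ar C \<and> Dom C f = X \<and> Cod C f = Y"
  by (simp add: hom_def)

lemma homD:
  assumes "f \<in> hom C X Y"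
  shows "f \<in> Ar C" "Dom C f = X" "Cod C f = Y"
  using assms by (auto simp: hom_def)

context category
begin

lemma Cmp_Ar [simp]:
  assumes "f \<in> Ar C" "g \<in> Ar C" "Dom C g = Cod C f"
  shows "g \<cdot> f \<in> Ar C" "Dom C (g \<cdot> f) = Dom C f" "Cod C (g \<cdot> f) = Cod C g"
  using Cmp_hom[of f "Dom C f" "Cod C f" g "Cod C g"] assms by (auto simp: hom_iff)

lemma assoc [simp]:
  assumes "f \<in> Ar C" "g \<in> Ar C" "h \<in> Ar C" "Dom C g = Cod C f" "Dom C h = Cod C g"
  shows "(h \<cdot> g) \<cdot> f = h \<cdot> (g \<cdot> f)"
  using Cmp_assoc[of f "Dom C f" "Cod C f" g "Cod C g" h "Cod C h"] assms by (auto simp: hom_iff)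

lemma Id_Ar [simp]:
  assumes "X \<in> Ob C"
  shows "Id C X \<in> Ar C" "Dom C (Id C X) = X" "Cod C (Id C X) = X"
  using Id_hom[OF assms] by (auto simp: hom_iff)

lemma Id_right [simp]: "f \<in> Ar C \<Longrightarrow> Dom C f = X \<Longrightarrow> f \<cdot> Id C X = f"
  using Cmp_Id_right[of f X "Cod C f"] by (auto simp: hom_iff)

lemma Id_left [simp]: "f \<in> Ar C \<Longrightarrow> Cod C f = X \<Longrightarrow> Id C X \<cdot> f = f"
  using Cmp_Id_left[of f "Dom C f" X] by (auto simp: hom_iff)

lemma hom_Ob:
  assumes "f \<in> hom C X Y"
  shows "X \<in> Ob C" "Y \<in> Ob C"
  using assms Dom_Ob Cod_Ob by (auto simp: hom_iff)

lemma is_inverse_unique: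
  assumes "is_inverse C f g" "is_inverse C f g'"
  shows "g = g'"
proof -
  have "g = g \<cdot> (f \<cdot> g')"
    using assms by (simp add: is_inverse_def hom_iff)
  also have "\<dots> = (g \<cdot> f) \<cdot> g'"
    using assms by (subst assoc) (auto simp: is_inverse_def hom_iff)
  also have "\<dots> = g'"
    using assms by (simp add: is_inverse_def hom_iff)
  finally show ?thesis .
qed

lemma inv_ar_eq: "is_inverse C f g \<Longrightarrow> inv_ar C f = g"
  unfolding inv_ar_def using is_inverse_unique by blast

lemma iso_cancel_left:
  assumes "iso C h" "f \<in> Ar C" "g \<in> Ar C" "Cod C f = Dom C h" "Cod C g = Dom C h" "h \<cdot> f = h \<cdot> g"
  shows "f = g"
proof -
  obtain k where k: "is_inverse C h k"
    using assms by (auto simp: iso_def)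
  then have k': "k \<in> Ar C" "h \<in> Ar C" "Dom C k = Cod C h" "Cod C k = Dom C h" "k \<cdot> h = Id C (Dom C h)"
    by (auto simp: is_inverse_def hom_iff)
  have "f = (k \<cdot> h) \<cdot> f"
    unfolding k' using assms by simp
  also have "\<dots> = k \<cdot> (h \<cdot> f)"
    using k'(1-4) assms by simp
  also have "\<dots> = (k \<cdot> h) \<cdot> g"
    using k'(1-4) assms by simp
  also have "\<dots> = g"
    unfolding k' using assms by simp
  finally show ?thesis .
qed

lemma iso_cancel_right:
  assumes "iso C h" "f \<in> Ar C" "g \<in> Ar C" "Dom C f = Cod C h" "Dom C g = Cod C h" "f \<cdot> h = g \<cdot> h"
  shows "f = g"
proof -
  obtain k where k: "is_inverse C h k"
    using assms by (auto simp: iso_def)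
  then have k': "k \<in> Ar C" "h \<in> Ar C" "Dom C k = Cod C h" "Cod C k = Dom C h" "h \<cdot> k = Id C (Cod C h)"
    by (auto simp: is_inverse_def hom_iff)
  have "f = f \<cdot> (h \<cdot> k)"
    unfolding k' using assms by simp
  also have "\<dots> = (f \<cdot> h) \<cdot> k"
    using k'(1-4) assms(2-5) by simp
  also have "\<dots> = (g \<cdot> h) \<cdot> k"
    using assms by simp
  also have "\<dots> = g \<cdot> (h \<cdot> k)"
    using k'(1-4) assms(2-5) by simp
  also have "\<dots> = g"
    unfolding k' using assms by simp
  finally show ?thesis .
qed

end

section \<open>A Grothendieck topos as a category of sheaves\<close>

text \<open>
  A more flexible form of sheaves and their matching families: the sections may have any type, and
  restriction maps are unconstrained off the sections.
\<close>

definition matching :: "('c, 'm) cat \<Rightarrow> ('c \<Rightarrow> 'x set) \<Rightarrow> ('m \<Rightarrow> 'x \<Rightarrow> 'x) \<Rightarrow> 'm set \<Rightarrow> ('m \<Rightarrow> 'x) \<Rightarrow> bool"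
  where "matching C S r R x \<longleftrightarrow> (\<forall>f \<in> R. x f \<in> S (Dom C f) \<and>
    (\<forall>g \<in> Ar C. Cod C g = Dom C f \<longrightarrow> r g (x f) = x (f \<cdot>\<^bsub>C\<^esub> g)))"

definition sheaf_data :: "'u::universe itself \<Rightarrow> ('c, 'm) cat \<Rightarrow> ('c \<Rightarrow> 'm set set) \<Rightarrow>
    ('c \<Rightarrow> 'x set) \<Rightarrow> ('m \<Rightarrow> 'x \<Rightarrow> 'x) \<Rightarrow> bool"
  where "sheaf_data u C J S r \<longleftrightarrow>
    (\<forall>c \<in> Ob C. small u (S c)) \<and>
    (\<forall>f \<in> Ar C. \<forall>x \<in> S (Cod C f). r f x \<in> S (Dom C f)) \<and>
    (\<forall>c \<in> Ob C. \<forall>x \<in> S c. r (Id C c) x = x) \<and>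
    (\<forall>f \<in> Ar C. \<forall>g \<in> Ar C. Cod C g = Dom C f \<longrightarrow>
      (\<forall>x \<in> S (Cod C f). r (f \<cdot>\<^bsub>C\<^esub> g) x = r g (r f x))) \<and>
    (\<forall>c \<in> Ob C. \<forall>R \<in> J c. \<forall>x. matching C S r R x \<longrightarrow>
      (\<exists>!a. a \<in> S c \<and> (\<forall>f \<in> R. r f a = x f)))"

text \<open>
  A category seen through sections: \<open>el X c\<close> are the sections of X over an object c of the site,
  \<open>rs X m\<close> restricts sections along m, and \<open>ap f c\<close> is the action of an arrow f on sections over c.
  The last three assumptions make the category equivalent to the category of all sheaves on the site.
\<close>

locale sheaf_model =
  category \<E> + S: site C J
  for \<E> :: "('o, 'a) cat" (structure) and C :: "('u::universe, 'u) cat" and J +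
  fixes el :: "'o \<Rightarrow> 'u \<Rightarrow> 'u set"
    and rs :: "'o \<Rightarrow> 'u \<Rightarrow> 'u \<Rightarrow> 'u"
    and ap :: "'a \<Rightarrow> 'u \<Rightarrow> 'u \<Rightarrow> 'u"
  assumes small_Ob: "small TYPE('u) (Ob C)"
    and small_Ar: "small TYPE('u) (Ar C)"
    and sheaf: "X \<in> Ob \<E> \<Longrightarrow> sheaf_data TYPE('u) C J (el X) (rs X)"
    and ap_el: "f \<in> hom \<E> X Y \<Longrightarrow> c \<in> Ob C \<Longrightarrow> x \<in> el X c \<Longrightarrow> ap f c x \<in> el Y c"
    and ap_rs: "f \<in> hom \<E> X Y \<Longrightarrow> m \<in> Ar C \<Longrightarrow> x \<in> el X (Cod C m) \<Longrightarrow>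
      ap f (Dom C m) (rs X m x) = rs Y m (ap f (Cod C m) x)"
    and ap_Id: "X \<in> Ob \<E> \<Longrightarrow> c \<in> Ob C \<Longrightarrow> x \<in> el X c \<Longrightarrow> ap (Id \<E> X) c x = x"
    and ap_Cmp: "f \<in> hom \<E> X Y \<Longrightarrow> g \<in> hom \<E> Y Z \<Longrightarrow> c \<in> Ob C \<Longrightarrow> x \<in> el X c \<Longrightarrow>
      ap (g \<cdot> f) c x = ap g c (ap f c x)"
    and ap_inj: "f \<in> hom \<E> X Y \<Longrightarrow> g \<in> hom \<E> X Y \<Longrightarrow>
      (\<And>c x. c \<in> Ob C \<Longrightarrow> x \<in> el X c \<Longrightarrow> ap f c x = ap g c x) \<Longrightarrow> f = g"
    and ap_full: "X \<in> Ob \<E> \<Longrightarrow> Y \<in> Ob \<E> \<Longrightarrow>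
      (\<And>c x. c \<in> Ob C \<Longrightarrow> x \<in> el X c \<Longrightarrow> \<eta> c x \<in> el Y c) \<Longrightarrow>
      (\<And>m x. m \<in> Ar C \<Longrightarrow> x \<in> el X (Cod C m) \<Longrightarrow>
        \<eta> (Dom C m) (rs X m x) = rs Y m (\<eta> (Cod C m) x)) \<Longrightarrow>
      \<exists>f \<in> hom \<E> X Y. \<forall>c \<in> Ob C. \<forall>x \<in> el X c. ap f c x = \<eta> c x"
    and represent_in_universe: "sheaf_data TYPE('u) C J (Q :: 'u \<Rightarrow> 'u set) r \<Longrightarrow> \<exists>X \<in> Ob \<E>. \<exists>e.
      (\<forall>c \<in> Ob C. bij_betw (e c) (el X c) (Q c)) \<and>
      (\<forall>m \<in> Ar C. \<forall>x \<in> el X (Cod C m). e (Dom C m) (rs X m x) = r m (e (Cod C m) x))"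
begin

text \<open>
  Coding the sections over each c injectively in the universe turns an arbitrary sheaf into one with
  values in the universe; restriction maps are transported along the codes.
\<close>

lemma represent:
  fixes Q :: "'u \<Rightarrow> 'x set"
  assumes Q: "sheaf_data TYPE('u) C J Q r"
  shows "\<exists>X \<in> Ob \<E>. \<exists>e. (\<forall>c \<in> Ob C. bij_betw (e c) (el X c) (Q c)) \<and>
      (\<forall>m \<in> Ar C. \<forall>x \<in> el X (Cod C m). e (Dom C m) (rs X m x) = r m (e (Cod C m) x))"
proof -
  note Q' = Q[unfolded sheaf_data_def]
  have "\<forall>c. \<exists>d :: _ \<Rightarrow> 'u. c \<in> Ob C \<longrightarrow> inj_on d (Q c) \<and> small TYPE('u) (d ` Q c)"
  proof
    fix c show "\<exists>d :: _ \<Rightarrow> 'u. c \<in> Ob C \<longrightarrow> inj_on d (Q c) \<and> small TYPE('u) (d ` Q c)"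
      using small_code[of "Q c"] Q'[THEN conjunct1] by blast
  qed
  then obtain d :: "_ \<Rightarrow> _ \<Rightarrow> 'u" where
    d: "\<And>c. c \<in> Ob C \<Longrightarrow> inj_on (d c) (Q c)" "\<And>c. c \<in> Ob C \<Longrightarrow> small TYPE('u) (d c ` Q c)"
    by metis
  define i where "i c = inv_into (Q c) (d c)" for c
  have id: "i c (d c x) = x" if "c \<in> Ob C" "x \<in> Q c" for c x
    unfolding i_def using that d by simp
  have di: "d c (i c y) = y" "i c y \<in> Q c" if "y \<in> d c ` Q c" for c y
    unfolding i_def using that by (auto simp: f_inv_into_f inv_into_into)
  define Q1 where "Q1 c = d c ` Q c" for c
  define r1 where "r1 m y = d (Dom C m) (r m (i (Cod C m) y))" for m y
  have r1: "r1 m (d (Cod C m) x) = d (Dom C m) (r m x)" if "m \<in> Ar C" "x \<in> Q (Cod C m)" for m x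
    unfolding r1_def using that id S.Cod_Ob by simp
  have "sheaf_data TYPE('u) C J Q1 r1"
    unfolding sheaf_data_def
  proof (intro conjI ballI allI impI)
    fix c R x
    assume c: "c \<in> Ob C" and R: "R \<in> J c" and x: "matching C Q1 r1 R x"
    have RA: "f \<in> Ar C" "Cod C f = c" "Dom C f \<in> Ob C" if "f \<in> R" for f
      using S.J_sieve[OF c R] that S.Dom_Ob by (auto simp: sieve_def)
    have RC: "f \<cdot>\<^bsub>C\<^esub> g \<in> R" if "f \<in> R" "g \<in> Ar C" "Cod C g = Dom C f" for f g
      using S.J_sieve[OF c R] that by (auto simp: sieve_def)
    have xQ: "x f \<in> d (Dom C f) ` Q (Dom C f)" if "f \<in> R" for f
      using x that by (auto simp: matching_def Q1_def)
    have xr: "r1 g (x f) = x (f \<cdot>\<^bsub>C\<^esub> g)" if "f \<in> R" "g \<in> Ar C" "Cod C g = Dom C f" for f g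
      using x that by (auto simp: matching_def)
    have "matching C Q r R (\<lambda>f. i (Dom C f) (x f))"
      unfolding matching_def
    proof (intro ballI conjI impI)
      fix f assume f: "f \<in> R"
      show m: "i (Dom C f) (x f) \<in> Q (Dom C f)"
        by (rule di(2)[OF xQ[OF f]])
      fix g assume g: "g \<in> Ar C" "Cod C g = Dom C f"
      have "d (Dom C g) (r g (i (Dom C f) (x f))) = r1 g (x f)"
        using r1[of g "i (Dom C f) (x f)"] g m di(1)[OF xQ[OF f]] by simp
      then have "i (Dom C g) (d (Dom C g) (r g (i (Dom C f) (x f)))) = i (Dom C g) (x (f \<cdot>\<^bsub>C\<^esub> g))"
        using xr[OF f g] by simp
      moreover have "r g (i (Dom C f) (x f)) \<in> Q (Dom C g)"
        using Q' g m by metis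
      ultimately show "r g (i (Dom C f) (x f)) = i (Dom C (f \<cdot>\<^bsub>C\<^esub> g)) (x (f \<cdot>\<^bsub>C\<^esub> g))"
        using id S.Dom_Ob g RA f by simp
    qed
    then have ex1: "\<exists>!a. a \<in> Q c \<and> (\<forall>f\<in>R. r f a = i (Dom C f) (x f))"
      using Q' c R by blast
    then obtain a where a: "a \<in> Q c" "\<forall>f\<in>R. r f a = i (Dom C f) (x f)"
      by blast
    show "\<exists>!a. a \<in> Q1 c \<and> (\<forall>f\<in>R. r1 f a = x f)"
    proof (rule ex1I[of _ "d c a"], intro conjI ballI)
      show "d c a \<in> Q1 c"
        using a by (simp add: Q1_def)
      show "r1 f (d c a) = x f" if "f \<in> R" for f
        using r1[of f a] RA[OF that] a that di[OF xQ[OF that]] by simp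
      fix b assume b: "b \<in> Q1 c \<and> (\<forall>f\<in>R. r1 f b = x f)"
      then obtain b' where b': "b' \<in> Q c" "b = d c b'"
        by (auto simp: Q1_def)
      have "r f b' = i (Dom C f) (x f)" if f: "f \<in> R" for f
      proof -
        have "d (Dom C f) (r f b') = x f"
          using r1[of f b'] RA[OF f] b' b f by simp
        moreover have "r f b' \<in> Q (Dom C f)"
          using Q' b' RA[OF f] by metis
        ultimately show ?thesis
          using id RA[OF f] by metis
      qed
      then have "b' = a"
        using ex1 a b' by blast
      then show "b = d c a"
        using b' by simp
    qed
  next
    fix f g x
    assume fg: "f \<in> Ar C" "g \<in> Ar C" "Cod C g = Dom C f" and "x \<in> Q1 (Cod C f)"
    then obtain y where y: "y \<in> Q (Cod C f)" "x = d (Cod C f) y"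
      by (auto simp: Q1_def)
    have "r f y \<in> Q (Dom C f)" "r (f \<cdot>\<^bsub>C\<^esub> g) y = r g (r f y)"
      using Q' fg y by metis+
    then show "r1 (f \<cdot>\<^bsub>C\<^esub> g) x = r1 g (r1 f x)"
      using r1[of "f \<cdot>\<^bsub>C\<^esub> g" y] r1[of f y] r1[of g "r f y"] fg y by simp
  next
    fix c x assume c: "c \<in> Ob C" and "x \<in> Q1 c"
    then obtain y where y: "y \<in> Q c" "x = d c y"
      by (auto simp: Q1_def)
    have "r (Id C c) y = y"
      using Q' c y by metis
    then show "r1 (Id C c) x = x"
      using r1[of "Id C c" y] c y by simp
  next
    fix f x assume f: "f \<in> Ar C" and "x \<in> Q1 (Cod C f)"
    then obtain y where y: "y \<in> Q (Cod C f)" "x = d (Cod C f) y"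
      by (auto simp: Q1_def)
    then have "r f y \<in> Q (Dom C f)"
      using Q' f by metis
    then show "r1 f x \<in> Q1 (Dom C f)"
      using r1[of f y] f y by (auto simp: Q1_def)
  qed (use d in \<open>auto simp: Q1_def\<close>)
  from represent_in_universe[OF this] obtain X e where X: "X \<in> Ob \<E>"
    and e': "\<forall>c \<in> Ob C. bij_betw (e c) (el X c) (Q1 c)"
    and en': "\<forall>m \<in> Ar C. \<forall>x \<in> el X (Cod C m). e (Dom C m) (rs X m x) = r1 m (e (Cod C m) x)"
    by blast
  note e = e'[rule_format] and en = en'[rule_format]
  have "bij_betw (i c \<circ> e c) (el X c) (Q c)" if "c \<in> Ob C" for c
  proof -
    have "bij_betw (i c) (Q1 c) (Q c)"
      unfolding i_def Q1_def by (rule bij_betw_inv_into[OF inj_on_imp_bij_betw[OF d(1)[OF that]]])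
    then show ?thesis
      by (rule bij_betw_trans[OF e[OF that]])
  qed
  moreover have "(i (Dom C m) \<circ> e (Dom C m)) (rs X m x) = r m ((i (Cod C m) \<circ> e (Cod C m)) x)"
    if m: "m \<in> Ar C" "x \<in> el X (Cod C m)" for m x
  proof -
    have "e (Cod C m) x \<in> Q1 (Cod C m)"
      using bij_betwE[OF e[of "Cod C m"]] m S.Cod_Ob by simp
    then have *: "i (Cod C m) (e (Cod C m) x) \<in> Q (Cod C m)"
      using di by (auto simp: Q1_def)
    then have "r m (i (Cod C m) (e (Cod C m) x)) \<in> Q (Dom C m)"
      using Q' m by metis
    then show ?thesis
      using en[OF m] id m S.Dom_Ob by (simp add: r1_def)
  qed
  ultimately show ?thesis
    using X by (intro bexI[of _ X] exI[of _ "\<lambda>c. i c \<circ> e c"]) auto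
qed

end

text \<open>
  Naturality of \<open>\<eta>\<close> gives \<open>\<eta> \<cdot> f = G F f \<cdot> \<eta>\<close>, so \<open>F f\<close> determines \<open>\<eta> \<cdot> f\<close> and hence f.
\<close>

lemma equivalence_faithful:
  assumes "cat_functor C D F" "cat_functor D C G" "natural_iso C C id_functor (comp_functor G F) \<eta>"
    and f: "f \<in> hom C X Y" and g: "g \<in> hom C X Y" and eq: "FAr F f = FAr F g"
  shows "f = g"
proof -
  interpret F: cat_functor C D F by fact
  interpret G: cat_functor D C G by fact
  have XY: "X \<in> Ob C" "Y \<in> Ob C"
    using F.C.hom_Ob f by auto
  have \<eta>: "\<eta> Z \<in> hom C Z (FOb G (FOb F Z))" "iso C (\<eta> Z)" if "Z \<in> Ob C" for Z
    using assms(3) that by (auto simp: natural_iso_def id_functor_def comp_functor_def)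
  have nat: "\<eta> Y \<cdot>\<^bsub>C\<^esub> h = FAr G (FAr F h) \<cdot>\<^bsub>C\<^esub> \<eta> X" if "h \<in> hom C X Y" for h
    using assms(3) that by (auto simp: natural_iso_def id_functor_def comp_functor_def hom_iff)
  show ?thesis
    by (rule F.C.iso_cancel_left[OF \<eta>(2)[OF XY(2)]])
      (use nat[OF f] nat[OF g] eq f g \<eta>(1)[OF XY(2)] in \<open>auto simp: hom_iff\<close>)
qed

lemma equivalence_faithful':
  assumes "cat_functor C D F" "cat_functor D C G" "natural_iso D D (comp_functor F G) id_functor \<epsilon>"
    and f: "f \<in> hom D X Y" and g: "g \<in> hom D X Y" and eq: "FAr G f = FAr G g"
  shows "f = g"
proof -
  interpret F: cat_functor C D F by fact
  interpret G: cat_functor D C G by fact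
  have XY: "X \<in> Ob D" "Y \<in> Ob D"
    using F.D.hom_Ob f by auto
  have \<epsilon>: "\<epsilon> Z \<in> hom D (FOb F (FOb G Z)) Z" "iso D (\<epsilon> Z)" if "Z \<in> Ob D" for Z
    using assms(3) that by (auto simp: natural_iso_def id_functor_def comp_functor_def)
  have nat: "\<epsilon> Y \<cdot>\<^bsub>D\<^esub> FAr F (FAr G h) = h \<cdot>\<^bsub>D\<^esub> \<epsilon> X" if "h \<in> hom D X Y" for h
    using assms(3) that by (auto simp: natural_iso_def id_functor_def comp_functor_def hom_iff)
  show ?thesis
    by (rule F.D.iso_cancel_right[OF \<epsilon>(2)[OF XY(1)]])
      (use nat[OF f] nat[OF g] eq f g \<epsilon>(1)[OF XY(1)] in \<open>auto simp: hom_iff\<close>)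
qed

text \<open>
  A preimage of k is \<open>\<eta>\<^sup>-\<^sup>1 \<cdot> G k \<cdot> \<eta>\<close>: its image under \<open>G F\<close> is \<open>G k\<close>, and G is faithful.
\<close>

lemma equivalence_full:
  assumes F: "cat_functor C D F" and G: "cat_functor D C G"
    and \<eta>: "natural_iso C C id_functor (comp_functor G F) \<eta>"
    and \<epsilon>: "natural_iso D D (comp_functor F G) id_functor \<epsilon>"
    and X: "X \<in> Ob C" and Y: "Y \<in> Ob C" and k: "k \<in> hom D (FOb F X) (FOb F Y)"
  shows "\<exists>f \<in> hom C X Y. FAr F f = k"
proof -
  interpret F: cat_functor C D F by fact
  interpret G: cat_functor D C G by fact
  have \<eta>': "\<eta> Z \<in> hom C Z (FOb G (FOb F Z))" "iso C (\<eta> Z)" if "Z \<in> Ob C" for Z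
    using \<eta> that by (auto simp: natural_iso_def id_functor_def comp_functor_def)
  have nat: "\<eta> Y \<cdot>\<^bsub>C\<^esub> h = FAr G (FAr F h) \<cdot>\<^bsub>C\<^esub> \<eta> X" if "h \<in> hom C X Y" for h
    using \<eta> that by (auto simp: natural_iso_def id_functor_def comp_functor_def hom_iff)
  obtain j where "is_inverse C (\<eta> Y) j"
    using \<eta>'(2)[OF Y] by (auto simp: iso_def)
  then have j: "j \<in> hom C (FOb G (FOb F Y)) Y" "\<eta> Y \<cdot>\<^bsub>C\<^esub> j = Id C (FOb G (FOb F Y))"
    using \<eta>'(1)[OF Y] by (auto simp: is_inverse_def hom_iff)
  have Gk: "FAr G k \<in> hom C (FOb G (FOb F X)) (FOb G (FOb F Y))"
    using G.FAr_hom k by blast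
  define f where "f = j \<cdot>\<^bsub>C\<^esub> (FAr G k \<cdot>\<^bsub>C\<^esub> \<eta> X)"
  have f: "f \<in> hom C X Y"
    unfolding f_def using j Gk \<eta>'(1)[OF X] by (auto simp: hom_iff)
  have "\<eta> Y \<cdot>\<^bsub>C\<^esub> f = (\<eta> Y \<cdot>\<^bsub>C\<^esub> j) \<cdot>\<^bsub>C\<^esub> (FAr G k \<cdot>\<^bsub>C\<^esub> \<eta> X)"
    unfolding f_def using j(1) Gk \<eta>'(1)[OF X] \<eta>'(1)[OF Y] by (auto simp: hom_iff)
  also have "\<dots> = FAr G k \<cdot>\<^bsub>C\<^esub> \<eta> X"
    unfolding j(2) using Gk \<eta>'(1)[OF X] by (auto simp: hom_iff)
  finally have eq: "FAr G (FAr F f) \<cdot>\<^bsub>C\<^esub> \<eta> X = FAr G k \<cdot>\<^bsub>C\<^esub> \<eta> X"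
    using nat[OF f] by simp
  have "FAr G (FAr F f) = FAr G k"
    by (rule F.C.iso_cancel_right[OF \<eta>'(2)[OF X]])
      (use eq Gk G.FAr_hom[OF F.FAr_hom[OF f]] \<eta>'(1)[OF X] in \<open>auto simp: hom_iff\<close>)
  then have "FAr F f = k"
    using equivalence_faithful'[OF F G \<epsilon>] F.FAr_hom[OF f] k by blast
  then show ?thesis
    using f by blast
qed

lemma hom_Sh:
  "hom (Sh C J) P Q = {(P, \<theta>, Q) |\<theta>. is_sheaf C J P \<and> is_sheaf C J Q \<and> \<theta> \<in> nat_trans C P Q}"
  by (auto simp: hom_def Sh_def)

lemma is_sheaf_data:
  fixes P :: "('c, 'm, 'u::universe) psh"
  assumes "is_sheaf C J P"
  shows "sheaf_data TYPE('u) C J (Sec P) (Res P)"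
proof -
  interpret presheaf C P
    using assms by (simp add: is_sheaf_def)
  show ?thesis
    unfolding sheaf_data_def
  proof (intro conjI ballI allI impI)
    show "Res P f x \<in> Sec P (Dom C f)" if "f \<in> Ar C" "x \<in> Sec P (Cod C f)" for f x
      using Res_fun[of f "Dom C f" "Cod C f"] that by (auto simp: hom_iff)
    show "\<exists>!a. a \<in> Sec P c \<and> (\<forall>f\<in>R. Res P f a = x f)"
      if "c \<in> Ob C" "R \<in> J c" "matching C (Sec P) (Res P) R x" for c R x
      using assms that by (simp add: is_sheaf_def matching_def matching_family_def)
  qed (auto simp: Sec_small Res_Id hom_iff intro!: Res_Cmp)
qed

lemma sheaf_data_is_sheaf:
  fixes Q :: "'c \<Rightarrow> 'u::universe set"
  assumes "site C J" and Q: "sheaf_data TYPE('u) C J Q r"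
  shows "\<exists>P. is_sheaf C J P \<and> (\<forall>c \<in> Ob C. Sec P c = Q c) \<and>
    (\<forall>m \<in> Ar C. \<forall>x \<in> Q (Cod C m). Res P m x = r m x)"
proof -
  interpret site C J by fact
  note Q' = Q[unfolded sheaf_data_def]
  define P where "P = \<lparr>Sec = (\<lambda>c. if c \<in> Ob C then Q c else {}),
    Res = (\<lambda>f. if f \<in> Ar C then restrict (r f) (Q (Cod C f)) else (\<lambda>x. undefined))\<rparr>"
  have [simp]: "Sec P c = Q c" if "c \<in> Ob C" for c
    using that by (simp add: P_def)
  have [simp]: "Res P f x = r f x" if "f \<in> Ar C" "x \<in> Q (Cod C f)" for f x
    using that by (simp add: P_def)
  have rQ: "r f x \<in> Q (Dom C f)" if "f \<in> Ar C" "x \<in> Q (Cod C f)" for f x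
    using Q' that by metis
  have "presheaf C P"
  proof
    show "Res P f \<in> Sec P c \<rightarrow>\<^sub>E Sec P d" if "f \<in> hom C d c" for f c d
      using that rQ Dom_Ob Cod_Ob by (auto simp: P_def hom_iff)
    show "Res P (Id C c) x = x" if "c \<in> Ob C" "x \<in> Sec P c" for c x
      using that Q' by simp
    show "Res P (f \<cdot>\<^bsub>C\<^esub> g) x = Res P g (Res P f x)"
      if "g \<in> hom C e d" "f \<in> hom C d c" "x \<in> Sec P c" for g e d f c x
      using that Q' rQ[of f x] Cod_Ob by (auto simp: hom_iff)
  qed (use Q' in \<open>auto simp: P_def\<close>)
  moreover have "\<exists>!a. a \<in> Sec P c \<and> (\<forall>f\<in>R. Res P f a = x f)"
    if c: "c \<in> Ob C" and R: "R \<in> J c" and x: "matching_family C P R x" for c R x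
  proof -
    have RA: "f \<in> Ar C" "Cod C f = c" "Dom C f \<in> Ob C" if "f \<in> R" for f
      using J_sieve[OF c R] that Dom_Ob by (auto simp: sieve_def)
    have xQ: "x f \<in> Q (Dom C f)" if "f \<in> R" for f
      using bspec[OF x[unfolded matching_family_def] that] RA[OF that] by simp
    have "matching C Q r R x"
      unfolding matching_def
    proof (intro ballI conjI impI)
      show "r g (x f) = x (f \<cdot>\<^bsub>C\<^esub> g)" if f: "f \<in> R" and g: "g \<in> Ar C" "Cod C g = Dom C f" for f g
        using x f g xQ[OF f] unfolding matching_family_def by (metis \<open>\<And>x f. f \<in> Ar C \<Longrightarrow>
            x \<in> Q (Cod C f) \<Longrightarrow> Res P f x = r f x\<close>)
    qed (use xQ in blast)
    then have "\<exists>!a. a \<in> Q c \<and> (\<forall>f\<in>R. r f a = x f)"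
      using Q' c R by blast
    moreover have "(a \<in> Sec P c \<and> (\<forall>f\<in>R. Res P f a = x f)) \<longleftrightarrow> (a \<in> Q c \<and> (\<forall>f\<in>R. r f a = x f))" for a
      using RA c by auto
    ultimately show ?thesis
      by simp
  qed
  ultimately have "is_sheaf C J P"
    unfolding is_sheaf_def by blast
  then show ?thesis
    by (intro exI[of _ P]) auto
qed

text \<open>
  Let F be the equivalence from the topos to the sheaves.  The sections of X are those of \<open>F X\<close>.
  Arrows are the natural families because F is full and faithful, and a sheaf P is represented by
  \<open>G P\<close>, whose sections are matched with those of P by the counit.
\<close>

lemma topos_sheaf_model:
  fixes \<E> :: "('o, 'a) cat"
  assumes "grothendieck_topos TYPE('u::universe) \<E>"
  shows "\<exists>(C :: ('u, 'u) cat) J el rs ap. sheaf_model \<E> C J el rs ap"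
proof -
  from assms obtain C :: "('u, 'u) cat" and J where "category \<E>" and site: "site C J"
    and small: "small TYPE('u) (Ob C)" "small TYPE('u) (Ar C)"
    and equiv: "equivalent_cats \<E> (Sh C J :: (('u, 'u, 'u) psh, _) cat)"
    unfolding grothendieck_topos_def by blast
  interpret category \<E> by fact
  interpret S: site C J by fact
  define D where "D = (Sh C J :: (('u, 'u, 'u) psh, _) cat)"
  from equiv obtain F G \<eta> \<epsilon> where F: "cat_functor \<E> D F" and G: "cat_functor D \<E> G"
    and \<eta>: "natural_iso \<E> \<E> id_functor (comp_functor G F) \<eta>"
    and \<epsilon>: "natural_iso D D (comp_functor F G) id_functor \<epsilon>"
    unfolding equivalent_cats_def D_def by blast
  interpret F: cat_functor \<E> D F by fact
  interpret G: cat_functor D \<E> G by fact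
  have homD_iff: "k \<in> hom D P Q \<longleftrightarrow>
      (\<exists>\<theta>. k = (P, \<theta>, Q) \<and> is_sheaf C J P \<and> is_sheaf C J Q \<and> \<theta> \<in> nat_trans C P Q)" for k P Q
    unfolding D_def hom_Sh by blast
  have CmpD: "(Q, \<theta>, R) \<cdot>\<^bsub>D\<^esub> (P, \<eta>, Q) = (P, \<lambda>c\<in>Ob C. compose (Sec P c) (\<theta> c) (\<eta> c), R)" for P Q R \<theta> \<eta>
    by (simp add: D_def Sh_def)
  have IdD: "Id D P = (P, \<lambda>c\<in>Ob C. \<lambda>x\<in>Sec P c. x, P)" for P
    by (simp add: D_def Sh_def)
  define el where "el X = Sec (FOb F X)" for X
  define rs where "rs X = Res (FOb F X)" for X
  define ap where "ap f = fst (snd (FAr F f))" for f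
  have ap: "FAr F f = (FOb F X, ap f, FOb F Y)" "ap f \<in> nat_trans C (FOb F X) (FOb F Y)"
    if "f \<in> hom \<E> X Y" for f X Y
    using F.FAr_hom[OF that] by (auto simp: homD_iff ap_def)
  have sheafF: "is_sheaf C J (FOb F X)" if "X \<in> Ob \<E>" for X
    using F.FOb_Ob[OF that] by (auto simp: D_def Sh_def)
  have "sheaf_model \<E> C J el rs ap"
  proof
    show "sheaf_data TYPE('u) C J (el X) (rs X)" if "X \<in> Ob \<E>" for X
      unfolding el_def rs_def using is_sheaf_data sheafF[OF that] by blast
    show "ap f c x \<in> el Y c" if "f \<in> hom \<E> X Y" "c \<in> Ob C" "x \<in> el X c" for f X Y c x
      using ap(2)[OF that(1)] that by (auto simp: nat_trans_def el_def)
    show "ap f (Dom C m) (rs X m x) = rs Y m (ap f (Cod C m) x)"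
      if "f \<in> hom \<E> X Y" "m \<in> Ar C" "x \<in> el X (Cod C m)" for f X Y m x
      using ap(2)[OF that(1)] that by (auto simp: nat_trans_def el_def rs_def)
    show "ap (Id \<E> X) c x = x" if "X \<in> Ob \<E>" "c \<in> Ob C" "x \<in> el X c" for X c x
      using that F.FAr_Id[of X] by (simp add: ap_def IdD el_def)
    show "ap (g \<cdot>\<^bsub>\<E>\<^esub> f) c x = ap g c (ap f c x)"
      if f: "f \<in> hom \<E> X Y" and g: "g \<in> hom \<E> Y Z" and "c \<in> Ob C" "x \<in> el X c" for f g X Y Z c x
    proof -
      have "FAr F (g \<cdot>\<^bsub>\<E>\<^esub> f) = (FOb F Y, ap g, FOb F Z) \<cdot>\<^bsub>D\<^esub> (FOb F X, ap f, FOb F Y)"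
        using F.FAr_Cmp[OF f g] ap(1)[OF f] ap(1)[OF g] by simp
      then show ?thesis
        using that by (simp add: ap_def[of "g \<cdot>\<^bsub>\<E>\<^esub> f"] CmpD el_def compose_def)
    qed
    show "f = g" if f: "f \<in> hom \<E> X Y" and g: "g \<in> hom \<E> X Y"
      and eq: "\<And>c x. c \<in> Ob C \<Longrightarrow> x \<in> el X c \<Longrightarrow> ap f c x = ap g c x" for f g X Y
    proof (rule equivalence_faithful[OF F G \<eta> f g])
      have P: "ap f \<in> (\<Pi>\<^sub>E c\<in>Ob C. el X c \<rightarrow>\<^sub>E el Y c)" "ap g \<in> (\<Pi>\<^sub>E c\<in>Ob C. el X c \<rightarrow>\<^sub>E el Y c)"
        using ap(2)[OF f] ap(2)[OF g] by (auto simp: nat_trans_def el_def)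
      have "ap f c = ap g c" if "c \<in> Ob C" for c
        by (rule PiE_ext[OF PiE_mem[OF P(1) that] PiE_mem[OF P(2) that] eq[OF that]])
      then have "ap f = ap g"
        by (rule PiE_ext[OF P])
      then show "FAr F f = FAr F g"
        using ap(1)[OF f] ap(1)[OF g] by simp
    qed
    show "\<exists>f\<in>hom \<E> X Y. \<forall>c\<in>Ob C. \<forall>x\<in>el X c. ap f c x = \<theta> c x"
      if X: "X \<in> Ob \<E>" and Y: "Y \<in> Ob \<E>"
        and \<theta>: "\<And>c x. c \<in> Ob C \<Longrightarrow> x \<in> el X c \<Longrightarrow> \<theta> c x \<in> el Y c"
        and n: "\<And>m x. m \<in> Ar C \<Longrightarrow> x \<in> el X (Cod C m) \<Longrightarrow>
          \<theta> (Dom C m) (rs X m x) = rs Y m (\<theta> (Cod C m) x)" for X Y \<theta>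
    proof -
      define k where "k = (FOb F X, \<lambda>c\<in>Ob C. \<lambda>x\<in>el X c. \<theta> c x, FOb F Y)"
      have rX: "rs X m x \<in> el X (Dom C m)" if "m \<in> Ar C" "x \<in> el X (Cod C m)" for m x
        using is_sheaf_data[OF sheafF[OF X], unfolded sheaf_data_def] that by (simp add: el_def rs_def)
      have "k \<in> hom D (FOb F X) (FOb F Y)"
        unfolding homD_iff k_def nat_trans_def
        using X Y sheafF \<theta> n rX S.Dom_Ob S.Cod_Ob by (auto simp: el_def rs_def)
      from equivalence_full[OF F G \<eta> \<epsilon> X Y this]
      obtain f where f: "f \<in> hom \<E> X Y" "FAr F f = k"
        by blast
      then show ?thesis
        by (intro bexI[of _ f]) (auto simp: ap_def k_def)
    qed
    show "\<exists>X\<in>Ob \<E>. \<exists>e. (\<forall>c\<in>Ob C. bij_betw (e c) (el X c) (Q c)) \<and>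
        (\<forall>m\<in>Ar C. \<forall>x\<in>el X (Cod C m). e (Dom C m) (rs X m x) = r m (e (Cod C m) x))"
      if Q: "sheaf_data TYPE('u) C J Q r" for Q :: "'u \<Rightarrow> 'u set" and r
    proof -
      obtain P where P: "is_sheaf C J P" "\<And>c. c \<in> Ob C \<Longrightarrow> Sec P c = Q c"
        "\<And>m x. m \<in> Ar C \<Longrightarrow> x \<in> Q (Cod C m) \<Longrightarrow> Res P m x = r m x"
        using sheaf_data_is_sheaf[OF site Q] by metis
      have PO: "P \<in> Ob D"
        using P(1) by (simp add: D_def Sh_def)
      define X where "X = FOb G P"
      have X: "X \<in> Ob \<E>"
        unfolding X_def using G.FOb_Ob PO by blast
      have \<epsilon>P: "\<epsilon> P \<in> hom D (FOb F X) P" "iso D (\<epsilon> P)"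
        using \<epsilon> PO by (auto simp: natural_iso_def comp_functor_def id_functor_def X_def)
      then obtain e where e: "\<epsilon> P = (FOb F X, e, P)" "e \<in> nat_trans C (FOb F X) P"
        by (auto simp: homD_iff)
      obtain j where "is_inverse D (\<epsilon> P) j"
        using \<epsilon>P(2) by (auto simp: iso_def)
      then have j: "j \<in> hom D P (FOb F X)" "j \<cdot>\<^bsub>D\<^esub> \<epsilon> P = Id D (FOb F X)" "\<epsilon> P \<cdot>\<^bsub>D\<^esub> j = Id D P"
        using \<epsilon>P(1) by (auto simp: is_inverse_def hom_iff)
      then obtain i where i: "j = (P, i, FOb F X)" "i \<in> nat_trans C P (FOb F X)"
        by (auto simp: homD_iff)
      have eq1: "(\<lambda>c\<in>Ob C. compose (el X c) (i c) (e c)) = (\<lambda>c\<in>Ob C. \<lambda>x\<in>el X c. x)"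
        using j(2) unfolding e(1) i(1) CmpD IdD el_def by simp
      have ie: "i c (e c x) = x" if "c \<in> Ob C" "x \<in> el X c" for c x
        using fun_cong[OF fun_cong[OF eq1, of c], of x] that by (simp add: compose_def)
      have eq2: "(\<lambda>c\<in>Ob C. compose (Sec P c) (e c) (i c)) = (\<lambda>c\<in>Ob C. \<lambda>x\<in>Sec P c. x)"
        using j(3) unfolding e(1) i(1) CmpD IdD el_def by simp
      have ei: "e c (i c x) = x" if "c \<in> Ob C" "x \<in> Sec P c" for c x
        using fun_cong[OF fun_cong[OF eq2, of c], of x] that by (simp add: compose_def)
      have eQ: "e c x \<in> Q c" if "c \<in> Ob C" "x \<in> el X c" for c x
        using e(2) P(2) that by (auto simp: nat_trans_def el_def)
      have iQ: "i c x \<in> el X c" if "c \<in> Ob C" "x \<in> Sec P c" for c x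
        using i(2) that by (auto simp: nat_trans_def el_def)
      have "bij_betw (e c) (el X c) (Q c)" if c: "c \<in> Ob C" for c
        unfolding P(2)[OF c, symmetric]
        by (rule bij_betw_byWitness[of _ "i c"])
          (use c ie ei eQ iQ P(2) in auto)
      moreover have "e (Dom C m) (rs X m x) = r m (e (Cod C m) x)"
        if "m \<in> Ar C" "x \<in> el X (Cod C m)" for m x
        using e(2) P(3)[of m "e (Cod C m) x"] that eQ S.Cod_Ob by (auto simp: nat_trans_def el_def rs_def)
      ultimately show ?thesis
        using X by blast
    qed
  qed (fact small)+
  then show ?thesis
    by blast
qed

section \<open>Categories with finite limits and stable unions\<close>

text \<open>
  W is jointly extremal: no proper subobject of T contains all its arrows.  In a topos this means
  that W is jointly epimorphic.
\<close>

definition covers :: "('o, 'a) cat \<Rightarrow> 'o \<Rightarrow> 'a set \<Rightarrow> bool"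
  where "covers C T W \<longleftrightarrow> (\<forall>n \<in> subs C T. (\<forall>a \<in> W. factors C a n) \<longrightarrow> factors C (Id C T) n)"

text \<open>
  The pullback along g of the sieve that is generated by U.
\<close>

definition pulled :: "('o, 'a) cat \<Rightarrow> 'a set \<Rightarrow> 'a \<Rightarrow> 'a set"
  where "pulled C U g = {a \<in> Ar C. Cod C a = Dom C g \<and> (\<exists>u \<in> U. factors C (g \<cdot>\<^bsub>C\<^esub> a) u)}"

definition els :: "('o, 'a) cat \<Rightarrow> 'o \<Rightarrow> 'o list \<Rightarrow> 'a list \<Rightarrow> bool"
  where "els C X As xs \<longleftrightarrow> X \<in> Ob C \<and> list_all2 (\<lambda>x A. x \<in> hom C X A) xs As"

text \<open>
  The last assumption provides the union k of the images of the arrows in U, together with its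
  stability under pullback: an arrow factors through k if and only if it does so locally through
  members of U.  A one-element set U gives images, a set of monomorphisms gives unions of subobjects.
\<close>

locale geometric_category = category C for C :: "('o, 'a) cat" (structure) +
  assumes ex_terminal: "\<exists>T. is_terminal C T"
    and ex_pullback: "f \<in> Ar C \<Longrightarrow> g \<in> Ar C \<Longrightarrow> Cod C f = Cod C g \<Longrightarrow> \<exists>p q. is_pullback C f g p q"
    and ex_union: "X \<in> Ob C \<Longrightarrow> U \<subseteq> {u \<in> Ar C. Cod C u = X} \<Longrightarrow>
      \<exists>k \<in> subs C X. \<forall>g \<in> Ar C. Cod C g = X \<longrightarrow>
        (factors C g k \<longleftrightarrow> covers C (Dom C g) (pulled C U g))"

context category
begin

lemma subsD:
  assumes "m \<in> subs C X"
  shows "m \<in> Ar C" "Cod C m = X"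
  using assms by (auto simp: subs_def)

lemma subs_mono:
  assumes "m \<in> subs C X" "f \<in> Ar C" "g \<in> Ar C" "Dom C f = Dom C g" "Cod C f = Dom C m" "Cod C g = Dom C m"
    "m \<cdot> f = m \<cdot> g"
  shows "f = g"
  using assms Dom_Ob[of g] by (auto simp: subs_def hom_iff)

lemma subsI:
  assumes "m \<in> Ar C" "Cod C m = X"
    and "\<And>f g. f \<in> Ar C \<Longrightarrow> g \<in> Ar C \<Longrightarrow> Dom C f = Dom C g \<Longrightarrow> Cod C f = Dom C m \<Longrightarrow>
      Cod C g = Dom C m \<Longrightarrow> m \<cdot> f = m \<cdot> g \<Longrightarrow> f = g"
  shows "m \<in> subs C X"
  using assms by (auto simp: subs_def hom_iff)

lemma factors_iff: "factors C f m \<longleftrightarrow> (\<exists>k \<in> Ar C. Dom C k = Dom C f \<and> Cod C k = Dom C m \<and> m \<cdot> k = f)"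
  by (auto simp: factors_def hom_iff)

lemma factorsI: "k \<in> Ar C \<Longrightarrow> m \<in> Ar C \<Longrightarrow> Cod C k = Dom C m \<Longrightarrow> factors C (m \<cdot> k) m"
  by (auto simp: factors_iff)

lemma factors_refl [simp]: "m \<in> Ar C \<Longrightarrow> factors C m m"
  using factorsI[of "Id C (Dom C m)" m] Dom_Ob by simp

lemma factors_Cmp:
  assumes "factors C f m" "m \<in> Ar C" "a \<in> Ar C" "Cod C a = Dom C f"
  shows "factors C (f \<cdot> a) m"
proof -
  obtain k where "k \<in> Ar C" "Dom C k = Dom C f" "Cod C k = Dom C m" "m \<cdot> k = f"
    using assms(1) by (auto simp: factors_iff)
  then show ?thesis
    using factorsI[of "k \<cdot> a" m] assms by auto
qed

lemma factors_trans:
  assumes "factors C f m" "factors C m n" "n \<in> Ar C"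
  shows "factors C f n"
proof -
  obtain k where "k \<in> Ar C" "Dom C k = Dom C f" "Cod C k = Dom C m" "m \<cdot> k = f"
    using assms(1) by (auto simp: factors_iff)
  then show ?thesis
    using factors_Cmp[OF assms(2,3)] by auto
qed

lemma subs_Cmp:
  assumes m: "m \<in> subs C X" and n: "n \<in> subs C (Dom C m)"
  shows "m \<cdot> n \<in> subs C X"
proof (rule subsI)
  fix f g
  assume *: "f \<in> Ar C" "g \<in> Ar C" "Dom C f = Dom C g" "Cod C f = Dom C (m \<cdot> n)" "Cod C g = Dom C (m \<cdot> n)"
    "(m \<cdot> n) \<cdot> f = (m \<cdot> n) \<cdot> g"
  note [simp] = subsD[OF m] subsD[OF n]
  have "n \<cdot> f = n \<cdot> g"
    by (rule subs_mono[OF m]) (use * in auto)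
  then show "f = g"
    by (rule subs_mono[OF n, rotated 5]) (use * in auto)
qed (use subsD[OF m] subsD[OF n] in auto)

lemma Id_subs: "X \<in> Ob C \<Longrightarrow> Id C X \<in> subs C X"
  by (rule subsI) auto

lemma covers_mono: "covers C T W \<Longrightarrow> W \<subseteq> W' \<Longrightarrow> covers C T W'"
  by (auto simp: covers_def)

lemma covers_Id: "Id C T \<in> W \<Longrightarrow> covers C T W"
  by (auto simp: covers_def)

lemma pullbackD:
  assumes "is_pullback C f g p q" "f \<in> Ar C" "g \<in> Ar C"
  shows "p \<in> Ar C" "q \<in> Ar C" "Cod C p = Dom C f" "Cod C q = Dom C g" "Dom C q = Dom C p" "f \<cdot> p = g \<cdot> q"
  using assms by (auto simp: is_pullback_def hom_iff)

lemma pullback_lift: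
  assumes "is_pullback C f g p q" "h \<in> Ar C" "k \<in> Ar C" "Dom C k = Dom C h"
    "Cod C h = Dom C f" "Cod C k = Dom C g" "f \<cdot> h = g \<cdot> k"
  obtains u where "u \<in> Ar C" "Dom C u = Dom C h" "Cod C u = Dom C p" "p \<cdot> u = h" "q \<cdot> u = k"
proof -
  have "\<forall>X \<in> Ob C. \<forall>h \<in> hom C X (Dom C f). \<forall>k \<in> hom C X (Dom C g). f \<cdot> h = g \<cdot> k \<longrightarrow>
      (\<exists>!u. u \<in> hom C X (Dom C p) \<and> p \<cdot> u = h \<and> q \<cdot> u = k)"
    using assms(1) by (simp add: is_pullback_def)
  then have "\<exists>!u. u \<in> hom C (Dom C h) (Dom C p) \<and> p \<cdot> u = h \<and> q \<cdot> u = k"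
    using Dom_Ob[of h] assms(2-7) by (simp add: hom_iff)
  then show thesis
    using that by (auto simp: hom_iff)
qed

lemma pullback_eq:
  assumes pb: "is_pullback C f g p q" and fg: "f \<in> Ar C" "g \<in> Ar C"
    and uv: "u \<in> Ar C" "v \<in> Ar C" "Dom C u = Dom C v" "Cod C u = Dom C p" "Cod C v = Dom C p"
      "p \<cdot> u = p \<cdot> v" "q \<cdot> u = q \<cdot> v"
  shows "u = v"
proof -
  note [simp] = pullbackD[OF pb fg]
  have "f \<cdot> (p \<cdot> v) = g \<cdot> (q \<cdot> v)"
  proof -
    have "f \<cdot> (p \<cdot> v) = (f \<cdot> p) \<cdot> v"
      using fg uv by (simp del: pullbackD(6)[OF pb fg])
    then show ?thesis
      using fg uv by simp
  qed
  then have "\<exists>!w. w \<in> hom C (Dom C v) (Dom C p) \<and> p \<cdot> w = p \<cdot> v \<and> q \<cdot> w = q \<cdot> v"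
    using pb uv fg Dom_Ob[of v] unfolding is_pullback_def by (auto simp: hom_iff)
  then show ?thesis
    using uv by (auto simp: hom_iff)
qed

text \<open>
  The inverse image of a subobject, characterized by the arrows that factor through it.
\<close>

lemma pullback_subs:
  assumes pb: "is_pullback C f m p q" and f: "f \<in> Ar C" and m: "m \<in> subs C (Cod C f)"
  shows "p \<in> subs C (Dom C f)"
    and "\<And>g. g \<in> Ar C \<Longrightarrow> Cod C g = Dom C f \<Longrightarrow> factors C g p \<longleftrightarrow> factors C (f \<cdot> g) m"
proof -
  note [simp] = pullbackD[OF pb f subsD(1)[OF m]] subsD[OF m]
  show "p \<in> subs C (Dom C f)"
  proof (rule subsI)
    fix u v
    assume *: "u \<in> Ar C" "v \<in> Ar C" "Dom C u = Dom C v" "Cod C u = Dom C p" "Cod C v =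
        Dom C p" "p \<cdot> u = p \<cdot> v"
    have "m \<cdot> (q \<cdot> w) = f \<cdot> (p \<cdot> w)" if "w \<in> Ar C" "Cod C w = Dom C p" for w
    proof -
      have "m \<cdot> (q \<cdot> w) = (m \<cdot> q) \<cdot> w"
        using that f by (simp del: pullbackD(6)[OF pb f subsD(1)[OF m]])
      also have "\<dots> = (f \<cdot> p) \<cdot> w"
        by simp
      also have "\<dots> = f \<cdot> (p \<cdot> w)"
        using that f by (simp del: pullbackD(6)[OF pb f subsD(1)[OF m]])
      finally show ?thesis .
    qed
    then have "m \<cdot> (q \<cdot> u) = m \<cdot> (q \<cdot> v)"
      using * by simp
    then have "q \<cdot> u = q \<cdot> v"
      by (rule subs_mono[OF m, rotated 5]) (use * in auto)
    then show "u = v"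
      using pullback_eq[OF pb f subsD(1)[OF m]] * by blast
  qed auto
  fix g assume g: "g \<in> Ar C" "Cod C g = Dom C f"
  show "factors C g p \<longleftrightarrow> factors C (f \<cdot> g) m"
  proof
    assume "factors C g p"
    then obtain k where k: "k \<in> Ar C" "Dom C k = Dom C g" "Cod C k = Dom C p" "p \<cdot> k = g"
      by (auto simp: factors_iff)
    have "f \<cdot> g = (f \<cdot> p) \<cdot> k"
      using k f by (simp del: pullbackD(6)[OF pb f subsD(1)[OF m]])
    then have "f \<cdot> g = m \<cdot> (q \<cdot> k)"
      using k f by simp
    then show "factors C (f \<cdot> g) m"
      using factorsI[of "q \<cdot> k" m] k by simp
  next
    assume "factors C (f \<cdot> g) m"
    then obtain k where k: "k \<in> Ar C" "Dom C k = Dom C g" "Cod C k = Dom C m" "m \<cdot> k = f \<cdot> g"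
      using f g by (auto simp: factors_iff)
    obtain u where "u \<in> Ar C" "Dom C u = Dom C g" "Cod C u = Dom C p" "p \<cdot> u = g"
      using pullback_lift[OF pb, of g k] k g f by auto
    then show "factors C g p"
      by (auto simp: factors_iff)
  qed
qed

end

context geometric_category
begin

lemma pb_is_pullback:
  assumes "f \<in> Ar C" "g \<in> Ar C" "Cod C f = Cod C g"
  shows "is_pullback C f g (fst (pb C f g)) (snd (pb C f g))"
proof -
  have "\<exists>x. case x of (p, q) \<Rightarrow> is_pullback C f g p q"
    using ex_pullback[OF assms] by auto
  from someI_ex[OF this] show ?thesis
    by (auto simp: pb_def split: prod.splits)
qed

text \<open>
  The arrows a for which \<open>f \<cdot> a\<close> factors through m are those that factor through the inverse image
  of m along f, a subobject of the domain of f.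
\<close>

lemma local_factors:
  assumes cov: "covers C (Dom C f) W" and f: "f \<in> Ar C" and m: "m \<in> subs C (Cod C f)"
    and W: "\<And>a. a \<in> W \<Longrightarrow> a \<in> Ar C \<and> Cod C a = Dom C f \<and> factors C (f \<cdot> a) m"
  shows "factors C f m"
proof -
  obtain p q where pb: "is_pullback C f m p q"
    using ex_pullback[of f m] f subsD[OF m] by auto
  have "factors C (Id C (Dom C f)) p"
    using cov pullback_subs[OF pb f m] W by (auto simp: covers_def)
  then show ?thesis
    using pullback_subs(2)[OF pb f m, of "Id C (Dom C f)"] f Dom_Ob by simp
qed

text \<open>
  W covers T if and only if the identity of T, and hence every arrow s into T, factors through the
  union of the images of W.
\<close>

lemma covers_stable:
  assumes cov: "covers C T W" and W: "\<And>a. a \<in> W \<Longrightarrow> a \<in> Ar C \<and> Cod C a = T"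
    and s: "s \<in> Ar C" "Cod C s = T"
  shows "covers C (Dom C s) (pulled C W s)"
proof -
  have T: "T \<in> Ob C"
    using s Cod_Ob by blast
  obtain k where k: "k \<in> subs C T"
    "\<And>g. g \<in> Ar C \<Longrightarrow> Cod C g = T \<Longrightarrow> factors C g k \<longleftrightarrow> covers C (Dom C g) (pulled C W g)"
    using ex_union[of T W] T W by blast
  have "W \<subseteq> pulled C W (Id C T)"
  proof
    fix a assume "a \<in> W"
    then show "a \<in> pulled C W (Id C T)"
      using W[of a] T by (auto simp: pulled_def intro: bexI[of _ a])
  qed
  then have "covers C T (pulled C W (Id C T))"
    by (rule covers_mono[OF cov])
  then have "factors C (Id C T) k"
    using k(2)[of "Id C T"] T by simp
  then have "factors C s k"
    using factors_Cmp[of "Id C T" k s] subsD[OF k(1)] s T by simp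
  then show ?thesis
    using k(2) s by blast
qed

text \<open>
  Any subobject with the universal property of the union admits the local description of its
  generalized elements, so it does not matter which one \<open>image_ar\<close> and \<open>union_sub\<close> pick.
\<close>

lemma union_iff:
  assumes X: "X \<in> Ob C" and U: "U \<subseteq> {u \<in> Ar C. Cod C u = X}"
  shows "\<exists>k. k \<in> subs C X \<and> (\<forall>u \<in> U. factors C u k) \<and>
      (\<forall>n \<in> subs C X. (\<forall>u \<in> U. factors C u n) \<longrightarrow> factors C k n)"
    and "k \<in> subs C X \<Longrightarrow> \<forall>u \<in> U. factors C u k \<Longrightarrow>
      \<forall>n \<in> subs C X. (\<forall>u \<in> U. factors C u n) \<longrightarrow> factors C k n \<Longrightarrow>
      g \<in> Ar C \<Longrightarrow> Cod C g = X \<Longrightarrow> factors C g k \<longleftrightarrow> covers C (Dom C g) (pulled C U g)"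
proof -
  obtain j where j: "j \<in> subs C X"
    "\<And>g. g \<in> Ar C \<Longrightarrow> Cod C g = X \<Longrightarrow> factors C g j \<longleftrightarrow> covers C (Dom C g) (pulled C U g)"
    using ex_union[OF X U] by blast
  have upper: "factors C u j" if "u \<in> U" for u
  proof -
    have "Id C (Dom C u) \<in> pulled C U u"
      using that U Dom_Ob by (auto simp: pulled_def intro!: bexI[of _ u])
    then show ?thesis
      using j(2)[of u] covers_Id that U by blast
  qed
  have least: "factors C j n" if n: "n \<in> subs C X" "\<forall>u \<in> U. factors C u n" for n
  proof (rule local_factors)
    show "covers C (Dom C j) (pulled C U j)"
      using j(2)[of j] subsD[OF j(1)] by simp
    show "a \<in> Ar C \<and> Cod C a = Dom C j \<and> factors C (j \<cdot> a) n" if "a \<in> pulled C U j" for a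
      using that n subsD[OF n(1)] factors_trans by (auto simp: pulled_def)
  qed (use subsD[OF j(1)] n in auto)
  show "\<exists>k. k \<in> subs C X \<and> (\<forall>u \<in> U. factors C u k) \<and>
      (\<forall>n \<in> subs C X. (\<forall>u \<in> U. factors C u n) \<longrightarrow> factors C k n)"
    using j(1) upper least by blast
  show "factors C g k \<longleftrightarrow> covers C (Dom C g) (pulled C U g)"
    if k: "k \<in> subs C X" "\<forall>u \<in> U. factors C u k"
      "\<forall>n \<in> subs C X. (\<forall>u \<in> U. factors C u n) \<longrightarrow> factors C k n" and g: "g \<in> Ar C" "Cod C g = X"
  proof -
    have "factors C k j" "factors C j k"
      using k j(1) upper least by blast+
    then have "factors C g k \<longleftrightarrow> factors C g j"
      using factors_trans subsD[OF j(1)] subsD[OF k(1)] by blast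
    then show ?thesis
      using j(2)[OF g] by blast
  qed
qed

lemma image_ar:
  assumes f: "f \<in> Ar C"
  shows "image_ar C f \<in> subs C (Cod C f)"
    and "g \<in> Ar C \<Longrightarrow> Cod C g = Cod C f \<Longrightarrow>
      factors C g (image_ar C f) \<longleftrightarrow> covers C (Dom C g) (pulled C {f} g)"
proof -
  have X: "Cod C f \<in> Ob C" "{f} \<subseteq> {u \<in> Ar C. Cod C u = Cod C f}"
    using f Cod_Ob by auto
  let ?m = "image_ar C f"
  have "?m \<in> subs C (Cod C f) \<and> factors C f ?m \<and>
      (\<forall>n \<in> subs C (Cod C f). factors C f n \<longrightarrow> factors C ?m n)"
    unfolding image_ar_def by (rule someI_ex) (use union_iff(1)[OF X] in simp)
  then show "?m \<in> subs C (Cod C f)"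
    and "g \<in> Ar C \<Longrightarrow> Cod C g = Cod C f \<Longrightarrow>
      factors C g (image_ar C f) \<longleftrightarrow> covers C (Dom C g) (pulled C {f} g)"
    using union_iff(2)[OF X, of ?m g] by simp_all
qed

lemma union_sub:
  assumes X: "X \<in> Ob C" and U: "U \<subseteq> {u \<in> Ar C. Cod C u = X}"
  shows "union_sub C X U \<in> subs C X"
    and "g \<in> Ar C \<Longrightarrow> Cod C g = X \<Longrightarrow>
      factors C g (union_sub C X U) \<longleftrightarrow> covers C (Dom C g) (pulled C U g)"
proof -
  let ?m = "union_sub C X U"
  have "?m \<in> subs C X \<and> (\<forall>u \<in> U. factors C u ?m) \<and>
      (\<forall>n \<in> subs C X. (\<forall>u \<in> U. factors C u n) \<longrightarrow> factors C ?m n)"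
    unfolding union_sub_def by (rule someI_ex[OF union_iff(1)[OF X U]])
  then show "?m \<in> subs C X"
    and "g \<in> Ar C \<Longrightarrow> Cod C g = X \<Longrightarrow>
      factors C g ?m \<longleftrightarrow> covers C (Dom C g) (pulled C U g)"
    using union_iff(2)[OF X U, of ?m g] by simp_all
qed

lemma meet_sub:
  assumes m: "m \<in> subs C X" and n: "n \<in> subs C X"
  shows "meet_sub C X m n \<in> subs C X"
    and "factors C g (meet_sub C X m n) \<longleftrightarrow> factors C g m \<and> factors C g n"
proof -
  let ?P = "\<lambda>k. k \<in> subs C X \<and> factors C k m \<and> factors C k n \<and>
    (\<forall>l \<in> subs C X. factors C l m \<and> factors C l n \<longrightarrow> factors C l k)"
  note mn = subsD[OF m] subsD[OF n]
  obtain p q where pb: "is_pullback C m n p q"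
    using ex_pullback[of m n] mn by auto
  note pq = pullbackD[OF pb mn(1) mn(3)]
  have n': "n \<in> subs C (Cod C m)"
    using n mn by simp
  have fac: "factors C g (m \<cdot> p) \<longleftrightarrow> factors C g m \<and> factors C g n" for g
  proof
    assume "factors C g (m \<cdot> p)"
    moreover have "factors C (m \<cdot> p) m" "factors C (m \<cdot> p) n"
      using factorsI[of p m] factorsI[of q n] mn pq by auto
    ultimately show "factors C g m \<and> factors C g n"
      using factors_trans mn by blast
  next
    assume *: "factors C g m \<and> factors C g n"
    then obtain k where k: "k \<in> Ar C" "Dom C k = Dom C g" "Cod C k = Dom C m" "m \<cdot> k = g"
      by (auto simp: factors_iff)
    then have "factors C k p"
      using pullback_subs(2)[OF pb mn(1) n', of k] * by simp
    then obtain l where l: "l \<in> Ar C" "Dom C l = Dom C k" "Cod C l = Dom C p" "p \<cdot> l = k"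
      by (auto simp: factors_iff)
    show "factors C g (m \<cdot> p)"
      using factorsI[of l "m \<cdot> p"] l k(4) mn pq assoc[of l p m] by (simp del: pq(6))
  qed
  have "?P (m \<cdot> p)"
    using fac[of "m \<cdot> p"] fac subs_Cmp[OF m pullback_subs(1)[OF pb mn(1) n']] mn pq by auto
  then have *: "?P (meet_sub C X m n)"
    unfolding meet_sub_def by (rule someI)
  then show "meet_sub C X m n \<in> subs C X"
    by blast
  have "factors C (m \<cdot> p) (meet_sub C X m n)"
    using * \<open>?P (m \<cdot> p)\<close> by blast
  then show "factors C g (meet_sub C X m n) \<longleftrightarrow> factors C g m \<and> factors C g n"
    using fac * factors_trans mn subsD[of "meet_sub C X m n" X] by meson
qed

end

subsection \<open>Finite products\<close>

context category
begin

lemma els_Nil [simp]: "els C X [] xs \<longleftrightarrow> X \<in> Ob C \<and> xs = []"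
  by (auto simp: els_def)

lemma els_Cons: "els C X (A # As) xs \<longleftrightarrow> (\<exists>y ys. xs = y # ys \<and> y \<in> hom C X A \<and> els C X As ys)"
  by (auto simp: els_def list_all2_Cons2)

lemma els_length: "els C X As xs \<Longrightarrow> length xs = length As"
  by (auto simp: els_def list_all2_lengthD)

lemma els_nth: "els C X As xs \<Longrightarrow> i < length As \<Longrightarrow> xs ! i \<in> hom C X (As ! i)"
  by (auto simp: els_def list_all2_conv_all_nth)

lemma els_Ob: "els C X As xs \<Longrightarrow> X \<in> Ob C"
  by (auto simp: els_def)

lemma els_Cmp:
  assumes "els C X As xs" "a \<in> hom C Y X"
  shows "els C Y As (map (\<lambda>x. x \<cdot> a) xs)"
  using assms Cmp_hom hom_Ob(1)[OF assms(2)] by (auto simp: els_def list.rel_map elim!: list_all2_mono)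

lemma els_in: "els C X As xs \<Longrightarrow> x \<in> set xs \<Longrightarrow> x \<in> Ar C \<and> Dom C x = X"
  by (metis els_length els_nth homD(1,2) in_set_conv_nth)

lemma map_Cmp_assoc:
  assumes "els C X As xs" "a \<in> hom C Y X" "b \<in> hom C Z Y"
  shows "map (\<lambda>x. x \<cdot> b) (map (\<lambda>x. x \<cdot> a) xs) = map (\<lambda>x. x \<cdot> (a \<cdot> b)) xs"
  using els_in[OF assms(1)] assms(2,3) by (auto simp: hom_iff)

lemma is_product_els:
  "is_product C As P ps \<longleftrightarrow> els C P As ps \<and>
    (\<forall>X fs. els C X As fs \<longrightarrow> (\<exists>!u. u \<in> hom C X P \<and> map (\<lambda>p. p \<cdot> u) ps = fs))"
  unfolding is_product_def els_def by blast

lemma product_ex1: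
  "is_product C As P ps \<Longrightarrow> els C X As fs \<Longrightarrow> \<exists>!u. u \<in> hom C X P \<and> map (\<lambda>p. p \<cdot> u) ps = fs"
  unfolding is_product_els by blast

end

context geometric_category
begin

text \<open>
  By recursion on the list: \<open>A \<times> P\<close> is the pullback of A and P over the terminal object.
\<close>

lemma ex_product:
  assumes "set As \<subseteq> Ob C"
  shows "\<exists>P ps. is_product C As P ps"
  using assms
proof (induction As)
  case Nil
  obtain T where T: "is_terminal C T"
    using ex_terminal by blast
  have "is_product C [] T []"
    using T by (auto simp: is_product_els is_terminal_def)
  then show ?case
    by blast
next
  case (Cons A As)
  then obtain P ps where P: "is_product C As P ps"
    by auto
  obtain T where T: "is_terminal C T"
    using ex_terminal by blast
  have A: "A \<in> Ob C" and PO: "P \<in> Ob C" and ps: "els C P As ps"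
    using Cons.prems P by (auto simp: is_product_els els_Ob)
  obtain a b where a: "a \<in> hom C A T" and b: "b \<in> hom C P T"
    using T A PO by (meson is_terminal_def)
  then obtain p q where pb: "is_pullback C a b p q"
    using ex_pullback[of a b] by (auto simp: hom_iff)
  have ab: "a \<in> Ar C" "b \<in> Ar C" "Dom C a = A" "Dom C b = P" "Cod C a = T" "Cod C b = T"
    using a b by (auto simp: hom_iff)
  note pq = pullbackD[OF pb ab(1,2)]
  have q: "q \<in> hom C (Dom C p) P" and p: "p \<in> hom C (Dom C p) A"
    using pq ab by (auto simp: hom_iff)
  have "is_product C (A # As) (Dom C p) (p # map (\<lambda>x. x \<cdot> q) ps)"
    unfolding is_product_els
  proof (intro conjI allI impI)
    show "els C (Dom C p) (A # As) (p # map (\<lambda>x. x \<cdot> q) ps)"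
      using p els_Cmp[OF ps q] by (simp add: els_Cons)
    fix X fs assume "els C X (A # As) fs"
    then obtain f gs where fs: "fs = f # gs" and f: "f \<in> hom C X A" and gs: "els C X As gs"
      by (auto simp: els_Cons)
    have X: "X \<in> Ob C"
      using gs els_Ob by blast
    obtain v where v: "v \<in> hom C X P" "map (\<lambda>p. p \<cdot> v) ps = gs"
      using product_ex1[OF P gs] by blast
    have "a \<cdot> f = b \<cdot> v"
      using T X Cmp_hom[OF f a] Cmp_hom[OF v(1) b] by (auto simp: is_terminal_def)
    then obtain u where u: "u \<in> Ar C" "Dom C u = X" "Cod C u = Dom C p" "p \<cdot> u = f" "q \<cdot> u = v"
      using pullback_lift[OF pb, of f v] f v ab by (auto simp: hom_iff)
    have uh: "u \<in> hom C X (Dom C p)"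
      using u by (simp add: hom_iff)
    show "\<exists>!u. u \<in> hom C X (Dom C p) \<and> map (\<lambda>p. p \<cdot> u) (p # map (\<lambda>x. x \<cdot> q) ps) = fs"
    proof (rule ex1I[of _ u])
      show "u \<in> hom C X (Dom C p) \<and> map (\<lambda>p. p \<cdot> u) (p # map (\<lambda>x. x \<cdot> q) ps) = fs"
        using uh map_Cmp_assoc[OF ps q uh] u v fs by simp
      fix w assume w: "w \<in> hom C X (Dom C p) \<and> map (\<lambda>p. p \<cdot> w) (p # map (\<lambda>x. x \<cdot> q) ps) = fs"
      then have "map (\<lambda>x. x \<cdot> (q \<cdot> w)) ps = gs" "p \<cdot> w = f"
        using map_Cmp_assoc[OF ps q, of w X] fs by auto
      moreover have "q \<cdot> w \<in> hom C X P"
        using w Cmp_hom[OF _ q] by blast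
      ultimately have "q \<cdot> w = v"
        using product_ex1[OF P gs] v by blast
      then show "w = u"
        using pullback_eq[OF pb ab(1,2), of w u] u w \<open>p \<cdot> w = f\<close> by (auto simp: hom_iff)
    qed
  qed
  then show ?case
    by blast
qed

lemma prjs_product:
  assumes "set As \<subseteq> Ob C"
  shows "is_product C As (prod_ob C As) (prjs C As)"
proof -
  have "\<exists>x. case x of (P, ps) \<Rightarrow> is_product C As P ps"
    using ex_product[OF assms] by auto
  from someI_ex[OF this] show ?thesis
    by (auto simp: product_def prod_ob_def prjs_def split: prod.splits)
qed

lemma prjs_els: "set As \<subseteq> Ob C \<Longrightarrow> els C (prod_ob C As) As (prjs C As)"
  using prjs_product is_product_els by blast

lemma prod_ob_Ob [simp]: "set As \<subseteq> Ob C \<Longrightarrow> prod_ob C As \<in> Ob C"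
  using prjs_els els_Ob by blast

lemma els_set: "els C X As xs \<Longrightarrow> set As \<subseteq> Ob C"
  using els_nth hom_Ob(2) by (fastforce simp: in_set_conv_nth)

lemma tuple:
  assumes "els C X As xs"
  shows "tuple C X As xs \<in> hom C X (prod_ob C As)" "map (\<lambda>p. p \<cdot> tuple C X As xs) (prjs C As) = xs"
proof -
  have "\<exists>!u. u \<in> hom C X (prod_ob C As) \<and> map (\<lambda>p. p \<cdot> u) (prjs C As) = xs"
    using prjs_product[OF els_set[OF assms]] assms by (simp add: is_product_els)
  from theI'[OF this] show "tuple C X As xs \<in> hom C X (prod_ob C As)"
    "map (\<lambda>p. p \<cdot> tuple C X As xs) (prjs C As) = xs"
    by (auto simp: tuple_def)
qed

lemma tuple_Ar:
  assumes "els C X As xs"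
  shows "tuple C X As xs \<in> Ar C" "Dom C (tuple C X As xs) = X" "Cod C (tuple C X As xs) = prod_ob C As"
  using tuple(1)[OF assms] by (auto simp: hom_iff)

lemma prod_eqI:
  assumes "set As \<subseteq> Ob C" "u \<in> hom C X (prod_ob C As)" "v \<in> hom C X (prod_ob C As)"
    "map (\<lambda>p. p \<cdot> u) (prjs C As) = map (\<lambda>p. p \<cdot> v) (prjs C As)"
  shows "u = v"
proof -
  have "els C X As (map (\<lambda>p. p \<cdot> v) (prjs C As))"
    using els_Cmp prjs_els assms by blast
  then show ?thesis
    using product_ex1[OF prjs_product[OF assms(1)]] assms by blast
qed

lemma tuple_inject:
  assumes "els C X As xs" "els C X As ys"
  shows "tuple C X As xs = tuple C X As ys \<longleftrightarrow> xs = ys"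
proof
  assume "tuple C X As xs = tuple C X As ys"
  then have "map (\<lambda>p. p \<cdot> tuple C X As xs) (prjs C As) = map (\<lambda>p. p \<cdot> tuple C X As ys) (prjs C As)"
    by simp
  then show "xs = ys"
    unfolding tuple(2)[OF assms(1)] tuple(2)[OF assms(2)] .
qed simp

lemma tuple_eqI:
  assumes "els C X As xs" "u \<in> hom C X (prod_ob C As)" "map (\<lambda>p. p \<cdot> u) (prjs C As) = xs"
  shows "tuple C X As xs = u"
  using prod_eqI[OF els_set[OF assms(1)] tuple(1)[OF assms(1)] assms(2)] tuple(2)[OF assms(1)] assms(3)
  by simp

lemma tuple_prjs:
  assumes "set As \<subseteq> Ob C" "u \<in> hom C X (prod_ob C As)"
  shows "els C X As (map (\<lambda>p. p \<cdot> u) (prjs C As))" "tuple C X As (map (\<lambda>p. p \<cdot> u) (prjs C As)) = u"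
  using els_Cmp[OF prjs_els] tuple_eqI assms by blast+

lemma tuple_Cmp:
  assumes xs: "els C X As xs" and a: "a \<in> hom C Y X"
  shows "tuple C X As xs \<cdot> a = tuple C Y As (map (\<lambda>x. x \<cdot> a) xs)"
proof (rule tuple_eqI[OF els_Cmp[OF xs a], symmetric])
  show "tuple C X As xs \<cdot> a \<in> hom C Y (prod_ob C As)"
    using tuple(1)[OF xs] a Cmp_hom by blast
  show "map (\<lambda>p. p \<cdot> (tuple C X As xs \<cdot> a)) (prjs C As) = map (\<lambda>x. x \<cdot> a) xs"
    using map_Cmp_assoc[OF prjs_els[OF els_set[OF xs]] tuple(1)[OF xs] a] tuple(2)[OF xs] by simp
qed

lemma prjs_nth_tuple:
  assumes "els C X As xs" "i < length As"
  shows "prjs C As ! i \<cdot> tuple C X As xs = xs ! i"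
proof -
  have "length (prjs C As) = length As"
    using els_length prjs_els els_set assms by blast
  then show ?thesis
    using arg_cong[OF tuple(2)[OF assms(1)], of "\<lambda>l. l ! i"] assms by simp
qed

text \<open>
  The equalizer of f and g is the pullback of the graphs \<open>\<langle>1, f\<rangle>\<close> and \<open>\<langle>1, g\<rangle>\<close>.
\<close>

lemma ex_equalizer:
  assumes f: "f \<in> hom C X Y" and g: "g \<in> hom C X Y"
  shows "\<exists>m. is_equalizer C f g m"
proof -
  have XY: "X \<in> Ob C" "Y \<in> Ob C"
    using hom_Ob f by auto
  have e: "els C X [X, Y] [Id C X, f]" "els C X [X, Y] [Id C X, g]"
    using f g XY Id_hom by (auto simp: els_Cons)
  let ?f = "tuple C X [X, Y] [Id C X, f]" and ?g = "tuple C X [X, Y] [Id C X, g]"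
  obtain p q where pb: "is_pullback C ?f ?g p q"
    using ex_pullback[of ?f ?g] tuple_Ar e by auto
  note pq = pullbackD[OF pb tuple_Ar(1)[OF e(1)] tuple_Ar(1)[OF e(2)]]
  have fg: "f \<in> Ar C" "g \<in> Ar C" "Dom C f = X" "Dom C g = X"
    using f g by (auto simp: hom_iff)
  have p: "p \<in> hom C (Dom C p) X" and q: "q \<in> hom C (Dom C p) X"
    using pq tuple_Ar e by (auto simp: hom_iff)
  have tuples: "?f \<cdot> u = ?g \<cdot> v \<longleftrightarrow> u = v \<and> f \<cdot> u = g \<cdot> v" if "u \<in> hom C Z X" "v \<in> hom C Z X" for u v Z
  proof -
    have "?f \<cdot> u = tuple C Z [X, Y] [u, f \<cdot> u]" "?g \<cdot> v = tuple C Z [X, Y] [v, g \<cdot> v]"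
      using tuple_Cmp[OF e(1) that(1)] tuple_Cmp[OF e(2) that(2)] that by (auto simp: hom_iff)
    moreover have "els C Z [X, Y] [u, f \<cdot> u]" "els C Z [X, Y] [v, g \<cdot> v]"
      using els_Cmp[OF e(1) that(1)] els_Cmp[OF e(2) that(2)] that by (auto simp: hom_iff)
    ultimately show ?thesis
      using tuple_inject[of Z "[X, Y]"] by simp
  qed
  have pqeq: "p = q" "f \<cdot> p = g \<cdot> p"
    using tuples[OF p q] pq by auto
  have "is_equalizer C f g p"
    unfolding is_equalizer_def
  proof (intro conjI ballI impI)
    fix Z h assume h: "Z \<in> Ob C" "h \<in> hom C Z (Dom C f)" "f \<cdot> h = g \<cdot> h"
    then have hX: "h \<in> hom C Z X"
      using fg by simp
    then obtain u where u: "u \<in> Ar C" "Dom C u = Z" "Cod C u = Dom C p" "p \<cdot> u = h"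
      using pullback_lift[OF pb, of h h] tuples[OF hX hX] h tuple_Ar e by (auto simp: hom_iff)
    show "\<exists>!u. u \<in> hom C Z (Dom C p) \<and> p \<cdot> u = h"
    proof (rule ex1I[of _ u])
      show "w = u" if "w \<in> hom C Z (Dom C p) \<and> p \<cdot> w = h" for w
        by (rule pullback_eq[OF pb]) (use u that pqeq tuple_Ar e in \<open>auto simp: hom_iff\<close>)
    qed (use u in \<open>auto simp: hom_iff\<close>)
  qed (use p pqeq fg in auto)
  then show ?thesis
    by blast
qed

lemma equalizer_subs:
  assumes m: "is_equalizer C f g m" and f: "f \<in> hom C X Y" and g: "g \<in> hom C X Y"
  shows "m \<in> subs C X"
    and "\<And>h. h \<in> Ar C \<Longrightarrow> Cod C h = X \<Longrightarrow> factors C h m \<longleftrightarrow> f \<cdot> h = g \<cdot> h"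
proof -
  have fg: "f \<in> Ar C" "g \<in> Ar C" "Dom C f = X" "Dom C g = X" "Cod C f = Y" "Cod C g = Y"
    using f g by (auto simp: hom_iff)
  have mA: "m \<in> Ar C" "Cod C m = X" "f \<cdot> m = g \<cdot> m"
    using m fg by (auto simp: is_equalizer_def hom_iff)
  have eqm: "f \<cdot> (m \<cdot> u) = g \<cdot> (m \<cdot> u)" if "u \<in> Ar C" "Cod C u = Dom C m" for u
    using mA fg that assoc[of u m f] assoc[of u m g] by simp
  have uni: "\<exists>!u. u \<in> hom C (Dom C h) (Dom C m) \<and> m \<cdot> u = h"
    if "h \<in> Ar C" "Cod C h = X" "f \<cdot> h = g \<cdot> h" for h
    using m that fg Dom_Ob[of h] by (auto simp: is_equalizer_def hom_iff)
  show "m \<in> subs C X"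
  proof (rule subsI)
    fix u v assume *: "u \<in> Ar C" "v \<in> Ar C" "Dom C u = Dom C v" "Cod C u = Dom C m" "Cod C v =
        Dom C m" "m \<cdot> u = m \<cdot> v"
    show "u = v"
      using uni[of "m \<cdot> v"] eqm[of v] * mA by (auto simp: hom_iff)
  qed (use mA in auto)
  show "factors C h m \<longleftrightarrow> f \<cdot> h = g \<cdot> h" if "h \<in> Ar C" "Cod C h = X" for h
    using uni[OF that] eqm mA by (auto simp: factors_iff hom_iff)
qed

text \<open>
  Two arrows agree if and only if the identity factors through their equalizer, a subobject.
\<close>

lemma local_eq:
  assumes cov: "covers C T W" and f: "f \<in> hom C T Y" and g: "g \<in> hom C T Y"
    and W: "\<And>a. a \<in> W \<Longrightarrow> a \<in> Ar C \<and> Cod C a = T \<and> f \<cdot> a = g \<cdot> a"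
  shows "f = g"
proof -
  obtain m where m: "is_equalizer C f g m"
    using ex_equalizer[OF f g] by blast
  note mm = equalizer_subs[OF m f g]
  have T: "T \<in> Ob C"
    using f hom_Ob by blast
  have "factors C (Id C T) m"
    using cov mm W by (auto simp: covers_def)
  then have "f \<cdot> Id C T = g \<cdot> Id C T"
    using mm(2)[of "Id C T"] T by simp
  then show ?thesis
    using f g by (auto simp: hom_iff)
qed

end

section \<open>Semantics in terms of generalized elements\<close>

text \<open>
  The value of a term at a tuple xs of generalized elements at stage X.  Taking the projections of
  the product of the context for xs gives back the interpretation of the term.
\<close>

primrec eval_tm :: "('s, 'f, 'r) signature \<Rightarrow> ('o, 'a) cat \<Rightarrow> ('s, 'f, 'r, 'o, 'a) struct \<Rightarrow>
    'o \<Rightarrow> 'a list \<Rightarrow> 'f tm \<Rightarrow> 'a" where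
    "eval_tm \<Sigma> C M X xs (Var i) = xs ! i"
  | "eval_tm \<Sigma> C M X xs (Fun f ts) = FunI M f \<cdot>\<^bsub>C\<^esub>
      tuple C X (map (SortI M) (FDom \<Sigma> f)) (map (eval_tm \<Sigma> C M X xs) ts)"

text \<open>
  Kripke-Joyal forcing.  The lemmas \<open>forces_Rel\<close> to \<open>forces_Ex\<close> are its recursive clauses.
\<close>

definition forces :: "('s, 'f, 'r) signature \<Rightarrow> ('o, 'a) cat \<Rightarrow> ('s, 'f, 'r, 'o, 'a) struct \<Rightarrow>
    's list \<Rightarrow> 'o \<Rightarrow> 'a list \<Rightarrow> ('s, 'f, 'r, 'u) fm \<Rightarrow> bool"
  where "forces \<Sigma> C M \<Gamma> X xs \<phi> \<longleftrightarrow> factors C (tuple C X (map (SortI M) \<Gamma>) xs) (sem_fm \<Sigma> C M \<phi> \<Gamma>)"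

locale structure_in = geometric_category C
  for C :: "('o, 'a) cat" (structure) +
  fixes \<Sigma> :: "('s, 'f, 'r) signature" and M :: "('s, 'f, 'r, 'o, 'a) struct"
  assumes sig: "is_signature \<Sigma>"
    and struct: "is_struct \<Sigma> C M"
begin

abbreviation ctx :: "'s list \<Rightarrow> 'o list"
  where "ctx \<Gamma> \<equiv> map (SortI M) \<Gamma>"

lemma SortI_Ob: "A \<in> Sorts \<Sigma> \<Longrightarrow> SortI M A \<in> Ob C"
  using struct by (simp add: is_struct_def)

lemma ctx_Ob: "\<Gamma> \<in> lists (Sorts \<Sigma>) \<Longrightarrow> set (ctx \<Gamma>) \<subseteq> Ob C"
  using SortI_Ob by auto

lemma FunI_hom: "f \<in> Funs \<Sigma> \<Longrightarrow> FunI M f \<in> hom C (prod_ob C (ctx (FDom \<Sigma> f))) (SortI M (FCod \<Sigma> f))"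
  using struct by (simp add: is_struct_def)

lemma RelI_subs: "R \<in> Rels \<Sigma> \<Longrightarrow> RelI M R \<in> subs C (prod_ob C (ctx (RAr \<Sigma> R)))"
  using struct by (simp add: is_struct_def)

lemma FDom_sorts: "f \<in> Funs \<Sigma> \<Longrightarrow> FDom \<Sigma> f \<in> lists (Sorts \<Sigma>)"
  using sig by (simp add: is_signature_def)

lemma FCod_sort: "f \<in> Funs \<Sigma> \<Longrightarrow> FCod \<Sigma> f \<in> Sorts \<Sigma>"
  using sig by (simp add: is_signature_def)

lemma RAr_sorts: "R \<in> Rels \<Sigma> \<Longrightarrow> RAr \<Sigma> R \<in> lists (Sorts \<Sigma>)"
  using sig by (simp add: is_signature_def)

lemma eval_tm_els_aux:
  assumes "X \<in> Ob C" "list_all2 (\<lambda>t A. eval_tm \<Sigma> C M X xs t \<in> hom C X (SortI M A)) ts As"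
  shows "els C X (ctx As) (map (eval_tm \<Sigma> C M X xs) ts)"
  using assms by (simp add: els_def list.rel_map)

lemma eval_tm_hom:
  assumes xs: "els C X (ctx \<Gamma>) xs" and t: "has_sort \<Sigma> \<Gamma> t A"
  shows "eval_tm \<Sigma> C M X xs t \<in> hom C X (SortI M A)"
  using t
proof (induction t A rule: has_sort.induct)
  case (1 i)
  then show ?case
    using els_nth[OF xs, of i] by simp
next
  case (2 f ts)
  then have "els C X (ctx (FDom \<Sigma> f)) (map (eval_tm \<Sigma> C M X xs) ts)"
    using els_Ob[OF xs] by (intro eval_tm_els_aux) (auto elim: list_all2_mono)
  then show ?case
    using Cmp_hom[OF tuple(1) FunI_hom[OF 2(1)]] by simp
qed

lemma eval_tm_els:
  assumes xs: "els C X (ctx \<Gamma>) xs" and t: "list_all2 (has_sort \<Sigma> \<Gamma>) ts As"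
  shows "els C X (ctx As) (map (eval_tm \<Sigma> C M X xs) ts)"
  using t eval_tm_hom[OF xs] els_Ob[OF xs] by (intro eval_tm_els_aux) (auto elim: list_all2_mono)

lemma eval_tm_Cmp:
  assumes xs: "els C X (ctx \<Gamma>) xs" and a: "a \<in> hom C Y X" and t: "has_sort \<Sigma> \<Gamma> t A"
  shows "eval_tm \<Sigma> C M Y (map (\<lambda>x. x \<cdot> a) xs) t = eval_tm \<Sigma> C M X xs t \<cdot> a"
  using t
proof (induction t A rule: has_sort.induct)
  case (1 i)
  then show ?case
    using els_length[OF xs] by simp
next
  case (2 f ts)
  have ts: "list_all2 (has_sort \<Sigma> \<Gamma>) ts (FDom \<Sigma> f)"
    using 2(2) by (auto elim: list_all2_mono)
  have m: "map (eval_tm \<Sigma> C M Y (map (\<lambda>x. x \<cdot> a) xs)) ts = map (\<lambda>x. x \<cdot> a) (map (eval_tm \<Sigma> C M X xs) ts)"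
    using 2(2) by (auto simp: list_all2_conv_all_nth in_set_conv_nth)
  then show ?case
    using tuple_Cmp[OF eval_tm_els[OF xs ts] a] tuple(1)[OF eval_tm_els[OF xs ts]] FunI_hom[OF 2(1)] a
    by (simp add: hom_iff m del: map_map)
qed

lemma sem_tm_eval_tm: "sem_tm \<Sigma> C M \<Gamma> t = eval_tm \<Sigma> C M (prod_ob C (ctx \<Gamma>)) (prjs C (ctx \<Gamma>)) t"
  by (induction t) (auto cong: map_cong)

lemma sem_tm_hom:
  assumes "\<Gamma> \<in> lists (Sorts \<Sigma>)" "has_sort \<Sigma> \<Gamma> t A"
  shows "sem_tm \<Sigma> C M \<Gamma> t \<in> hom C (prod_ob C (ctx \<Gamma>)) (SortI M A)"
  unfolding sem_tm_eval_tm by (rule eval_tm_hom[OF prjs_els[OF ctx_Ob[OF assms(1)]] assms(2)])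

lemma sem_tm_tuple:
  assumes xs: "els C X (ctx \<Gamma>) xs" and t: "has_sort \<Sigma> \<Gamma> t A"
  shows "sem_tm \<Sigma> C M \<Gamma> t \<cdot> tuple C X (ctx \<Gamma>) xs = eval_tm \<Sigma> C M X xs t"
  using eval_tm_Cmp[OF prjs_els[OF els_set[OF xs]] tuple(1)[OF xs] t] tuple(2)[OF xs]
  by (simp add: sem_tm_eval_tm)

lemma sem_tms_els:
  assumes "\<Gamma> \<in> lists (Sorts \<Sigma>)" "list_all2 (has_sort \<Sigma> \<Gamma>) ts As"
  shows "els C (prod_ob C (ctx \<Gamma>)) (ctx As) (map (sem_tm \<Sigma> C M \<Gamma>) ts)"
  using eval_tm_els[OF prjs_els[OF ctx_Ob[OF assms(1)]] assms(2)] by (simp add: sem_tm_eval_tm[abs_def])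

lemma sem_tms_tuple:
  assumes xs: "els C X (ctx \<Gamma>) xs" and \<Gamma>: "\<Gamma> \<in> lists (Sorts \<Sigma>)" and ts: "list_all2 (has_sort \<Sigma> \<Gamma>) ts As"
  shows "tuple C (prod_ob C (ctx \<Gamma>)) (ctx As) (map (sem_tm \<Sigma> C M \<Gamma>) ts) \<cdot> tuple C X (ctx \<Gamma>) xs =
    tuple C X (ctx As) (map (eval_tm \<Sigma> C M X xs) ts)"
proof -
  have m: "map (\<lambda>x. x \<cdot> tuple C X (ctx \<Gamma>) xs) (map (sem_tm \<Sigma> C M \<Gamma>) ts) = map (eval_tm \<Sigma> C M X xs) ts"
  proof -
    have "\<forall>t \<in> set ts. \<exists>A. has_sort \<Sigma> \<Gamma> t A"
      using ts by (fastforce simp: list_all2_conv_all_nth in_set_conv_nth)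
    then show ?thesis
      using sem_tm_tuple[OF xs] by auto
  qed
  show ?thesis
    using tuple_Cmp[OF sem_tms_els[OF \<Gamma> ts] tuple(1)[OF xs]] unfolding m .
qed

text \<open>
  The projection along which the existential quantifier takes images; on elements it forgets the
  value of the bound variable.
\<close>

lemma drop_first:
  assumes A: "A # \<Gamma> \<in> lists (Sorts \<Sigma>)"
  defines "\<pi> \<equiv> tuple C (prod_ob C (ctx (A # \<Gamma>))) (ctx \<Gamma>) (tl (prjs C (ctx (A # \<Gamma>))))"
  shows "\<pi> \<in> hom C (prod_ob C (ctx (A # \<Gamma>))) (prod_ob C (ctx \<Gamma>))"
    and "els C X (ctx (A # \<Gamma>)) (b # xs) \<Longrightarrow> \<pi> \<cdot> tuple C X (ctx (A # \<Gamma>)) (b # xs) = tuple C X (ctx \<Gamma>) xs"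
proof -
  obtain p ps where ps: "prjs C (ctx (A # \<Gamma>)) = p # ps" "els C (prod_ob C (ctx (A # \<Gamma>))) (ctx \<Gamma>) ps"
    using prjs_els[OF ctx_Ob[OF A]] by (auto simp: els_Cons)
  then show "\<pi> \<in> hom C (prod_ob C (ctx (A # \<Gamma>))) (prod_ob C (ctx \<Gamma>))"
    using tuple(1) by (simp add: \<pi>_def)
  assume xs: "els C X (ctx (A # \<Gamma>)) (b # xs)"
  show "\<pi> \<cdot> tuple C X (ctx (A # \<Gamma>)) (b # xs) = tuple C X (ctx \<Gamma>) xs"
    using tuple_Cmp[OF ps(2) tuple(1)[OF xs]] tuple(2)[OF xs] ps(1) by (simp add: \<pi>_def)
qed

lemma sem_fm_subs:
  assumes "geometric_fm \<Sigma> \<phi> \<Gamma>" "\<Gamma> \<in> lists (Sorts \<Sigma>)"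
  shows "sem_fm \<Sigma> C M \<phi> \<Gamma> \<in> subs C (prod_ob C (ctx \<Gamma>))"
  using assms
proof (induction \<phi> arbitrary: \<Gamma>)
  case (Rel R ts)
  then have t: "els C (prod_ob C (ctx \<Gamma>)) (ctx (RAr \<Sigma> R)) (map (sem_tm \<Sigma> C M \<Gamma>) ts)"
    using sem_tms_els by simp
  have R: "RelI M R \<in> subs C (prod_ob C (ctx (RAr \<Sigma> R)))"
    using Rel RelI_subs by simp
  show ?case
    using pullback_subs(1)[OF pb_is_pullback, OF tuple_Ar(1)[OF t] subsD(1)[OF R]] tuple_Ar[OF t] R
        subsD[OF R]
    by simp
next
  case (Eq s t)
  then obtain A where st: "sem_tm \<Sigma> C M \<Gamma> s \<in> hom C (prod_ob C (ctx \<Gamma>)) (SortI M A)"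
    "sem_tm \<Sigma> C M \<Gamma> t \<in> hom C (prod_ob C (ctx \<Gamma>)) (SortI M A)"
    using sem_tm_hom by fastforce
  show ?case
    using equalizer_subs(1)[OF someI_ex[OF ex_equalizer[OF st]] st] by simp
next
  case Top
  then show ?case
    using Id_subs prod_ob_Ob[OF ctx_Ob] by simp
next
  case (And \<phi> \<psi>)
  then show ?case
    using meet_sub(1) by simp
next
  case (Disj I \<phi>s)
  then have "(\<lambda>i. sem_fm \<Sigma> C M (\<phi>s i) \<Gamma>) ` I \<subseteq> {u \<in> Ar C. Cod C u = prod_ob C (ctx \<Gamma>)}"
    using subsD by fastforce
  then show ?case
    using union_sub(1)[OF prod_ob_Ob[OF ctx_Ob[OF Disj.prems(2)]]] by simp
next
  case (Ex A \<phi>)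
  then have A: "A # \<Gamma> \<in> lists (Sorts \<Sigma>)"
    by auto
  have m: "sem_fm \<Sigma> C M \<phi> (A # \<Gamma>) \<in> subs C (prod_ob C (ctx (A # \<Gamma>)))"
    using Ex.IH[OF _ A] Ex.prems by simp
  define \<pi> where "\<pi> = tuple C (prod_ob C (ctx (A # \<Gamma>))) (ctx \<Gamma>) (tl (prjs C (ctx (A # \<Gamma>))))"
  have \<pi>: "\<pi> \<in> Ar C" "Dom C \<pi> = prod_ob C (ctx (A # \<Gamma>))" "Cod C \<pi> = prod_ob C (ctx \<Gamma>)"
    using drop_first(1)[OF A] by (auto simp: \<pi>_def hom_iff)
  have "image_ar C (\<pi> \<cdot> sem_fm \<Sigma> C M \<phi> (A # \<Gamma>)) \<in> subs C (prod_ob C (ctx \<Gamma>))"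
    using image_ar(1)[of "\<pi> \<cdot> sem_fm \<Sigma> C M \<phi> (A # \<Gamma>)"] \<pi> subsD[OF m] by simp
  then show ?case
    by (simp add: \<pi>_def)
qed

lemma forces_Rel:
  assumes "geometric_fm \<Sigma> (Rel R ts) \<Gamma>" "\<Gamma> \<in> lists (Sorts \<Sigma>)" and xs: "els C X (ctx \<Gamma>) xs"
  shows "forces \<Sigma> C M \<Gamma> X xs (Rel R ts) \<longleftrightarrow>
    factors C (tuple C X (ctx (RAr \<Sigma> R)) (map (eval_tm \<Sigma> C M X xs) ts)) (RelI M R)"
proof -
  have ts: "list_all2 (has_sort \<Sigma> \<Gamma>) ts (RAr \<Sigma> R)"
    using assms by simp
  note t = sem_tms_els[OF assms(2) ts]
  have R: "RelI M R \<in> subs C (prod_ob C (ctx (RAr \<Sigma> R)))"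
    using assms RelI_subs by simp
  let ?t = "tuple C (prod_ob C (ctx \<Gamma>)) (ctx (RAr \<Sigma> R)) (map (sem_tm \<Sigma> C M \<Gamma>) ts)"
  have pb: "is_pullback C ?t (RelI M R) (fst (pb C ?t (RelI M R))) (snd (pb C ?t (RelI M R)))"
    by (rule pb_is_pullback) (use tuple_Ar[OF t] subsD[OF R] in auto)
  have R': "RelI M R \<in> subs C (Cod C ?t)"
    using R tuple_Ar[OF t] by simp
  show ?thesis
    using pullback_subs(2)[OF pb tuple_Ar(1)[OF t] R', of "tuple C X (ctx \<Gamma>) xs"]
      sem_tms_tuple[OF xs assms(2) ts] tuple_Ar[OF t] tuple_Ar[OF xs] by (simp add: forces_def)
qed

lemma forces_Eq:
  assumes "geometric_fm \<Sigma> (Eq s t) \<Gamma>" "\<Gamma> \<in> lists (Sorts \<Sigma>)" and xs: "els C X (ctx \<Gamma>) xs"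
  shows "forces \<Sigma> C M \<Gamma> X xs (Eq s t) \<longleftrightarrow> eval_tm \<Sigma> C M X xs s = eval_tm \<Sigma> C M X xs t"
proof -
  obtain A where A: "has_sort \<Sigma> \<Gamma> s A" "has_sort \<Sigma> \<Gamma> t A"
    using assms by auto
  note st = sem_tm_hom[OF assms(2) A(1)] sem_tm_hom[OF assms(2) A(2)]
  show ?thesis
    using equalizer_subs(2)[OF someI_ex[OF ex_equalizer[OF st]] st, of "tuple C X (ctx \<Gamma>) xs"]
      sem_tm_tuple[OF xs A(1)] sem_tm_tuple[OF xs A(2)] tuple_Ar[OF xs] by (simp add: forces_def)
qed

lemma forces_Top:
  assumes xs: "els C X (ctx \<Gamma>) xs"
  shows "forces \<Sigma> C M \<Gamma> X xs Top"
proof -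
  have "prod_ob C (ctx \<Gamma>) \<in> Ob C"
    using prod_ob_Ob els_set[OF xs] by blast
  then show ?thesis
    using factorsI[of "tuple C X (ctx \<Gamma>) xs" "Id C (prod_ob C (ctx \<Gamma>))"] tuple_Ar[OF xs]
    by (simp add: forces_def)
qed

lemma forces_And:
  assumes "geometric_fm \<Sigma> (And \<phi> \<psi>) \<Gamma>" "\<Gamma> \<in> lists (Sorts \<Sigma>)"
  shows "forces \<Sigma> C M \<Gamma> X xs (And \<phi> \<psi>) \<longleftrightarrow> forces \<Sigma> C M \<Gamma> X xs \<phi> \<and> forces \<Sigma> C M \<Gamma> X xs \<psi>"
  using meet_sub(2)[OF sem_fm_subs[of \<phi>, OF _ assms(2)] sem_fm_subs[of \<psi>, OF _ assms(2)]] assms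
  by (simp add: forces_def)

text \<open>
  Factoring through a union is a local matter, by the description of unions in \<open>geometric_category\<close>.
\<close>

lemma forces_Disj:
  assumes "geometric_fm \<Sigma> (Disj I \<phi>s) \<Gamma>" "\<Gamma> \<in> lists (Sorts \<Sigma>)" and xs: "els C X (ctx \<Gamma>) xs"
  shows "forces \<Sigma> C M \<Gamma> X xs (Disj I \<phi>s) \<longleftrightarrow>
    covers C X {a \<in> Ar C. Cod C a = X \<and> (\<exists>i \<in> I. forces \<Sigma> C M \<Gamma> (Dom C a) (map (\<lambda>x. x \<cdot> a) xs) (\<phi>s i))}"
proof -
  let ?U = "(\<lambda>i. sem_fm \<Sigma> C M (\<phi>s i) \<Gamma>) ` I"
  have U: "?U \<subseteq> {u \<in> Ar C. Cod C u = prod_ob C (ctx \<Gamma>)}"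
    using sem_fm_subs[OF _ assms(2)] assms(1) subsD by fastforce
  have "pulled C ?U (tuple C X (ctx \<Gamma>) xs) =
      {a \<in> Ar C. Cod C a = X \<and> (\<exists>i \<in> I. forces \<Sigma> C M \<Gamma> (Dom C a) (map (\<lambda>x. x \<cdot> a) xs) (\<phi>s i))}"
    using tuple_Ar[OF xs] tuple_Cmp[OF xs] by (auto simp: pulled_def forces_def hom_iff)
  then show ?thesis
    using union_sub(2)[OF prod_ob_Ob[OF ctx_Ob[OF assms(2)]] U, of "tuple C X (ctx \<Gamma>) xs"] tuple_Ar[OF xs]
    by (simp add: forces_def)
qed

text \<open>
  The image of \<open>\<pi> \<cdot> m\<close>, where m interprets \<open>\<phi>\<close>, contains xs if xs factors through \<open>\<pi> \<cdot> m\<close> locally.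
  A factorization of \<open>xs \<cdot> a\<close> through \<open>\<pi> \<cdot> m\<close> is a witness b such that \<open>\<phi>\<close> holds of b and \<open>xs \<cdot> a\<close>.
\<close>

lemma forces_Ex:
  assumes "geometric_fm \<Sigma> (Ex A \<phi>) \<Gamma>" "\<Gamma> \<in> lists (Sorts \<Sigma>)" and xs: "els C X (ctx \<Gamma>) xs"
  shows "forces \<Sigma> C M \<Gamma> X xs (Ex A \<phi>) \<longleftrightarrow>
    covers C X {a \<in> Ar C. Cod C a = X \<and>
      (\<exists>b \<in> hom C (Dom C a) (SortI M A). forces \<Sigma> C M (A # \<Gamma>) (Dom C a) (b # map (\<lambda>x. x \<cdot> a) xs) \<phi>)}"
proof -
  have A: "A # \<Gamma> \<in> lists (Sorts \<Sigma>)"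
    using assms by auto
  define m where "m = sem_fm \<Sigma> C M \<phi> (A # \<Gamma>)"
  have ms: "m \<in> subs C (prod_ob C (ctx (A # \<Gamma>)))"
    unfolding m_def by (rule sem_fm_subs) (use assms A in auto)
  define \<pi> where "\<pi> = tuple C (prod_ob C (ctx (A # \<Gamma>))) (ctx \<Gamma>) (tl (prjs C (ctx (A # \<Gamma>))))"
  have \<pi>: "\<pi> \<in> Ar C" "Dom C \<pi> = prod_ob C (ctx (A # \<Gamma>))" "Cod C \<pi> = prod_ob C (ctx \<Gamma>)"
    using drop_first(1)[OF A] by (auto simp: \<pi>_def hom_iff)
  have \<pi>t: "\<pi> \<cdot> tuple C Y (ctx (A # \<Gamma>)) (b # ys) =
      tuple C Y (ctx \<Gamma>) ys" if "els C Y (ctx (A # \<Gamma>)) (b # ys)" for Y b ys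
    using drop_first(2)[OF A that] by (simp add: \<pi>_def)
  have iff: "factors C (tuple C X (ctx \<Gamma>) xs \<cdot> a) (\<pi> \<cdot> m) \<longleftrightarrow>
      (\<exists>b \<in> hom C (Dom C a) (SortI M A). forces \<Sigma> C M (A # \<Gamma>) (Dom C a) (b # map (\<lambda>x. x \<cdot> a) xs) \<phi>)"
    (is "?L \<longleftrightarrow> ?R") if a: "a \<in> Ar C" "Cod C a = X" for a
  proof
    have ah: "a \<in> hom C (Dom C a) X"
      using a by (simp add: hom_iff)
    note xa = els_Cmp[OF xs ah]
    have ta: "tuple C X (ctx \<Gamma>) xs \<cdot> a = tuple C (Dom C a) (ctx \<Gamma>) (map (\<lambda>x. x \<cdot> a) xs)"
      by (rule tuple_Cmp[OF xs ah])
    show ?R if L: ?L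
    proof -
      obtain k where k: "k \<in> Ar C" "Dom C k = Dom C a" "Cod C k = Dom C m" "(\<pi> \<cdot> m) \<cdot> k =
          tuple C X (ctx \<Gamma>) xs \<cdot> a"
        using L a \<pi> tuple_Ar[OF xs] subsD[OF ms] by (auto simp: factors_iff)
      have mk: "m \<cdot> k \<in> hom C (Dom C a) (prod_ob C (ctx (A # \<Gamma>)))"
        using k subsD[OF ms] by (simp add: hom_iff)
      obtain ys where ys: "els C (Dom C a) (ctx (A # \<Gamma>)) ys" "tuple C (Dom C a) (ctx (A # \<Gamma>)) ys = m \<cdot> k"
        using tuple_prjs[OF ctx_Ob[OF A] mk] by blast
      then obtain b zs where b: "ys = b # zs" "b \<in> hom C (Dom C a) (SortI M A)" "els C (Dom C a) (ctx \<Gamma>) zs"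
        by (auto simp: els_Cons)
      have "tuple C (Dom C a) (ctx \<Gamma>) zs = tuple C (Dom C a) (ctx \<Gamma>) (map (\<lambda>x. x \<cdot> a) xs)"
        using \<pi>t[of "Dom C a" b zs] ys b k \<pi> subsD[OF ms] ta by simp
      then have "zs = map (\<lambda>x. x \<cdot> a) xs"
        using tuple_inject[OF b(3) xa] by blast
      then have "forces \<Sigma> C M (A # \<Gamma>) (Dom C a) (b # map (\<lambda>x. x \<cdot> a) xs) \<phi>"
        unfolding forces_def m_def[symmetric]
        using ys b(1) factorsI[of k m] k subsD[OF ms] by simp
      then show ?thesis
        using b by blast
    qed
    show ?L if ?R
    proof -
      from that obtain b where b: "b \<in> hom C (Dom C a) (SortI M A)"
        "factors C (tuple C (Dom C a) (ctx (A # \<Gamma>)) (b # map (\<lambda>x. x \<cdot> a) xs)) m"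
        unfolding forces_def m_def by blast
      have e: "els C (Dom C a) (ctx (A # \<Gamma>)) (b # map (\<lambda>x. x \<cdot> a) xs)"
        using b(1) xa by (simp add: els_Cons)
      obtain k where k: "k \<in> Ar C" "Dom C k = Dom C a" "Cod C k = Dom C m"
        "m \<cdot> k = tuple C (Dom C a) (ctx (A # \<Gamma>)) (b # map (\<lambda>x. x \<cdot> a) xs)"
        using b(2) tuple_Ar[OF e] by (auto simp: factors_iff)
      have "(\<pi> \<cdot> m) \<cdot> k = tuple C X (ctx \<Gamma>) xs \<cdot> a"
        using \<pi>t[OF e] k ta \<pi> subsD[OF ms] by simp
      then show ?thesis
        using factorsI[of k "\<pi> \<cdot> m"] k \<pi> subsD[OF ms] by simp
    qed
  qed
  have "pulled C {\<pi> \<cdot> m} (tuple C X (ctx \<Gamma>) xs) = {a \<in> Ar C. Cod C a = X \<and>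
      (\<exists>b \<in> hom C (Dom C a) (SortI M A). forces \<Sigma> C M (A # \<Gamma>) (Dom C a) (b # map (\<lambda>x. x \<cdot> a) xs) \<phi>)}"
    unfolding pulled_def using iff tuple_Ar[OF xs] by auto
  moreover have "forces \<Sigma> C M \<Gamma> X xs (Ex A \<phi>) \<longleftrightarrow> covers C X (pulled C {\<pi> \<cdot> m} (tuple C X (ctx \<Gamma>) xs))"
    using image_ar(2)[of "\<pi> \<cdot> m" "tuple C X (ctx \<Gamma>) xs"] \<pi> subsD[OF ms] tuple_Ar[OF xs]
    by (simp add: forces_def m_def \<pi>_def)
  ultimately show ?thesis
    by simp
qed

text \<open>
  The Yoneda lemma for subobjects: for the converse take m itself as a generalized element.
\<close>

lemma factors_elements:
  assumes \<Gamma>: "set As \<subseteq> Ob C" and m: "m \<in> subs C (prod_ob C As)" and n: "n \<in> subs C (prod_ob C As)"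
  shows "factors C m n \<longleftrightarrow> (\<forall>X xs. els C X As xs \<longrightarrow> factors C (tuple C X As xs) m \<longrightarrow>
      factors C (tuple C X As xs) n)"
proof
  assume "factors C m n"
  then show "\<forall>X xs. els C X As xs \<longrightarrow> factors C (tuple C X As xs) m \<longrightarrow> factors C (tuple C X As xs) n"
    using factors_trans subsD[OF n] by blast
next
  assume R: "\<forall>X xs. els C X As xs \<longrightarrow> factors C (tuple C X As xs) m \<longrightarrow> factors C (tuple C X As xs) n"
  have "m \<in> hom C (Dom C m) (prod_ob C As)"
    using subsD[OF m] by (simp add: hom_iff)
  from R[rule_format, OF tuple_prjs(1)[OF \<Gamma> this]] tuple_prjs(2)[OF \<Gamma> this] show "factors C m n"
    using subsD[OF m] by simp
qed

lemma sequent_forces: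
  assumes "geometric_fm \<Sigma> \<phi> \<Gamma>" "geometric_fm \<Sigma> \<psi> \<Gamma>" "\<Gamma> \<in> lists (Sorts \<Sigma>)"
  shows "factors C (sem_fm \<Sigma> C M \<phi> \<Gamma>) (sem_fm \<Sigma> C M \<psi> \<Gamma>) \<longleftrightarrow>
    (\<forall>X xs. els C X (ctx \<Gamma>) xs \<longrightarrow> forces \<Sigma> C M \<Gamma> X xs \<phi> \<longrightarrow> forces \<Sigma> C M \<Gamma> X xs \<psi>)"
  unfolding forces_def
  by (rule factors_elements[OF ctx_Ob[OF assms(3)] sem_fm_subs[OF assms(1,3)] sem_fm_subs[OF assms(2,3)]])

end

subsection \<open>Homomorphisms act on generalized elements\<close>

text \<open>
  The conditions on a homomorphism for operations \<open>\<theta> A\<close> that act on generalized elements of the sort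
  A at a single stage X.
\<close>

definition preserves :: "('s, 'f, 'r) signature \<Rightarrow> ('o, 'a) cat \<Rightarrow> ('s, 'f, 'r, 'o, 'a) struct \<Rightarrow>
    ('s, 'f, 'r, 'o, 'a) struct \<Rightarrow> 'o \<Rightarrow> ('s \<Rightarrow> 'a \<Rightarrow> 'a) \<Rightarrow> bool"
  where "preserves \<Sigma> C M N X \<theta> \<longleftrightarrow>
    (\<forall>f \<in> Funs \<Sigma>. \<forall>xs. els C X (map (SortI M) (FDom \<Sigma> f)) xs \<longrightarrow>
      \<theta> (FCod \<Sigma> f) (FunI M f \<cdot>\<^bsub>C\<^esub> tuple C X (map (SortI M) (FDom \<Sigma> f)) xs) =
      FunI N f \<cdot>\<^bsub>C\<^esub> tuple C X (map (SortI N) (FDom \<Sigma> f)) (map2 \<theta> (FDom \<Sigma> f) xs)) \<and>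
    (\<forall>R \<in> Rels \<Sigma>. \<forall>xs. els C X (map (SortI M) (RAr \<Sigma> R)) xs \<longrightarrow>
      factors C (tuple C X (map (SortI M) (RAr \<Sigma> R)) xs) (RelI M R) \<longrightarrow>
      factors C (tuple C X (map (SortI N) (RAr \<Sigma> R)) (map2 \<theta> (RAr \<Sigma> R) xs)) (RelI N R))"

context geometric_category
begin

lemma els_map2:
  assumes "\<And>A. A \<in> set ss \<Longrightarrow> h A \<in> hom C (a A) (b A)" "els C X (map a ss) xs"
  shows "els C X (map b ss) (map2 (\<lambda>A x. h A \<cdot> x) ss xs)"
  using assms
proof (induction ss arbitrary: xs)
  case (Cons s ss)
  then show ?case
    using Cmp_hom[OF _ Cons.prems(1)[of s]] by (auto simp: els_Cons)
qed simp

lemma prod_map_hom: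
  assumes h: "\<And>A. A \<in> set ss \<Longrightarrow> h A \<in> hom C (a A) (b A)" and ob: "set (map a ss) \<subseteq> Ob C"
  shows "prod_map C (map a ss) (map b ss) (map h ss) \<in> hom C (prod_ob C (map a ss)) (prod_ob C (map b ss))"
    and "els C X (map a ss) xs \<Longrightarrow>
      prod_map C (map a ss) (map b ss) (map h ss) \<cdot> tuple C X (map a ss) xs =
      tuple C X (map b ss) (map2 (\<lambda>A x. h A \<cdot> x) ss xs)"
proof -
  note ps = prjs_els[OF ob]
  have eq: "map2 (\<lambda>g p. g \<cdot> p) (map h ss) (prjs C (map a ss)) = map2 (\<lambda>A x. h A \<cdot> x) ss (prjs C (map a ss))"
    by (simp add: map_zip_map case_prod_unfold)
  have e: "els C (prod_ob C (map a ss)) (map b ss) (map2 (\<lambda>g p. g \<cdot> p) (map h ss) (prjs C (map a ss)))"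
    unfolding eq using els_map2[OF h ps] by blast
  show "prod_map C (map a ss) (map b ss) (map h ss) \<in> hom C (prod_ob C (map a ss)) (prod_ob C (map b ss))"
    unfolding prod_map_def by (rule tuple(1)[OF e])
  assume xs: "els C X (map a ss) xs"
  have aux: "map (\<lambda>x. x \<cdot> t) (map2 (\<lambda>A x. h A \<cdot> x) ss ps) = map2 (\<lambda>A x. h A \<cdot> x) ss (map (\<lambda>p. p \<cdot> t) ps)"
    if "\<And>A. A \<in> set ss \<Longrightarrow> h A \<in> hom C (a A) (b A)" "els C P (map a ss) ps" "t \<in> hom C X P" for t P ps ss
    using that
  proof (induction ss arbitrary: ps)
    case (Cons s ss)
    then show ?case
      by (auto simp: els_Cons hom_iff)
  qed simp
  show "prod_map C (map a ss) (map b ss) (map h ss) \<cdot> tuple C X (map a ss) xs =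
      tuple C X (map b ss) (map2 (\<lambda>A x. h A \<cdot> x) ss xs)"
    using tuple_Cmp[OF e tuple(1)[OF xs]] aux[OF h ps tuple(1)[OF xs]] tuple(2)[OF xs]
    by (simp add: prod_map_def eq)
qed

text \<open>
  An instance of the Yoneda lemma: the two conditions on h hold once they hold after composition
  with the generic elements, which are the projections of the product for a function symbol and the
  subobject that interprets it for a relation symbol.
\<close>

lemma struct_homs_iff:
  assumes sig: "is_signature \<Sigma>" and M: "is_struct \<Sigma> C M" and N: "is_struct \<Sigma> C N"
  shows "h \<in> struct_homs \<Sigma> C M N \<longleftrightarrow> h \<in> (\<Pi>\<^sub>E A \<in> Sorts \<Sigma>. hom C (SortI M A) (SortI N A)) \<and>
    (\<forall>X. preserves \<Sigma> C M N X (\<lambda>A x. h A \<cdot> x))"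
proof -
  interpret M: structure_in C \<Sigma> M
    by unfold_locales fact+
  interpret N: structure_in C \<Sigma> N
    by unfold_locales fact+
  have "(h (FCod \<Sigma> f) \<cdot> FunI M f = FunI N f \<cdot> prod_map C (map (SortI M) (FDom \<Sigma> f))
      (map (SortI N) (FDom \<Sigma> f)) (map h (FDom \<Sigma> f))) \<longleftrightarrow>
      (\<forall>X xs. els C X (map (SortI M) (FDom \<Sigma> f)) xs \<longrightarrow>
        h (FCod \<Sigma> f) \<cdot> (FunI M f \<cdot> tuple C X (map (SortI M) (FDom \<Sigma> f)) xs) =
        FunI N f \<cdot> tuple C X (map (SortI N) (FDom \<Sigma> f)) (map2 (\<lambda>A x. h A \<cdot> x) (FDom \<Sigma> f) xs))"
    (is "_ \<longleftrightarrow> ?F f") if h: "h \<in> (\<Pi>\<^sub>E A \<in> Sorts \<Sigma>. hom C (SortI M A) (SortI N A))" and f: "f \<in> Funs \<Sigma>" for f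
  proof -
    have h': "h A \<in> hom C (SortI M A) (SortI N A)" if "A \<in> set (FDom \<Sigma> f)" for A
      using h that M.FDom_sorts[OF f] by auto
    note ob = M.ctx_Ob[OF M.FDom_sorts[OF f]]
    let ?p = "prod_map C (map (SortI M) (FDom \<Sigma> f)) (map (SortI N) (FDom \<Sigma> f)) (map h (FDom \<Sigma> f))"
    have p: "?p \<in> hom C (prod_ob C (M.ctx (FDom \<Sigma> f))) (prod_ob C (N.ctx (FDom \<Sigma> f)))"
      using prod_map_hom(1)[of "FDom \<Sigma> f" h "SortI M" "SortI N", OF h' ob] by blast
    have pt: "?p \<cdot> tuple C X (M.ctx (FDom \<Sigma> f)) xs =
        tuple C X (N.ctx (FDom \<Sigma> f)) (map2 (\<lambda>A x. h A \<cdot> x) (FDom \<Sigma> f) xs)"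
      if "els C X (M.ctx (FDom \<Sigma> f)) xs" for X xs
      using prod_map_hom(2)[of "FDom \<Sigma> f" h "SortI M" "SortI N", OF h' ob that] by blast
    have ar: "h (FCod \<Sigma> f) \<in> hom C (SortI M (FCod \<Sigma> f)) (SortI N (FCod \<Sigma> f))"
      using h M.FCod_sort[OF f] by auto
    note ars = ar[unfolded hom_iff] p[unfolded hom_iff] M.FunI_hom[OF f, unfolded hom_iff]
        N.FunI_hom[OF f, unfolded hom_iff]
    show ?thesis
    proof
      assume eq: "h (FCod \<Sigma> f) \<cdot> FunI M f = FunI N f \<cdot> ?p"
      show "?F f"
      proof (intro allI impI)
        fix X xs assume xs: "els C X (M.ctx (FDom \<Sigma> f)) xs"
        have "h (FCod \<Sigma> f) \<cdot> (FunI M f \<cdot> tuple C X (M.ctx (FDom \<Sigma> f)) xs) =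
            (h (FCod \<Sigma> f) \<cdot> FunI M f) \<cdot> tuple C X (M.ctx (FDom \<Sigma> f)) xs"
          using ars tuple_Ar[OF xs] by simp
        also have "\<dots> = FunI N f \<cdot> (?p \<cdot> tuple C X (M.ctx (FDom \<Sigma> f)) xs)"
          unfolding eq using ars tuple_Ar[OF xs] by simp
        finally show "h (FCod \<Sigma> f) \<cdot> (FunI M f \<cdot> tuple C X (M.ctx (FDom \<Sigma> f)) xs) =
            FunI N f \<cdot> tuple C X (N.ctx (FDom \<Sigma> f)) (map2 (\<lambda>A x. h A \<cdot> x) (FDom \<Sigma> f) xs)"
          unfolding pt[OF xs] .
      qed
    next
      assume F: "?F f"
      let ?P = "prod_ob C (M.ctx (FDom \<Sigma> f))" and ?ps = "prjs C (M.ctx (FDom \<Sigma> f))"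
      note ps = prjs_els[OF ob]
      have "tuple C ?P (M.ctx (FDom \<Sigma> f)) ?ps = Id C ?P"
        by (rule tuple_eqI[OF ps Id_hom[OF els_Ob[OF ps]]]) (use els_in[OF ps] in \<open>auto intro: map_idI\<close>)
      then show "h (FCod \<Sigma> f) \<cdot> FunI M f = FunI N f \<cdot> ?p"
        using F[rule_format, OF ps] pt[OF ps, symmetric] ars by simp
    qed
  qed
  moreover have "factors C (prod_map C (map (SortI M) (RAr \<Sigma> R)) (map (SortI N) (RAr \<Sigma> R))
      (map h (RAr \<Sigma> R)) \<cdot> RelI M R)
      (RelI N R) \<longleftrightarrow>
      (\<forall>X xs. els C X (map (SortI M) (RAr \<Sigma> R)) xs \<longrightarrow>
        factors C (tuple C X (map (SortI M) (RAr \<Sigma> R)) xs) (RelI M R) \<longrightarrow>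
        factors C (tuple C X (map (SortI N) (RAr \<Sigma> R)) (map2 (\<lambda>A x. h A \<cdot> x) (RAr \<Sigma> R) xs)) (RelI N R))"
    (is "_ \<longleftrightarrow> ?R R") if h: "h \<in> (\<Pi>\<^sub>E A \<in> Sorts \<Sigma>. hom C (SortI M A) (SortI N A))" and R: "R \<in> Rels \<Sigma>" for R
  proof -
    have h': "h A \<in> hom C (SortI M A) (SortI N A)" if "A \<in> set (RAr \<Sigma> R)" for A
      using h that M.RAr_sorts[OF R] by auto
    note ob = M.ctx_Ob[OF M.RAr_sorts[OF R]]
    let ?p = "prod_map C (map (SortI M) (RAr \<Sigma> R)) (map (SortI N) (RAr \<Sigma> R)) (map h (RAr \<Sigma> R))"
    have p: "?p \<in> hom C (prod_ob C (M.ctx (RAr \<Sigma> R))) (prod_ob C (N.ctx (RAr \<Sigma> R)))"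
      using prod_map_hom(1)[of "RAr \<Sigma> R" h "SortI M" "SortI N", OF h' ob] by blast
    have pt: "?p \<cdot> tuple C X (M.ctx (RAr \<Sigma> R)) xs =
        tuple C X (N.ctx (RAr \<Sigma> R)) (map2 (\<lambda>A x. h A \<cdot> x) (RAr \<Sigma> R) xs)"
      if "els C X (M.ctx (RAr \<Sigma> R)) xs" for X xs
      using prod_map_hom(2)[of "RAr \<Sigma> R" h "SortI M" "SortI N", OF h' ob that] by blast
    note ars = p[unfolded hom_iff] subsD[OF M.RelI_subs[OF R]] subsD[OF N.RelI_subs[OF R]]
    show ?thesis
    proof
      assume fac: "factors C (?p \<cdot> RelI M R) (RelI N R)"
      show "?R R"
      proof (intro allI impI)
        fix X xs assume xs: "els C X (M.ctx (RAr \<Sigma> R)) xs"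
          and "factors C (tuple C X (M.ctx (RAr \<Sigma> R)) xs) (RelI M R)"
        then obtain k where k: "k \<in> Ar C" "Dom C k = X" "Cod C k = Dom C (RelI M R)"
          "RelI M R \<cdot> k = tuple C X (M.ctx (RAr \<Sigma> R)) xs"
          using tuple_Ar[OF xs] by (auto simp: factors_iff)
        then have "(?p \<cdot> RelI M R) \<cdot> k = ?p \<cdot> tuple C X (M.ctx (RAr \<Sigma> R)) xs"
          using ars by simp
        then show "factors C (tuple C X (N.ctx (RAr \<Sigma> R)) (map2 (\<lambda>A x. h A \<cdot> x) (RAr \<Sigma> R) xs)) (RelI N R)"
          using factors_Cmp[OF fac, of k] k ars pt[OF xs] by simp
      qed
    next
      assume "?R R"
      moreover have r: "RelI M R \<in> hom C (Dom C (RelI M R)) (prod_ob C (M.ctx (RAr \<Sigma> R)))"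
        using ars by (simp add: hom_iff)
      ultimately show "factors C (?p \<cdot> RelI M R) (RelI N R)"
        using tuple_prjs[OF ob r] pt[OF tuple_prjs(1)[OF ob r]] ars by simp
    qed
  qed
  ultimately show ?thesis
    unfolding struct_homs_def preserves_def by blast
qed

end

section \<open>Slices\<close>

lemma slice_simps [simp]:
  "Dom (slice C E) (x, g, y) = x"
  "Cod (slice C E) (x, g, y) = y"
  "Id (slice C E) x = (x, Id C (Dom C x), x)"
  "(y', k, z) \<cdot>\<^bsub>slice C E\<^esub> (x, g, y) = (x, k \<cdot>\<^bsub>C\<^esub> g, z)"
  "x \<in> Ob (slice C E) \<longleftrightarrow> x \<in> Ar C \<and> Cod C x = E"
  "(x, g, y) \<in> Ar (slice C E) \<longleftrightarrow> x \<in> Ar C \<and> Cod C x = E \<and> y \<in> Ar C \<and> Cod C y = E \<and>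
    g \<in> Ar C \<and> Dom C g = Dom C x \<and> Cod C g = Dom C y \<and> y \<cdot>\<^bsub>C\<^esub> g = x"
  by (simp_all add: slice_def hom_iff conj_ac)

lemma slice_ar_simps [simp]: "slice_ar (x, g, y) = g"
  by (simp add: slice_ar_def)

lemma hom_slice_iff:
  "k \<in> hom (slice C E) x y \<longleftrightarrow> (\<exists>g. k = (x, g, y) \<and> x \<in> Ar C \<and> Cod C x = E \<and> y \<in> Ar C \<and> Cod C y = E \<and>
    g \<in> Ar C \<and> Dom C g = Dom C x \<and> Cod C g = Dom C y \<and> y \<cdot>\<^bsub>C\<^esub> g = x)"
  by (cases k) (simp add: hom_iff conj_ac, blast)

lemma slice_triple: "k \<in> Ar (slice C E) \<Longrightarrow> \<exists>g. k = (Dom (slice C E) k, g, Cod (slice C E) k)"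
  by (cases k) auto

context category
begin

lemma slice_category: "category (slice C E)"
proof
  fix f g W X Y assume f: "f \<in> hom (slice C E) W X" and g: "g \<in> hom (slice C E) X Y"
  obtain f' where f': "f = (W, f', X)" "f' \<in> Ar C" "Dom C f' = Dom C W" "Cod C f' = Dom C X" "X \<cdot> f' = W"
      "W \<in> Ar C" "Cod C W = E" "X \<in> Ar C" "Cod C X = E"
    using f unfolding hom_slice_iff by blast
  obtain g' where g': "g = (X, g', Y)" "g' \<in> Ar C" "Dom C g' = Dom C X" "Cod C g' = Dom C Y" "Y \<cdot> g' = X"
      "Y \<in> Ar C" "Cod C Y = E"
    using g unfolding hom_slice_iff by blast
  have "Y \<cdot> (g' \<cdot> f') = (Y \<cdot> g') \<cdot> f'"
    using f'(2-4) g'(2-4,6) by simp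
  then have "Y \<cdot> (g' \<cdot> f') = W"
    using f' g' by simp
  then show "g \<cdot>\<^bsub>slice C E\<^esub> f \<in> hom (slice C E) W Y"
    unfolding hom_slice_iff using f' g' by (intro exI[of _ "g' \<cdot> f'"]) simp
  show "(h \<cdot>\<^bsub>slice C E\<^esub> g) \<cdot>\<^bsub>slice C E\<^esub> f = h \<cdot>\<^bsub>slice C E\<^esub> (g \<cdot>\<^bsub>slice C E\<^esub> f)"
    if h: "h \<in> hom (slice C E) Y Z" for h Z
  proof -
    obtain h' where "h = (Y, h', Z)" "h' \<in> Ar C" "Dom C h' = Dom C Y"
      using h unfolding hom_slice_iff by blast
    then show ?thesis
      using f' g' by simp
  qed
qed (fastforce simp: hom_slice_iff Dom_Ob)+

text \<open>
  An arrow into the domain of an object x of the slice lifts uniquely to an arrow into x, so a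
  subobject of x is the same thing as a subobject of its domain.
\<close>

lemma slice_subs_iff:
  assumes x: "x \<in> Ar C" "Cod C x = E"
  shows "(y, m, x) \<in> subs (slice C E) x \<longleftrightarrow> m \<in> subs C (Dom C x) \<and> y = x \<cdot> m"
proof
  interpret S: category "slice C E"
    by (rule slice_category)
  assume m: "(y, m, x) \<in> subs (slice C E) x"
  then have mA: "y \<in> Ar C" "Cod C y = E" "m \<in> Ar C" "Dom C m = Dom C y" "Cod C m = Dom C x" "x \<cdot> m = y"
    using S.subsD[OF m] by auto
  have "m \<in> subs C (Dom C x)"
  proof (rule subsI)
    fix f g assume fg: "f \<in> Ar C" "g \<in> Ar C" "Dom C f = Dom C g" "Cod C f = Dom C m" "Cod C g =
        Dom C m" "m \<cdot> f = m \<cdot> g"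
    have "y \<cdot> f = x \<cdot> (m \<cdot> f)" "y \<cdot> g = x \<cdot> (m \<cdot> g)"
      using fg(1-5) mA x assoc[of f m x] assoc[of g m x] by auto
    then have yfg: "y \<cdot> f = y \<cdot> g"
      using fg by simp
    have "(y \<cdot> f, f, y) = (y \<cdot> g, g, y)"
      by (rule S.subs_mono[OF m]) (use fg mA yfg in auto)
    then show "f = g"
      by simp
  qed (use mA in auto)
  then show "m \<in> subs C (Dom C x) \<and> y = x \<cdot> m"
    using mA by simp
next
  interpret S: category "slice C E"
    by (rule slice_category)
  assume m: "m \<in> subs C (Dom C x) \<and> y = x \<cdot> m"
  then have mA: "m \<in> Ar C" "Cod C m = Dom C x" "m \<in> subs C (Dom C x)" and y: "y = x \<cdot> m"
    using subsD by auto
  show "(y, m, x) \<in> subs (slice C E) x"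
  proof (rule S.subsI)
    fix f g
    assume fg: "f \<in> Ar (slice C E)" "g \<in> Ar (slice C E)" "Dom (slice C E) f = Dom (slice C E) g"
      "Cod (slice C E) f = Dom (slice C E) (y, m, x)" "Cod (slice C E) g = Dom (slice C E) (y, m, x)"
      "(y, m, x) \<cdot>\<^bsub>slice C E\<^esub> f = (y, m, x) \<cdot>\<^bsub>slice C E\<^esub> g"
    obtain z f' g' where "f = (z, f', y)" "g = (z, g', y)"
      using slice_triple[OF fg(1)] slice_triple[OF fg(2)] fg(3-5) by auto
    then show "f = g"
      using subs_mono[OF mA(3), of f' g'] fg mA x y by auto
  qed (use mA x y in auto)
qed

lemma slice_factors_iff:
  assumes "(z, g, x) \<in> Ar (slice C E)" "(y, m, x) \<in> Ar (slice C E)"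
  shows "factors (slice C E) (z, g, x) (y, m, x) \<longleftrightarrow> factors C g m"
proof
  interpret S: category "slice C E"
    by (rule slice_category)
  assume "factors (slice C E) (z, g, x) (y, m, x)"
  then obtain k where "k \<in> Ar (slice C E)" "Dom (slice C E) k = z" "Cod (slice C E) k = y"
    "(y, m, x) \<cdot>\<^bsub>slice C E\<^esub> k = (z, g, x)"
    by (auto simp: S.factors_iff)
  moreover from this obtain k' where "k = (z, k', y)"
    using slice_triple by metis
  ultimately show "factors C g m"
    using assms by (auto simp: factors_iff intro!: bexI[of _ k'])
next
  interpret S: category "slice C E"
    by (rule slice_category)
  assume "factors C g m"
  then obtain k where k: "k \<in> Ar C" "Dom C k = Dom C g" "Cod C k = Dom C m" "m \<cdot> k = g"
    by (auto simp: factors_iff)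
  have "y \<cdot> k = x \<cdot> (m \<cdot> k)"
    using assms k(1-3) assoc[of k m x] by auto
  then have "(z, k, y) \<in> Ar (slice C E)"
    using assms k by simp
  then have "factors (slice C E) ((y, m, x) \<cdot>\<^bsub>slice C E\<^esub> (z, k, y)) (y, m, x)"
    by (rule S.factorsI[OF _ assms(2)]) simp
  then show "factors (slice C E) (z, g, x) (y, m, x)"
    using k by simp
qed

text \<open>
  Since x and its domain have the same subobjects, they have the same covers.
\<close>

lemma slice_covers_iff:
  assumes x: "x \<in> Ar C" "Cod C x = E" and W: "\<And>a. a \<in> W \<Longrightarrow> a \<in> Ar C \<and> Cod C a = Dom C x"
  shows "covers (slice C E) x ((\<lambda>a. (x \<cdot> a, a, x)) ` W) \<longleftrightarrow> covers C (Dom C x) W"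
proof -
  interpret S: category "slice C E"
    by (rule slice_category)
  have subs: "subs (slice C E) x = (\<lambda>m. (x \<cdot> m, m, x)) ` subs C (Dom C x)"
  proof (rule equalityI; rule subsetI)
    fix n assume n: "n \<in> subs (slice C E) x"
    then obtain y m where nm: "n = (y, m, x)"
      using S.subsD[OF n] by (cases n) auto
    then show "n \<in> (\<lambda>m. (x \<cdot> m, m, x)) ` subs C (Dom C x)"
      using n slice_subs_iff[OF x, of y m] by auto
  qed (use slice_subs_iff[OF x] in auto)
  have "factors (slice C E) (x \<cdot> a, a, x) (x \<cdot> m, m, x) \<longleftrightarrow> factors C a m"
    if "m \<in> subs C (Dom C x)" "a \<in> Ar C" "Cod C a = Dom C x" for m a
    by (rule slice_factors_iff) (use that subsD[OF that(1)] x in auto)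
  moreover have "factors (slice C E) (x, Id C (Dom C x), x) (x \<cdot> m, m, x) \<longleftrightarrow> factors C (Id C (Dom C x)) m"
    if "m \<in> subs C (Dom C x)" for m
    by (rule slice_factors_iff) (use that subsD[OF that(1)] x Dom_Ob in auto)
  ultimately show ?thesis
    using W by (simp add: covers_def subs)
qed

end

text \<open>
  The identity of E is terminal.  Pullbacks and unions in the slice are those of the underlying
  arrows, which acquire a structure map to E by composition.
\<close>

lemma (in geometric_category) slice_geometric_category:
  assumes E: "E \<in> Ob C"
  shows "geometric_category (slice C E)"
proof -
  interpret S: category "slice C E"
    by (rule slice_category)
  show ?thesis
  proof
    have "\<exists>!f. f \<in> hom (slice C E) X (Id C E)" if "X \<in> Ob (slice C E)" for X
      by (rule ex1I[of _ "(X, X, Id C E)"]) (use that E in \<open>auto simp: hom_slice_iff\<close>)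
    then show "\<exists>T. is_terminal (slice C E) T"
      using E by (intro exI[of _ "Id C E"]) (simp add: is_terminal_def)
  next
    fix f g assume fg: "f \<in> Ar (slice C E)" "g \<in> Ar (slice C E)" "Cod (slice C E) f = Cod (slice C E) g"
    then obtain a f' x b g' where f: "f = (a, f', x)" and g: "g = (b, g', x)"
      by (cases f; cases g) auto
    have f': "a \<in> Ar C" "Cod C a = E" "f' \<in> Ar C" "Dom C f' = Dom C a" "Cod C f' = Dom C x" "x \<cdot> f' = a"
      and g': "b \<in> Ar C" "Cod C b = E" "g' \<in> Ar C" "Dom C g' = Dom C b" "Cod C g' = Dom C x" "x \<cdot> g' = b"
      and x: "x \<in> Ar C" "Cod C x = E"
      using fg f g by auto
    obtain p q where pb: "is_pullback C f' g' p q"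
      using ex_pullback[of f' g'] f' g' by auto
    note pq = pullbackD[OF pb f'(3) g'(3)]
    have apbq: "b \<cdot> q = a \<cdot> p"
      using assoc[of q g' x] assoc[of p f' x] f' g' x pq by metis
    have "is_pullback (slice C E) f g (a \<cdot> p, p, a) (a \<cdot> p, q, b)"
      unfolding is_pullback_def
    proof (intro conjI ballI impI)
      show "(a \<cdot> p, p, a) \<in> hom (slice C E) (Dom (slice C E) (a \<cdot> p, p, a)) (Dom (slice C E) f)"
        "(a \<cdot> p, q, b) \<in> hom (slice C E) (Dom (slice C E) (a \<cdot> p, p, a)) (Dom (slice C E) g)"
        "f \<cdot>\<^bsub>slice C E\<^esub> (a \<cdot> p, p, a) = g \<cdot>\<^bsub>slice C E\<^esub> (a \<cdot> p, q, b)"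
        using f' g' x pq apbq f g by (auto simp: hom_iff)
      fix Z h k
      assume Z: "Z \<in> Ob (slice C E)" and "h \<in> hom (slice C E) Z (Dom (slice C E) f)"
        "k \<in> hom (slice C E) Z (Dom (slice C E) g)" and eq: "f \<cdot>\<^bsub>slice C E\<^esub> h = g \<cdot>\<^bsub>slice C E\<^esub> k"
      then obtain h' k' where h: "h = (Z, h', a)" "h' \<in> Ar C" "Dom C h' = Dom C Z" "Cod C h' =
          Dom C a" "a \<cdot> h' = Z"
        and k: "k = (Z, k', b)" "k' \<in> Ar C" "Dom C k' = Dom C Z" "Cod C k' = Dom C b" "b \<cdot> k' = Z"
        using f g by (auto simp: hom_slice_iff)
      obtain u where u: "u \<in> Ar C" "Dom C u = Dom C Z" "Cod C u = Dom C p" "p \<cdot> u = h'" "q \<cdot> u = k'"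
        using pullback_lift[OF pb, of h' k'] h k eq f g f' g' by auto
      show "\<exists>!u. u \<in> hom (slice C E) Z (Dom (slice C E) (a \<cdot> p, p, a)) \<and>
          (a \<cdot> p, p, a) \<cdot>\<^bsub>slice C E\<^esub> u = h \<and> (a \<cdot> p, q, b) \<cdot>\<^bsub>slice C E\<^esub> u = k"
      proof (rule ex1I[of _ "(Z, u, a \<cdot> p)"])
        show "(Z, u, a \<cdot> p) \<in> hom (slice C E) Z (Dom (slice C E) (a \<cdot> p, p, a)) \<and>
          (a \<cdot> p, p, a) \<cdot>\<^bsub>slice C E\<^esub> (Z, u, a \<cdot> p) = h \<and> (a \<cdot> p, q, b) \<cdot>\<^bsub>slice C E\<^esub> (Z, u, a \<cdot> p) = k"
          using u h k Z f' pq by (auto simp: hom_slice_iff)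
        fix w assume w: "w \<in> hom (slice C E) Z (Dom (slice C E) (a \<cdot> p, p, a)) \<and>
          (a \<cdot> p, p, a) \<cdot>\<^bsub>slice C E\<^esub> w = h \<and> (a \<cdot> p, q, b) \<cdot>\<^bsub>slice C E\<^esub> w = k"
        then obtain w' where w': "w = (Z, w', a \<cdot> p)" "w' \<in> Ar C" "Dom C w' = Dom C Z" "Cod C w' = Dom C p"
          using f' pq by (auto simp: hom_slice_iff)
        have "w' = u"
          by (rule pullback_eq[OF pb f'(3) g'(3)]) (use w w' u h k in auto)
        then show "w = (Z, u, a \<cdot> p)"
          using w' by simp
      qed
    qed
    then show "\<exists>p q. is_pullback (slice C E) f g p q"
      by blast
  next
    fix X U assume X: "X \<in> Ob (slice C E)" and U: "U \<subseteq> {u \<in> Ar (slice C E). Cod (slice C E) u = X}"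
    then have x: "X \<in> Ar C" "Cod C X = E"
      by auto
    have U': "u = (X \<cdot> slice_ar u, slice_ar u, X) \<and> slice_ar u \<in> Ar C \<and>
        Cod C (slice_ar u) = Dom C X" if "u \<in> U" for u
      using U that by (cases u) auto
    have sU: "slice_ar ` U \<subseteq> {u \<in> Ar C. Cod C u = Dom C X}"
      using U' by blast
    obtain k where k: "k \<in> subs C (Dom C X)" "\<And>g. g \<in> Ar C \<Longrightarrow> Cod C g = Dom C X \<Longrightarrow>
        factors C g k \<longleftrightarrow> covers C (Dom C g) (pulled C (slice_ar ` U) g)"
      using ex_union[OF Dom_Ob[OF x(1)] sU] by blast
    have kA: "k \<in> Ar C" "Cod C k = Dom C X"
      using subsD[OF k(1)] by auto
    have "factors (slice C E) g (X \<cdot> k, k, X) \<longleftrightarrow> covers (slice C E) (Dom (slice C E) g)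
        (pulled (slice C E) U g)"
      if g: "g \<in> Ar (slice C E)" "Cod (slice C E) g = X" for g
    proof -
      obtain z g' where g': "g = (z, g', X)" "g' \<in> Ar C" "Cod C g' = Dom C X" "z \<in> Ar C" "Cod C z = E"
        "Dom C g' = Dom C z" "X \<cdot> g' = z"
        using g by (cases g) auto
      have fu: "factors (slice C E) (z \<cdot> a, g' \<cdot> a, X) u \<longleftrightarrow> factors C (g' \<cdot> a) (slice_ar u)"
        if "a \<in> Ar C" "Cod C a = Dom C z" "u \<in> U" for a u
      proof -
        have "factors (slice C E) (z \<cdot> a, g' \<cdot> a, X) (X \<cdot> slice_ar u, slice_ar u, X) \<longleftrightarrow>
            factors C (g' \<cdot> a) (slice_ar u)"
        proof (rule slice_factors_iff)
          have "(X \<cdot> g') \<cdot> a = X \<cdot> (g' \<cdot> a)"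
            by (rule assoc) (use that g' x in simp_all)
          then show "(z \<cdot> a, g' \<cdot> a, X) \<in> Ar (slice C E)"
            unfolding g'(7) using that g'(2-6) x by simp
          show "(X \<cdot> slice_ar u, slice_ar u, X) \<in> Ar (slice C E)"
            using conjunct2[OF U'[OF that(3)]] x by simp
        qed
        then show ?thesis
          using U'[OF that(3)] by simp
      qed
      have "pulled (slice C E) U g = (\<lambda>a. (z \<cdot> a, a, z)) ` pulled C (slice_ar ` U) g'"
      proof (rule equalityI; rule subsetI)
        fix b assume b: "b \<in> pulled (slice C E) U g"
        then obtain a where a: "b = (z \<cdot> a, a, z)" "a \<in> Ar C" "Cod C a = Dom C z"
          using g' by (cases b) (auto simp: pulled_def)
        then show "b \<in> (\<lambda>a. (z \<cdot> a, a, z)) ` pulled C (slice_ar ` U) g'"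
          using b fu[OF a(2,3)] g' by (auto simp: pulled_def)
      next
        fix b assume "b \<in> (\<lambda>a. (z \<cdot> a, a, z)) ` pulled C (slice_ar ` U) g'"
        then obtain a u where a: "b = (z \<cdot> a, a, z)" "a \<in> Ar C" "Cod C a = Dom C z"
            and u: "u \<in> U" "factors C (g' \<cdot> a) (slice_ar u)"
          using g'(6) by (auto simp: pulled_def)
        have "factors (slice C E) (g \<cdot>\<^bsub>slice C E\<^esub> b) u"
          using fu[OF a(2,3) u(1)] u(2) a(1) g'(1) by simp
        moreover have "b \<in> Ar (slice C E)" "Cod (slice C E) b = Dom (slice C E) g"
          using a g'(1,4,5) by simp_all
        ultimately show "b \<in> pulled (slice C E) U g"
          using u(1) by (auto simp: pulled_def)
      qed
      moreover have "factors (slice C E) g (X \<cdot> k, k, X) \<longleftrightarrow> factors C g' k"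
        unfolding g'(1) by (rule slice_factors_iff) (use g g' kA x in auto)
      moreover have "covers (slice C E) z ((\<lambda>a. (z \<cdot> a, a, z)) ` pulled C (slice_ar ` U) g') \<longleftrightarrow>
          covers C (Dom C z) (pulled C (slice_ar ` U) g')"
        by (rule slice_covers_iff) (use g' in \<open>auto simp: pulled_def\<close>)
      ultimately show ?thesis
        using k(2)[OF g'(2,3)] g' by simp
    qed
    moreover have "(X \<cdot> k, k, X) \<in> subs (slice C E) X"
      using slice_subs_iff[OF x] k(1) by simp
    ultimately show "\<exists>k\<in>subs (slice C E) X. \<forall>g\<in>Ar (slice C E). Cod (slice C E) g = X \<longrightarrow>
        factors (slice C E) g k = covers (slice C E) (Dom (slice C E) g) (pulled (slice C E) U g)"
      by blast
  qed
qed

section \<open>Pulling back to a slice\<close>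

text \<open>
  The two projections of the pullback of \<open>!\<^sub>E\<close> and \<open>!\<^sub>X\<close>, that is, of the product of E and X.  The
  first one is the object \<open>!\<^sub>E\<^sup>* X\<close> of the slice over E.
\<close>

definition base_prj :: "('o, 'a) cat \<Rightarrow> 'o \<Rightarrow> 'o \<Rightarrow> 'a"
  where "base_prj C E X = fst (pb C (bang C E) (bang C X))"

definition fibre_prj :: "('o, 'a) cat \<Rightarrow> 'o \<Rightarrow> 'o \<Rightarrow> 'a"
  where "fibre_prj C E X = snd (pb C (bang C E) (bang C X))"

definition pairing :: "('o, 'a) cat \<Rightarrow> 'o \<Rightarrow> 'o \<Rightarrow> 'a \<Rightarrow> 'a \<Rightarrow> 'a"
  where "pairing C E X t a = (THE u. u \<in> hom C (Dom C t) (Dom C (base_prj C E X)) \<and>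
    base_prj C E X \<cdot>\<^bsub>C\<^esub> u = t \<and> fibre_prj C E X \<cdot>\<^bsub>C\<^esub> u = a)"

text \<open>
  The generalized element of \<open>!\<^sub>E\<^sup>* X\<close> at the stage t that corresponds to \<open>a : T \<rightarrow> X\<close>, where T is the
  domain of t.  This is transposition for the adjunction between the domain functor and \<open>!\<^sub>E\<^sup>*\<close>.
\<close>

definition slice_el :: "('o, 'a) cat \<Rightarrow> 'o \<Rightarrow> 'o \<Rightarrow> 'a \<Rightarrow> 'a \<Rightarrow> 'a \<times> 'a \<times> 'a"
  where "slice_el C E X t a = (t, pairing C E X t a, base_prj C E X)"

definition slice_els :: "('o, 'a) cat \<Rightarrow> 'o \<Rightarrow> 'o list \<Rightarrow> 'a \<Rightarrow> 'a list \<Rightarrow> ('a \<times> 'a \<times> 'a) list"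
  where "slice_els C E Xs t as = map2 (\<lambda>X a. slice_el C E X t a) Xs as"

lemma slice_els_Nil [simp]: "slice_els C E [] t as = []"
  by (simp add: slice_els_def)

lemma slice_els_Cons [simp]: "slice_els C E (X # Xs) t (a # as) =
    slice_el C E X t a # slice_els C E Xs t as"
  by (simp add: slice_els_def)

lemma slice_els_nth: "i < length Xs \<Longrightarrow> length as = length Xs \<Longrightarrow>
    slice_els C E Xs t as ! i = slice_el C E (Xs ! i) t (as ! i)"
  by (simp add: slice_els_def)

context geometric_category
begin

lemma bang:
  assumes "X \<in> Ob C"
  shows "bang C X \<in> hom C X (one C)" "f \<in> hom C X (one C) \<Longrightarrow> f = bang C X"
proof -
  have "is_terminal C (one C)"
    unfolding one_def by (rule someI_ex[OF ex_terminal])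
  then have ex1: "\<exists>!f. f \<in> hom C X (one C)"
    using assms by (simp add: is_terminal_def)
  from theI'[OF ex1] show b: "bang C X \<in> hom C X (one C)"
    by (simp add: bang_def)
  show "f = bang C X" if "f \<in> hom C X (one C)"
    using ex1 b that by blast
qed

end

locale over_object = geometric_category C for C :: "('o, 'a) cat" (structure) +
  fixes E :: 'o
  assumes E: "E \<in> Ob C"
begin

abbreviation \<S> where "\<S> \<equiv> slice C E"
abbreviation pull where "pull \<equiv> bang_pb C E"
abbreviation \<pi> where "\<pi> \<equiv> base_prj C E"
abbreviation \<epsilon> where "\<epsilon> \<equiv> fibre_prj C E"
abbreviation pair where "pair \<equiv> pairing C E"
abbreviation lift where "lift \<equiv> slice_el C E"
abbreviation lifts where "lifts \<equiv> slice_els C E"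

sublocale S: geometric_category \<S>
  by (rule slice_geometric_category[OF E])

lemma base_prj_pullback:
  assumes "X \<in> Ob C"
  shows "is_pullback C (bang C E) (bang C X) (\<pi> X) (\<epsilon> X)"
  unfolding base_prj_def fibre_prj_def
  by (rule pb_is_pullback) (use bang(1)[OF assms] bang(1)[OF E] in \<open>auto simp: hom_iff\<close>)

lemma base_prj [simp]:
  assumes "X \<in> Ob C"
  shows "\<pi> X \<in> Ar C" "Cod C (\<pi> X) = E" "\<epsilon> X \<in> Ar C"
    "Dom C (\<epsilon> X) = Dom C (\<pi> X)" "Cod C (\<epsilon> X) = X"
  using pullbackD[OF base_prj_pullback[OF assms]] bang(1)[OF assms] bang(1)[OF E] by (auto simp: hom_iff)

lemma base_prj_eqI:
  assumes "X \<in> Ob C" "u \<in> Ar C" "v \<in> Ar C" "Dom C u = Dom C v" "Cod C u = Dom C (\<pi> X)"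
    "Cod C v = Dom C (\<pi> X)" "\<pi> X \<cdot> u = \<pi> X \<cdot> v" "\<epsilon> X \<cdot> u = \<epsilon> X \<cdot> v"
  shows "u = v"
  by (rule pullback_eq[OF base_prj_pullback[OF assms(1)]])
    (use bang(1)[OF assms(1)] bang(1)[OF E] assms in \<open>auto simp: hom_iff\<close>)

lemma pairing:
  assumes X: "X \<in> Ob C" and t: "t \<in> Ar C" "Cod C t = E" and a: "a \<in> Ar C" "Dom C a = Dom C t" "Cod C a = X"
  shows "pair X t a \<in> Ar C" "Dom C (pair X t a) = Dom C t" "Cod C (pair X t a) = Dom C (\<pi> X)"
    "\<pi> X \<cdot> pair X t a = t" "\<epsilon> X \<cdot> pair X t a = a"
proof -
  note bs = bang(1)[OF X, unfolded hom_iff] bang(1)[OF E, unfolded hom_iff]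
  have "bang C E \<cdot> t = bang C X \<cdot> a"
    using bang(2)[OF Dom_Ob[OF t(1)], of "bang C E \<cdot> t"] bang(2)[OF Dom_Ob[OF t(1)], of "bang C X \<cdot> a"]
      t a bs by (simp add: hom_iff)
  then obtain u where u: "u \<in> Ar C" "Dom C u = Dom C t" "Cod C u = Dom C (\<pi> X)"
    "\<pi> X \<cdot> u = t" "\<epsilon> X \<cdot> u = a"
    using pullback_lift[OF base_prj_pullback[OF X], of t a] t a bs by auto
  have "\<exists>!u. u \<in> hom C (Dom C t) (Dom C (\<pi> X)) \<and> \<pi> X \<cdot> u = t \<and> \<epsilon> X \<cdot> u = a"
    by (rule ex1I[of _ u]) (use u in \<open>auto simp: hom_iff intro!: base_prj_eqI[OF X]\<close>)
  from theI'[OF this] show "pair X t a \<in> Ar C" "Dom C (pair X t a) = Dom C t"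
    "Cod C (pair X t a) = Dom C (\<pi> X)" "\<pi> X \<cdot> pair X t a = t" "\<epsilon> X \<cdot> pair X t a = a"
    unfolding pairing_def[symmetric] by (auto simp: hom_iff)
qed

lemma pairing_unique:
  assumes X: "X \<in> Ob C" and u: "u \<in> Ar C" "Cod C u = Dom C (\<pi> X)"
  shows "pair X (\<pi> X \<cdot> u) (\<epsilon> X \<cdot> u) = u"
proof -
  note p = pairing[OF X, of "\<pi> X \<cdot> u" "\<epsilon> X \<cdot> u"]
  show ?thesis
    by (rule base_prj_eqI[OF X]) (use p u X in auto)
qed

lemma pairing_Cmp:
  assumes X: "X \<in> Ob C" and t: "t \<in> Ar C" "Cod C t = E" and a: "a \<in> Ar C" "Dom C a = Dom C t" "Cod C a = X"
    and s: "s \<in> Ar C" "Cod C s = Dom C t"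
  shows "pair X t a \<cdot> s = pair X (t \<cdot> s) (a \<cdot> s)"
proof -
  note p = pairing[OF X t a]
  have "\<pi> X \<cdot> (pair X t a \<cdot> s) = t \<cdot> s" "\<epsilon> X \<cdot> (pair X t a \<cdot> s) = a \<cdot> s"
    using assoc[of s "pair X t a" "\<pi> X"] assoc[of s "pair X t a" "\<epsilon> X"] p s X by auto
  then show ?thesis
    using pairing_unique[OF X, of "pair X t a \<cdot> s"] p s by simp
qed

lemma FOb_bang: "FOb pull X = \<pi> X"
  by (simp add: bang_pb_def pb_functor_def base_prj_def)

lemma FAr_bang:
  assumes g: "g \<in> hom C X Y"
  shows "FAr pull g = (\<pi> X, pair Y (\<pi> X) (g \<cdot> \<epsilon> X), \<pi> Y)"
proof -
  have "(THE u. u \<in> hom C (Dom C (\<pi> X)) (Dom C (\<pi> Y)) \<and>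
      \<pi> Y \<cdot> u = \<pi> X \<and> \<epsilon> Y \<cdot> u = g \<cdot> \<epsilon> X) = pair Y (\<pi> X) (g \<cdot> \<epsilon> X)"
    by (simp add: pairing_def)
  then show ?thesis
    using g by (simp add: bang_pb_def pb_functor_def base_prj_def fibre_prj_def hom_iff)
qed

lemma slice_el_hom:
  assumes X: "X \<in> Ob C" and t: "t \<in> Ar C" "Cod C t = E" and a: "a \<in> hom C (Dom C t) X"
  shows "lift X t a \<in> hom \<S> t (\<pi> X)"
proof -
  have a': "a \<in> Ar C" "Dom C a = Dom C t" "Cod C a = X"
    using a by (auto simp: hom_iff)
  show ?thesis
    using pairing[OF X t a'] t X by (simp add: hom_slice_iff slice_el_def)
qed

lemma slice_el_surj:
  assumes X: "X \<in> Ob C" and y: "y \<in> hom \<S> t (\<pi> X)"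
  obtains a where "a \<in> hom C (Dom C t) X" "y = lift X t a"
proof -
  obtain u where u: "y = (t, u, \<pi> X)" "u \<in> Ar C" "Dom C u = Dom C t" "Cod C u = Dom C (\<pi> X)"
    "\<pi> X \<cdot> u = t"
    using y by (auto simp: hom_slice_iff)
  show thesis
    by (rule that[of "\<epsilon> X \<cdot> u"]) (use u pairing_unique[OF X u(2,4)] X in \<open>auto simp: hom_iff slice_el_def\<close>)
qed

lemma slice_el_inject:
  assumes X: "X \<in> Ob C" and t: "t \<in> Ar C" "Cod C t = E"
      and a: "a \<in> hom C (Dom C t) X" "b \<in> hom C (Dom C t) X"
    and eq: "lift X t a = lift X t b"
  shows "a = b"
proof -
  have sec: "\<epsilon> X \<cdot> pair X t c = c" if "c \<in> hom C (Dom C t) X" for c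
    by (rule pairing(5)[OF X t]) (use that in \<open>simp_all add: hom_iff\<close>)
  have "a = \<epsilon> X \<cdot> pair X t a"
    by (rule sec[OF a(1), symmetric])
  also have "pair X t a = pair X t b"
    using eq by (simp add: slice_el_def)
  also have "\<epsilon> X \<cdot> pair X t b = b"
    by (rule sec[OF a(2)])
  finally show ?thesis .
qed

lemma slice_el_Cmp:
  assumes X: "X \<in> Ob C" and t: "t \<in> Ar C" "Cod C t = E" and a: "a \<in> hom C (Dom C t) X"
    and s: "s \<in> Ar C" "Cod C s = Dom C t" and r: "r = t \<cdot> s"
  shows "lift X t a \<cdot>\<^bsub>\<S>\<^esub> (r, s, t) = lift X r (a \<cdot> s)"
  using pairing_Cmp[OF X t _ _ _ s, of a] a r by (auto simp: hom_iff slice_el_def)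

lemma FAr_slice_el:
  assumes g: "g \<in> hom C X Y" and t: "t \<in> Ar C" "Cod C t = E" and a: "a \<in> hom C (Dom C t) X"
  shows "FAr pull g \<cdot>\<^bsub>\<S>\<^esub> lift X t a = lift Y t (g \<cdot> a)"
proof -
  have XY: "X \<in> Ob C" "Y \<in> Ob C"
    using hom_Ob[OF g] by auto
  have a': "a \<in> Ar C" "Dom C a = Dom C t" "Cod C a = X" and g': "g \<in> Ar C" "Dom C g = X" "Cod C g = Y"
    using a g by (auto simp: hom_iff)
  note p = pairing[OF XY(1) t a']
  have "(g \<cdot> \<epsilon> X) \<cdot> pair X t a = g \<cdot> a"
    using p g' XY by simp
  then show ?thesis
    using pairing_Cmp[OF XY(2), of "\<pi> X" "g \<cdot> \<epsilon> X" "pair X t a"] p g' XY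
    by (simp add: FAr_bang[OF g] slice_el_def)
qed

lemma FAr_hom:
  assumes g: "g \<in> hom C X Y"
  shows "FAr pull g \<in> hom \<S> (\<pi> X) (\<pi> Y)"
  using slice_el_hom[of Y "\<pi> X" "g \<cdot> \<epsilon> X"] hom_Ob[OF g] g
  by (simp add: FAr_bang[OF g] slice_el_def hom_iff[of g] hom_iff[of "g \<cdot> \<epsilon> X"])

lemma els_slice_els:
  assumes "els C (Dom C t) Xs as" "t \<in> Ar C" "Cod C t = E"
  shows "els \<S> t (map \<pi> Xs) (lifts Xs t as)"
  using assms
proof (induction Xs arbitrary: as)
  case (Cons X Xs)
  then obtain y ys where y: "as = y # ys" "y \<in> hom C (Dom C t) X" "els C (Dom C t) Xs ys"
    by (auto simp: els_Cons)
  then show ?case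
    using slice_el_hom[OF hom_Ob(2)[OF y(2)] Cons.prems(2,3) y(2)] Cons.IH[OF y(3) Cons.prems(2,3)]
    by (simp add: S.els_Cons)
qed simp

lemma els_slice_els_surj:
  assumes "set Xs \<subseteq> Ob C" "els \<S> t (map \<pi> Xs) ys"
  obtains as where "els C (Dom C t) Xs as" "ys = lifts Xs t as"
proof -
  have "\<exists>as. els C (Dom C t) Xs as \<and> ys = lifts Xs t as"
    using assms
  proof (induction Xs arbitrary: ys)
    case Nil
    then show ?case
      using Dom_Ob by simp
  next
    case (Cons X Xs)
    then obtain y zs where ys: "ys = y # zs" "y \<in> hom \<S> t (\<pi> X)"
      "els \<S> t (map \<pi> Xs) zs"
      by (auto simp: S.els_Cons)
    obtain a where a: "a \<in> hom C (Dom C t) X" "y = lift X t a"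
      using slice_el_surj[OF _ ys(2)] Cons.prems(1) by auto
    obtain as where "els C (Dom C t) Xs as" "zs = lifts Xs t as"
      using Cons.IH[OF _ ys(3)] Cons.prems(1) by auto
    then show ?case
      using a ys(1) by (auto simp: els_Cons intro!: exI[of _ "a # as"])
  qed
  then show thesis
    using that by blast
qed

lemma slice_els_inject:
  assumes "set Xs \<subseteq> Ob C" "els C (Dom C t) Xs as" "els C (Dom C t) Xs bs" "t \<in> Ar C" "Cod C t = E"
    "lifts Xs t as = lifts Xs t bs"
  shows "as = bs"
  using assms
proof (induction Xs arbitrary: as bs)
  case (Cons X Xs)
  then show ?case
    using slice_el_inject[of X t] by (auto simp: els_Cons)
qed simp

lemma slice_els_Cmp:
  assumes "set Xs \<subseteq> Ob C" "els C (Dom C t) Xs as" "t \<in> Ar C" "Cod C t = E" "s \<in> Ar C" "Cod C s =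
      Dom C t" "r = t \<cdot> s"
  shows "map (\<lambda>y. y \<cdot>\<^bsub>\<S>\<^esub> (r, s, t)) (lifts Xs t as) = lifts Xs r (map (\<lambda>a. a \<cdot> s) as)"
  using assms
proof (induction Xs arbitrary: as)
  case (Cons X Xs)
  then show ?case
    using slice_el_Cmp[of X t] by (auto simp: els_Cons)
qed simp

subsection \<open>The comparison with products in the slice\<close>

abbreviation cmp :: "'o list \<Rightarrow> 'a \<times> 'a \<times> 'a"
  where "cmp As \<equiv> prod_comparison C \<S> pull As"

lemma FOb_bang_fun: "FOb pull = \<pi>"
  using FOb_bang by blast

lemma cmp_els:
  assumes As: "set As \<subseteq> Ob C"
  shows "els \<S> (\<pi> (prod_ob C As)) (map \<pi> As) (map (FAr pull) (prjs C As))"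
proof -
  have "list_all2 (\<lambda>x A. FAr pull x \<in> hom \<S> (\<pi> (prod_ob C As)) (\<pi> A)) (prjs C As) As"
    using prjs_els[OF As] FAr_hom by (auto simp: els_def elim: list_all2_mono)
  then show ?thesis
    using base_prj As by (simp add: els_def list.rel_map)
qed

lemma cmp_hom:
  assumes As: "set As \<subseteq> Ob C"
  shows "cmp As \<in> hom \<S> (\<pi> (prod_ob C As)) (prod_ob \<S> (map \<pi> As))"
  unfolding prod_comparison_def FOb_bang_fun by (rule S.tuple(1)[OF cmp_els[OF As]])

text \<open>
  On generalized elements the comparison arrow rearranges the transpose of a tuple into the tuple of
  the transposes.
\<close>

lemma cmp_slice_el:
  assumes t: "t \<in> Ar C" "Cod C t = E" and as: "els C (Dom C t) As as"
  shows "cmp As \<cdot>\<^bsub>\<S>\<^esub> lift (prod_ob C As) t (tuple C (Dom C t) As as) =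
    tuple \<S> t (map \<pi> As) (lifts As t as)"
proof -
  note As = els_set[OF as]
  let ?u = "tuple C (Dom C t) As as"
  note u = tuple(1)[OF as]
  have uh: "lift (prod_ob C As) t ?u \<in> hom \<S> t (\<pi> (prod_ob C As))"
    by (rule slice_el_hom[OF prod_ob_Ob[OF As] t u])
  have "map (\<lambda>x. x \<cdot>\<^bsub>\<S>\<^esub> lift (prod_ob C As) t ?u) (map (FAr pull) (prjs C As)) = lifts As t as"
  proof (rule nth_equalityI)
    note ps = prjs_els[OF As]
    show "length (map (\<lambda>x. x \<cdot>\<^bsub>\<S>\<^esub> lift (prod_ob C As) t ?u) (map (FAr pull) (prjs C As))) =
        length (lifts As t as)"
      using els_length[OF ps] els_length[OF as] by (simp add: slice_els_def)
    fix i assume "i < length (map (\<lambda>x. x \<cdot>\<^bsub>\<S>\<^esub> lift (prod_ob C As) t ?u) (map (FAr pull) (prjs C As)))"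
    then have i: "i < length As"
      using els_length[OF ps] by simp
    show "map (\<lambda>x. x \<cdot>\<^bsub>\<S>\<^esub> lift (prod_ob C As) t ?u) (map (FAr pull) (prjs C As)) ! i = lifts As t as ! i"
      using FAr_slice_el[OF els_nth[OF ps i] t u] prjs_nth_tuple[OF as i] i els_length[OF ps]
          els_length[OF as]
      by (simp add: slice_els_nth)
  qed
  then show ?thesis
    using S.tuple_Cmp[OF cmp_els[OF As] uh] by (simp add: prod_comparison_def FOb_bang_fun)
qed

lemma cmp_inject:
  assumes As: "set As \<subseteq> Ob C" and t: "t \<in> Ar C" "Cod C t = E"
    and u: "u \<in> hom C (Dom C t) (prod_ob C As)" "v \<in> hom C (Dom C t) (prod_ob C As)"
    and eq: "cmp As \<cdot>\<^bsub>\<S>\<^esub> lift (prod_ob C As) t u = cmp As \<cdot>\<^bsub>\<S>\<^esub> lift (prod_ob C As) t v"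
  shows "u = v"
proof -
  obtain as where as: "els C (Dom C t) As as" "tuple C (Dom C t) As as = u"
    using tuple_prjs[OF As u(1)] by blast
  obtain bs where bs: "els C (Dom C t) As bs" "tuple C (Dom C t) As bs = v"
    using tuple_prjs[OF As u(2)] by blast
  have "lifts As t as = lifts As t bs"
    using S.tuple_inject[OF els_slice_els[OF as(1) t] els_slice_els[OF bs(1) t]] cmp_slice_el[OF t
        as(1)] cmp_slice_el[OF t bs(1)] eq as bs
    by simp
  then have "as = bs"
    by (rule slice_els_inject[OF As as(1) bs(1) t])
  then show ?thesis
    using as bs by simp
qed

text \<open>
  The projections of the product of the \<open>!\<^sub>E\<^sup>* A\<^sub>i\<close> are transposes of arrows into the \<open>A\<^sub>i\<close>.  The transpose
  of the tuple of these arrows is inverse to the comparison.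
\<close>

lemma cmp_inverse:
  assumes As: "set As \<subseteq> Ob C"
  shows "is_inverse \<S> (cmp As) (inv_ar \<S> (cmp As))"
proof -
  let ?P = "prod_ob \<S> (map \<pi> As)" and ?Q = "prod_ob C As"
  have Q: "?Q \<in> Ob C"
    using As by simp
  have Ls: "set (map \<pi> As) \<subseteq> Ob \<S>"
    using As by auto
  note ps = S.prjs_els[OF Ls]
  have P: "?P \<in> Ar C" "Cod C ?P = E"
    using S.els_Ob[OF ps] by auto
  obtain as where as: "els C (Dom C ?P) As as" "prjs \<S> (map \<pi> As) = lifts As ?P as"
    using els_slice_els_surj[OF As ps] .
  define l where "l = lift ?Q ?P (tuple C (Dom C ?P) As as)"
  have l: "l \<in> hom \<S> ?P (\<pi> ?Q)"
    unfolding l_def by (rule slice_el_hom[OF Q P tuple(1)[OF as(1)]])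
  note c = cmp_hom[OF As]
  have "cmp As \<cdot>\<^bsub>\<S>\<^esub> l = tuple \<S> ?P (map \<pi> As) (prjs \<S> (map \<pi> As))"
    unfolding l_def as(2) by (rule cmp_slice_el[OF P as(1)])
  also have "\<dots> = Id \<S> ?P"
    by (rule S.tuple_eqI[OF ps S.Id_hom[OF S.els_Ob[OF ps]]]) (use S.els_in[OF ps] in \<open>auto intro: map_idI\<close>)
  finally have cl: "cmp As \<cdot>\<^bsub>\<S>\<^esub> l = Id \<S> ?P" .
  have b: "\<pi> ?Q \<in> Ar C" "Cod C (\<pi> ?Q) = E"
    using Q by auto
  have lc: "l \<cdot>\<^bsub>\<S>\<^esub> cmp As \<in> hom \<S> (\<pi> ?Q) (\<pi> ?Q)"
    using S.Cmp_hom[OF c l] .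
  have id: "Id \<S> (\<pi> ?Q) \<in> hom \<S> (\<pi> ?Q) (\<pi> ?Q)"
    by (rule S.Id_hom) (use b in simp)
  obtain u where u: "u \<in> hom C (Dom C (\<pi> ?Q)) ?Q" "l \<cdot>\<^bsub>\<S>\<^esub> cmp As = lift ?Q (\<pi> ?Q) u"
    using slice_el_surj[OF Q lc] .
  obtain v where v: "v \<in> hom C (Dom C (\<pi> ?Q)) ?Q" "Id \<S> (\<pi> ?Q) = lift ?Q (\<pi> ?Q) v"
    using slice_el_surj[OF Q id] .
  \<comment> \<open>The other composite is the identity because the comparison is injective on elements.\<close>
  have "cmp As \<cdot>\<^bsub>\<S>\<^esub> (l \<cdot>\<^bsub>\<S>\<^esub> cmp As) = (cmp As \<cdot>\<^bsub>\<S>\<^esub> l) \<cdot>\<^bsub>\<S>\<^esub> cmp As"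
    by (rule S.Cmp_assoc[OF c l c, symmetric])
  also have "\<dots> = cmp As \<cdot>\<^bsub>\<S>\<^esub> Id \<S> (\<pi> ?Q)"
    unfolding cl S.Cmp_Id_left[OF c] S.Cmp_Id_right[OF c] ..
  finally have "u = v"
    unfolding u(2) v(2) by (rule cmp_inject[OF As b u(1) v(1)])
  then have "l \<cdot>\<^bsub>\<S>\<^esub> cmp As = Id \<S> (\<pi> ?Q)"
    using u v by simp
  then have "is_inverse \<S> (cmp As) l"
    using cl c l unfolding is_inverse_def hom_iff by simp
  then show ?thesis
    using S.inv_ar_eq by metis
qed

lemma inv_cmp_tuple:
  assumes t: "t \<in> Ar C" "Cod C t = E" and as: "els C (Dom C t) As as"
  shows "inv_ar \<S> (cmp As) \<cdot>\<^bsub>\<S>\<^esub> tuple \<S> t (map \<pi> As) (lifts As t as) =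
    lift (prod_ob C As) t (tuple C (Dom C t) As as)"
proof -
  note As = els_set[OF as]
  let ?i = "inv_ar \<S> (cmp As)" and ?u = "lift (prod_ob C As) t (tuple C (Dom C t) As as)"
  note c = cmp_hom[OF As]
  have i: "?i \<in> hom \<S> (prod_ob \<S> (map \<pi> As)) (\<pi> (prod_ob C As))"
    "?i \<cdot>\<^bsub>\<S>\<^esub> cmp As = Id \<S> (\<pi> (prod_ob C As))"
    using cmp_inverse[OF As] c unfolding is_inverse_def hom_iff by auto
  have u: "?u \<in> hom \<S> t (\<pi> (prod_ob C As))"
    by (rule slice_el_hom[OF prod_ob_Ob[OF As] t tuple(1)[OF as]])
  have "?i \<cdot>\<^bsub>\<S>\<^esub> (cmp As \<cdot>\<^bsub>\<S>\<^esub> ?u) = (?i \<cdot>\<^bsub>\<S>\<^esub> cmp As) \<cdot>\<^bsub>\<S>\<^esub> ?u"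
    by (rule S.Cmp_assoc[OF u c i(1), symmetric])
  then show ?thesis
    unfolding cmp_slice_el[OF t as] i(2) S.Cmp_Id_left[OF u] .
qed

end

section \<open>The pulled back structure\<close>

locale pulled_structure = over_object C E + structure_in C \<Sigma> M
  for C :: "('o, 'a) cat" (structure) and E :: 'o
    and \<Sigma> :: "('s, 'f, 'r) signature" and M :: "('s, 'f, 'r, 'o, 'a) struct"
begin

abbreviation BM :: "('s, 'f, 'r, 'a, 'a \<times> 'a \<times> 'a) struct"
  where "BM \<equiv> bang_struct \<Sigma> C E M"

lemma SortI_BM: "SortI BM A = \<pi> (SortI M A)"
  by (simp add: bang_struct_def map_struct_def FOb_bang)

lemma ctx_BM: "map (SortI BM) \<Gamma> = map \<pi> (ctx \<Gamma>)"
  by (simp add: SortI_BM)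

lemma FunI_BM:
  assumes f: "f \<in> Funs \<Sigma>"
  shows "FunI BM f \<in> hom \<S> (prod_ob \<S> (map \<pi> (ctx (FDom \<Sigma> f)))) (\<pi> (SortI M (FCod \<Sigma> f)))"
    and "t \<in> Ar C \<Longrightarrow> Cod C t = E \<Longrightarrow> els C (Dom C t) (ctx (FDom \<Sigma> f)) as \<Longrightarrow>
      FunI BM f \<cdot>\<^bsub>\<S>\<^esub> tuple \<S> t (map \<pi> (ctx (FDom \<Sigma> f))) (lifts (ctx (FDom \<Sigma> f)) t as) =
      lift (SortI M (FCod \<Sigma> f)) t (FunI M f \<cdot> tuple C (Dom C t) (ctx (FDom \<Sigma> f)) as)"
proof -
  note As = ctx_Ob[OF FDom_sorts[OF f]]
  let ?i = "inv_ar \<S> (cmp (ctx (FDom \<Sigma> f)))"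
  have F: "FunI BM f = FAr pull (FunI M f) \<cdot>\<^bsub>\<S>\<^esub> ?i"
    by (simp add: bang_struct_def map_struct_def)
  have i: "?i \<in> hom \<S> (prod_ob \<S> (map \<pi> (ctx (FDom \<Sigma> f)))) (\<pi> (prod_ob C (ctx (FDom \<Sigma> f))))"
    using cmp_inverse[OF As] cmp_hom[OF As] unfolding is_inverse_def hom_iff by auto
  note L = FAr_hom[OF FunI_hom[OF f]]
  show "FunI BM f \<in> hom \<S> (prod_ob \<S> (map \<pi> (ctx (FDom \<Sigma> f)))) (\<pi> (SortI M (FCod \<Sigma> f)))"
    unfolding F by (rule S.Cmp_hom[OF i L])
  assume t: "t \<in> Ar C" "Cod C t = E" and as: "els C (Dom C t) (ctx (FDom \<Sigma> f)) as"
  note tu = S.tuple(1)[OF els_slice_els[OF as t]]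
  show "FunI BM f \<cdot>\<^bsub>\<S>\<^esub> tuple \<S> t (map \<pi> (ctx (FDom \<Sigma> f))) (lifts (ctx (FDom \<Sigma> f)) t as) =
      lift (SortI M (FCod \<Sigma> f)) t (FunI M f \<cdot> tuple C (Dom C t) (ctx (FDom \<Sigma> f)) as)"
    unfolding F S.Cmp_assoc[OF tu i L] inv_cmp_tuple[OF t as]
    by (rule FAr_slice_el[OF FunI_hom[OF f] t tuple(1)[OF as]])
qed

lemma RelI_BM:
  assumes R: "R \<in> Rels \<Sigma>"
  shows "RelI BM R \<in> subs \<S> (prod_ob \<S> (map \<pi> (ctx (RAr \<Sigma> R))))"
    and "t \<in> Ar C \<Longrightarrow> Cod C t = E \<Longrightarrow> els C (Dom C t) (ctx (RAr \<Sigma> R)) as \<Longrightarrow>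
      factors \<S> (tuple \<S> t (map \<pi> (ctx (RAr \<Sigma> R))) (lifts (ctx (RAr \<Sigma> R)) t as)) (RelI BM R) \<longleftrightarrow>
      factors C (tuple C (Dom C t) (ctx (RAr \<Sigma> R)) as) (RelI M R)"
proof -
  note As = ctx_Ob[OF RAr_sorts[OF R]]
  let ?As = "ctx (RAr \<Sigma> R)" and ?D = "Dom C (RelI M R)"
  note r = RelI_subs[OF R]
  have rh: "RelI M R \<in> hom C ?D (prod_ob C ?As)"
    using subsD[OF r] by (simp add: hom_iff)
  have D: "?D \<in> Ob C"
    using hom_Ob[OF rh] by simp
  have F: "RelI BM R = cmp ?As \<cdot>\<^bsub>\<S>\<^esub> FAr pull (RelI M R)"
    by (simp add: bang_struct_def map_struct_def)
  note L = FAr_hom[OF rh] and c = cmp_hom[OF As]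
  have Fh: "RelI BM R \<in> hom \<S> (\<pi> ?D) (prod_ob \<S> (map \<pi> ?As))"
    unfolding F by (rule S.Cmp_hom[OF L c])
  have Fup: "RelI BM R \<cdot>\<^bsub>\<S>\<^esub> lift ?D t k = cmp ?As \<cdot>\<^bsub>\<S>\<^esub> lift (prod_ob C ?As) t (RelI M R \<cdot> k)"
    if t: "t \<in> Ar C" "Cod C t = E" and k: "k \<in> hom C (Dom C t) ?D" for t k
    unfolding F S.Cmp_assoc[OF slice_el_hom[OF D t k] L c] FAr_slice_el[OF rh t k] ..
  show "RelI BM R \<in> subs \<S> (prod_ob \<S> (map \<pi> ?As))"
  proof (rule S.subsI)
    fix f g assume *: "f \<in> Ar \<S>" "g \<in> Ar \<S>" "Dom \<S> f = Dom \<S> g"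
      "Cod \<S> f = Dom \<S> (RelI BM R)" "Cod \<S> g = Dom \<S> (RelI BM R)"
      "RelI BM R \<cdot>\<^bsub>\<S>\<^esub> f = RelI BM R \<cdot>\<^bsub>\<S>\<^esub> g"
    define t where "t = Dom \<S> f"
    have t: "t \<in> Ar C" "Cod C t = E"
      using S.Dom_Ob[OF *(1)] by (auto simp: t_def)
    have f: "f \<in> hom \<S> t (\<pi> ?D)" and g: "g \<in> hom \<S> t (\<pi> ?D)"
      using * Fh by (auto simp: hom_iff t_def)
    obtain k where k: "k \<in> hom C (Dom C t) ?D" "f = lift ?D t k"
      using slice_el_surj[OF D f] .
    obtain l where l: "l \<in> hom C (Dom C t) ?D" "g = lift ?D t l"
      using slice_el_surj[OF D g] .
    have "RelI M R \<cdot> k = RelI M R \<cdot> l"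
      by (rule cmp_inject[OF As t Cmp_hom[OF k(1) rh] Cmp_hom[OF l(1) rh]])
        (use *(6) Fup[OF t k(1)] Fup[OF t l(1)] k l in simp)
    then have "k = l"
      by (rule subs_mono[OF r, rotated 5]) (use k l in \<open>auto simp: hom_iff\<close>)
    then show "f = g"
      using k l by simp
  qed (use Fh in \<open>auto simp: hom_iff\<close>)
  assume t: "t \<in> Ar C" "Cod C t = E" and as: "els C (Dom C t) ?As as"
  let ?tu = "tuple \<S> t (map \<pi> ?As) (lifts ?As t as)"
  note tu = S.tuple(1)[OF els_slice_els[OF as t]]
  show "factors \<S> ?tu (RelI BM R) \<longleftrightarrow> factors C (tuple C (Dom C t) ?As as) (RelI M R)"
  proof
    assume "factors \<S> ?tu (RelI BM R)"
    then obtain j where j: "j \<in> hom \<S> t (\<pi> ?D)" "RelI BM R \<cdot>\<^bsub>\<S>\<^esub> j = ?tu"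
      unfolding factors_def homD(2)[OF tu] homD(2)[OF Fh] by blast
    obtain k where k: "k \<in> hom C (Dom C t) ?D" "j = lift ?D t k"
      using slice_el_surj[OF D j(1)] .
    have "RelI M R \<cdot> k = tuple C (Dom C t) ?As as"
      by (rule cmp_inject[OF As t Cmp_hom[OF k(1) rh] tuple(1)[OF as]])
        (use j(2) Fup[OF t k(1)] k(2) cmp_slice_el[OF t as] in simp)
    then show "factors C (tuple C (Dom C t) ?As as) (RelI M R)"
      using factorsI[of k "RelI M R"] k(1) rh by (simp add: hom_iff)
  next
    assume "factors C (tuple C (Dom C t) ?As as) (RelI M R)"
    then obtain k where k: "k \<in> hom C (Dom C t) ?D" "RelI M R \<cdot> k = tuple C (Dom C t) ?As as"
      using tuple_Ar[OF as] by (auto simp: factors_def)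
    have "RelI BM R \<cdot>\<^bsub>\<S>\<^esub> lift ?D t k = ?tu"
      using Fup[OF t k(1)] cmp_slice_el[OF t as] k(2) by simp
    then show "factors \<S> ?tu (RelI BM R)"
      unfolding factors_def homD(2)[OF tu] homD(2)[OF Fh] using slice_el_hom[OF D t k(1)] by blast
  qed
qed

lemma is_struct_BM: "is_struct \<Sigma> \<S> BM"
  unfolding is_struct_def ctx_BM
proof (intro conjI ballI)
  show "SortI BM A \<in> Ob \<S>" if "A \<in> Sorts \<Sigma>" for A
    using SortI_Ob[OF that] by (simp add: SortI_BM)
  show "FunI BM f \<in> hom \<S> (prod_ob \<S> (map \<pi> (ctx (FDom \<Sigma> f)))) (SortI BM (FCod \<Sigma> f))"
    if "f \<in> Funs \<Sigma>" for f
    using FunI_BM(1)[OF that] by (simp only: SortI_BM)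
qed (rule RelI_BM(1))

sublocale B: structure_in "\<S>" \<Sigma> BM
  by unfold_locales (fact sig is_struct_BM)+

text \<open>
  By \<open>FunI_BM\<close> and \<open>RelI_BM\<close> the symbols act on transposes as they act on the elements transposed.
  This extends to terms and, by \<open>forces_BM\<close>, to formulas.
\<close>

lemma eval_tm_BM:
  assumes t: "t \<in> Ar C" "Cod C t = E" and as: "els C (Dom C t) (ctx \<Gamma>) as" and tm: "has_sort \<Sigma> \<Gamma> tm A"
  shows "eval_tm \<Sigma> \<S> BM t (lifts (ctx \<Gamma>) t as) tm = lift (SortI M A) t (eval_tm \<Sigma> C M (Dom C t) as tm)"
  using tm
proof (induction tm A rule: has_sort.induct)
  case (1 i)
  then show ?case
    using els_length[OF as] by (simp add: slice_els_nth)
next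
  case (2 f ts)
  have ts: "list_all2 (has_sort \<Sigma> \<Gamma>) ts (FDom \<Sigma> f)"
    using 2(2) by (auto elim: list_all2_mono)
  have m: "map (eval_tm \<Sigma> \<S> BM t (lifts (ctx \<Gamma>) t as)) ts =
      lifts (ctx (FDom \<Sigma> f)) t (map (eval_tm \<Sigma> C M (Dom C t) as) ts)"
    by (rule nth_equalityI) (use 2(2) in \<open>auto simp: list_all2_conv_all_nth slice_els_def\<close>)
  show ?case
    unfolding eval_tm.simps ctx_BM m by (rule FunI_BM(2)[OF 2(1) t eval_tm_els[OF as ts]])
qed

lemma eval_tms_BM:
  assumes t: "t \<in> Ar C" "Cod C t = E" and as: "els C (Dom C t) (ctx \<Gamma>) as"
      and ts: "list_all2 (has_sort \<Sigma> \<Gamma>) ts As"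
  shows "map (eval_tm \<Sigma> \<S> BM t (lifts (ctx \<Gamma>) t as)) ts =
      lifts (ctx As) t (map (eval_tm \<Sigma> C M (Dom C t) as) ts)"
proof (rule nth_equalityI)
  have len: "length ts = length As"
    using ts by (rule list_all2_lengthD)
  then show "length (map (eval_tm \<Sigma> \<S> BM t (lifts (ctx \<Gamma>) t as)) ts) =
      length (lifts (ctx As) t (map (eval_tm \<Sigma> C M (Dom C t) as) ts))"
    by (simp add: slice_els_def)
  fix i assume "i < length (map (eval_tm \<Sigma> \<S> BM t (lifts (ctx \<Gamma>) t as)) ts)"
  then have i: "i < length ts"
    by simp
  show "map (eval_tm \<Sigma> \<S> BM t (lifts (ctx \<Gamma>) t as)) ts ! i =
      lifts (ctx As) t (map (eval_tm \<Sigma> C M (Dom C t) as) ts) ! i"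
    using eval_tm_BM[OF t as list_all2_nthD[OF ts i]] i len by (simp add: slice_els_nth)
qed

lemma els_BM:
  assumes "els C (Dom C t) (ctx \<Gamma>) as" "t \<in> Ar C" "Cod C t = E"
  shows "els \<S> t (B.ctx \<Gamma>) (lifts (ctx \<Gamma>) t as)"
  unfolding ctx_BM by (rule els_slice_els[OF assms])

lemma slice_covers_eq:
  assumes t: "t \<in> Ar C" "Cod C t = E"
    and PQ: "\<And>a. a \<in> Ar C \<Longrightarrow> Cod C a = Dom C t \<Longrightarrow> P (t \<cdot> a, a, t) \<longleftrightarrow> Q a"
  shows "covers \<S> t {b \<in> Ar \<S>. Cod \<S> b = t \<and> P b} \<longleftrightarrow>
    covers C (Dom C t) {a \<in> Ar C. Cod C a = Dom C t \<and> Q a}"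
proof -
  have "{b \<in> Ar \<S>. Cod \<S> b = t \<and> P b} =
      (\<lambda>a. (t \<cdot> a, a, t)) ` {a \<in> Ar C. Cod C a = Dom C t \<and> Q a}"
  proof (rule equalityI; rule subsetI)
    fix b assume b: "b \<in> {b \<in> Ar \<S>. Cod \<S> b = t \<and> P b}"
    then obtain a where "b = (t \<cdot> a, a, t)" "a \<in> Ar C" "Cod C a = Dom C t"
      by (cases b) auto
    then show "b \<in> (\<lambda>a. (t \<cdot> a, a, t)) ` {a \<in> Ar C. Cod C a = Dom C t \<and> Q a}"
      using b PQ by blast
  next
    fix b assume "b \<in> (\<lambda>a. (t \<cdot> a, a, t)) ` {a \<in> Ar C. Cod C a = Dom C t \<and> Q a}"
    then obtain a where "b = (t \<cdot> a, a, t)" "a \<in> Ar C" "Cod C a = Dom C t" "Q a"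
      by blast
    then show "b \<in> {b \<in> Ar \<S>. Cod \<S> b = t \<and> P b}"
      using PQ t by simp
  qed
  then show ?thesis
    using slice_covers_iff[OF t, of "{a \<in> Ar C. Cod C a = Dom C t \<and> Q a}"] by simp
qed

text \<open>
  Elements of \<open>!\<^sub>E\<^sup>*(M)\<close> at the stage t are the transposes of elements of M at the domain of t, and
  this is compatible with change of stage.  So each clause of the forcing relation over E turns into
  the same clause for M; for disjunction and existence this uses \<open>slice_covers_eq\<close>.
\<close>

lemma forces_BM:
  assumes "geometric_fm \<Sigma> \<phi> \<Gamma>" "\<Gamma> \<in> lists (Sorts \<Sigma>)" "t \<in> Ar C" "Cod C t = E" "els C (Dom C t) (ctx \<Gamma>) as"
  shows "forces \<Sigma> \<S> BM \<Gamma> t (lifts (ctx \<Gamma>) t as) \<phi> \<longleftrightarrow> forces \<Sigma> C M \<Gamma> (Dom C t) as \<phi>"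
  using assms
proof (induction \<phi> arbitrary: \<Gamma> t as)
  case (Rel R ts)
  note t = Rel.prems(3,4) and as = Rel.prems(5)
  have R: "R \<in> Rels \<Sigma>" and ts: "list_all2 (has_sort \<Sigma> \<Gamma>) ts (RAr \<Sigma> R)"
    using Rel.prems(1) by auto
  show ?case
    unfolding forces_Rel[OF Rel.prems(1,2) as] B.forces_Rel[OF Rel.prems(1,2) els_BM[OF as t]]
      eval_tms_BM[OF t as ts] ctx_BM
    by (rule RelI_BM(2)[OF R t eval_tm_els[OF as ts]])
next
  case (Eq u v)
  note t = Eq.prems(3,4) and as = Eq.prems(5)
  obtain A where A: "has_sort \<Sigma> \<Gamma> u A" "has_sort \<Sigma> \<Gamma> v A"
    using Eq.prems(1) by auto
  have "SortI M A \<in> Ob C"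
    using hom_Ob eval_tm_hom[OF as A(1)] by blast
  then show ?case
    unfolding forces_Eq[OF Eq.prems(1,2) as] B.forces_Eq[OF Eq.prems(1,2) els_BM[OF as t]]
      eval_tm_BM[OF t as A(1)] eval_tm_BM[OF t as A(2)]
    using slice_el_inject[OF _ t eval_tm_hom[OF as A(1)] eval_tm_hom[OF as A(2)]] by auto
next
  case Top
  then show ?case
    using forces_Top B.forces_Top els_BM by blast
next
  case (And \<phi> \<psi>)
  then show ?case
    using forces_And[OF And.prems(1,2)] B.forces_And[OF And.prems(1,2)] by simp
next
  case (Disj I \<phi>s)
  note t = Disj.prems(3,4) and as = Disj.prems(5)
  have "forces \<Sigma> \<S> BM \<Gamma> (Dom \<S> (t \<cdot> a, a, t))
      (map (\<lambda>x. x \<cdot>\<^bsub>\<S>\<^esub> (t \<cdot> a, a, t)) (lifts (ctx \<Gamma>) t as)) (\<phi>s i) \<longleftrightarrow>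
      forces \<Sigma> C M \<Gamma> (Dom C a) (map (\<lambda>x. x \<cdot> a) as) (\<phi>s i)"
    if a: "a \<in> Ar C" "Cod C a = Dom C t" and i: "i \<in> I" for a i
  proof -
    have ah: "a \<in> hom C (Dom C a) (Dom C t)"
      using a by (simp add: hom_iff)
    have "geometric_fm \<Sigma> (\<phi>s i) \<Gamma>"
      using Disj.prems(1) i by simp
    then show ?thesis
      unfolding slice_els_Cmp[OF els_set[OF as] as t a refl]
      using Disj.IH[of "\<phi>s i" \<Gamma> "t \<cdot> a" "map (\<lambda>x. x \<cdot> a) as"] Disj.prems(2) els_Cmp[OF as ah] a t by simp
  qed
  then show ?case
    unfolding forces_Disj[OF Disj.prems(1,2) as] B.forces_Disj[OF Disj.prems(1,2) els_BM[OF as t]]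
    by (intro slice_covers_eq[OF t]) (auto cong: bex_cong)
next
  case (Ex A \<phi>)
  note t = Ex.prems(3,4) and as = Ex.prems(5)
  have A: "A \<in> Sorts \<Sigma>" "A # \<Gamma> \<in> lists (Sorts \<Sigma>)" and \<phi>: "geometric_fm \<Sigma> \<phi> (A # \<Gamma>)"
    using Ex.prems by auto
  note MA = SortI_Ob[OF A(1)]
  have "(\<exists>b \<in> hom \<S> (Dom \<S> (t \<cdot> a, a, t)) (SortI BM A).
        forces \<Sigma> \<S> BM (A # \<Gamma>) (Dom \<S> (t \<cdot> a, a, t))
        (b # map (\<lambda>x. x \<cdot>\<^bsub>\<S>\<^esub> (t \<cdot> a, a, t)) (lifts (ctx \<Gamma>) t as)) \<phi>) \<longleftrightarrow>
      (\<exists>b \<in> hom C (Dom C a) (SortI M A). forces \<Sigma> C M (A # \<Gamma>) (Dom C a) (b # map (\<lambda>x. x \<cdot> a) as) \<phi>)"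
    (is "?L \<longleftrightarrow> ?R") if a: "a \<in> Ar C" "Cod C a = Dom C t" for a
  proof -
    have ah: "a \<in> hom C (Dom C a) (Dom C t)"
      using a by (simp add: hom_iff)
    have ta: "t \<cdot> a \<in> Ar C" "Cod C (t \<cdot> a) = E" "Dom C (t \<cdot> a) = Dom C a"
      using a t by auto
    have IH: "forces \<Sigma> \<S> BM (A # \<Gamma>) (t \<cdot> a) (lift (SortI M A) (t \<cdot> a) b #
          lifts (ctx \<Gamma>) (t \<cdot> a) (map (\<lambda>x. x \<cdot> a) as)) \<phi> \<longleftrightarrow>
        forces \<Sigma> C M (A # \<Gamma>) (Dom C a) (b # map (\<lambda>x. x \<cdot> a) as) \<phi>" if b: "b \<in> hom C (Dom C a)
            (SortI M A)" for b
      using Ex.IH[OF \<phi> A(2) ta(1,2), of "b # map (\<lambda>x. x \<cdot> a) as"] els_Cmp[OF as ah] b ta(3)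
      by (simp add: els_Cons)
    have hom: "hom \<S> (t \<cdot> a) (\<pi> (SortI M A)) =
        lift (SortI M A) (t \<cdot> a) ` hom C (Dom C a) (SortI M A)"
    proof (rule equalityI; rule subsetI)
      fix y assume y: "y \<in> hom \<S> (t \<cdot> a) (\<pi> (SortI M A))"
      show "y \<in> lift (SortI M A) (t \<cdot> a) ` hom C (Dom C a) (SortI M A)"
        by (rule slice_el_surj[OF MA y]) (simp add: ta(3))
    qed (use slice_el_hom[OF MA ta(1,2)] ta(3) in auto)
    show ?thesis
      unfolding slice_els_Cmp[OF els_set[OF as] as t a refl] slice_simps SortI_BM hom using IH by simp
  qed
  then show ?case
    unfolding forces_Ex[OF Ex.prems(1,2) as] B.forces_Ex[OF Ex.prems(1,2) els_BM[OF as t]]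
    by (rule slice_covers_eq[OF t])
qed

end

text \<open>
  A sequent holds if and only if forcing of the antecedent implies forcing of the succedent, for all
  elements at all stages.  The stages and elements over E are among those of M by \<open>forces_BM\<close>.
\<close>

lemma (in over_object) bang_struct_model:
  assumes \<T>: "geometric_theory \<T>" and M: "is_model \<T> C M"
  shows "is_model \<T> \<S> (bang_struct (Sg \<T>) C E M)"
proof -
  interpret pulled_structure C E "Sg \<T>" M
    by unfold_locales (use assms in \<open>auto simp: geometric_theory_def is_model_def\<close>)
  have "factors \<S> (sem_fm (Sg \<T>) \<S> BM \<phi> \<Gamma>) (sem_fm (Sg \<T>) \<S> BM \<psi> \<Gamma>)"
    if ax: "(\<Gamma>, \<phi>, \<psi>) \<in> Axs \<T>" for \<Gamma> \<phi> \<psi>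
  proof -
    have g: "geometric_fm (Sg \<T>) \<phi> \<Gamma>" "geometric_fm (Sg \<T>) \<psi> \<Gamma>" "\<Gamma> \<in> lists (Sorts (Sg \<T>))"
      using \<T> ax by (auto simp: geometric_theory_def)
    have base: "forces (Sg \<T>) C M \<Gamma> X xs \<psi>" if "els C X (ctx \<Gamma>) xs" "forces (Sg \<T>) C M \<Gamma> X xs \<phi>" for X xs
      using sequent_forces[OF g] M ax that by (auto simp: is_model_def)
    show ?thesis
      unfolding B.sequent_forces[OF g]
    proof (intro allI impI)
      fix t ys assume ys: "els \<S> t (B.ctx \<Gamma>) ys" and f: "forces (Sg \<T>) \<S> BM \<Gamma> t ys \<phi>"
      have t: "t \<in> Ar C" "Cod C t = E"
        using S.els_Ob[OF ys] by auto
      obtain as where as: "els C (Dom C t) (ctx \<Gamma>) as" "ys = lifts (ctx \<Gamma>) t as"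
        using els_slice_els_surj[OF ctx_Ob[OF g(3)]] ys unfolding ctx_BM by blast
      show "forces (Sg \<T>) \<S> BM \<Gamma> t ys \<psi>"
        using f base[OF as(1)] unfolding as(2) forces_BM[OF g(1,3) t as(1)] forces_BM[OF g(2,3) t
            as(1)] by blast
    qed
  qed
  then show ?thesis
    using is_struct_BM by (auto simp: is_model_def)
qed

section \<open>Constructions in a topos\<close>

context sheaf_model
begin

lemma el_small: "X \<in> Ob \<E> \<Longrightarrow> c \<in> Ob C \<Longrightarrow> small TYPE('u) (el X c)"
  using sheaf by (simp add: sheaf_data_def)

lemma rs_el: "X \<in> Ob \<E> \<Longrightarrow> m \<in> Ar C \<Longrightarrow> x \<in> el X (Cod C m) \<Longrightarrow> rs X m x \<in> el X (Dom C m)"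
  using sheaf by (simp add: sheaf_data_def)

lemma rs_Id: "X \<in> Ob \<E> \<Longrightarrow> c \<in> Ob C \<Longrightarrow> x \<in> el X c \<Longrightarrow> rs X (Id C c) x = x"
  using sheaf by (simp add: sheaf_data_def)

lemma rs_Cmp: "X \<in> Ob \<E> \<Longrightarrow> f \<in> Ar C \<Longrightarrow> g \<in> Ar C \<Longrightarrow> Cod C g = Dom C f \<Longrightarrow> x \<in> el X (Cod C f) \<Longrightarrow>
    rs X (f \<cdot>\<^bsub>C\<^esub> g) x = rs X g (rs X f x)"
  using sheaf by (simp add: sheaf_data_def)

lemma glue:
  assumes "X \<in> Ob \<E>" "c \<in> Ob C" "R \<in> J c" "matching C (el X) (rs X) R x"
  shows "\<exists>!a. a \<in> el X c \<and> (\<forall>f \<in> R. rs X f a = x f)"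
  using sheaf[OF assms(1)] assms by (simp add: sheaf_data_def)

lemma cover_arrow:
  assumes "c \<in> Ob C" "R \<in> J c" "f \<in> R"
  shows "f \<in> Ar C" "Cod C f = c" "g \<in> Ar C \<Longrightarrow> Cod C g = Dom C f \<Longrightarrow> f \<cdot>\<^bsub>C\<^esub> g \<in> R"
  using S.J_sieve[OF assms(1,2)] assms(3) by (auto simp: sieve_def)

lemma matching_restrict:
  assumes X: "X \<in> Ob \<E>" and c: "c \<in> Ob C" "R \<in> J c" and a: "a \<in> el X c"
  shows "matching C (el X) (rs X) R (\<lambda>f. rs X f a)"
  unfolding matching_def using cover_arrow[OF c] rs_el[OF X] rs_Cmp[OF X] a by metis

lemma separated:
  assumes X: "X \<in> Ob \<E>" and c: "c \<in> Ob C" "R \<in> J c" and ab: "a \<in> el X c" "b \<in> el X c"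
    and eq: "\<And>f. f \<in> R \<Longrightarrow> rs X f a = rs X f b"
  shows "a = b"
  using glue[OF X c matching_restrict[OF X c ab(2)]] ab eq by blast

lemma arrowI:
  assumes "X \<in> Ob \<E>" "Y \<in> Ob \<E>" "\<And>c x. c \<in> Ob C \<Longrightarrow> x \<in> el X c \<Longrightarrow> \<eta> c x \<in> el Y c"
    "\<And>m x. m \<in> Ar C \<Longrightarrow> x \<in> el X (Cod C m) \<Longrightarrow> \<eta> (Dom C m) (rs X m x) = rs Y m (\<eta> (Cod C m) x)"
  obtains f where "f \<in> hom \<E> X Y" "\<And>c x. c \<in> Ob C \<Longrightarrow> x \<in> el X c \<Longrightarrow> ap f c x = \<eta> c x"
proof -
  have "\<exists>f \<in> hom \<E> X Y. \<forall>c \<in> Ob C. \<forall>x \<in> el X c. ap f c x = \<eta> c x"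
    by (rule ap_full[OF assms])
  then show thesis
    using that by blast
qed

text \<open>
  The monomorphisms are the arrows that are injective on sections; see \<open>subs_injective\<close> for the
  other direction.
\<close>

lemma injective_subs:
  assumes m: "m \<in> hom \<E> Y X" and inj: "\<And>c. c \<in> Ob C \<Longrightarrow> inj_on (ap m c) (el Y c)"
  shows "m \<in> subs \<E> X"
proof (rule subsI)
  fix f g assume *: "f \<in> Ar \<E>" "g \<in> Ar \<E>" "Dom \<E> f = Dom \<E> g" "Cod \<E> f = Dom \<E> m" "Cod \<E> g =
      Dom \<E> m" "m \<cdot> f = m \<cdot> g"
  have fg: "f \<in> hom \<E> (Dom \<E> f) Y" "g \<in> hom \<E> (Dom \<E> f) Y"
    using * m by (auto simp: hom_iff)
  show "f = g"
  proof (rule ap_inj[OF fg])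
    fix c x assume cx: "c \<in> Ob C" "x \<in> el (Dom \<E> f) c"
    have "ap m c (ap f c x) = ap m c (ap g c x)"
      using ap_Cmp[OF fg(1) m cx] ap_Cmp[OF fg(2) m cx] *(6) by simp
    then show "ap f c x = ap g c x"
      using inj[OF cx(1)] ap_el[OF fg(1) cx] ap_el[OF fg(2) cx] by (auto dest: inj_onD)
  qed
qed (use m in \<open>auto simp: hom_iff\<close>)

lemma represented_terminal:
  "\<exists>T \<in> Ob \<E>. is_terminal \<E> T \<and> (\<forall>c \<in> Ob C. \<exists>!x. x \<in> el T c)"
proof -
  have "sheaf_data TYPE('u) C J (\<lambda>c. {()}) (\<lambda>f x. ())"
    by (auto simp: sheaf_data_def small_unit)
  then obtain T e where T: "T \<in> Ob \<E>" and e: "\<And>c. c \<in> Ob C \<Longrightarrow> bij_betw (e c) (el T c) {()}"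
    using represent by blast
  have ex1: "\<exists>!x. x \<in> el T c" if "c \<in> Ob C" for c
    using e[OF that] bij_betw_def[of "e c" "el T c" "{()}"] by (auto simp: inj_on_def)
  have uni: "\<exists>!f. f \<in> hom \<E> X T" if X: "X \<in> Ob \<E>" for X
  proof -
    have the: "(THE x. x \<in> el T c) \<in> el T c" if "c \<in> Ob C" for c
      by (rule theI'[OF ex1[OF that]])
    obtain f where f: "f \<in> hom \<E> X T"
    proof (rule arrowI[OF X T, of "\<lambda>c _. THE x. x \<in> el T c"])
      show "(THE x. x \<in> el T c) \<in> el T c" if "c \<in> Ob C" for c
        by (rule the[OF that])
      show "(THE x. x \<in> el T (Dom C m)) = rs T m (THE x. x \<in> el T (Cod C m))" if m: "m \<in> Ar C" for m
        using ex1[OF S.Dom_Ob[OF m]] the[OF S.Dom_Ob[OF m]] rs_el[OF T m the[OF S.Cod_Ob[OF m]]] by blast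
    qed
    then show ?thesis
    proof (rule ex1I)
      fix g assume g: "g \<in> hom \<E> X T"
      show "g = f"
        by (rule ap_inj[OF g f]) (use ex1 ap_el[OF g] ap_el[OF f] in blast)
    qed
  qed
  have "is_terminal \<E> T"
    unfolding is_terminal_def using T uni by simp
  then show ?thesis
    using T ex1 by (intro bexI[of _ T]) simp_all
qed

text \<open>
  The pairs of sections with the same image form a sheaf, because sections of Z are determined
  locally.
\<close>

lemma represented_pullback:
  assumes f: "f \<in> hom \<E> X Z" and g: "g \<in> hom \<E> Y Z"
  shows "\<exists>p q. is_pullback \<E> f g p q \<and> (\<forall>c \<in> Ob C. \<forall>x \<in> el X c. \<forall>y \<in> el Y c.
    ap f c x = ap g c y \<longrightarrow> (\<exists>!z. z \<in> el (Dom \<E> p) c \<and> ap p c z = x \<and> ap q c z = y))"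
proof -
  note XYZ = hom_Ob[OF f] hom_Ob[OF g]
  define Q where "Q c = {(x, y). x \<in> el X c \<and> y \<in> el Y c \<and> ap f c x = ap g c y}" for c
  define r where "r m = map_prod (rs X m) (rs Y m)" for m
  have "sheaf_data TYPE('u) C J Q r"
    unfolding sheaf_data_def
  proof (intro conjI ballI allI impI)
    show "small TYPE('u) (Q c)" if "c \<in> Ob C" for c
      by (rule small_subset[OF small_Sigma[of "el X c" "\<lambda>_. el Y c"]])
          (use el_small XYZ that in \<open>auto simp: Q_def\<close>)
    show "r m x \<in> Q (Dom C m)" if "m \<in> Ar C" "x \<in> Q (Cod C m)" for m x
      using that rs_el XYZ ap_rs[OF f, of m "fst x"] ap_rs[OF g, of m "snd x"] by (auto simp: Q_def r_def)
    show "r (Id C c) x = x" if "c \<in> Ob C" "x \<in> Q c" for c x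
      using that rs_Id XYZ by (auto simp: Q_def r_def)
    show "r (h \<cdot>\<^bsub>C\<^esub> k) x = r k (r h x)" if "h \<in> Ar C" "k \<in> Ar C" "Cod C k =
        Dom C h" "x \<in> Q (Cod C h)" for h k x
      using that rs_Cmp XYZ by (auto simp: Q_def r_def)
    fix c R z assume c: "c \<in> Ob C" "R \<in> J c" and z: "matching C Q r R z"
    have z': "z m \<in> Q (Dom C m)" "n \<in> Ar C \<Longrightarrow> Cod C n = Dom C m \<Longrightarrow>
        r n (z m) = z (m \<cdot>\<^bsub>C\<^esub> n)" if "m \<in> R" for m n
      using z that by (auto simp: matching_def)
    have zel: "fst (z m) \<in> el X (Dom C m)" "snd (z m) \<in> el Y (Dom C m)" if "m \<in> R" for m
      using z'(1)[OF that] by (auto simp: Q_def)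
    have zrs: "rs X n (fst (z m)) = fst (z (m \<cdot>\<^bsub>C\<^esub> n))" "rs Y n (snd (z m)) = snd (z (m \<cdot>\<^bsub>C\<^esub> n))"
      if "m \<in> R" "n \<in> Ar C" "Cod C n = Dom C m" for m n
      using z'(2)[OF that, symmetric] by (simp_all add: r_def)
    have m1: "matching C (el X) (rs X) R (fst \<circ> z)" and m2: "matching C (el Y) (rs Y) R (snd \<circ> z)"
      unfolding matching_def using zel zrs by simp_all
    obtain x where x: "x \<in> el X c" "\<And>m. m \<in> R \<Longrightarrow> rs X m x = fst (z m)"
      using glue[OF XYZ(1) c m1] by auto
    obtain y where y: "y \<in> el Y c" "\<And>m. m \<in> R \<Longrightarrow> rs Y m y = snd (z m)"
      using glue[OF XYZ(3) c m2] by auto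
    have "ap f c x = ap g c y"
    proof (rule separated[OF XYZ(2) c])
      show "rs Z m (ap f c x) = rs Z m (ap g c y)" if m: "m \<in> R" for m
        using ap_rs[OF f, of m x] ap_rs[OF g, of m y] cover_arrow[OF c m] x(1) y(1) x(2)[OF m] y(2)[OF
            m] z'(1)[OF m]
        by (auto simp: Q_def)
    qed (use ap_el f g c x y in auto)
    show "\<exists>!a. a \<in> Q c \<and> (\<forall>m\<in>R. r m a = z m)"
    proof (rule ex1I[of _ "(x, y)"])
      show "(x, y) \<in> Q c \<and> (\<forall>m\<in>R. r m (x, y) = z m)"
        using x y \<open>ap f c x = ap g c y\<close> by (simp add: Q_def r_def)
      fix b assume b: "b \<in> Q c \<and> (\<forall>m\<in>R. r m b = z m)"
      then have bR: "rs X m (fst b) = fst (z m)" "rs Y m (snd b) = snd (z m)" if "m \<in> R" for m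
        using that by (auto simp: r_def) (metis fst_map_prod snd_map_prod)+
      have "fst b = x" "snd b = y"
        using b separated[OF XYZ(1) c, of "fst b" x] separated[OF XYZ(3) c, of "snd b" y] x y bR
        by (auto simp: Q_def)
      then show "b = (x, y)"
        by (cases b) simp
    qed
  qed
  from represent[OF this] obtain P e where P: "P \<in> Ob \<E>" and e': "\<forall>c \<in> Ob C. bij_betw (e c) (el P c) (Q c)"
    and en': "\<forall>m \<in> Ar C. \<forall>x \<in> el P (Cod C m). e (Dom C m) (rs P m x) = r m (e (Cod C m) x)"
    by blast
  note e = e'[rule_format] and en = en'[rule_format]
  have eQ: "e c z \<in> Q c" if "c \<in> Ob C" "z \<in> el P c" for c z
    using bij_betwE[OF e[OF that(1)]] that(2) by blast
  have e1: "fst (e c z) \<in> el X c" "snd (e c z) \<in> el Y c" "ap f c (fst (e c z)) = ap g c (snd (e c z))"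
    if "c \<in> Ob C" "z \<in> el P c" for c z
    using eQ[OF that] by (auto simp: Q_def)
  obtain p where p: "p \<in> hom \<E> P X" "\<And>c z. c \<in> Ob C \<Longrightarrow> z \<in> el P c \<Longrightarrow> ap p c z = fst (e c z)"
    by (rule arrowI[OF P XYZ(1), of "\<lambda>c z. fst (e c z)"]) (use e1 en in \<open>auto simp: r_def\<close>)
  obtain q where q: "q \<in> hom \<E> P Y" "\<And>c z. c \<in> Ob C \<Longrightarrow> z \<in> el P c \<Longrightarrow> ap q c z = snd (e c z)"
    by (rule arrowI[OF P XYZ(3), of "\<lambda>c z. snd (e c z)"]) (use e1 en in \<open>auto simp: r_def\<close>)
  have einj: "z = z'" if "c \<in> Ob C" "z \<in> el P c" "z' \<in> el P c" "ap p c z = ap p c z'" "ap q c z =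
      ap q c z'" for c z z'
    using bij_betw_imp_inj_on[OF e[OF that(1)]] that p(2) q(2) by (metis inj_onD prod_eqI)
  have esurj: "\<exists>z. z \<in> el P c \<and> ap p c z = x \<and> ap q c z = y"
    if "c \<in> Ob C" "x \<in> el X c" "y \<in> el Y c" "ap f c x = ap g c y" for c x y
  proof -
    have "(x, y) \<in> e c ` el P c"
      using bij_betw_imp_surj_on[OF e[OF that(1)]] that by (simp add: Q_def)
    then obtain z where z: "z \<in> el P c" "e c z = (x, y)"
      by auto
    then have "ap p c z = x" "ap q c z = y"
      using p(2)[OF that(1) z(1)] q(2)[OF that(1) z(1)] by simp_all
    then show ?thesis
      using z(1) by blast
  qed
  have ex1: "\<exists>!z. z \<in> el P c \<and> ap p c z = x \<and> ap q c z = y"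
    if cxy: "c \<in> Ob C" "x \<in> el X c" "y \<in> el Y c" "ap f c x = ap g c y" for c x y
  proof -
    obtain z where z: "z \<in> el P c" "ap p c z = x" "ap q c z = y"
      using esurj[OF cxy] by blast
    show ?thesis
    proof (rule ex1I[of _ z])
      show "z' = z" if z': "z' \<in> el P c \<and> ap p c z' = x \<and> ap q c z' = y" for z'
        by (rule einj[OF \<open>c \<in> Ob C\<close>]) (use z z' in simp_all)
    qed (use z in simp)
  qed
  have D: "Dom \<E> p = P" "Dom \<E> f = X" "Dom \<E> g = Y"
    using p(1) f g by (auto simp: hom_iff)
  have "is_pullback \<E> f g p q"
    unfolding is_pullback_def D
  proof (intro conjI ballI impI)
    show "f \<cdot> p = g \<cdot> q"
      by (rule ap_inj[OF Cmp_hom[OF p(1) f] Cmp_hom[OF q(1) g]])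
        (simp add: ap_Cmp[OF p(1) f] ap_Cmp[OF q(1) g] p(2) q(2) e1)
    fix W h k assume W: "W \<in> Ob \<E>" and h: "h \<in> hom \<E> W X" and k: "k \<in> hom \<E> W Y" and eq: "f \<cdot> h = g \<cdot> k"
    have hk: "ap f c (ap h c w) = ap g c (ap k c w)" if "c \<in> Ob C" "w \<in> el W c" for c w
      using ap_Cmp[OF h f that] ap_Cmp[OF k g that] eq by simp
    define \<eta> where "\<eta> c w = (THE z. z \<in> el P c \<and> ap p c z = ap h c w \<and> ap q c z = ap k c w)" for c w
    have \<eta>: "\<eta> c w \<in> el P c \<and> ap p c (\<eta> c w) = ap h c w \<and> ap q c (\<eta> c w) = ap k c w"
      if "c \<in> Ob C" "w \<in> el W c" for c w
      unfolding \<eta>_def by (rule theI'[OF ex1[OF that(1) ap_el[OF h that] ap_el[OF k that] hk[OF that]]])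
    have ex: "\<exists>u \<in> hom \<E> W P. \<forall>c \<in> Ob C. \<forall>w \<in> el W c. ap u c w = \<eta> c w"
    proof (rule ap_full[OF W P, of \<eta>])
      show "\<eta> c w \<in> el P c" if "c \<in> Ob C" "w \<in> el W c" for c w
        using \<eta>[OF that] by blast
      fix m w assume m: "m \<in> Ar C" and w: "w \<in> el W (Cod C m)"
      note mw = \<eta>[OF S.Cod_Ob[OF m] w] \<eta>[OF S.Dom_Ob[OF m] rs_el[OF W m w]]
      show "\<eta> (Dom C m) (rs W m w) = rs P m (\<eta> (Cod C m) w)"
      proof (rule einj[OF S.Dom_Ob[OF m]])
        show "rs P m (\<eta> (Cod C m) w) \<in> el P (Dom C m)"
          using mw rs_el[OF P m] by blast
        show "ap p (Dom C m) (\<eta> (Dom C m) (rs W m w)) = ap p (Dom C m) (rs P m (\<eta> (Cod C m) w))"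
          using mw ap_rs[OF p(1) m] ap_rs[OF h m w] by simp
        show "ap q (Dom C m) (\<eta> (Dom C m) (rs W m w)) = ap q (Dom C m) (rs P m (\<eta> (Cod C m) w))"
          using mw ap_rs[OF q(1) m] ap_rs[OF k m w] by simp
      qed (use mw in blast)
    qed
    then obtain u where u: "u \<in> hom \<E> W P" "\<And>c w. c \<in> Ob C \<Longrightarrow> w \<in> el W c \<Longrightarrow> ap u c w = \<eta> c w"
      by blast
    show "\<exists>!u. u \<in> hom \<E> W P \<and> p \<cdot> u = h \<and> q \<cdot> u = k"
    proof (rule ex1I[of _ u], intro conjI)
      show "p \<cdot> u = h"
        by (rule ap_inj[OF Cmp_hom[OF u(1) p(1)] h]) (simp add: ap_Cmp[OF u(1) p(1)] u(2) \<eta>)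
      show "q \<cdot> u = k"
        by (rule ap_inj[OF Cmp_hom[OF u(1) q(1)] k]) (simp add: ap_Cmp[OF u(1) q(1)] u(2) \<eta>)
      fix v assume v: "v \<in> hom \<E> W P \<and> p \<cdot> v = h \<and> q \<cdot> v = k"
      then have vh: "v \<in> hom \<E> W P"
        by blast
      show "v = u"
      proof (rule ap_inj[OF vh u(1)])
        fix c w assume cw: "c \<in> Ob C" "w \<in> el W c"
        show "ap v c w = ap u c w"
          by (rule einj[OF cw(1) ap_el[OF vh cw] ap_el[OF u(1) cw]])
            (use v ap_Cmp[OF vh p(1) cw] ap_Cmp[OF vh q(1) cw] u(2)[OF cw] \<eta>[OF cw] in auto)
      qed
    qed (fact u(1))
  qed (use p(1) q(1) in auto)
  then show ?thesis
    using ex1 D by (intro exI[of _ p] exI[of _ q]) simp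
qed

text \<open>
  Every pullback is isomorphic to the one constructed from pairs of sections.
\<close>

lemma pullback_el:
  assumes pb: "is_pullback \<E> f g p q" and f: "f \<in> hom \<E> X Z" and g: "g \<in> hom \<E> Y Z"
    and c: "c \<in> Ob C" and xy: "x \<in> el X c" "y \<in> el Y c" "ap f c x = ap g c y"
  shows "\<exists>!z. z \<in> el (Dom \<E> p) c \<and> ap p c z = x \<and> ap q c z = y"
proof -
  obtain p0 q0 where pb0: "is_pullback \<E> f g p0 q0" and el0: "\<And>c x y. c \<in> Ob C \<Longrightarrow> x \<in> el X c \<Longrightarrow> y \<in> el Y c \<Longrightarrow>
    ap f c x = ap g c y \<Longrightarrow> \<exists>!z. z \<in> el (Dom \<E> p0) c \<and> ap p0 c z = x \<and> ap q0 c z = y"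
    using represented_pullback[OF f g] by blast
  have fg: "f \<in> Ar \<E>" "g \<in> Ar \<E>" "Dom \<E> f = X" "Dom \<E> g = Y" "Cod \<E> f = Z" "Cod \<E> g = Z"
    using f g by (auto simp: hom_iff)
  note a = pullbackD[OF pb fg(1,2)] and a0 = pullbackD[OF pb0 fg(1,2)]
  obtain u where u: "u \<in> Ar \<E>" "Dom \<E> u = Dom \<E> p0" "Cod \<E> u = Dom \<E> p" "p \<cdot> u = p0" "q \<cdot> u = q0"
    using pullback_lift[OF pb a0(1,2,5,3,4,6)] by metis
  obtain v where v: "v \<in> Ar \<E>" "Dom \<E> v = Dom \<E> p" "Cod \<E> v = Dom \<E> p0" "p0 \<cdot> v = p" "q0 \<cdot> v = q"
    using pullback_lift[OF pb0 a(1,2,5,3,4,6)] by metis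
  have P: "Dom \<E> p \<in> Ob \<E>"
    using a(1) Dom_Ob by blast
  have uv: "u \<cdot> v = Id \<E> (Dom \<E> p)"
  proof (rule pullback_eq[OF pb fg(1,2)])
    have "p \<cdot> (u \<cdot> v) = (p \<cdot> u) \<cdot> v" "q \<cdot> (u \<cdot> v) = (q \<cdot> u) \<cdot> v"
      by (rule assoc[symmetric]; use u(1-3) v(1-3) a in simp)+
    then show "p \<cdot> (u \<cdot> v) = p \<cdot> Id \<E> (Dom \<E> p)" "q \<cdot> (u \<cdot> v) = q \<cdot> Id \<E> (Dom \<E> p)"
      using u(4,5) v(4,5) a by simp_all
  qed (use u v P in auto)
  have uh: "u \<in> hom \<E> (Dom \<E> p0) (Dom \<E> p)" and vh: "v \<in> hom \<E> (Dom \<E> p) (Dom \<E> p0)"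
    and ph: "p \<in> hom \<E> (Dom \<E> p) X" and qh: "q \<in> hom \<E> (Dom \<E> p) Y"
    and p0h: "p0 \<in> hom \<E> (Dom \<E> p0) X" and q0h: "q0 \<in> hom \<E> (Dom \<E> p0) Y"
    using u v a a0 fg by (auto simp: hom_iff)
  have pu: "ap p c (ap u c z) = ap p0 c z" "ap q c (ap u c z) = ap q0 c z" if "z \<in> el (Dom \<E> p0) c" for z
    using ap_Cmp[OF uh ph c that] ap_Cmp[OF uh qh c that] u by simp_all
  have pv: "ap p0 c (ap v c z) = ap p c z" "ap q0 c (ap v c z) = ap q c z" "ap u c (ap v c z) = z"
    if "z \<in> el (Dom \<E> p) c" for z
    using ap_Cmp[OF vh p0h c that] ap_Cmp[OF vh q0h c that] ap_Cmp[OF vh uh c that] ap_Id[OF P c that]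
        v uv by simp_all
  note ex1 = el0[OF c xy]
  then obtain z0 where z0: "z0 \<in> el (Dom \<E> p0) c" "ap p0 c z0 = x" "ap q0 c z0 = y"
    by blast
  show ?thesis
  proof (rule ex1I[of _ "ap u c z0"])
    show "ap u c z0 \<in> el (Dom \<E> p) c \<and> ap p c (ap u c z0) = x \<and> ap q c (ap u c z0) = y"
      using z0 pu ap_el[OF uh c] by simp
    fix z assume z: "z \<in> el (Dom \<E> p) c \<and> ap p c z = x \<and> ap q c z = y"
    then have zP: "z \<in> el (Dom \<E> p) c"
      by simp
    have "ap v c z \<in> el (Dom \<E> p0) c \<and> ap p0 c (ap v c z) = x \<and> ap q0 c (ap v c z) = y"
      using z pv(1,2)[OF zP] ap_el[OF vh c zP] by simp
    then have "ap v c z = z0"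
      using ex1 z0 by blast
    then show "z = ap u c z0"
      using pv(3)[OF zP] by simp
  qed
qed

text \<open>
  The two projections of the kernel pair of a monomorphism coincide, and the sections of the kernel
  pair are the pairs of sections with the same image.
\<close>

lemma subs_injective:
  assumes m: "m \<in> subs \<E> X" and c: "c \<in> Ob C"
  shows "inj_on (ap m c) (el (Dom \<E> m) c)"
proof (rule inj_onI)
  fix x y assume xy: "x \<in> el (Dom \<E> m) c" "y \<in> el (Dom \<E> m) c" "ap m c x = ap m c y"
  have mh: "m \<in> hom \<E> (Dom \<E> m) X"
    using subsD[OF m] by (simp add: hom_iff)
  obtain p q where pb: "is_pullback \<E> m m p q"
    using represented_pullback[OF mh mh] by blast
  note a = pullbackD[OF pb subsD(1)[OF m] subsD(1)[OF m]]
  have "p = q"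
    by (rule subs_mono[OF m]) (use a in auto)
  then show "x = y"
    using pullback_el[OF pb mh mh c xy] by blast
qed

lemma bijective_split:
  assumes n: "n \<in> hom \<E> N Y" and bij: "\<And>c. c \<in> Ob C \<Longrightarrow> bij_betw (ap n c) (el N c) (el Y c)"
  shows "factors \<E> (Id \<E> Y) n"
proof -
  note NY = hom_Ob[OF n]
  define i where "i c = inv_into (el N c) (ap n c)" for c
  have i: "i c y \<in> el N c" "ap n c (i c y) = y" if "c \<in> Ob C" "y \<in> el Y c" for c y
    using bij_betw_imp_surj_on[OF bij[OF that(1)]] that(2) unfolding i_def
    by (auto simp: inv_into_into f_inv_into_f)
  have ex: "\<exists>k \<in> hom \<E> Y N. \<forall>c \<in> Ob C. \<forall>y \<in> el Y c. ap k c y = i c y"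
  proof (rule ap_full[OF NY(2,1), of i])
    fix m y assume m: "m \<in> Ar C" and y: "y \<in> el Y (Cod C m)"
    note my = i[OF S.Cod_Ob[OF m] y] i[OF S.Dom_Ob[OF m] rs_el[OF NY(2) m y]]
    show "i (Dom C m) (rs Y m y) = rs N m (i (Cod C m) y)"
      by (rule inj_onD[OF bij_betw_imp_inj_on[OF bij[OF S.Dom_Ob[OF m]]]])
        (use my ap_rs[OF n m, of "i (Cod C m) y"] rs_el[OF NY(1) m] in auto)
  qed (use i in auto)
  then obtain k where k: "k \<in> hom \<E> Y N" "\<And>c y. c \<in> Ob C \<Longrightarrow> y \<in> el Y c \<Longrightarrow> ap k c y = i c y"
    by blast
  have "n \<cdot> k = Id \<E> Y"
    by (rule ap_inj[OF Cmp_hom[OF k(1) n] Id_hom[OF NY(2)]])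
      (simp add: ap_Cmp[OF k(1) n] k(2) i ap_Id[OF NY(2)])
  then show ?thesis
    using k(1) n NY by (auto simp: factors_def hom_iff)
qed

text \<open>
  A section x of X belongs to the union if the arrows along which it restricts into the image of some
  member of U form a covering sieve.  By the transitivity axiom of the site this defines a subsheaf.  If all
  sections of Y are mapped into it by g, and a subobject n of Y contains every arrow a such that
  \<open>g \<cdot> a\<close> factors through U, then every section of Y is locally in the image of n.  As n is injective
  on sections, the local preimages match, so they can be glued, and n is invertible.
\<close>

lemma represented_union:
  assumes X: "X \<in> Ob \<E>" and U: "U \<subseteq> {u \<in> Ar \<E>. Cod \<E> u = X}"
  shows "\<exists>k \<in> subs \<E> X. \<forall>g \<in> Ar \<E>. Cod \<E> g = X \<longrightarrow>
    (factors \<E> g k \<longleftrightarrow> covers \<E> (Dom \<E> g) (pulled \<E> U g))"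
proof -
  have Uh: "u \<in> hom \<E> (Dom \<E> u) X" "Dom \<E> u \<in> Ob \<E>" if "u \<in> U" for u
    using U that Dom_Ob by (auto simp: hom_iff)
  define P where "P d z \<longleftrightarrow> (\<exists>u \<in> U. \<exists>y \<in> el (Dom \<E> u) d. ap u d y = z)" for d z
  have P_rs: "P (Dom C m) (rs X m z)" if "m \<in> Ar C" "P (Cod C m) z" for m z
    using that ap_rs[OF Uh(1), of _ m] rs_el[OF Uh(2), of _ m] unfolding P_def by metis
  \<comment> \<open>L collects the arrows along which x restricts into the image of U, and K is the subsheaf sought.\<close>
  define L where "L c x = {f \<in> Ar C. Cod C f = c \<and> P (Dom C f) (rs X f x)}" for c x
  have L_sieve: "sieve C c (L c x)" if x: "x \<in> el X c" for c x
    unfolding sieve_def L_def using P_rs rs_Cmp[OF X] x by auto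
  have L_pull: "pull_sieve C f (L c x) = L (Dom C f) (rs X f x)" if "f \<in> Ar C" "Cod C f =
      c" "x \<in> el X c" for f c x
    unfolding pull_sieve_def L_def using that rs_Cmp[OF X] by auto
  define K where "K c = {x \<in> el X c. L c x \<in> J c}" for c
  have K_rs: "rs X f x \<in> K (Dom C f)" if f: "f \<in> Ar C" and x: "x \<in> K (Cod C f)" for f x
    using S.J_stable[of f "Dom C f" "Cod C f" "L (Cod C f) x"] L_pull[OF f refl, of x] rs_el[OF X f, of
        x] f x
    by (auto simp: K_def hom_iff)
  have "sheaf_data TYPE('u) C J K (rs X)"
    unfolding sheaf_data_def
  proof (intro conjI ballI allI impI)
    show "small TYPE('u) (K c)" if "c \<in> Ob C" for c
      by (rule small_subset[OF el_small[OF X that]]) (auto simp: K_def)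
    fix c R x assume c: "c \<in> Ob C" "R \<in> J c" and x: "matching C K (rs X) R x"
    have xK: "x f \<in> K (Dom C f)" if "f \<in> R" for f
      using x that by (auto simp: matching_def)
    have "matching C (el X) (rs X) R x"
      using x by (auto simp: matching_def K_def)
    then have ex1: "\<exists>!a. a \<in> el X c \<and> (\<forall>f\<in>R. rs X f a = x f)"
      by (rule glue[OF X c])
    then obtain a where a: "a \<in> el X c" "\<And>f. f \<in> R \<Longrightarrow> rs X f a = x f"
      by blast
    have "L c a \<in> J c"
    proof (rule S.J_trans[OF c L_sieve[OF a(1)]])
      show "pull_sieve C f (L c a) \<in> J (Dom C f)" if f: "f \<in> R" for f
        using L_pull[OF cover_arrow(1,2)[OF c f] a(1)] a(2)[OF f] xK[OF f] by (simp add: K_def)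
    qed
    then show "\<exists>!a. a \<in> K c \<and> (\<forall>f\<in>R. rs X f a = x f)"
      using ex1 a by (auto simp: K_def)
  qed (use K_rs rs_Id[OF X] rs_Cmp[OF X] in \<open>auto simp: K_def\<close>)
  from represent[OF this] obtain K0 e where K0: "K0 \<in> Ob \<E>"
      and e': "\<forall>c \<in> Ob C. bij_betw (e c) (el K0 c) (K c)"
    and en': "\<forall>m \<in> Ar C. \<forall>x \<in> el K0 (Cod C m). e (Dom C m) (rs K0 m x) = rs X m (e (Cod C m) x)"
    by blast
  note e = e'[rule_format] and en = en'[rule_format]
  have eK: "e c x \<in> K c" if "c \<in> Ob C" "x \<in> el K0 c" for c x
    using bij_betwE[OF e[OF that(1)]] that(2) by blast
  obtain k where k: "k \<in> hom \<E> K0 X" "\<And>c x. c \<in> Ob C \<Longrightarrow> x \<in> el K0 c \<Longrightarrow> ap k c x = e c x"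
    by (rule arrowI[OF K0 X, of e]) (use eK en in \<open>auto simp: K_def\<close>)
  have kinj: "inj_on (ap k c) (el K0 c)" if "c \<in> Ob C" for c
    using bij_betw_imp_inj_on[OF e[OF that]] k(2)[OF that] by (simp add: inj_on_def)
  have ksub: "k \<in> subs \<E> X"
    by (rule injective_subs[OF k(1) kinj])
  have fac: "factors \<E> g k \<longleftrightarrow> (\<forall>c \<in> Ob C. \<forall>y \<in> el Y c. ap g c y \<in> K c)" if g: "g \<in> hom \<E> Y X" for g Y
  proof
    assume "factors \<E> g k"
    then obtain j where j: "j \<in> hom \<E> Y K0" "k \<cdot> j = g"
      unfolding factors_def homD(2)[OF g] homD(2)[OF k(1)] by blast
    show "\<forall>c \<in> Ob C. \<forall>y \<in> el Y c. ap g c y \<in> K c"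
    proof (intro ballI)
      fix c y assume cy: "c \<in> Ob C" "y \<in> el Y c"
      show "ap g c y \<in> K c"
        using ap_Cmp[OF j(1) k(1) cy] k(2)[OF cy(1) ap_el[OF j(1) cy]] eK[OF cy(1) ap_el[OF j(1) cy]]
            j(2) by simp
    qed
  next
    assume gK: "\<forall>c \<in> Ob C. \<forall>y \<in> el Y c. ap g c y \<in> K c"
    define i where "i c y = inv_into (el K0 c) (ap k c) (ap g c y)" for c y
    have i: "i c y \<in> el K0 c" "ap k c (i c y) = ap g c y" if cy: "c \<in> Ob C" "y \<in> el Y c" for c y
    proof -
      have "ap k c ` el K0 c = K c"
        using bij_betw_imp_surj_on[OF e[OF cy(1)]] k(2)[OF cy(1)] by force
      then have "ap g c y \<in> ap k c ` el K0 c"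
        using gK cy by blast
      then show "i c y \<in> el K0 c" "ap k c (i c y) = ap g c y"
        unfolding i_def by (rule inv_into_into, rule f_inv_into_f)
    qed
    note YX = hom_Ob[OF g]
    have ex: "\<exists>j \<in> hom \<E> Y K0. \<forall>c \<in> Ob C. \<forall>y \<in> el Y c. ap j c y = i c y"
    proof (rule ap_full[OF YX(1) K0, of i])
      fix m y assume m: "m \<in> Ar C" and y: "y \<in> el Y (Cod C m)"
      note my = i[OF S.Cod_Ob[OF m] y] i[OF S.Dom_Ob[OF m] rs_el[OF YX(1) m y]]
      show "i (Dom C m) (rs Y m y) = rs K0 m (i (Cod C m) y)"
        by (rule inj_onD[OF kinj[OF S.Dom_Ob[OF m]]])
          (use my ap_rs[OF k(1) m, of "i (Cod C m) y"] ap_rs[OF g m y] rs_el[OF K0 m] in auto)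
    qed (use i in auto)
    then obtain j where j: "j \<in> hom \<E> Y K0" "\<And>c y. c \<in> Ob C \<Longrightarrow> y \<in> el Y c \<Longrightarrow> ap j c y = i c y"
      by blast
    have "k \<cdot> j = g"
      by (rule ap_inj[OF Cmp_hom[OF j(1) k(1)] g]) (simp add: ap_Cmp[OF j(1) k(1)] j(2) i)
    then show "factors \<E> g k"
      unfolding factors_def homD(2)[OF g] homD(2)[OF k(1)] using j(1) by blast
  qed
  have ufac: "factors \<E> u k" if u: "u \<in> U" for u
    unfolding fac[OF Uh(1)[OF u]]
  proof (intro ballI)
    fix c y assume cy: "c \<in> Ob C" "y \<in> el (Dom \<E> u) c"
    have "L c (ap u c y) = {f \<in> Ar C. Cod C f = c}"
      unfolding L_def P_def using ap_rs[OF Uh(1)[OF u], of _ y] rs_el[OF Uh(2)[OF u], of _ y] u cy by force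
    then show "ap u c y \<in> K c"
      using S.J_max[OF cy(1)] ap_el[OF Uh(1)[OF u] cy] by (simp add: K_def)
  qed
  have "factors \<E> g k \<longleftrightarrow> covers \<E> (Dom \<E> g) (pulled \<E> U g)" if gA: "g \<in> Ar \<E>" "Cod \<E> g = X" for g
  proof
    define Y where "Y = Dom \<E> g"
    have g: "g \<in> hom \<E> Y X" and Y: "Y \<in> Ob \<E>"
      using gA Dom_Ob by (auto simp: hom_iff Y_def)
    assume "covers \<E> (Dom \<E> g) (pulled \<E> U g)"
    moreover obtain p q where pb: "is_pullback \<E> g k p q"
      using represented_pullback[OF g k(1)] by blast
    have kc: "k \<in> subs \<E> (Cod \<E> g)"
      using ksub gA by simp
    note ps = pullback_subs[OF pb gA(1) kc]
    have "factors \<E> a p" if aU: "a \<in> pulled \<E> U g" for a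
    proof -
      obtain u where u: "u \<in> U" "factors \<E> (g \<cdot> a) u" and a: "a \<in> Ar \<E>" "Cod \<E> a = Dom \<E> g"
        using aU by (auto simp: pulled_def)
      show ?thesis
        using ps(2)[OF a] factors_trans[OF u(2) ufac[OF u(1)] subsD(1)[OF ksub]] by blast
    qed
    ultimately have "factors \<E> (Id \<E> (Dom \<E> g)) p"
      using ps(1) by (auto simp: covers_def)
    then show "factors \<E> g k"
      using ps(2)[of "Id \<E> (Dom \<E> g)"] Y gA by (simp add: Y_def)
  next
    define Y where "Y = Dom \<E> g"
    have g: "g \<in> hom \<E> Y X" and Y: "Y \<in> Ob \<E>"
      using gA Dom_Ob by (auto simp: hom_iff Y_def)
    assume "factors \<E> g k"
    then have gK: "ap g c y \<in> K c" if "c \<in> Ob C" "y \<in> el Y c" for c y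
      using fac[OF g] that by blast
    show "covers \<E> (Dom \<E> g) (pulled \<E> U g)"
      unfolding covers_def Y_def[symmetric]
    proof (intro ballI impI)
      fix n assume n: "n \<in> subs \<E> Y" and W: "\<forall>a\<in>pulled \<E> U g. factors \<E> a n"
      define N where "N = Dom \<E> n"
      have nh: "n \<in> hom \<E> N Y" and N: "N \<in> Ob \<E>"
        using subsD[OF n] Dom_Ob by (auto simp: hom_iff N_def)
      have ninj: "inj_on (ap n c) (el N c)" if "c \<in> Ob C" for c
        using subs_injective[OF n that] by (simp add: N_def)
      have "y \<in> ap n c ` el N c" if cy: "c \<in> Ob C" "y \<in> el Y c" for c y
      proof -
        define R where "R = L c (ap g c y)"
        have R: "R \<in> J c"
          using gK[OF cy] by (simp add: K_def R_def)
        have "\<exists>v \<in> el N (Dom C f). ap n (Dom C f) v = rs Y f y" if f: "f \<in> R" for f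
        proof -
          have fA: "f \<in> Ar C" "Cod C f = c" "Dom C f \<in> Ob C"
            using cover_arrow[OF cy(1) R f] S.Dom_Ob by auto
          obtain u z where u: "u \<in> U" "z \<in> el (Dom \<E> u) (Dom C f)" "ap u (Dom C f) z = rs X f (ap g c y)"
            using f by (auto simp: R_def L_def P_def)
          have eq: "ap g (Dom C f) (rs Y f y) = ap u (Dom C f) z"
            using ap_rs[OF g fA(1)] fA(2) cy(2) u(3) by simp
          \<comment> \<open>The restriction of y is a section in the image of the projection p, which n contains.\<close>
          obtain p q where pb: "is_pullback \<E> g u p q"
            using represented_pullback[OF g Uh(1)[OF u(1)]] by blast
          note pA = pullbackD[OF pb homD(1)[OF g] homD(1)[OF Uh(1)[OF u(1)]]]
          have ry: "rs Y f y \<in> el Y (Dom C f)"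
            using rs_el[OF Y fA(1)] fA(2) cy(2) by simp
          obtain w where w: "w \<in> el (Dom \<E> p) (Dom C f)" "ap p (Dom C f) w = rs Y f y"
            using pullback_el[OF pb g Uh(1)[OF u(1)] fA(3) ry u(2) eq] by blast
          have "factors \<E> (g \<cdot> p) u"
            using factorsI[of q u] pA U u(1) by auto
          then have "p \<in> pulled \<E> U g"
            using pA u(1) by (auto simp: pulled_def)
          then obtain j where j: "j \<in> hom \<E> (Dom \<E> p) N" "n \<cdot> j = p"
            using W pA by (auto simp: factors_def N_def)
          show ?thesis
            using ap_Cmp[OF j(1) nh fA(3) w(1)] ap_el[OF j(1) fA(3) w(1)] j(2) w(2) by auto
        qed
        then obtain v where v: "\<And>f. f \<in> R \<Longrightarrow> v f \<in> el N (Dom C f)" "\<And>f. f \<in> R \<Longrightarrow>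
            ap n (Dom C f) (v f) = rs Y f y"
          by metis
        have "matching C (el N) (rs N) R v"
          unfolding matching_def
        proof (intro ballI conjI impI)
          fix f h assume f: "f \<in> R" and h: "h \<in> Ar C" "Cod C h = Dom C f"
          note fA = cover_arrow[OF cy(1) R f]
          have fh: "f \<cdot>\<^bsub>C\<^esub> h \<in> R"
            using fA(3) h by blast
          have vf: "v f \<in> el N (Cod C h)"
            using v(1)[OF f] h by simp
          have "ap n (Dom C h) (rs N h (v f)) = ap n (Dom C h) (v (f \<cdot>\<^bsub>C\<^esub> h))"
            using ap_rs[OF nh h(1) vf] v(2)[OF f] v(2)[OF fh] rs_Cmp[OF Y fA(1) h] h fA(1,2) cy(2) by simp
          then show "rs N h (v f) = v (f \<cdot>\<^bsub>C\<^esub> h)"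
            using inj_onD[OF ninj[OF S.Dom_Ob[OF h(1)]]] rs_el[OF N h(1) vf] v(1)[OF fh] h fA(1) by auto
        qed (use v in blast)
        then obtain x where x: "x \<in> el N c" "\<And>f. f \<in> R \<Longrightarrow> rs N f x = v f"
          using glue[OF N cy(1) R] by blast
        have "ap n c x = y"
        proof (rule separated[OF Y cy(1) R ap_el[OF nh cy(1) x(1)] cy(2)])
          fix f assume f: "f \<in> R"
          show "rs Y f (ap n c x) = rs Y f y"
            using ap_rs[OF nh, of f x] cover_arrow[OF cy(1) R f] x(1) x(2)[OF f] v(2)[OF f] by simp
        qed
        then show ?thesis
          using x(1) by blast
      qed
      then have "bij_betw (ap n c) (el N c) (el Y c)" if "c \<in> Ob C" for c
        unfolding bij_betw_def using ninj[OF that] ap_el[OF nh that] that by blast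
      then show "factors \<E> (Id \<E> Y) n"
        by (rule bijective_split[OF nh])
    qed
  qed
  then show ?thesis
    using ksub by blast
qed

sublocale geometric_category \<E>
proof
  show "\<exists>T. is_terminal \<E> T"
    using represented_terminal by blast
  show "\<exists>p q. is_pullback \<E> f g p q" if "f \<in> Ar \<E>" "g \<in> Ar \<E>" "Cod \<E> f = Cod \<E> g" for f g
    using represented_pullback[of f "Dom \<E> f" "Cod \<E> f" g "Dom \<E> g"] that by (auto simp: hom_iff)
qed (rule represented_union)

end

section \<open>The object of families of arrows\<close>

context sheaf_model
begin

text \<open>
  Every terminal object is isomorphic to the one with a single section over each object.
\<close>

lemma terminal_el:
  assumes "is_terminal \<E> T" "c \<in> Ob C" "x \<in> el T c" "y \<in> el T c"
  shows "x = y"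
proof -
  obtain T0 where T0: "T0 \<in> Ob \<E>" "is_terminal \<E> T0" and ex1: "\<exists>!x. x \<in> el T0 c"
    using represented_terminal assms(2) by blast
  have T: "T \<in> Ob \<E>"
    using assms(1) by (simp add: is_terminal_def)
  obtain u where u: "u \<in> hom \<E> T T0"
    using T0 T by (auto simp: is_terminal_def)
  obtain v where v: "v \<in> hom \<E> T0 T"
    using assms(1) T0(1) by (auto simp: is_terminal_def)
  have "v \<cdot> u \<in> hom \<E> T T" "Id \<E> T \<in> hom \<E> T T"
    using Cmp_hom[OF u v] Id_hom[OF T] by auto
  then have vu: "v \<cdot> u = Id \<E> T"
    using assms(1) T unfolding is_terminal_def by blast
  have "ap v c (ap u c z) = z" if "z \<in> el T c" for z
    using ap_Cmp[OF u v assms(2) that] ap_Id[OF T assms(2) that] vu by simp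
  moreover have "ap u c x = ap u c y"
    using ex1 ap_el[OF u assms(2)] assms(3,4) by blast
  ultimately show ?thesis
    using assms(3,4) by metis
qed

lemma product_el:
  assumes E: "E \<in> Ob \<E>" and X: "X \<in> Ob \<E>" and c: "c \<in> Ob C" and ex: "e \<in> el E c" "x \<in> el X c"
  shows "\<exists>!z. z \<in> el (Dom \<E> (base_prj \<E> E X)) c \<and> ap (base_prj \<E> E X) c z = e \<and>
      ap (fibre_prj \<E> E X) c z = x"
proof -
  interpret ov: over_object \<E> E
    by unfold_locales (rule E)
  have "is_terminal \<E> (one \<E>)"
    unfolding one_def by (rule someI_ex[OF ex_terminal])
  then have "ap (bang \<E> E) c e = ap (bang \<E> X) c x"
    using terminal_el c ap_el[OF bang(1)[OF E] c ex(1)] ap_el[OF bang(1)[OF X] c ex(2)] by blast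
  then show ?thesis
    by (rule pullback_el[OF ov.base_prj_pullback[OF X] bang(1)[OF E] bang(1)[OF X] c ex])
qed

text \<open>
  The sections over c of the product of the exponentials \<open>Y\<^sub>i\<^bsup>X\<^sub>i\<^esup>\<close>: natural families of functions from
  the sections of \<open>X\<^sub>i\<close> to those of \<open>Y\<^sub>i\<close>, indexed by the arrows f into c.
\<close>

definition family :: "'i set \<Rightarrow> ('i \<Rightarrow> 'o) \<Rightarrow> ('i \<Rightarrow> 'o) \<Rightarrow> 'u \<Rightarrow> ('i \<Rightarrow> 'u \<Rightarrow> 'u \<Rightarrow> 'u) set"
  where "family I X Y c = {\<sigma> \<in> (\<Pi>\<^sub>E i \<in> I. \<Pi>\<^sub>E f \<in> {f \<in> Ar C. Cod C f =
      c}. el (X i) (Dom C f) \<rightarrow>\<^sub>E el (Y i) (Dom C f)).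
    \<forall>i \<in> I. \<forall>f \<in> Ar C. Cod C f = c \<longrightarrow> (\<forall>g \<in> Ar C. Cod C g = Dom C f \<longrightarrow> (\<forall>x \<in> el (X i) (Dom C f).
      \<sigma> i (f \<cdot>\<^bsub>C\<^esub> g) (rs (X i) g x) = rs (Y i) g (\<sigma> i f x)))}"

definition family_res :: "'i set \<Rightarrow> 'u \<Rightarrow> ('i \<Rightarrow> 'u \<Rightarrow> 'u \<Rightarrow> 'u) \<Rightarrow> ('i \<Rightarrow> 'u \<Rightarrow> 'u \<Rightarrow> 'u)"
  where "family_res I m \<sigma> = (\<lambda>i\<in>I. \<lambda>f\<in>{f \<in> Ar C. Cod C f = Dom C m}. \<sigma> i (m \<cdot>\<^bsub>C\<^esub> f))"

lemma family_el:
  assumes "\<sigma> \<in> family I X Y c" "i \<in> I" "f \<in> Ar C" "Cod C f = c" "x \<in> el (X i) (Dom C f)"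
  shows "\<sigma> i f x \<in> el (Y i) (Dom C f)"
  using assms by (fastforce simp: family_def PiE_iff)

lemma family_nat:
  assumes "\<sigma> \<in> family I X Y c" "i \<in> I" "f \<in> Ar C" "Cod C f = c" "x \<in> el (X i) (Dom C f)"
    "g \<in> Ar C" "Cod C g = Dom C f"
  shows "\<sigma> i (f \<cdot>\<^bsub>C\<^esub> g) (rs (X i) g x) = rs (Y i) g (\<sigma> i f x)"
  using assms by (simp add: family_def)

lemma family_eqI:
  assumes \<sigma>: "\<sigma> \<in> family I X Y c" and \<tau>: "\<tau> \<in> family I X Y c"
    and eq: "\<And>i f x. i \<in> I \<Longrightarrow> f \<in> Ar C \<Longrightarrow> Cod C f = c \<Longrightarrow> x \<in> el (X i) (Dom C f) \<Longrightarrow> \<sigma> i f x = \<tau> i f x"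
  shows "\<sigma> = \<tau>"
proof -
  have P: "\<sigma> \<in> (\<Pi>\<^sub>E i \<in> I. \<Pi>\<^sub>E f \<in> {f \<in> Ar C. Cod C f = c}. el (X i) (Dom C f) \<rightarrow>\<^sub>E el (Y i) (Dom C f))"
    "\<tau> \<in> (\<Pi>\<^sub>E i \<in> I. \<Pi>\<^sub>E f \<in> {f \<in> Ar C. Cod C f = c}. el (X i) (Dom C f) \<rightarrow>\<^sub>E el (Y i) (Dom C f))"
    using \<sigma> \<tau> by (simp_all add: family_def)
  show ?thesis
  proof (rule PiE_ext[OF P])
    fix i assume i: "i \<in> I"
    show "\<sigma> i = \<tau> i"
    proof (rule PiE_ext[OF PiE_mem[OF P(1) i] PiE_mem[OF P(2) i]])
      fix f assume f: "f \<in> {f \<in> Ar C. Cod C f = c}"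
      show "\<sigma> i f = \<tau> i f"
        by (rule PiE_ext[OF PiE_mem[OF PiE_mem[OF P(1) i] f] PiE_mem[OF PiE_mem[OF P(2) i] f]])
            (use eq i f in simp)
    qed
  qed
qed

lemma familyI:
  assumes el: "\<And>i f x. i \<in> I \<Longrightarrow> f \<in> Ar C \<Longrightarrow> Cod C f = c \<Longrightarrow> x \<in> el (X i) (Dom C f) \<Longrightarrow>
      s i f x \<in> el (Y i) (Dom C f)"
    and nat: "\<And>i f g x. i \<in> I \<Longrightarrow> f \<in> Ar C \<Longrightarrow> Cod C f = c \<Longrightarrow> x \<in> el (X i) (Dom C f) \<Longrightarrow> g \<in> Ar C \<Longrightarrow>
      Cod C g = Dom C f \<Longrightarrow> s i (f \<cdot>\<^bsub>C\<^esub> g) (rs (X i) g x) = rs (Y i) g (s i f x)"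
    and X: "\<And>i. i \<in> I \<Longrightarrow> X i \<in> Ob \<E>"
  shows "(\<lambda>i\<in>I. \<lambda>f\<in>{f \<in> Ar C. Cod C f = c}. \<lambda>x\<in>el (X i) (Dom C f). s i f x) \<in> family I X Y c"
  unfolding family_def using el nat rs_el[OF X] by (auto simp del: S.assoc)

lemma family_res_apply:
  assumes "i \<in> I" "f \<in> Ar C" "Cod C f = Dom C m"
  shows "family_res I m \<sigma> i f = \<sigma> i (m \<cdot>\<^bsub>C\<^esub> f)"
  using assms by (simp add: family_res_def)

lemma family_res_fam:
  assumes m: "m \<in> Ar C" and \<sigma>: "\<sigma> \<in> family I X Y (Cod C m)" and X: "\<And>i. i \<in> I \<Longrightarrow> X i \<in> Ob \<E>"
  shows "family_res I m \<sigma> \<in> family I X Y (Dom C m)"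
proof -
  have "family_res I m \<sigma> i f \<in> el (X i) (Dom C f) \<rightarrow>\<^sub>E el (Y i) (Dom C f)"
    if i: "i \<in> I" and f: "f \<in> Ar C" "Cod C f = Dom C m" for i f
  proof -
    have "\<sigma> \<in> (\<Pi>\<^sub>E i \<in> I. \<Pi>\<^sub>E f \<in> {f \<in> Ar C. Cod C f = Cod C m}. el (X i) (Dom C f) \<rightarrow>\<^sub>E el (Y i) (Dom C f))"
      using \<sigma> by (simp add: family_def)
    from PiE_mem[OF PiE_mem[OF this i], of "m \<cdot>\<^bsub>C\<^esub> f"] show ?thesis
      using m f by (simp add: family_res_apply[OF i f])
  qed
  moreover have "family_res I m \<sigma> i (f \<cdot>\<^bsub>C\<^esub> g) (rs (X i) g x) = rs (Y i) g (family_res I m \<sigma> i f x)"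
    if i: "i \<in> I" and f: "f \<in> Ar C" "Cod C f = Dom C m" and g: "g \<in> Ar C" "Cod C g = Dom C f"
        and x: "x \<in> el (X i) (Dom C f)"
    for i f g x
    using family_nat[OF \<sigma> i, of "m \<cdot>\<^bsub>C\<^esub> f" x g] m f g x by (simp add: family_res_apply[OF i])
  ultimately show ?thesis
    by (auto simp: family_def family_res_def)
qed

text \<open>
  Let t be a matching family of such sections on a covering sieve R.  The glued section sends x, at
  the arrow f, to the section that glues the values of \<open>t (f \<cdot> g)\<close> at the restrictions of x along
  those g for which \<open>f \<cdot> g\<close> lies in R; such g form a covering sieve.
\<close>

lemma family_sheaf:
  assumes I: "small TYPE('u) I" and X: "\<And>i. i \<in> I \<Longrightarrow> X i \<in> Ob \<E>" and Y: "\<And>i. i \<in> I \<Longrightarrow> Y i \<in> Ob \<E>"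
  shows "sheaf_data TYPE('u) C J (family I X Y) (family_res I)"
  unfolding sheaf_data_def
proof (intro conjI ballI allI impI)
  show "small TYPE('u) (family I X Y c)" if "c \<in> Ob C" for c
  proof (rule small_subset[OF small_PiE[OF I small_PiE]])
    show "small TYPE('u) {f \<in> Ar C. Cod C f = c}"
      by (rule small_subset[OF small_Ar]) auto
    show "small TYPE('u) (el (X i) (Dom C f) \<rightarrow>\<^sub>E el (Y i) (Dom C f))"
      if "i \<in> I" "f \<in> {f \<in> Ar C. Cod C f = c}" for i f
      using that by (intro small_PiE el_small X Y S.Dom_Ob) auto
  qed (auto simp: family_def)
  show "family_res I m \<sigma> \<in> family I X Y (Dom C m)" if "m \<in> Ar C" "\<sigma> \<in> family I X Y (Cod C m)" for m \<sigma>
    using family_res_fam X that by blast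
  show "family_res I (Id C c) \<sigma> = \<sigma>" if c: "c \<in> Ob C" and \<sigma>: "\<sigma> \<in> family I X Y c" for c \<sigma>
  proof (rule family_eqI[OF _ \<sigma>])
    show "family_res I (Id C c) \<sigma> \<in> family I X Y c"
      using family_res_fam[of "Id C c" \<sigma> I X Y] X c \<sigma> by simp
  qed (use c in \<open>simp add: family_res_apply\<close>)
  show "family_res I (f \<cdot>\<^bsub>C\<^esub> g) \<sigma> = family_res I g (family_res I f \<sigma>)"
    if f: "f \<in> Ar C" and g: "g \<in> Ar C" "Cod C g = Dom C f" and \<sigma>: "\<sigma> \<in> family I X Y (Cod C f)" for f g \<sigma>
  proof (rule family_eqI)
    show "family_res I (f \<cdot>\<^bsub>C\<^esub> g) \<sigma> \<in> family I X Y (Dom C g)"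
      using family_res_fam[of "f \<cdot>\<^bsub>C\<^esub> g" \<sigma> I X Y] X f g \<sigma> by simp
    show "family_res I g (family_res I f \<sigma>) \<in> family I X Y (Dom C g)"
      by (rule family_res_fam) (use family_res_fam[OF f \<sigma>] X g in auto)
  qed (use f g in \<open>simp add: family_res_apply\<close>)
  fix c R t assume c: "c \<in> Ob C" "R \<in> J c" and t: "matching C (family I X Y) (family_res I) R t"
  note RA = cover_arrow[OF c]
  have tf: "t f \<in> family I X Y (Dom C f)" if "f \<in> R" for f
    using t that by (simp add: matching_def)
  have tr: "family_res I g (t f) = t (f \<cdot>\<^bsub>C\<^esub> g)" if "f \<in> R" "g \<in> Ar C" "Cod C g = Dom C f" for f g
    using t that by (simp add: matching_def)
  have t_apply: "t (f \<cdot>\<^bsub>C\<^esub> g) i h = t f i (g \<cdot>\<^bsub>C\<^esub> h)"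
    if "f \<in> R" "g \<in> Ar C" "Cod C g = Dom C f" "h \<in> Ar C" "Cod C h = Dom C g" "i \<in> I" for f g h i
    using tr[OF that(1-3), symmetric] family_res_apply[OF that(6,4,5), of "t f"] by simp
  have pull: "pull_sieve C f R \<in> J (Dom C f)" if "f \<in> Ar C" "Cod C f = c" for f
    using S.J_stable[of f "Dom C f" c R] c that by (simp add: hom_iff)
  \<comment> \<open>The values to be glued, and the result of gluing them.\<close>
  define v where "v i f x g = t (f \<cdot>\<^bsub>C\<^esub> g) i (Id C (Dom C g)) (rs (X i) g x)" for i f x g
  have pA: "g \<in> Ar C" "Cod C g = Dom C f" "f \<cdot>\<^bsub>C\<^esub> g \<in> R" "Dom C g \<in> Ob C" if "g \<in> pull_sieve C f R" for g f
    using that S.Dom_Ob by (auto simp: pull_sieve_def)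
  have v_match: "matching C (el (Y i)) (rs (Y i)) (pull_sieve C f R) (v i f x)"
    if i: "i \<in> I" and f: "f \<in> Ar C" "Cod C f = c" and x: "x \<in> el (X i) (Dom C f)" for i f x
    unfolding matching_def
  proof (intro ballI conjI impI)
    fix g assume g: "g \<in> pull_sieve C f R"
    note gA = pA[OF g]
    have rx: "rs (X i) g x \<in> el (X i) (Dom C g)"
      using rs_el[OF X[OF i] gA(1)] gA(2) x by simp
    show "v i f x g \<in> el (Y i) (Dom C g)"
      using family_el[OF tf[OF gA(3)] i, of "Id C (Dom C g)" "rs (X i) g x"] gA f rx by (simp add: v_def)
    fix h assume h: "h \<in> Ar C" "Cod C h = Dom C g"
    have "rs (Y i) h (v i f x g) = t (f \<cdot>\<^bsub>C\<^esub> g) i (Id C (Dom C g) \<cdot>\<^bsub>C\<^esub> h) (rs (X i) h (rs (X i) g x))"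
      using family_nat[OF tf[OF gA(3)] i, of "Id C (Dom C g)" "rs (X i) g x" h] gA f rx h by
          (simp add: v_def)
    also have "\<dots> = t ((f \<cdot>\<^bsub>C\<^esub> g) \<cdot>\<^bsub>C\<^esub> h) i (Id C (Dom C h)) (rs (X i) (g \<cdot>\<^bsub>C\<^esub> h) x)"
      using t_apply[OF gA(3), of h "Id C (Dom C h)" i] rs_Cmp[OF X[OF i] gA(1) h, of x] gA f h i x
          S.Dom_Ob by simp
    also have "\<dots> = v i f x (g \<cdot>\<^bsub>C\<^esub> h)"
      using f gA h by (simp add: v_def)
    finally show "rs (Y i) h (v i f x g) = v i f x (g \<cdot>\<^bsub>C\<^esub> h)" .
  qed
  define s where "s i f x = (THE y. y \<in> el (Y i) (Dom C f) \<and>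
      (\<forall>g \<in> pull_sieve C f R. rs (Y i) g y = v i f x g))" for i f x
  have s: "s i f x \<in> el (Y i) (Dom C f) \<and> (\<forall>g \<in> pull_sieve C f R. rs (Y i) g (s i f x) = v i f x g)"
    if i: "i \<in> I" and f: "f \<in> Ar C" "Cod C f = c" and x: "x \<in> el (X i) (Dom C f)" for i f x
    unfolding s_def by (rule theI'[OF glue[OF Y[OF i] S.Dom_Ob[OF f(1)] pull[OF f] v_match[OF i f x]]])
  define \<sigma> where "\<sigma> = (\<lambda>i\<in>I. \<lambda>f\<in>{f \<in> Ar C. Cod C f = c}. \<lambda>x\<in>el (X i) (Dom C f). s i f x)"
  have \<sigma>_apply: "\<sigma> i f x = s i f x" if "i \<in> I" "f \<in> Ar C" "Cod C f = c" "x \<in> el (X i) (Dom C f)" for i f x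
    using that by (simp add: \<sigma>_def)
  have \<sigma>: "\<sigma> \<in> family I X Y c"
    unfolding \<sigma>_def
  proof (rule familyI)
    fix i f g x
    assume i: "i \<in> I" and f: "f \<in> Ar C" "Cod C f = c" and x: "x \<in> el (X i) (Dom C f)"
        and g: "g \<in> Ar C" "Cod C g = Dom C f"
    have fg: "f \<cdot>\<^bsub>C\<^esub> g \<in> Ar C" "Cod C (f \<cdot>\<^bsub>C\<^esub> g) = c" "Dom C (f \<cdot>\<^bsub>C\<^esub> g) = Dom C g"
      using f g by auto
    have rx: "rs (X i) g x \<in> el (X i) (Dom C (f \<cdot>\<^bsub>C\<^esub> g))"
      using rs_el[OF X[OF i] g(1)] g(2) x fg by simp
    note s1 = s[OF i fg(1,2) rx] and s2 = s[OF i f x]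
    show "s i (f \<cdot>\<^bsub>C\<^esub> g) (rs (X i) g x) = rs (Y i) g (s i f x)"
    proof (rule separated[OF Y[OF i] S.Dom_Ob[OF fg(1)] pull[OF fg(1,2)]])
      show "rs (Y i) g (s i f x) \<in> el (Y i) (Dom C (f \<cdot>\<^bsub>C\<^esub> g))"
        using s2 rs_el[OF Y[OF i] g(1)] g(2) fg(3) by simp
      fix h assume h: "h \<in> pull_sieve C (f \<cdot>\<^bsub>C\<^esub> g) R"
      note hA = pA[OF h]
      have gh: "g \<cdot>\<^bsub>C\<^esub> h \<in> pull_sieve C f R"
        using hA f g by (auto simp: pull_sieve_def)
      have "rs (Y i) h (s i (f \<cdot>\<^bsub>C\<^esub> g) (rs (X i) g x)) = v i (f \<cdot>\<^bsub>C\<^esub> g) (rs (X i) g x) h"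
        using s1 h by blast
      also have "\<dots> = v i f x (g \<cdot>\<^bsub>C\<^esub> h)"
        using f g hA rs_Cmp[OF X[OF i] g(1) hA(1), of x] x by (simp add: v_def)
      also have "\<dots> = rs (Y i) (g \<cdot>\<^bsub>C\<^esub> h) (s i f x)"
        using s2 gh by simp
      also have "\<dots> = rs (Y i) h (rs (Y i) g (s i f x))"
        using rs_Cmp[OF Y[OF i] g(1) hA(1), of "s i f x"] s2 hA fg g by simp
      finally show "rs (Y i) h (s i (f \<cdot>\<^bsub>C\<^esub> g) (rs (X i) g x)) = rs (Y i) h (rs (Y i) g (s i f x))" .
    qed (use s1 in blast)
  qed (use s X in auto)
  have \<sigma>_rs: "family_res I f \<sigma> = t f" if f: "f \<in> R" for f
  proof (rule family_eqI[OF _ tf[OF f]])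
    show "family_res I f \<sigma> \<in> family I X Y (Dom C f)"
      using family_res_fam[of f \<sigma>] RA[OF f] \<sigma> X by simp
    fix i g x assume i: "i \<in> I" and g: "g \<in> Ar C" "Cod C g = Dom C f" and x: "x \<in> el (X i) (Dom C g)"
    have fg: "f \<cdot>\<^bsub>C\<^esub> g \<in> Ar C" "Cod C (f \<cdot>\<^bsub>C\<^esub> g) = c" "Dom C (f \<cdot>\<^bsub>C\<^esub> g) = Dom C g" "f \<cdot>\<^bsub>C\<^esub> g \<in> R"
      using RA[OF f] g by auto
    have gO: "Dom C g \<in> Ob C"
      using S.Dom_Ob g by blast
    have x': "x \<in> el (X i) (Dom C (f \<cdot>\<^bsub>C\<^esub> g))"
      using x fg by simp
    have id: "Id C (Dom C g) \<in> pull_sieve C (f \<cdot>\<^bsub>C\<^esub> g) R"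
      using fg gO by (simp add: pull_sieve_def)
    note s1 = s[OF i fg(1,2) x']
    have "family_res I f \<sigma> i g x = s i (f \<cdot>\<^bsub>C\<^esub> g) x"
      using family_res_apply[OF i g, of \<sigma>] \<sigma>_apply[OF i fg(1,2) x'] by simp
    also have "\<dots> = rs (Y i) (Id C (Dom C g)) (s i (f \<cdot>\<^bsub>C\<^esub> g) x)"
      using rs_Id[OF Y[OF i] gO] s1 fg(3) by simp
    also have "\<dots> = v i (f \<cdot>\<^bsub>C\<^esub> g) x (Id C (Dom C g))"
      using s1 id by blast
    also have "\<dots> = t (f \<cdot>\<^bsub>C\<^esub> g) i (Id C (Dom C g)) x"
      using fg gO rs_Id[OF X[OF i] gO x] by (simp add: v_def)
    also have "\<dots> = t f i g x"
      using t_apply[OF f g, of "Id C (Dom C g)" i] g gO i by simp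
    finally show "family_res I f \<sigma> i g x = t f i g x" .
  qed
  show "\<exists>!a. a \<in> family I X Y c \<and> (\<forall>f\<in>R. family_res I f a = t f)"
  proof (rule ex1I[of _ \<sigma>])
    show "\<sigma> \<in> family I X Y c \<and> (\<forall>f\<in>R. family_res I f \<sigma> = t f)"
      using \<sigma> \<sigma>_rs by blast
    fix \<tau> assume "\<tau> \<in> family I X Y c \<and> (\<forall>f\<in>R. family_res I f \<tau> = t f)"
    then have \<tau>: "\<tau> \<in> family I X Y c" "\<And>f. f \<in> R \<Longrightarrow> family_res I f \<tau> = family_res I f \<sigma>"
      using \<sigma>_rs by auto
    show "\<tau> = \<sigma>"
    proof (rule family_eqI[OF \<tau>(1) \<sigma>])
      fix i f x assume i: "i \<in> I" and f: "f \<in> Ar C" "Cod C f = c" and x: "x \<in> el (X i) (Dom C f)"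
      show "\<tau> i f x = \<sigma> i f x"
      proof (rule separated[OF Y[OF i] S.Dom_Ob[OF f(1)] pull[OF f] family_el[OF \<tau>(1) i f x]
          family_el[OF \<sigma> i f x]])
        fix g assume g: "g \<in> pull_sieve C f R"
        note gA = pA[OF g]
        have at: "\<rho> i (f \<cdot>\<^bsub>C\<^esub> g) = family_res I (f \<cdot>\<^bsub>C\<^esub> g) \<rho> i (Id C (Dom C g))" for \<rho>
          using family_res_apply[OF i, of "Id C (Dom C g)" "f \<cdot>\<^bsub>C\<^esub> g" \<rho>] gA f by simp
        have "rs (Y i) g (\<tau> i f x) = \<tau> i (f \<cdot>\<^bsub>C\<^esub> g) (rs (X i) g x)"
          by (rule family_nat[OF \<tau>(1) i f x gA(1,2), symmetric])
        also have "\<dots> = \<sigma> i (f \<cdot>\<^bsub>C\<^esub> g) (rs (X i) g x)"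
          unfolding at \<tau>(2)[OF gA(3)] ..
        also have "\<dots> = rs (Y i) g (\<sigma> i f x)"
          by (rule family_nat[OF \<sigma> i f x gA(1,2)])
        finally show "rs (Y i) g (\<tau> i f x) = rs (Y i) g (\<sigma> i f x)" .
      qed
    qed
  qed
qed

text \<open>
  The object B of families of arrows, described by the evaluation \<open>\<alpha> i b a\<close> of the i-th member of a
  generalized family b at an element a of \<open>X\<^sub>i\<close>.  A family of arrows \<open>E \<times> X\<^sub>i \<rightarrow> Y\<^sub>i\<close> is classified by a
  unique \<open>g : E \<rightarrow> B\<close>, whose evaluation at the generic elements of E and \<open>X\<^sub>i\<close> gives the family back.
\<close>

lemma object_of_families:
  assumes I: "small TYPE('u) I" and X: "\<And>i. i \<in> I \<Longrightarrow> X i \<in> Ob \<E>" and Y: "\<And>i. i \<in> I \<Longrightarrow> Y i \<in> Ob \<E>"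
  shows "\<exists>B \<in> Ob \<E>. \<exists>\<alpha>.
    (\<forall>i \<in> I. \<forall>T. \<forall>b \<in> hom \<E> T B. \<forall>a \<in> hom \<E> T (X i). \<alpha> i b a \<in> hom \<E> T (Y i)) \<and>
    (\<forall>i \<in> I. \<forall>T T'. \<forall>b \<in> hom \<E> T B. \<forall>a \<in> hom \<E> T (X i). \<forall>s \<in> hom \<E> T' T. \<alpha> i (b \<cdot> s) (a \<cdot> s) =
        \<alpha> i b a \<cdot> s) \<and>
    (\<forall>E \<in> Ob \<E>. \<forall>k. (\<forall>i \<in> I. k i \<in> hom \<E> (Dom \<E> (base_prj \<E> E (X i))) (Y i)) \<longrightarrow>
      (\<exists>!g. g \<in> hom \<E> E B \<and> (\<forall>i \<in> I. \<alpha> i (g \<cdot> base_prj \<E> E (X i)) (fibre_prj \<E> E (X i)) = k i)))"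
proof -
  have "sheaf_data TYPE('u) C J (family I X Y) (family_res I)"
    by (rule family_sheaf) (use I X Y in auto)
  from represent[OF this] obtain B e where B: "B \<in> Ob \<E>"
    and e': "\<forall>c \<in> Ob C. bij_betw (e c) (el B c) (family I X Y c)"
    and en': "\<forall>m \<in> Ar C. \<forall>x \<in> el B (Cod C m). e (Dom C m) (rs B m x) = family_res I m (e (Cod C m) x)"
    by blast
  note e = e'[rule_format] and en = en'[rule_format]
  have eF: "e c x \<in> family I X Y c" if "c \<in> Ob C" "x \<in> el B c" for c x
    using bij_betwE[OF e[OF that(1)]] that(2) by blast
  have e_inj: "x = y" if "c \<in> Ob C" "x \<in> el B c" "y \<in> el B c" "e c x = e c y" for c x y
    using bij_betw_imp_inj_on[OF e[OF that(1)]] that(2-4) by (auto dest: inj_onD)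
  define is_\<alpha> where "is_\<alpha> i b a h \<longleftrightarrow> h \<in> hom \<E> (Dom \<E> b) (Y i) \<and>
    (\<forall>c \<in> Ob C. \<forall>t \<in> el (Dom \<E> b) c. ap h c t = e c (ap b c t) i (Id C c) (ap a c t))" for i b a h
  have ex\<alpha>: "\<exists>h. is_\<alpha> i b a h" if i: "i \<in> I" and b: "b \<in> hom \<E> T B" and a: "a \<in> hom \<E> T (X i)" for i b a T
  proof -
    have T: "T \<in> Ob \<E>"
      using hom_Ob[OF b] by simp
    have D: "Dom \<E> b = T"
      using b by (simp add: hom_iff)
    have "\<exists>h \<in> hom \<E> T (Y i). \<forall>c \<in> Ob C. \<forall>t \<in> el T c. ap h c t = e c (ap b c t) i (Id C c) (ap a c t)"
    proof (rule ap_full[OF T Y[OF i]])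
      show "e c (ap b c t) i (Id C c) (ap a c t) \<in> el (Y i) c" if ct: "c \<in> Ob C" "t \<in> el T c" for c t
        using family_el[OF eF[OF ct(1) ap_el[OF b ct]] i, of "Id C c" "ap a c t"] ap_el[OF a ct] ct by simp
      fix m t assume m: "m \<in> Ar C" and t: "t \<in> el T (Cod C m)"
      note mO = S.Cod_Ob[OF m] S.Dom_Ob[OF m]
      have "e (Dom C m) (ap b (Dom C m) (rs T m t)) i (Id C (Dom C m)) (ap a (Dom C m) (rs T m t)) =
          family_res I m (e (Cod C m) (ap b (Cod C m) t)) i (Id C (Dom C m))
              (rs (X i) m (ap a (Cod C m) t))"
        using ap_rs[OF b m t] ap_rs[OF a m t] en[OF m ap_el[OF b mO(1) t]] by simp
      also have "\<dots> = e (Cod C m) (ap b (Cod C m) t) i (Id C (Cod C m) \<cdot>\<^bsub>C\<^esub> m)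
          (rs (X i) m (ap a (Cod C m) t))"
        using family_res_apply[OF i, of "Id C (Dom C m)" m] m mO by simp
      also have "\<dots> = rs (Y i) m (e (Cod C m) (ap b (Cod C m) t) i (Id C (Cod C m)) (ap a (Cod C m) t))"
        by (rule family_nat[OF eF[OF mO(1) ap_el[OF b mO(1) t]] i])
            (use m mO ap_el[OF a mO(1) t] in simp_all)
      finally show "e (Dom C m) (ap b (Dom C m) (rs T m t)) i (Id C (Dom C m)) (ap a (Dom C m) (rs T m t)) =
          rs (Y i) m (e (Cod C m) (ap b (Cod C m) t) i (Id C (Cod C m)) (ap a (Cod C m) t))" .
    qed
    then show ?thesis
      unfolding is_\<alpha>_def D by blast
  qed
  define \<alpha> where "\<alpha> i b a = (SOME h. is_\<alpha> i b a h)" for i b a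
  have \<alpha>: "\<alpha> i b a \<in> hom \<E> T (Y i)"
    "\<And>c t. c \<in> Ob C \<Longrightarrow> t \<in> el T c \<Longrightarrow> ap (\<alpha> i b a) c t = e c (ap b c t) i (Id C c) (ap a c t)"
    if i: "i \<in> I" and b: "b \<in> hom \<E> T B" and a: "a \<in> hom \<E> T (X i)" for i b a T
  proof -
    have "is_\<alpha> i b a (\<alpha> i b a)"
      unfolding \<alpha>_def by (rule someI_ex[OF ex\<alpha>[OF i b a]])
    then show "\<alpha> i b a \<in> hom \<E> T (Y i)"
      "\<And>c t. c \<in> Ob C \<Longrightarrow> t \<in> el T c \<Longrightarrow> ap (\<alpha> i b a) c t = e c (ap b c t) i (Id C c) (ap a c t)"
      unfolding is_\<alpha>_def homD(2)[OF b] by blast+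
  qed
  have nat: "\<alpha> i (b \<cdot> s) (a \<cdot> s) = \<alpha> i b a \<cdot> s"
    if i: "i \<in> I" and b: "b \<in> hom \<E> T B" and a: "a \<in> hom \<E> T (X i)" and s: "s \<in> hom \<E> T' T" for i b a s T T'
  proof (rule ap_inj[OF \<alpha>(1)[OF i Cmp_hom[OF s b] Cmp_hom[OF s a]] Cmp_hom[OF s \<alpha>(1)[OF i b a]]])
    fix c t assume ct: "c \<in> Ob C" "t \<in> el T' c"
    show "ap (\<alpha> i (b \<cdot> s) (a \<cdot> s)) c t = ap (\<alpha> i b a \<cdot> s) c t"
      using \<alpha>(2)[OF i Cmp_hom[OF s b] Cmp_hom[OF s a] ct] \<alpha>(2)[OF i b a ct(1) ap_el[OF s ct]]
        ap_Cmp[OF s b ct] ap_Cmp[OF s a ct] ap_Cmp[OF s \<alpha>(1)[OF i b a] ct] by simp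
  qed
  have univ: "\<exists>!g. g \<in> hom \<E> E B \<and> (\<forall>i \<in> I. \<alpha> i (g \<cdot> base_prj \<E> E (X i)) (fibre_prj \<E> E (X i)) = k i)"
    if E: "E \<in> Ob \<E>" and k: "\<forall>i \<in> I. k i \<in> hom \<E> (Dom \<E> (base_prj \<E> E (X i))) (Y i)" for E k
  proof -
    interpret ov: over_object \<E> E
      by unfold_locales (rule E)
    define p where "p i = base_prj \<E> E (X i)" for i
    define q where "q i = fibre_prj \<E> E (X i)" for i
    define P where "P i = Dom \<E> (p i)" for i
    have ph: "p i \<in> hom \<E> (P i) E" and qh: "q i \<in> hom \<E> (P i) (X i)" and PO: "P i \<in> Ob \<E>"
      and kh: "k i \<in> hom \<E> (P i) (Y i)" if "i \<in> I" for i
      using ov.base_prj[OF X[OF that]] k that Dom_Ob by (auto simp: p_def q_def P_def hom_iff)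
    define pair where "pair i c x y = (THE z. z \<in> el (P i) c \<and> ap (p i) c z = x \<and>
        ap (q i) c z = y)" for i c x y
    have ex1: "\<exists>!z. z \<in> el (P i) c \<and> ap (p i) c z = x \<and> ap (q i) c z = y"
      if "i \<in> I" "c \<in> Ob C" "x \<in> el E c" "y \<in> el (X i) c" for i c x y
      using product_el[OF E X[OF that(1)] that(2-4)] by (simp add: P_def p_def q_def)
    have pair: "pair i c x y \<in> el (P i) c" "ap (p i) c (pair i c x y) = x" "ap (q i) c (pair i c x y) = y"
      if "i \<in> I" "c \<in> Ob C" "x \<in> el E c" "y \<in> el (X i) c" for i c x y
      using theI'[OF ex1[OF that]] by (auto simp: pair_def)
    have pair_eq: "pair i c (ap (p i) c z) (ap (q i) c z) =
        z" if "i \<in> I" "c \<in> Ob C" "z \<in> el (P i) c" for i c z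
      using ex1[OF that(1,2) ap_el[OF ph[OF that(1)] that(2,3)] ap_el[OF qh[OF that(1)] that(2,3)]]
        pair[OF that(1,2) ap_el[OF ph[OF that(1)] that(2,3)] ap_el[OF qh[OF that(1)] that(2,3)]]
            that(3) by blast
    have pair_rs: "pair i (Dom C m) (rs E m x) (rs (X i) m y) = rs (P i) m (pair i (Cod C m) x y)"
      if i: "i \<in> I" and m: "m \<in> Ar C" and x: "x \<in> el E (Cod C m)"
          and y: "y \<in> el (X i) (Cod C m)" for i m x y
    proof -
      note pairing = pair[OF i S.Cod_Ob[OF m] x y]
      have "rs E m x = ap (p i) (Dom C m) (rs (P i) m (pair i (Cod C m) x y))"
        "rs (X i) m y = ap (q i) (Dom C m) (rs (P i) m (pair i (Cod C m) x y))"
        using ap_rs[OF ph[OF i] m pairing(1)] ap_rs[OF qh[OF i] m pairing(1)] pairing(2,3) by simp_all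
      then show ?thesis
        using pair_eq[OF i S.Dom_Ob[OF m] rs_el[OF PO[OF i] m pairing(1)]] by simp
    qed
    \<comment> \<open>Currying: the section of B that belongs to a section x of E.\<close>
    define fm where "fm c x = (\<lambda>i\<in>I. \<lambda>f\<in>{f \<in> Ar C. Cod C f = c}. \<lambda>y\<in>el (X i) (Dom C f).
      ap (k i) (Dom C f) (pair i (Dom C f) (rs E f x) y))" for c x
    have fm_apply: "fm c x i f y = ap (k i) (Dom C f) (pair i (Dom C f) (rs E f x) y)"
      if "i \<in> I" "f \<in> Ar C" "Cod C f = c" "y \<in> el (X i) (Dom C f)" for c x i f y
      using that by (simp add: fm_def)
    have fm: "fm c x \<in> family I X Y c" if c: "c \<in> Ob C" and x: "x \<in> el E c" for c x
      unfolding fm_def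
    proof (rule familyI)
      fix i f y assume i: "i \<in> I" and f: "f \<in> Ar C" "Cod C f = c" and y: "y \<in> el (X i) (Dom C f)"
      have rx: "rs E f x \<in> el E (Dom C f)"
        using rs_el[OF E f(1)] f x by simp
      note pairing = pair[OF i S.Dom_Ob[OF f(1)] rx y]
      show "ap (k i) (Dom C f) (pair i (Dom C f) (rs E f x) y) \<in> el (Y i) (Dom C f)"
        by (rule ap_el[OF kh[OF i] S.Dom_Ob[OF f(1)] pairing(1)])
      fix g assume g: "g \<in> Ar C" "Cod C g = Dom C f"
      have "pair i (Dom C g) (rs E g (rs E f x)) (rs (X i) g y) =
          rs (P i) g (pair i (Dom C f) (rs E f x) y)"
        using pair_rs[OF i g(1), of "rs E f x" y] g rx y by simp
      then show "ap (k i) (Dom C (f \<cdot>\<^bsub>C\<^esub> g)) (pair i (Dom C (f \<cdot>\<^bsub>C\<^esub> g)) (rs E (f \<cdot>\<^bsub>C\<^esub> g) x)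
          (rs (X i) g y)) =
          rs (Y i) g (ap (k i) (Dom C f) (pair i (Dom C f) (rs E f x) y))"
        using rs_Cmp[OF E f(1) g, of x] ap_rs[OF kh[OF i] g(1), of "pair i (Dom C f) (rs E f x) y"]
            pairing f g x by simp
    qed (use X in blast)
    define \<eta> where "\<eta> c x = inv_into (el B c) (e c) (fm c x)" for c x
    have \<eta>: "\<eta> c x \<in> el B c" "e c (\<eta> c x) = fm c x" if "c \<in> Ob C" "x \<in> el E c" for c x
    proof -
      have "fm c x \<in> e c ` el B c"
        using bij_betw_imp_surj_on[OF e[OF that(1)]] fm[OF that] by simp
      then show "\<eta> c x \<in> el B c" "e c (\<eta> c x) = fm c x"
        unfolding \<eta>_def by (rule inv_into_into, rule f_inv_into_f)
    qed
    have "\<exists>g \<in> hom \<E> E B. \<forall>c \<in> Ob C. \<forall>x \<in> el E c. ap g c x = \<eta> c x"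
    proof (rule ap_full[OF E B])
      fix m x assume m: "m \<in> Ar C" and x: "x \<in> el E (Cod C m)"
      note mO = S.Cod_Ob[OF m] S.Dom_Ob[OF m]
      note \<eta>1 = \<eta>[OF mO(1) x] and \<eta>2 = \<eta>[OF mO(2) rs_el[OF E m x]]
      have "fm (Dom C m) (rs E m x) = family_res I m (fm (Cod C m) x)"
      proof (rule family_eqI[OF fm[OF mO(2) rs_el[OF E m x]] family_res_fam[OF m fm[OF mO(1) x] X]])
        fix i f y assume i: "i \<in> I" and f: "f \<in> Ar C" "Cod C f = Dom C m" and y: "y \<in> el (X i) (Dom C f)"
        show "fm (Dom C m) (rs E m x) i f y = family_res I m (fm (Cod C m) x) i f y"
          using fm_apply[OF i f y, of "rs E m x"] fm_apply[OF i, of "m \<cdot>\<^bsub>C\<^esub> f" "Cod C m" y x]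
            family_res_apply[OF i f, of "fm (Cod C m) x"] rs_Cmp[OF E m f x] m f y by simp
      qed
      then show "\<eta> (Dom C m) (rs E m x) = rs B m (\<eta> (Cod C m) x)"
        by (intro e_inj[OF mO(2) \<eta>2(1) rs_el[OF B m \<eta>1(1)]]) (simp add: \<eta>2(2) en[OF m \<eta>1(1)] \<eta>1(2))
    qed (rule \<eta>)
    then obtain g where g: "g \<in> hom \<E> E B" "\<And>c x. c \<in> Ob C \<Longrightarrow> x \<in> el E c \<Longrightarrow> ap g c x = \<eta> c x"
      by blast
    have eval: "\<alpha> i (g \<cdot> p i) (q i) = k i" if i: "i \<in> I" for i
    proof (rule ap_inj[OF \<alpha>(1)[OF i Cmp_hom[OF ph[OF i] g(1)] qh[OF i]] kh[OF i]])
      fix c z assume cz: "c \<in> Ob C" "z \<in> el (P i) c"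
      note pz = ap_el[OF ph[OF i] cz] and qz = ap_el[OF qh[OF i] cz]
      have "ap (\<alpha> i (g \<cdot> p i) (q i)) c z = fm c (ap (p i) c z) i (Id C c) (ap (q i) c z)"
        using \<alpha>(2)[OF i Cmp_hom[OF ph[OF i] g(1)] qh[OF i] cz] ap_Cmp[OF ph[OF i] g(1) cz] g(2)[OF cz(1) pz]
          \<eta>(2)[OF cz(1) pz] by simp
      also have "\<dots> = ap (k i) c z"
        using fm_apply[OF i, of "Id C c" c "ap (q i) c z" "ap (p i) c z"] cz(1) qz rs_Id[OF E cz(1) pz]
            pair_eq[OF i cz]
        by simp
      finally show "ap (\<alpha> i (g \<cdot> p i) (q i)) c z = ap (k i) c z" .
    qed
    \<comment> \<open>Any arrow into B is recovered from its evaluation at the generic elements.\<close>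
    have at: "e c (ap h c x) i f y = ap (\<alpha> i (h \<cdot> p i) (q i)) (Dom C f) (pair i (Dom C f) (rs E f x) y)"
      if h: "h \<in> hom \<E> E B" and c: "c \<in> Ob C" and x: "x \<in> el E c" and i: "i \<in> I"
          and f: "f \<in> Ar C" "Cod C f = c"
        and y: "y \<in> el (X i) (Dom C f)" for h c x i f y
    proof -
      have rx: "rs E f x \<in> el E (Dom C f)"
        using rs_el[OF E f(1)] f x by simp
      note fO = S.Dom_Ob[OF f(1)]
      note pairing = pair[OF i fO rx y]
      have "ap (\<alpha> i (h \<cdot> p i) (q i)) (Dom C f) (pair i (Dom C f) (rs E f x) y) =
          e (Dom C f) (ap h (Dom C f) (rs E f x)) i (Id C (Dom C f)) y"
        using \<alpha>(2)[OF i Cmp_hom[OF ph[OF i] h] qh[OF i] fO pairing(1)] ap_Cmp[OF ph[OF i] h fO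
            pairing(1)] pairing(2,3) by simp
      also have "\<dots> = family_res I f (e c (ap h c x)) i (Id C (Dom C f)) y"
        using ap_rs[OF h f(1), of x] en[OF f(1), of "ap h c x"] ap_el[OF h c x] f x by simp
      also have "\<dots> = e c (ap h c x) i f y"
        using family_res_apply[OF i, of "Id C (Dom C f)" f] fO f by simp
      finally show ?thesis
        by simp
    qed
    show ?thesis
      unfolding p_def[symmetric] q_def[symmetric]
    proof (rule ex1I[of _ g])
      show "g \<in> hom \<E> E B \<and> (\<forall>i\<in>I. \<alpha> i (g \<cdot> p i) (q i) = k i)"
        using g(1) eval by blast
      fix h assume h: "h \<in> hom \<E> E B \<and> (\<forall>i\<in>I. \<alpha> i (h \<cdot> p i) (q i) = k i)"
      then have hh: "h \<in> hom \<E> E B"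
        by blast
      show "h = g"
      proof (rule ap_inj[OF hh g(1)])
        fix c x assume cx: "c \<in> Ob C" "x \<in> el E c"
        have "e c (ap h c x) = e c (ap g c x)"
          by (rule family_eqI[OF eF[OF cx(1) ap_el[OF hh cx]] eF[OF cx(1) ap_el[OF g(1) cx]]])
            (use at[OF hh cx] at[OF g(1) cx] h eval in simp)
        then show "ap h c x = ap g c x"
          by (rule e_inj[OF cx(1) ap_el[OF hh cx] ap_el[OF g(1) cx]])
      qed
    qed
  qed
  show ?thesis
    using B \<alpha>(1) nat univ by (intro bexI[of _ B] exI[of _ \<alpha>]) blast+
qed

end

section \<open>Homomorphisms between pulled back structures\<close>

context over_object
begin

lemma slice_el_act:
  assumes X: "X \<in> Ob C" and Y: "Y \<in> Ob C" and u: "u \<in> hom C (Dom C (\<pi> X)) Y"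
    and t: "t \<in> Ar C" "Cod C t = E" and a: "a \<in> hom C (Dom C t) X"
  shows "lift Y (\<pi> X) u \<cdot>\<^bsub>\<S>\<^esub> lift X t a = lift Y t (u \<cdot> pair X t a)"
proof -
  have a': "a \<in> Ar C" "Dom C a = Dom C t" "Cod C a = X"
    using a by (auto simp: hom_iff)
  note p = pairing[OF X t a']
  show ?thesis
    unfolding slice_el_def[of C E X t a] by (rule slice_el_Cmp[OF Y _ _ u]) (use p X in auto)
qed

lemma slice_el_Id:
  assumes X: "X \<in> Ob C"
  shows "lift X (\<pi> X) (\<epsilon> X) = Id \<S> (\<pi> X)"
  using pairing_unique[OF X, of "Id C (Dom C (\<pi> X))"] base_prj[OF X] Dom_Ob by (simp add: slice_el_def)

end

locale pulled_pair = over_object C E + M: structure_in C \<Sigma> M + N: structure_in C \<Sigma> N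
  for C :: "('o, 'a) cat" (structure) and E :: 'o
    and \<Sigma> :: "('s, 'f, 'r) signature" and M N :: "('s, 'f, 'r, 'o, 'a) struct"
begin

sublocale BM: pulled_structure C E \<Sigma> M
  by unfold_locales

sublocale BN: pulled_structure C E \<Sigma> N
  by unfold_locales

lemma act_slice_els:
  assumes u: "\<And>A. A \<in> Sorts \<Sigma> \<Longrightarrow> u A \<in> hom C (Dom C (\<pi> (SortI M A))) (SortI N A)"
    and h: "\<And>A. A \<in> Sorts \<Sigma> \<Longrightarrow> h A = lift (SortI N A) (\<pi> (SortI M A)) (u A)"
    and t: "t \<in> Ar C" "Cod C t = E"
    and As: "As \<in> lists (Sorts \<Sigma>)" and as: "els C (Dom C t) (M.ctx As) as"
  shows "els C (Dom C t) (N.ctx As) (map2 (\<lambda>A a. u A \<cdot> pair (SortI M A) t a) As as)"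
    and "map2 (\<lambda>A y. h A \<cdot>\<^bsub>\<S>\<^esub> y) As (lifts (M.ctx As) t as) =
      lifts (N.ctx As) t (map2 (\<lambda>A a. u A \<cdot> pair (SortI M A) t a) As as)"
proof -
  have "els C (Dom C t) (N.ctx As) (map2 (\<lambda>A a. u A \<cdot> pair (SortI M A) t a) As as) \<and>
      map2 (\<lambda>A y. h A \<cdot>\<^bsub>\<S>\<^esub> y) As (lifts (M.ctx As) t as) =
      lifts (N.ctx As) t (map2 (\<lambda>A a. u A \<cdot> pair (SortI M A) t a) As as)"
    using As as
  proof (induction As arbitrary: as)
    case Nil
    then show ?case
      by simp
  next
    case (Cons A As)
    then obtain a bs where as: "as = a # bs" "a \<in> hom C (Dom C t) (SortI M A)" "els C (Dom C t)
        (M.ctx As) bs"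
      by (auto simp: els_Cons)
    note A = Cons.hyps(1)
    have a': "a \<in> Ar C" "Dom C a = Dom C t" "Cod C a = SortI M A"
      using as(2) by (auto simp: hom_iff)
    note p = pairing[OF M.SortI_Ob[OF A] t a']
    have "u A \<cdot> pair (SortI M A) t a \<in> hom C (Dom C t) (SortI N A)"
      using u[OF A] p by (simp add: hom_iff)
    moreover have "h A \<cdot>\<^bsub>\<S>\<^esub> lift (SortI M A) t a = lift (SortI N A) t (u A \<cdot> pair (SortI M A) t a)"
      unfolding h[OF A] by (rule slice_el_act[OF M.SortI_Ob[OF A] N.SortI_Ob[OF A] u[OF A] t as(2)])
    ultimately show ?case
      using Cons.IH[OF as(3)] as(1) by (simp add: els_Cons)
  qed
  then show "els C (Dom C t) (N.ctx As) (map2 (\<lambda>A a. u A \<cdot> pair (SortI M A) t a) As as)"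
    and "map2 (\<lambda>A y. h A \<cdot>\<^bsub>\<S>\<^esub> y) As (lifts (M.ctx As) t as) =
      lifts (N.ctx As) t (map2 (\<lambda>A a. u A \<cdot> pair (SortI M A) t a) As as)"
    by blast+
qed

lemma preserves_BM:
  assumes u: "\<And>A. A \<in> Sorts \<Sigma> \<Longrightarrow> u A \<in> hom C (Dom C (\<pi> (SortI M A))) (SortI N A)"
    and h: "\<And>A. A \<in> Sorts \<Sigma> \<Longrightarrow> h A = lift (SortI N A) (\<pi> (SortI M A)) (u A)"
    and t: "t \<in> Ar C" "Cod C t = E"
  shows "preserves \<Sigma> \<S> BM.BM BN.BM t (\<lambda>A y. h A \<cdot>\<^bsub>\<S>\<^esub> y) \<longleftrightarrow>
    preserves \<Sigma> C M N (Dom C t) (\<lambda>A a. u A \<cdot> pair (SortI M A) t a)"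
proof -
  let ?\<theta> = "\<lambda>A a. u A \<cdot> pair (SortI M A) t a"
  have all_els: "(\<forall>ys. els \<S> t (map \<pi> (M.ctx As)) ys \<longrightarrow> K ys) \<longleftrightarrow>
      (\<forall>as. els C (Dom C t) (M.ctx As) as \<longrightarrow> K (lifts (M.ctx As) t as))" if As: "As \<in> lists (Sorts \<Sigma>)"
          for As K
    using els_slice_els[OF _ t] els_slice_els_surj[OF M.ctx_Ob[OF As], of t] by metis
  have F: "(h (FCod \<Sigma> f) \<cdot>\<^bsub>\<S>\<^esub> (FunI BM.BM f \<cdot>\<^bsub>\<S>\<^esub>
        tuple \<S> t (map \<pi> (M.ctx (FDom \<Sigma> f))) (lifts (M.ctx (FDom \<Sigma> f)) t as)) =
      FunI BN.BM f \<cdot>\<^bsub>\<S>\<^esub> tuple \<S> t (map \<pi> (N.ctx (FDom \<Sigma> f)))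
        (map2 (\<lambda>A y. h A \<cdot>\<^bsub>\<S>\<^esub> y) (FDom \<Sigma> f) (lifts (M.ctx (FDom \<Sigma> f)) t as))) \<longleftrightarrow>
      (?\<theta> (FCod \<Sigma> f) (FunI M f \<cdot> tuple C (Dom C t) (M.ctx (FDom \<Sigma> f)) as) =
      FunI N f \<cdot> tuple C (Dom C t) (N.ctx (FDom \<Sigma> f)) (map2 ?\<theta> (FDom \<Sigma> f) as))"
    if f: "f \<in> Funs \<Sigma>" and as: "els C (Dom C t) (M.ctx (FDom \<Sigma> f)) as" for f as
  proof -
    note A = M.FCod_sort[OF f]
    note act = act_slice_els[of u h, OF u h t M.FDom_sorts[OF f] as, simplified]
    have fa: "FunI M f \<cdot> tuple C (Dom C t) (M.ctx (FDom \<Sigma> f)) as \<in> hom C (Dom C t) (SortI M (FCod \<Sigma> f))"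
      by (rule Cmp_hom[OF tuple(1)[OF as] M.FunI_hom[OF f]])
    have fb: "FunI N f \<cdot> tuple C (Dom C t) (N.ctx (FDom \<Sigma> f)) (map2 ?\<theta> (FDom \<Sigma> f) as) \<in> hom C (Dom C t)
        (SortI N (FCod \<Sigma> f))"
      by (rule Cmp_hom[OF tuple(1)[OF act(1)] N.FunI_hom[OF f]])
    have p: "pair (SortI M (FCod \<Sigma> f)) t (FunI M f \<cdot> tuple C (Dom C t) (M.ctx (FDom \<Sigma> f)) as) \<in>
        hom C (Dom C t) (Dom C (\<pi> (SortI M (FCod \<Sigma> f))))"
      using pairing[OF M.SortI_Ob[OF A] t] fa by (simp add: hom_iff)
    have ub: "?\<theta> (FCod \<Sigma> f) (FunI M f \<cdot> tuple C (Dom C t) (M.ctx (FDom \<Sigma> f)) as) \<in> hom C (Dom C t)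
        (SortI N (FCod \<Sigma> f))"
      by (rule Cmp_hom[OF p u[OF A]])
    show ?thesis
      unfolding act(2) BM.FunI_BM(2)[OF f t as] BN.FunI_BM(2)[OF f t act(1)] h[OF A]
        slice_el_act[OF M.SortI_Ob[OF A] N.SortI_Ob[OF A] u[OF A] t fa]
      by (intro iffI slice_el_inject[OF N.SortI_Ob[OF A] t ub fb]) simp_all
  qed
  have R: "(factors \<S> (tuple \<S> t (map \<pi> (M.ctx (RAr \<Sigma> R))) (lifts (M.ctx (RAr \<Sigma> R)) t as)) (RelI BM.BM R) \<longrightarrow>
      factors \<S> (tuple \<S> t (map \<pi> (N.ctx (RAr \<Sigma> R)))
        (map2 (\<lambda>A y. h A \<cdot>\<^bsub>\<S>\<^esub> y) (RAr \<Sigma> R) (lifts (M.ctx (RAr \<Sigma> R)) t as))) (RelI BN.BM R)) \<longleftrightarrow>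
      (factors C (tuple C (Dom C t) (M.ctx (RAr \<Sigma> R)) as) (RelI M R) \<longrightarrow>
      factors C (tuple C (Dom C t) (N.ctx (RAr \<Sigma> R)) (map2 ?\<theta> (RAr \<Sigma> R) as)) (RelI N R))"
    if R: "R \<in> Rels \<Sigma>" and as: "els C (Dom C t) (M.ctx (RAr \<Sigma> R)) as" for R as
  proof -
    note act = act_slice_els[of u h, OF u h t M.RAr_sorts[OF R] as, simplified]
    show ?thesis
      unfolding act(2) BM.RelI_BM(2)[OF R t as] BN.RelI_BM(2)[OF R t act(1)] ..
  qed
  show ?thesis
    unfolding preserves_def BM.ctx_BM BN.ctx_BM
    using all_els[OF M.FDom_sorts] all_els[OF M.RAr_sorts] F R by simp
qed

text \<open>
  A family of arrows over E is given by arrows \<open>u A : E \<times> MA \<rightarrow> NA\<close>.  On an element of \<open>!\<^sub>E\<^sup>*(M)\<close> at t,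
  transposed from a, it acts by applying \<open>u A\<close> to the pair of t and a.
\<close>

lemma struct_homs_BM:
  assumes u: "\<And>A. A \<in> Sorts \<Sigma> \<Longrightarrow> u A \<in> hom C (Dom C (\<pi> (SortI M A))) (SortI N A)"
  shows "(\<lambda>A\<in>Sorts \<Sigma>. lift (SortI N A) (\<pi> (SortI M A)) (u A)) \<in> struct_homs \<Sigma> \<S> BM.BM BN.BM \<longleftrightarrow>
    (\<forall>t \<in> Ar C. Cod C t = E \<longrightarrow> preserves \<Sigma> C M N (Dom C t) (\<lambda>A a. u A \<cdot> pair (SortI M A) t a))"
    (is "?h \<in> _ \<longleftrightarrow> _")
proof -
  have "?h \<in> (\<Pi>\<^sub>E A \<in> Sorts \<Sigma>. hom \<S> (SortI BM.BM A) (SortI BN.BM A))"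
    using slice_el_hom[OF N.SortI_Ob _ _ u] M.SortI_Ob by (simp add: BM.SortI_BM BN.SortI_BM)
  moreover have "preserves \<Sigma> \<S> BM.BM BN.BM t \<theta>" if "t \<notin> Ob \<S>" for t \<theta>
    using that unfolding preserves_def els_def by blast
  moreover have "preserves \<Sigma> \<S> BM.BM BN.BM t (\<lambda>A y. ?h A \<cdot>\<^bsub>\<S>\<^esub> y) \<longleftrightarrow>
      preserves \<Sigma> C M N (Dom C t) (\<lambda>A a. u A \<cdot> pair (SortI M A) t a)" if "t \<in> Ar C" "Cod C t = E" for t
    by (rule preserves_BM[OF u _ that]) simp_all
  ultimately show ?thesis
    unfolding S.struct_homs_iff[OF M.sig BM.is_struct_BM BN.is_struct_BM] using slice_simps(5)[of _ C
        E] by blast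
qed

end

lemma (in geometric_category) preserves_cong:
  assumes sig: "is_signature \<Sigma>" and M: "is_struct \<Sigma> C M"
    and eq: "\<And>A a. A \<in> Sorts \<Sigma> \<Longrightarrow> a \<in> hom C X (SortI M A) \<Longrightarrow> \<theta> A a = \<theta>' A a"
  shows "preserves \<Sigma> C M N X \<theta> \<longleftrightarrow> preserves \<Sigma> C M N X \<theta>'"
proof -
  interpret M: structure_in C \<Sigma> M
    by unfold_locales fact+
  have m: "map2 \<theta> As xs = map2 \<theta>' As xs" if "As \<in> lists (Sorts \<Sigma>)" "els C X (map (SortI M) As) xs" for As xs
    using that
  proof (induction As arbitrary: xs)
    case (Cons A As)
    then show ?case
      using eq by (auto simp: els_Cons simp del: map_eq_conv)
  qed simp
  have "\<theta> (FCod \<Sigma> f) (FunI M f \<cdot> tuple C X (map (SortI M) (FDom \<Sigma> f)) xs) =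
      \<theta>' (FCod \<Sigma> f) (FunI M f \<cdot> tuple C X (map (SortI M) (FDom \<Sigma> f)) xs)"
    if "f \<in> Funs \<Sigma>" "els C X (map (SortI M) (FDom \<Sigma> f)) xs" for f xs
    by (rule eq[OF M.FCod_sort[OF that(1)] Cmp_hom[OF tuple(1)[OF that(2)] M.FunI_hom[OF that(1)]]])
  then show ?thesis
    unfolding preserves_def using m M.FDom_sorts M.RAr_sorts by (simp del: map_eq_conv)
qed

section \<open>Families of arrows that preserve structure\<close>

text \<open>
  The object B and the evaluation \<open>\<alpha>\<close> from \<open>object_of_families\<close>, with the sorts as index set.
\<close>

locale family_action = M: structure_in C \<Sigma> M + N: structure_in C \<Sigma> N
  for C :: "('o, 'a) cat" (structure)
    and \<Sigma> :: "('s, 'f, 'r) signature" and M N :: "('s, 'f, 'r, 'o, 'a) struct" +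
  fixes B :: 'o and \<alpha> :: "'s \<Rightarrow> 'a \<Rightarrow> 'a \<Rightarrow> 'a"
  assumes B: "B \<in> Ob C"
    and \<alpha>_hom: "A \<in> Sorts \<Sigma> \<Longrightarrow> b \<in> hom C T B \<Longrightarrow> a \<in> hom C T (SortI M A) \<Longrightarrow> \<alpha> A b a \<in> hom C T (SortI N A)"
    and \<alpha>_nat: "A \<in> Sorts \<Sigma> \<Longrightarrow> b \<in> hom C T B \<Longrightarrow> a \<in> hom C T (SortI M A) \<Longrightarrow> s \<in> hom C T' T \<Longrightarrow>
      \<alpha> A (b \<cdot> s) (a \<cdot> s) = \<alpha> A b a \<cdot> s"
begin

text \<open>
  The stages s range over all arrows into the domain of b, so that being respectful is by definition
  stable under change of stage.
\<close>

definition respectful :: "'a \<Rightarrow> bool"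
  where "respectful b \<longleftrightarrow> (\<forall>s \<in> Ar C. Cod C s = Dom C b \<longrightarrow> preserves \<Sigma> C M N (Dom C s) (\<lambda>A a. \<alpha> A (b \<cdot> s) a))"

lemma els_act:
  assumes As: "As \<in> lists (Sorts \<Sigma>)" and b: "b \<in> hom C T B" and as: "els C T (M.ctx As) as"
  shows "els C T (N.ctx As) (map2 (\<lambda>A a. \<alpha> A b a) As as)"
    and "s \<in> hom C T' T \<Longrightarrow> map (\<lambda>x. x \<cdot> s) (map2 (\<lambda>A a. \<alpha> A b a) As as) =
      map2 (\<lambda>A a. \<alpha> A (b \<cdot> s) a) As (map (\<lambda>x. x \<cdot> s) as)"
proof -
  show "els C T (N.ctx As) (map2 (\<lambda>A a. \<alpha> A b a) As as)"
    using As as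
  proof (induction As arbitrary: as)
    case (Cons A As)
    then show ?case
      using \<alpha>_hom[OF _ b] by (auto simp: M.els_Cons)
  qed simp
  show "map (\<lambda>x. x \<cdot> s) (map2 (\<lambda>A a. \<alpha> A b a) As as) = map2 (\<lambda>A a. \<alpha> A (b \<cdot> s) a) As (map (\<lambda>x. x \<cdot> s) as)"
    if s: "s \<in> hom C T' T"
    using As as
  proof (induction As arbitrary: as)
    case (Cons A As)
    then show ?case
      using \<alpha>_nat[OF _ b _ s] by (auto simp: M.els_Cons)
  qed simp
qed

lemma respectful_Cmp:
  assumes b: "b \<in> Ar C" "respectful b" and s: "s \<in> Ar C" "Cod C s = Dom C b"
  shows "respectful (b \<cdot> s)"
  unfolding respectful_def
proof (intro ballI impI)
  fix r assume r: "r \<in> Ar C" "Cod C r = Dom C (b \<cdot> s)"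
  then have "preserves \<Sigma> C M N (Dom C (s \<cdot> r)) (\<lambda>A a. \<alpha> A (b \<cdot> (s \<cdot> r)) a)"
    using b(2)[unfolded respectful_def, rule_format, of "s \<cdot> r"] b(1) s by simp
  then show "preserves \<Sigma> C M N (Dom C r) (\<lambda>A a. \<alpha> A ((b \<cdot> s) \<cdot> r) a)"
    using r b s by simp
qed

text \<open>
  For a function symbol the condition is an equation and for a relation symbol it is a factorization
  through a subobject.  Both are local, by \<open>local_eq\<close> and \<open>local_factors\<close>; at a stage s they are
  tested on the cover W pulled back along s.
\<close>

lemma respectful_local:
  assumes b: "b \<in> hom C T B" and cov: "covers C T W"
    and W: "\<And>w. w \<in> W \<Longrightarrow> w \<in> Ar C \<and> Cod C w = T \<and> respectful (b \<cdot> w)"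
  shows "respectful b"
  unfolding respectful_def
proof (intro ballI impI)
  have bA: "b \<in> Ar C" "Dom C b = T" "Cod C b = B"
    using b by (auto simp: hom_iff)
  fix s assume s: "s \<in> Ar C" "Cod C s = Dom C b"
  let ?S = "Dom C s" and ?W = "pulled C W s"
  have cov': "covers C ?S ?W"
    by (rule M.covers_stable[OF cov]) (use W s bA in auto)
  have bs: "b \<cdot> s \<in> hom C ?S B"
    using s bA by (simp add: hom_iff)
  have W': "w \<in> hom C (Dom C w) ?S \<and> preserves \<Sigma> C M N (Dom C w) (\<lambda>A a. \<alpha> A ((b \<cdot> s) \<cdot> w) a)" if w: "w
      \<in> ?W" for w
  proof -
    have wA: "w \<in> Ar C" "Cod C w = ?S"
      using w by (auto simp: pulled_def)
    obtain x v where x: "x \<in> W" and v: "v \<in> Ar C" "Dom C v = Dom C w" "Cod C v = Dom C x" "x \<cdot> v = s \<cdot> w"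
      using w s by (auto simp: pulled_def M.factors_iff)
    have xA: "x \<in> Ar C" "Cod C x = T" "respectful (b \<cdot> x)"
      using W[OF x] by auto
    have "b \<cdot> x \<in> Ar C" "Dom C (b \<cdot> x) = Dom C x"
      using xA bA by simp_all
    then have "preserves \<Sigma> C M N (Dom C v) (\<lambda>A a. \<alpha> A ((b \<cdot> x) \<cdot> v) a)"
      using xA(3) v(1,3) unfolding respectful_def by simp
    moreover have "(b \<cdot> x) \<cdot> v = b \<cdot> (x \<cdot> v)"
      using xA bA v(1,3) by simp
    moreover have "(b \<cdot> s) \<cdot> w = b \<cdot> (s \<cdot> w)"
      using wA bA s by simp
    ultimately show ?thesis
      using v(2,4) wA by (simp add: hom_iff)
  qed
  show "preserves \<Sigma> C M N ?S (\<lambda>A a. \<alpha> A (b \<cdot> s) a)"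
    unfolding preserves_def
  proof (intro conjI ballI allI impI)
    fix f xs assume f: "f \<in> Funs \<Sigma>" and xs: "els C ?S (M.ctx (FDom \<Sigma> f)) xs"
    note D = M.FDom_sorts[OF f] and A = M.FCod_sort[OF f]
    let ?x = "FunI M f \<cdot> tuple C ?S (M.ctx (FDom \<Sigma> f)) xs"
    let ?ys = "map2 (\<lambda>A a. \<alpha> A (b \<cdot> s) a) (FDom \<Sigma> f) xs"
    have x: "?x \<in> hom C ?S (SortI M (FCod \<Sigma> f))"
      by (rule M.Cmp_hom[OF M.tuple(1)[OF xs] M.FunI_hom[OF f]])
    note ys = els_act(1)[OF D bs xs]
    have y: "FunI N f \<cdot> tuple C ?S (N.ctx (FDom \<Sigma> f)) ?ys \<in> hom C ?S (SortI N (FCod \<Sigma> f))"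
      by (rule M.Cmp_hom[OF M.tuple(1)[OF ys] N.FunI_hom[OF f]])
    show "\<alpha> (FCod \<Sigma> f) (b \<cdot> s) ?x = FunI N f \<cdot> tuple C ?S (N.ctx (FDom \<Sigma> f)) ?ys"
    proof (rule M.local_eq[OF cov' \<alpha>_hom[OF A bs x] y])
      fix w assume w: "w \<in> ?W"
      note wh = conjunct1[OF W'[OF w]]
      have "\<alpha> (FCod \<Sigma> f) (b \<cdot> s) ?x \<cdot> w = \<alpha> (FCod \<Sigma> f) ((b \<cdot> s) \<cdot> w) (?x \<cdot> w)"
        by (rule \<alpha>_nat[OF A bs x wh, symmetric])
      also have "?x \<cdot> w = FunI M f \<cdot> tuple C (Dom C w) (M.ctx (FDom \<Sigma> f)) (map (\<lambda>x. x \<cdot> w) xs)"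
        unfolding M.Cmp_assoc[OF wh M.tuple(1)[OF xs] M.FunI_hom[OF f]] M.tuple_Cmp[OF xs wh] ..
      also have "\<alpha> (FCod \<Sigma> f) ((b \<cdot> s) \<cdot> w) \<dots> = FunI N f \<cdot> tuple C (Dom C w) (N.ctx (FDom \<Sigma> f))
          (map2 (\<lambda>A a. \<alpha> A ((b \<cdot> s) \<cdot> w) a) (FDom \<Sigma> f) (map (\<lambda>x. x \<cdot> w) xs))"
        using conjunct2[OF W'[OF w]] f M.els_Cmp[OF xs wh] unfolding preserves_def by blast
      also have "\<dots> = (FunI N f \<cdot> tuple C ?S (N.ctx (FDom \<Sigma> f)) ?ys) \<cdot> w"
        unfolding M.Cmp_assoc[OF wh M.tuple(1)[OF ys] N.FunI_hom[OF f]] M.tuple_Cmp[OF ys wh]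
          els_act(2)[OF D bs xs wh] ..
      finally show "w \<in> Ar C \<and> Cod C w = ?S \<and>
          \<alpha> (FCod \<Sigma> f) (b \<cdot> s) ?x \<cdot> w = (FunI N f \<cdot> tuple C ?S (N.ctx (FDom \<Sigma> f)) ?ys) \<cdot> w"
        using wh by (simp add: hom_iff)
    qed
  next
    fix R xs assume R: "R \<in> Rels \<Sigma>" and xs: "els C ?S (M.ctx (RAr \<Sigma> R)) xs"
      and fac: "factors C (tuple C ?S (M.ctx (RAr \<Sigma> R)) xs) (RelI M R)"
    note D = M.RAr_sorts[OF R]
    let ?ys = "map2 (\<lambda>A a. \<alpha> A (b \<cdot> s) a) (RAr \<Sigma> R) xs"
    note ys = els_act(1)[OF D bs xs]
    note ty = M.tuple_Ar[OF ys] and tx = M.tuple_Ar[OF xs]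
    show "factors C (tuple C ?S (N.ctx (RAr \<Sigma> R)) ?ys) (RelI N R)"
    proof (rule M.local_factors)
      show "covers C (Dom C (tuple C ?S (N.ctx (RAr \<Sigma> R)) ?ys)) ?W"
        unfolding ty by (rule cov')
      show "RelI N R \<in> subs C (Cod C (tuple C ?S (N.ctx (RAr \<Sigma> R)) ?ys))"
        unfolding ty by (rule N.RelI_subs[OF R])
      fix w assume w: "w \<in> ?W"
      note wh = conjunct1[OF W'[OF w]]
      have "factors C (tuple C ?S (M.ctx (RAr \<Sigma> R)) xs \<cdot> w) (RelI M R)"
        by (rule M.factors_Cmp[OF fac M.subsD(1)[OF M.RelI_subs[OF R]]]) (use wh tx in \<open>auto simp: hom_iff\<close>)
      then have "factors C (tuple C (Dom C w) (N.ctx (RAr \<Sigma> R))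
          (map2 (\<lambda>A a. \<alpha> A ((b \<cdot> s) \<cdot> w) a) (RAr \<Sigma> R) (map (\<lambda>x. x \<cdot> w) xs))) (RelI N R)"
        using conjunct2[OF W'[OF w]] R M.els_Cmp[OF xs wh] unfolding preserves_def M.tuple_Cmp[OF xs
            wh] by blast
      then have "factors C (tuple C ?S (N.ctx (RAr \<Sigma> R)) ?ys \<cdot> w) (RelI N R)"
        unfolding M.tuple_Cmp[OF ys wh] els_act(2)[OF D bs xs wh] .
      then show "w \<in> Ar C \<and> Cod C w = Dom C (tuple C ?S (N.ctx (RAr \<Sigma> R)) ?ys) \<and>
          factors C (tuple C ?S (N.ctx (RAr \<Sigma> R)) ?ys \<cdot> w) (RelI N R)"
        using wh ty by (simp add: hom_iff)
    qed (rule ty)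
  qed
qed

text \<open>
  Take the union of the images of all respectful arrows.  An arrow that factors through it is
  locally respectful, hence respectful.
\<close>

lemma respectful_subobject: "\<exists>k \<in> subs C B. \<forall>b \<in> Ar C. Cod C b = B \<longrightarrow> (factors C b k \<longleftrightarrow> respectful b)"
proof -
  define U where "U = {u \<in> Ar C. Cod C u = B \<and> respectful u}"
  obtain k where k: "k \<in> subs C B" "\<And>g. g \<in> Ar C \<Longrightarrow> Cod C g = B \<Longrightarrow>
      factors C g k \<longleftrightarrow> covers C (Dom C g) (pulled C U g)"
    using M.ex_union[of B U] B by (auto simp: U_def)
  have "factors C b k \<longleftrightarrow> respectful b" if b: "b \<in> Ar C" "Cod C b = B" for b
  proof
    assume "factors C b k"
    then have cov: "covers C (Dom C b) (pulled C U b)"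
      using k(2)[OF b] by blast
    show "respectful b"
    proof (rule respectful_local[OF _ cov])
      show "b \<in> hom C (Dom C b) B"
        using b by (simp add: hom_iff)
      fix w assume w: "w \<in> pulled C U b"
      then obtain u v where u: "u \<in> U" and v: "v \<in> Ar C" "Cod C v = Dom C u" "u \<cdot> v = b \<cdot> w"
        by (auto simp: pulled_def M.factors_iff)
      have "respectful (u \<cdot> v)"
        by (rule respectful_Cmp) (use u v in \<open>auto simp: U_def\<close>)
      then show "w \<in> Ar C \<and> Cod C w = Dom C b \<and> respectful (b \<cdot> w)"
        using w v by (auto simp: pulled_def)
    qed
  next
    assume "respectful b"
    then have "Id C (Dom C b) \<in> pulled C U b"
      using b M.Dom_Ob by (auto simp: pulled_def U_def intro!: bexI[of _ b])
    then show "factors C b k"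
      using k(2)[OF b] M.covers_Id by blast
  qed
  then show ?thesis
    using k(1) by blast
qed

end

section \<open>Change of base\<close>

lemma (in geometric_category) pb_functor_ar:
  assumes f: "f \<in> hom C E' E" and x: "x \<in> Ar C" "Cod C x = E" and y: "y \<in> Ar C" "Cod C y = E"
    and g: "g \<in> Ar C" "Dom C g = Dom C x" "Cod C g = Dom C y" "y \<cdot> g = x"
  obtains u where "FAr (pb_functor C f) (x, g, y) = (fst (pb C f x), u, fst (pb C f y))"
    "u \<in> Ar C" "Dom C u = Dom C (fst (pb C f x))" "Cod C u = Dom C (fst (pb C f y))"
    "fst (pb C f y) \<cdot> u = fst (pb C f x)" "snd (pb C f y) \<cdot> u = g \<cdot> snd (pb C f x)"
proof -
  have fA: "f \<in> Ar C" "Dom C f = E'" "Cod C f = E"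
    using f by (auto simp: hom_iff)
  have pbx: "is_pullback C f x (fst (pb C f x)) (snd (pb C f x))"
      and pby: "is_pullback C f y (fst (pb C f y)) (snd (pb C f y))"
    by (rule pb_is_pullback; use fA x y in simp)+
  note px = pullbackD[OF pbx fA(1) x(1)] and py = pullbackD[OF pby fA(1) y(1)]
  have "y \<cdot> (g \<cdot> snd (pb C f x)) = (y \<cdot> g) \<cdot> snd (pb C f x)"
    by (rule assoc[symmetric]) (use px g(1-3) x y in simp_all)
  also have "\<dots> = f \<cdot> fst (pb C f x)"
    using px(6) g(4) by simp
  finally have eq: "f \<cdot> fst (pb C f x) = y \<cdot> (g \<cdot> snd (pb C f x))" ..
  obtain u where u: "u \<in> Ar C" "Dom C u = Dom C (fst (pb C f x))" "Cod C u = Dom C (fst (pb C f y))"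
    "fst (pb C f y) \<cdot> u = fst (pb C f x)" "snd (pb C f y) \<cdot> u = g \<cdot> snd (pb C f x)"
    by (rule pullback_lift[OF pby _ _ _ _ _ eq]) (use px py g(1-3) in simp_all)
  have "(THE u. u \<in> hom C (Dom C (fst (pb C f x))) (Dom C (fst (pb C f y))) \<and>
        fst (pb C f y) \<cdot>\<^bsub>C\<^esub> u = fst (pb C f x) \<and> snd (pb C f y) \<cdot>\<^bsub>C\<^esub> u = g \<cdot>\<^bsub>C\<^esub> snd (pb C f x)) = u"
  proof (rule the_equality)
    show "w = u" if "w \<in> hom C (Dom C (fst (pb C f x))) (Dom C (fst (pb C f y))) \<and>
        fst (pb C f y) \<cdot> w = fst (pb C f x) \<and> snd (pb C f y) \<cdot> w = g \<cdot> snd (pb C f x)" for w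
      by (rule pullback_eq[OF pby fA(1) y(1)]) (use that u in \<open>simp_all add: hom_iff\<close>)
  qed (use u in \<open>simp add: hom_iff\<close>)
  then have "FAr (pb_functor C f) (x, g, y) = (fst (pb C f x), u, fst (pb C f y))"
    by (simp add: pb_functor_def)
  then show thesis
    using that u by blast
qed

text \<open>
  With P and Q the projections of the pullback of f and \<open>!\<^sub>E\<^sup>* X\<close>, the canonical isomorphism is the
  transpose of the composite of Q with the projection to X.  The inverse comes from the universal
  property of P and Q, applied to \<open>!\<^sub>E\<^sub>'\<^sup>* X\<close> and to the pair of \<open>f \<cdot> !\<^sub>E\<^sub>'\<^sup>* X\<close> and the projection to X.
\<close>

lemma (in geometric_category) bang_pb_comp:
  assumes f: "f \<in> hom C E' E" and X: "X \<in> Ob C"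
  defines "P \<equiv> fst (pb C f (base_prj C E X))" and "Q \<equiv> snd (pb C f (base_prj C E X))"
  obtains w where "bang_pb_comp C f X = slice_el C E' X P (fibre_prj C E X \<cdot> Q)"
    "P \<in> Ar C" "Cod C P = E'" "Q \<in> Ar C" "Dom C Q = Dom C P" "Cod C Q =
        Dom C (base_prj C E X)" "f \<cdot> P = base_prj C E X \<cdot> Q"
    "inv_ar (slice C E') (bang_pb_comp C f X) = (base_prj C E' X, w, P)"
    "w \<in> Ar C" "Dom C w = Dom C (base_prj C E' X)" "Cod C w = Dom C P"
    "P \<cdot> w = base_prj C E' X" "Q \<cdot> w = pairing C E X (f \<cdot> base_prj C E' X) (fibre_prj C E' X)"
proof -
  have fA: "f \<in> Ar C" "Dom C f = E'" "Cod C f = E"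
    using f by (auto simp: hom_iff)
  have E: "E \<in> Ob C" and E': "E' \<in> Ob C"
    using hom_Ob[OF f] by auto
  interpret A: over_object C E
    by unfold_locales (rule E)
  interpret A': over_object C E'
    by unfold_locales (rule E')
  note b = A.base_prj[OF X] and b' = A'.base_prj[OF X]
  have pb: "is_pullback C f (base_prj C E X) P Q"
    unfolding P_def Q_def by (rule pb_is_pullback) (use fA b in simp_all)
  note pq = pullbackD[OF pb fA(1) b(1)]
  have P: "P \<in> Ar C" "Cod C P = E'"
    using pq fA by simp_all
  have a: "fibre_prj C E X \<cdot> Q \<in> hom C (Dom C P) X"
    using pq b by (simp add: hom_iff)
  let ?c = "slice_el C E' X P (fibre_prj C E X \<cdot> Q)"
  note ch = A'.slice_el_hom[OF X P a]
  have sec': "fibre_prj C E' X \<cdot> slice_ar (slice_el C E' X P c) = c" if "c \<in> hom C (Dom C P) X" for c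
    using A'.pairing(5)[OF X P, of c] that by (simp add: slice_el_def hom_iff)
  have comp: "bang_pb_comp C f X = ?c"
  proof -
    have "(THE t. t \<in> hom (slice C E') P (base_prj C E' X) \<and>
        fibre_prj C E' X \<cdot> slice_ar t = fibre_prj C E X \<cdot> Q) = ?c"
    proof (rule the_equality)
      show "?c \<in> hom (slice C E') P (base_prj C E' X) \<and>
          fibre_prj C E' X \<cdot> slice_ar ?c = fibre_prj C E X \<cdot> Q"
        using ch sec'[OF a] by blast
      fix t assume t: "t \<in> hom (slice C E') P (base_prj C E' X) \<and>
          fibre_prj C E' X \<cdot> slice_ar t = fibre_prj C E X \<cdot> Q"
      then obtain c where c: "c \<in> hom C (Dom C P) X" "t = slice_el C E' X P c"
        using A'.slice_el_surj[OF X] by blast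
      then show "t = ?c"
        using t sec'[OF c(1)] by simp
    qed
    then show ?thesis
      unfolding bang_pb_comp_def Let_def fA A.FOb_bang A'.FOb_bang fibre_prj_def[symmetric] P_def Q_def
      by (simp add: pb_functor_def)
  qed
  have fb: "f \<cdot> base_prj C E' X \<in> Ar C" "Cod C (f \<cdot> base_prj C E' X) =
      E" "Dom C (f \<cdot> base_prj C E' X) = Dom C (base_prj C E' X)"
    using fA b' by simp_all
  have b2: "fibre_prj C E' X \<in> Ar C" "Dom C (fibre_prj C E' X) =
      Dom C (f \<cdot> base_prj C E' X)" "Cod C (fibre_prj C E' X) = X"
    using fb b' by simp_all
  let ?r = "pairing C E X (f \<cdot> base_prj C E' X) (fibre_prj C E' X)"
  note r = A.pairing[OF X fb(1,2) b2]
  obtain w where w: "w \<in> Ar C" "Dom C w = Dom C (base_prj C E' X)" "Cod C w = Dom C P"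
    "P \<cdot> w = base_prj C E' X" "Q \<cdot> w = ?r"
    by (rule pullback_lift[OF pb, of "base_prj C E' X" ?r]) (use r fb b' fA in simp_all)
  let ?j = "(base_prj C E' X, w, P)"
  have j: "?j \<in> hom (slice C E') (base_prj C E' X) P"
    using w P b' by (simp add: hom_slice_iff)
  have "?c \<cdot>\<^bsub>slice C E'\<^esub> ?j = slice_el C E' X (base_prj C E' X) ((fibre_prj C E X \<cdot> Q) \<cdot> w)"
    by (rule A'.slice_el_Cmp[OF X P a]) (use w in simp_all)
  also have "(fibre_prj C E X \<cdot> Q) \<cdot> w = fibre_prj C E X \<cdot> (Q \<cdot> w)"
    by (rule assoc) (use w(1-3) pq b in simp_all)
  also have "\<dots> = fibre_prj C E' X"
    unfolding w(5) by (rule r(5))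
  finally have cj: "?c \<cdot>\<^bsub>slice C E'\<^esub> ?j = Id (slice C E') (base_prj C E' X)"
    using A'.slice_el_Id[OF X] by simp
  let ?p = "pairing C E' X P (fibre_prj C E X \<cdot> Q)"
  have a': "fibre_prj C E X \<cdot> Q \<in> Ar C" "Dom C (fibre_prj C E X \<cdot> Q) =
      Dom C P" "Cod C (fibre_prj C E X \<cdot> Q) = X"
    using a by (auto simp: hom_iff)
  note p = A'.pairing[OF X P a']
  have "w \<cdot> ?p = Id C (Dom C P)"
  proof (rule pullback_eq[OF pb fA(1) b(1)])
    have "P \<cdot> (w \<cdot> ?p) = (P \<cdot> w) \<cdot> ?p"
      by (rule assoc[symmetric]) (use w(1-3) p P in simp_all)
    then show "P \<cdot> (w \<cdot> ?p) = P \<cdot> Id C (Dom C P)"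
      unfolding w(4) p(4) using P by simp
    have "Q \<cdot> (w \<cdot> ?p) = (Q \<cdot> w) \<cdot> ?p"
      by (rule assoc[symmetric]) (use w(1-3) p pq in simp_all)
    also have "\<dots> = pairing C E X ((f \<cdot> base_prj C E' X) \<cdot> ?p) (fibre_prj C E' X \<cdot> ?p)"
      unfolding w(5) by (rule A.pairing_Cmp[OF X fb(1,2) b2]) (use p fb in simp_all)
    also have "(f \<cdot> base_prj C E' X) \<cdot> ?p = f \<cdot> (base_prj C E' X \<cdot> ?p)"
      by (rule assoc) (use p(1-3) fA b' in simp_all)
    also have "pairing C E X (f \<cdot> (base_prj C E' X \<cdot> ?p)) (fibre_prj C E' X \<cdot> ?p) =
        pairing C E X (base_prj C E X \<cdot> Q) (fibre_prj C E X \<cdot> Q)"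
      unfolding p(4,5) pq(6) ..
    also have "\<dots> = Q"
      by (rule A.pairing_unique[OF X]) (use pq in simp_all)
    finally show "Q \<cdot> (w \<cdot> ?p) = Q \<cdot> Id C (Dom C P)"
      using pq by simp
  qed (use w(1-3) p P Dom_Ob in simp_all)
  then have jc: "?j \<cdot>\<^bsub>slice C E'\<^esub> ?c = Id (slice C E') P"
    by (simp add: slice_el_def)
  have "is_inverse (slice C E') ?c ?j"
    using ch j cj jc unfolding is_inverse_def hom_iff by simp
  then have "inv_ar (slice C E') (bang_pb_comp C f X) = ?j"
    unfolding comp by (rule A'.S.inv_ar_eq)
  moreover have "Cod C Q = Dom C (base_prj C E X)" "Dom C Q = Dom C P" "Q \<in> Ar C" "f \<cdot> P =
      base_prj C E X \<cdot> Q"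
    using pq by simp_all
  ultimately show thesis
    using that[OF comp P] w by blast
qed

text \<open>
  Change of base along f composes the transpose u of an arrow \<open>!\<^sub>E\<^sup>* X \<rightarrow> !\<^sub>E\<^sup>* Y\<close> with \<open>f \<times> X\<close>, as one sees
  by following the projection to Y through the three arrows.
\<close>

lemma (in geometric_category) reindex_component:
  assumes f: "f \<in> hom C E' E" and X: "X \<in> Ob C" and Y: "Y \<in> Ob C"
      and u: "u \<in> hom C (Dom C (base_prj C E X)) Y"
  shows "bang_pb_comp C f Y \<cdot>\<^bsub>slice C E'\<^esub> (FAr (pb_functor C f) (slice_el C E Y (base_prj C E X) u)
      \<cdot>\<^bsub>slice C E'\<^esub>
      inv_ar (slice C E') (bang_pb_comp C f X)) =
    slice_el C E' Y (base_prj C E' X) (u \<cdot> pairing C E X (f \<cdot> base_prj C E' X) (fibre_prj C E' X))"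
proof -
  have fA: "f \<in> Ar C" "Dom C f = E'" "Cod C f = E"
    using f by (auto simp: hom_iff)
  have E: "E \<in> Ob C" and E': "E' \<in> Ob C"
    using hom_Ob[OF f] by auto
  interpret A: over_object C E
    by unfold_locales (rule E)
  interpret A': over_object C E'
    by unfold_locales (rule E')
  note bX = A.base_prj[OF X] and bX' = A'.base_prj[OF X] and bY = A.base_prj[OF Y]
      and bY' = A'.base_prj[OF Y]
  define PX QX PY QY where "PX = fst (pb C f (base_prj C E X))" and "QX = snd (pb C f (base_prj C E X))"
    and "PY = fst (pb C f (base_prj C E Y))" and "QY = snd (pb C f (base_prj C E Y))"
  obtain w where PX: "PX \<in> Ar C" "Cod C PX = E'" "QX \<in> Ar C" "Dom C QX = Dom C PX" "Cod C QX =
      Dom C (base_prj C E X)"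
    and inv: "inv_ar (slice C E') (bang_pb_comp C f X) = (base_prj C E' X, w, PX)"
    and w: "w \<in> Ar C" "Dom C w = Dom C (base_prj C E' X)" "Cod C w = Dom C PX"
      "PX \<cdot> w = base_prj C E' X" "QX \<cdot> w = pairing C E X (f \<cdot> base_prj C E' X) (fibre_prj C E' X)"
    unfolding PX_def QX_def by (rule bang_pb_comp[OF f X])
  obtain w' where compY: "bang_pb_comp C f Y = slice_el C E' Y PY (fibre_prj C E Y \<cdot> QY)"
    and PY: "PY \<in> Ar C" "Cod C PY = E'" "QY \<in> Ar C" "Dom C QY = Dom C PY" "Cod C QY =
        Dom C (base_prj C E Y)"
    unfolding PY_def QY_def by (rule bang_pb_comp[OF f Y])
  have u': "u \<in> Ar C" "Dom C u = Dom C (base_prj C E X)" "Cod C u = Y"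
    using u by (auto simp: hom_iff)
  let ?h = "pairing C E Y (base_prj C E X) u"
  note h = A.pairing[OF Y bX(1,2) u']
  obtain v where v: "FAr (pb_functor C f) (base_prj C E X, ?h, base_prj C E Y) = (PX, v, PY)"
    "v \<in> Ar C" "Dom C v = Dom C PX" "Cod C v = Dom C PY" "PY \<cdot> v = PX" "QY \<cdot> v = ?h \<cdot> QX"
    unfolding PX_def QX_def PY_def QY_def by (rule pb_functor_ar[OF f bX(1,2) bY(1,2) h(1-4)])
  have F: "FAr (pb_functor C f) (slice_el C E Y (base_prj C E X) u) \<cdot>\<^bsub>slice C E'\<^esub> inv_ar (slice C E')
      (bang_pb_comp C f X) =
      (base_prj C E' X, v \<cdot> w, PY)"
    unfolding inv slice_el_def v(1) by simp
  have vw: "v \<cdot> w \<in> Ar C" "Cod C (v \<cdot> w) = Dom C PY" "Dom C (v \<cdot> w) = Dom C (base_prj C E' X)"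
    using v w by simp_all
  have "PY \<cdot> (v \<cdot> w) = (PY \<cdot> v) \<cdot> w"
    by (rule assoc[symmetric]) (use v(2-4) w(1-3) PY in simp_all)
  then have PYvw: "base_prj C E' X = PY \<cdot> (v \<cdot> w)"
    unfolding v(5) w(4) by simp
  have bq: "fibre_prj C E Y \<cdot> QY \<in> hom C (Dom C PY) Y"
    using PY bY by (simp add: hom_iff)
  have "(fibre_prj C E Y \<cdot> QY) \<cdot> (v \<cdot> w) = (fibre_prj C E Y \<cdot> (QY \<cdot> v)) \<cdot> w"
    using v(2-4) w(1-3) PY bY by simp
  also have "\<dots> = ((fibre_prj C E Y \<cdot> ?h) \<cdot> QX) \<cdot> w"
    unfolding v(6) using h(1-3) PX w(1-3) bY bX by simp
  also have "\<dots> = u \<cdot> (QX \<cdot> w)"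
    unfolding h(5) by (rule assoc) (use u' PX w(1-3) in simp_all)
  finally have eq: "(fibre_prj C E Y \<cdot> QY) \<cdot> (v \<cdot> w) =
      u \<cdot> pairing C E X (f \<cdot> base_prj C E' X) (fibre_prj C E' X)"
    unfolding w(5) .
  show ?thesis
    unfolding F compY A'.slice_el_Cmp[OF Y PY(1,2) bq vw(1,2) PYvw] eq ..
qed

section \<open>The object of homomorphisms\<close>

text \<open>
  The domain of k is the object of homomorphisms.  The assumptions are the conclusions of
  \<open>object_of_families\<close> and \<open>respectful_subobject\<close>.
\<close>

locale hom_object = family_action C \<Sigma> M N B \<alpha>
  for C :: "('o, 'a) cat" (structure)
    and \<Sigma> :: "('s, 'f, 'r) signature" and M N :: "('s, 'f, 'r, 'o, 'a) struct"
    and B :: 'o and \<alpha> :: "'s \<Rightarrow> 'a \<Rightarrow> 'a \<Rightarrow> 'a" +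
  fixes k :: 'a
  assumes univ: "E \<in> Ob C \<Longrightarrow>
      (\<And>A. A \<in> Sorts \<Sigma> \<Longrightarrow> v A \<in> hom C (Dom C (base_prj C E (SortI M A))) (SortI N A)) \<Longrightarrow>
      \<exists>!b. b \<in> hom C E B \<and> (\<forall>A \<in> Sorts \<Sigma>. \<alpha> A (b \<cdot> base_prj C E (SortI M A))
          (fibre_prj C E (SortI M A)) = v A)"
    and k: "k \<in> subs C B" "\<And>b. b \<in> Ar C \<Longrightarrow> Cod C b = B \<Longrightarrow> factors C b k \<longleftrightarrow> respectful b"
begin

abbreviation H :: 'o
  where "H \<equiv> Dom C k"

text \<open>
  The arrow \<open>E \<times> MA \<rightarrow> NA\<close> that is classified by \<open>b : E \<rightarrow> B\<close>; \<open>components E b\<close> collects the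
  transposes of these arrows.
\<close>

definition component :: "'o \<Rightarrow> 'a \<Rightarrow> 's \<Rightarrow> 'a"
  where "component E b A = \<alpha> A (b \<cdot> base_prj C E (SortI M A)) (fibre_prj C E (SortI M A))"

definition components :: "'o \<Rightarrow> 'a \<Rightarrow> 's \<Rightarrow> 'a \<times> 'a \<times> 'a"
  where "components E b =
    (\<lambda>A\<in>Sorts \<Sigma>. slice_el C E (SortI N A) (base_prj C E (SortI M A)) (component E b A))"

abbreviation slice_homs :: "'o \<Rightarrow> ('s \<Rightarrow> 'a \<times> 'a \<times> 'a) set"
  where "slice_homs E \<equiv> struct_homs \<Sigma> (slice C E) (bang_struct \<Sigma> C E M) (bang_struct \<Sigma> C E N)"

lemma k_hom: "k \<in> hom C H B"
  using M.subsD[OF k(1)] by (simp add: hom_iff)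

lemma component:
  assumes E: "E \<in> Ob C" and b: "b \<in> hom C E B" and A: "A \<in> Sorts \<Sigma>"
  shows "component E b A \<in> hom C (Dom C (base_prj C E (SortI M A))) (SortI N A)"
    and "\<And>t a. t \<in> Ar C \<Longrightarrow> Cod C t = E \<Longrightarrow> a \<in> hom C (Dom C t) (SortI M A) \<Longrightarrow>
      component E b A \<cdot> pairing C E (SortI M A) t a = \<alpha> A (b \<cdot> t) a"
proof -
  interpret O: over_object C E
    by unfold_locales (rule E)
  note bp = O.base_prj[OF M.SortI_Ob[OF A]]
  have bA: "b \<in> Ar C" "Dom C b = E" "Cod C b = B"
    using b by (auto simp: hom_iff)
  have bb: "b \<cdot> base_prj C E (SortI M A) \<in> hom C (Dom C (base_prj C E (SortI M A))) B"
    and sn: "fibre_prj C E (SortI M A) \<in> hom C (Dom C (base_prj C E (SortI M A))) (SortI M A)"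
    using bA bp by (auto simp: hom_iff)
  show "component E b A \<in> hom C (Dom C (base_prj C E (SortI M A))) (SortI N A)"
    unfolding component_def by (rule \<alpha>_hom[OF A bb sn])
  fix t a assume t: "t \<in> Ar C" "Cod C t = E" and a: "a \<in> hom C (Dom C t) (SortI M A)"
  have a': "a \<in> Ar C" "Dom C a = Dom C t" "Cod C a = SortI M A"
    using a by (auto simp: hom_iff)
  note p = O.pairing[OF M.SortI_Ob[OF A] t a']
  have ph: "pairing C E (SortI M A) t a \<in> hom C (Dom C t) (Dom C (base_prj C E (SortI M A)))"
    using p by (simp add: hom_iff)
  have "(b \<cdot> base_prj C E (SortI M A)) \<cdot> pairing C E (SortI M A) t a = b \<cdot> t"
    using M.assoc[of "pairing C E (SortI M A) t a" "base_prj C E (SortI M A)" b] p bA bp by simp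
  then show "component E b A \<cdot> pairing C E (SortI M A) t a = \<alpha> A (b \<cdot> t) a"
    using \<alpha>_nat[OF A bb sn ph] p(5) by (simp add: component_def)
qed

text \<open>
  By naturality of \<open>\<alpha>\<close> the component of b acts on an element a at the stage t as \<open>\<alpha> A (b \<cdot> t) a\<close>, which
  is what being respectful is about.
\<close>

lemma components_struct_hom:
  assumes E: "E \<in> Ob C" and b: "b \<in> hom C E B"
  shows "components E b \<in> slice_homs E \<longleftrightarrow> respectful b"
proof -
  interpret pulled_pair C E \<Sigma> M N
    by unfold_locales (rule E)
  have "preserves \<Sigma> C M N (Dom C t) (\<lambda>A a. component E b A \<cdot> pairing C E (SortI M A) t a) \<longleftrightarrow>
      preserves \<Sigma> C M N (Dom C t) (\<lambda>A a. \<alpha> A (b \<cdot> t) a)" if t: "t \<in> Ar C" "Cod C t = E" for t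
    by (rule M.preserves_cong[OF M.sig M.struct]) (rule component(2)[OF E b _ t])
  then show ?thesis
    using struct_homs_BM[of "component E b"] component(1)[OF E b] homD(2)[OF b]
    by (simp add: components_def respectful_def)
qed

lemma components_inject:
  assumes E: "E \<in> Ob C" and b: "b \<in> hom C E B" "b' \<in> hom C E B" and eq: "components E b = components E b'"
  shows "b = b'"
proof -
  interpret O: over_object C E
    by unfold_locales (rule E)
  have "component E b A = component E b' A" if A: "A \<in> Sorts \<Sigma>" for A
    by (rule O.slice_el_inject[OF N.SortI_Ob[OF A] O.base_prj(1,2)[OF M.SortI_Ob[OF A]]
          component(1)[OF E b(1) A] component(1)[OF E b(2) A]])
      (use fun_cong[OF eq, of A] A in \<open>simp add: components_def\<close>)
  then have "\<forall>A \<in> Sorts \<Sigma>. component E b A = component E b' A"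
    by blast
  moreover have "\<exists>!c. c \<in> hom C E B \<and> (\<forall>A \<in> Sorts \<Sigma>. component E c A = component E b' A)"
    unfolding component_def[of E _ _] using univ[OF E component(1)[OF E b(2)]] by (simp add: component_def)
  ultimately show ?thesis
    using b by blast
qed

lemma components_surj:
  assumes E: "E \<in> Ob C" and h: "h \<in> slice_homs E"
  obtains b where "b \<in> hom C E B" "h = components E b"
proof -
  interpret O: over_object C E
    by unfold_locales (rule E)
  have hP: "h \<in> (\<Pi>\<^sub>E A \<in> Sorts \<Sigma>. hom (slice C E) (base_prj C E (SortI M A)) (base_prj C E (SortI N A)))"
    using h by (simp add: struct_homs_def bang_struct_def map_struct_def O.FOb_bang)
  have "\<exists>v. v \<in> hom C (Dom C (base_prj C E (SortI M A))) (SortI N A) \<and>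
      h A = slice_el C E (SortI N A) (base_prj C E (SortI M A)) v" if A: "A \<in> Sorts \<Sigma>" for A
    using O.slice_el_surj[OF N.SortI_Ob[OF A] PiE_mem[OF hP A]] by metis
  then obtain v where v: "\<And>A. A \<in> Sorts \<Sigma> \<Longrightarrow> v A \<in> hom C (Dom C (base_prj C E (SortI M A))) (SortI N A)"
    "\<And>A. A \<in> Sorts \<Sigma> \<Longrightarrow> h A = slice_el C E (SortI N A) (base_prj C E (SortI M A)) (v A)"
    by metis
  obtain b where b: "b \<in> hom C E B" "\<forall>A \<in> Sorts \<Sigma>. component E b A = v A"
    using univ[OF E v(1)] unfolding component_def by blast
  show thesis
  proof (rule that[OF b(1)], rule ext)
    show "h A = components E b A" for A
      using v(2)[of A] b(2) PiE_arb[OF hP, of A] by (cases "A \<in> Sorts \<Sigma>") (simp_all add: components_def)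
  qed
qed

lemma bij_betw_slice_homs:
  assumes E: "E \<in> Ob C"
  shows "bij_betw (\<lambda>g. components E (k \<cdot> g)) (hom C E H) (slice_homs E)"
proof (rule bij_betw_imageI)
  have kg: "k \<cdot> g \<in> hom C E B" "respectful (k \<cdot> g)" if g: "g \<in> hom C E H" for g
  proof -
    show *: "k \<cdot> g \<in> hom C E B"
      by (rule M.Cmp_hom[OF g k_hom])
    have "factors C (k \<cdot> g) k"
      by (rule M.factorsI) (use g k_hom in \<open>auto simp: hom_iff\<close>)
    then show "respectful (k \<cdot> g)"
      using k(2) homD[OF *] by blast
  qed
  show "inj_on (\<lambda>g. components E (k \<cdot> g)) (hom C E H)"
  proof (rule inj_onI)
    fix g g' assume g: "g \<in> hom C E H" "g' \<in> hom C E H"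
        and eq: "components E (k \<cdot> g) = components E (k \<cdot> g')"
    have "k \<cdot> g = k \<cdot> g'"
      by (rule components_inject[OF E kg(1)[OF g(1)] kg(1)[OF g(2)] eq])
    then show "g = g'"
      by (rule M.subs_mono[OF k(1), rotated 5]) (use g in \<open>auto simp: hom_iff\<close>)
  qed
  show "(\<lambda>g. components E (k \<cdot> g)) ` hom C E H = slice_homs E"
  proof (rule equalityI; rule subsetI)
    fix h assume "h \<in> (\<lambda>g. components E (k \<cdot> g)) ` hom C E H"
    then show "h \<in> slice_homs E"
      using components_struct_hom[OF E] kg by blast
  next
    fix h assume h: "h \<in> slice_homs E"
    obtain b where b: "b \<in> hom C E B" "h = components E b"
      using components_surj[OF E h] .
    then have "factors C b k"
      using components_struct_hom[OF E b(1)] h k(2) homD[OF b(1)] by blast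
    then obtain g where "g \<in> hom C E H" "k \<cdot> g = b"
      unfolding factors_def homD(2)[OF b(1)] by blast
    then show "h \<in> (\<lambda>g. components E (k \<cdot> g)) ` hom C E H"
      using b(2) by blast
  qed
qed

lemma components_reindex:
  assumes f: "f \<in> hom C E' E" and b: "b \<in> hom C E B"
  shows "components E' (b \<cdot> f) = reindex_hom \<Sigma> C M N f (components E b)"
proof
  have E: "E \<in> Ob C" and E': "E' \<in> Ob C"
    using M.hom_Ob[OF f] by auto
  interpret O': over_object C E'
    by unfold_locales (rule E')
  have fA: "f \<in> Ar C" "Dom C f = E'" "Cod C f = E"
    using f by (auto simp: hom_iff)
  fix A
  show "components E' (b \<cdot> f) A = reindex_hom \<Sigma> C M N f (components E b) A"
  proof (cases "A \<in> Sorts \<Sigma>")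
    case A: True
    note MA = M.SortI_Ob[OF A] and NA = N.SortI_Ob[OF A]
    note b' = O'.base_prj[OF MA]
    have fb: "f \<cdot> base_prj C E' (SortI M A) \<in> Ar C" "Cod C (f \<cdot> base_prj C E' (SortI M A)) = E"
      using fA b' by simp_all
    have sn: "fibre_prj C E' (SortI M A) \<in> hom C (Dom C (f \<cdot> base_prj C E' (SortI M A))) (SortI M A)"
      using fA b' by (simp add: hom_iff)
    have "component E b A \<cdot> pairing C E (SortI M A) (f \<cdot> base_prj C E' (SortI M A))
        (fibre_prj C E' (SortI M A)) =
        \<alpha> A (b \<cdot> (f \<cdot> base_prj C E' (SortI M A))) (fibre_prj C E' (SortI M A))"
      by (rule component(2)[OF E b A fb sn])
    also have "\<dots> = component E' (b \<cdot> f) A"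
      using M.assoc[of "base_prj C E' (SortI M A)" f b] b' fA homD[OF b] by (simp add: component_def)
    finally show ?thesis
      using M.reindex_component[OF f MA NA component(1)[OF E b A]] A fA by
          (simp add: reindex_hom_def components_def)
  qed (simp add: components_def reindex_hom_def)
qed

end

lemma (in geometric_category) hom_T_mod_bang:
  assumes \<T>: "geometric_theory \<T>" and M: "is_model \<T> C M" and N: "is_model \<T> C N" and E: "E \<in> Ob C"
  shows "hom (T_mod \<T> (slice C E)) (bang_struct (Sg \<T>) C E M) (bang_struct (Sg \<T>) C E N) =
    (\<lambda>h. (bang_struct (Sg \<T>) C E M, h, bang_struct (Sg \<T>) C E N)) `
      struct_homs (Sg \<T>) (slice C E) (bang_struct (Sg \<T>) C E M) (bang_struct (Sg \<T>) C E N)"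
proof -
  interpret O: over_object C E
    by unfold_locales (rule E)
  show ?thesis
    using O.bang_struct_model[OF \<T> M] O.bang_struct_model[OF \<T> N] by (auto simp: hom_def T_mod_def)
qed

theorem theorem4p3:
  fixes \<E> :: "('o, 'a) cat"
    and \<T> :: "('s, 'f, 'r, 'u::universe) thy"
    and M N :: "('s, 'f, 'r, 'o, 'a) struct"
  assumes "geometric_theory \<T>"
    and "grothendieck_topos TYPE('u) \<E>"
    and "M \<in> Ob (T_mod \<T> \<E>)"
    and "N \<in> Ob (T_mod \<T> \<E>)"
  shows "\<exists>H \<in> Ob \<E>. \<exists>\<Phi>.
    (\<forall>E \<in> Ob \<E>. bij_betw (\<Phi> E) (hom \<E> E H)
      (hom (T_mod \<T> (slice \<E> E)) (bang_struct (Sg \<T>) \<E> E M) (bang_struct (Sg \<T>) \<E> E N))) \<and>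
    (\<forall>E \<in> Ob \<E>. \<forall>E' \<in> Ob \<E>. \<forall>f \<in> hom \<E> E' E. \<forall>g \<in> hom \<E> E H.
      \<Phi> E' (g \<cdot>\<^bsub>\<E>\<^esub> f) = reindex (Sg \<T>) \<E> M N f (\<Phi> E g))"
proof -
  obtain C :: "('u, 'u) cat" and J el rs ap where "sheaf_model \<E> C J el rs ap"
    using topos_sheaf_model[OF assms(2)] by blast
  then interpret T: sheaf_model \<E> C J el rs ap .
  let ?\<Sigma> = "Sg \<T>"
  have Mm: "is_model \<T> \<E> M" and Nm: "is_model \<T> \<E> N"
    using assms(3,4) by (simp_all add: T_mod_def)
  have sig: "is_signature ?\<Sigma>" and small: "small TYPE('u) (Sorts ?\<Sigma>)"
    using assms(1) by (simp_all add: geometric_theory_def)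
  interpret M: structure_in \<E> ?\<Sigma> M
    by unfold_locales (use sig Mm in \<open>simp_all add: is_model_def\<close>)
  interpret N: structure_in \<E> ?\<Sigma> N
    by unfold_locales (use sig Nm in \<open>simp_all add: is_model_def\<close>)
  obtain B \<alpha> where B: "B \<in> Ob \<E>"
    and \<alpha>h: "\<forall>A \<in> Sorts ?\<Sigma>. \<forall>T. \<forall>b \<in> hom \<E> T B. \<forall>a \<in> hom \<E> T (SortI M A). \<alpha> A b a \<in> hom \<E> T (SortI N A)"
    and \<alpha>n: "\<forall>A \<in> Sorts ?\<Sigma>. \<forall>T T'. \<forall>b \<in> hom \<E> T B. \<forall>a \<in> hom \<E> T (SortI M A). \<forall>s \<in> hom \<E> T' T.
      \<alpha> A (b \<cdot>\<^bsub>\<E>\<^esub> s) (a \<cdot>\<^bsub>\<E>\<^esub> s) = \<alpha> A b a \<cdot>\<^bsub>\<E>\<^esub> s"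
    and \<alpha>u: "\<forall>E \<in> Ob \<E>. \<forall>v. (\<forall>A \<in> Sorts ?\<Sigma>. v A \<in> hom \<E> (Dom \<E> (base_prj \<E> E (SortI M A))) (SortI N A)) \<longrightarrow>
      (\<exists>!b. b \<in> hom \<E> E B \<and>
        (\<forall>A \<in> Sorts ?\<Sigma>. \<alpha> A (b \<cdot>\<^bsub>\<E>\<^esub> base_prj \<E> E (SortI M A)) (fibre_prj \<E> E (SortI M A)) = v A))"
    using T.object_of_families[of "Sorts ?\<Sigma>" "SortI M" "SortI N", OF small M.SortI_Ob N.SortI_Ob] by blast
  interpret F: family_action \<E> ?\<Sigma> M N B \<alpha>
    by unfold_locales (use B \<alpha>h \<alpha>n in auto)
  obtain k where k: "k \<in> subs \<E> B" "\<And>b. b \<in> Ar \<E> \<Longrightarrow> Cod \<E> b = B \<Longrightarrow> factors \<E> b k \<longleftrightarrow> F.respectful b"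
    using F.respectful_subobject by blast
  interpret H: hom_object \<E> ?\<Sigma> M N B \<alpha> k
  proof
    show "\<exists>!b. b \<in> hom \<E> E B \<and>
        (\<forall>A \<in> Sorts ?\<Sigma>. \<alpha> A (b \<cdot>\<^bsub>\<E>\<^esub> base_prj \<E> E (SortI M A)) (fibre_prj \<E> E (SortI M A)) = v A)"
      if "E \<in> Ob \<E>" "\<And>A. A \<in> Sorts ?\<Sigma> \<Longrightarrow> v A \<in> hom \<E> (Dom \<E> (base_prj \<E> E (SortI M A))) (SortI N A)" for E v
      by (rule \<alpha>u[rule_format, OF that])
  qed (fact k)+
  let ?P = "\<lambda>E h. (bang_struct ?\<Sigma> \<E> E M, h, bang_struct ?\<Sigma> \<E> E N)"
  define \<Phi> where "\<Phi> E g = ?P E (H.components E (k \<cdot>\<^bsub>\<E>\<^esub> g))" for E g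
  have "bij_betw (\<Phi> E) (hom \<E> E H.H)
      (hom (T_mod \<T> (slice \<E> E)) (bang_struct ?\<Sigma> \<E> E M) (bang_struct ?\<Sigma> \<E> E N))" if E: "E \<in> Ob \<E>" for E
  proof -
    have "bij_betw (?P E) (H.slice_homs E) (?P E ` H.slice_homs E)"
      by (rule bij_betw_imageI) (auto intro: inj_onI)
    then show ?thesis
      using bij_betw_trans[OF H.bij_betw_slice_homs[OF E]]
      unfolding T.hom_T_mod_bang[OF assms(1) Mm Nm E] \<Phi>_def[abs_def] comp_def by blast
  qed
  moreover have "\<Phi> E' (g \<cdot>\<^bsub>\<E>\<^esub> f) = reindex ?\<Sigma> \<E> M N f (\<Phi> E g)"
    if f: "f \<in> hom \<E> E' E" and g: "g \<in> hom \<E> E H.H" for E E' f g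
  proof -
    have "k \<cdot>\<^bsub>\<E>\<^esub> (g \<cdot>\<^bsub>\<E>\<^esub> f) = (k \<cdot>\<^bsub>\<E>\<^esub> g) \<cdot>\<^bsub>\<E>\<^esub> f"
      by (rule T.Cmp_assoc[OF f g H.k_hom, symmetric])
    then show ?thesis
      using H.components_reindex[OF f T.Cmp_hom[OF g H.k_hom]] homD(2)[OF f] by
          (simp add: \<Phi>_def reindex_def)
  qed
  moreover have "H.H \<in> Ob \<E>"
    using T.hom_Ob[OF H.k_hom] by simp
  ultimately show ?thesis
    by (intro bexI[of _ H.H] exI[of _ \<Phi>]) blast+
qed

end
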